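(* Let $\beta_1\in(0,1)$ and $\beta_2\in(\beta_1,\min\{\frac32\beta_1,1\})$. (1) Let $p\in[2,\infty)$, $r\in(2,\infty]$ with $\frac1p+\frac1r=\frac12$. There is a constant $C>0$ such that for all $t\ge t_0\ge0$, all integers $k\ge-1$, both choices of sign, and all functions $f$ on $\mathbb{R}^3$ (for which the right-hand side is finite), $$\|(1+s+|x|)^{\frac1p\beta_1}P_ke^{\pm is|\nabla|}f\|_{L^p_s([t_0,t];L^r_x(\mathbb{R}^3))}\le C\,2^{\frac2p(1+\beta_2)k}\,\|\langle x\rangle^{\frac2p\beta_2}P_kf\|_{L^2(\mathbb{R}^3)}.$$ (2) Let $p\in[2,2+2\beta_2-\beta_1)$, $r\in(2+\frac{4}{2\beta_2-\beta_1},\infty]$ with $\frac1p+\frac1r=\frac12$. There is a constant $C>0$ such that for all $t\ge t_0\ge0$, all integers $k\ge-1$, both choices of sign, and all such $f$, $$\|(1+s+|x|)^{\frac1p\beta_1}P_k|\nabla|^{-1}e^{\pm is|\nabla|}f\|_{L^p_s([t_0,t];L^r_x(\mathbb{R}^3))}\le C\,2^{(\frac{2+2\beta_2}{p}-1)k}\,\|\langle x\rangle^{\frac2p\beta_2}P_kf\|_{L^2(\mathbb{R}^3)}.$$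
   Context: $\langle x\rangle=(1+|x|^2)^{1/2}$. Fourier multipliers: $|\nabla|^{-1}$ and $e^{\pm is|\nabla|}$ have symbols $|\xi|^{-1}$ and $e^{\pm is|\xi|}$ on $\mathbb{R}^3$. Littlewood–Paley projections: fix a smooth $\psi:\mathbb{R}\to[0,1]$ equal to $1$ on $[-5/4,5/4]$ and vanishing outside $[-8/5,8/5]$; set $\psi_k(\xi)=\psi(|\xi|/2^k)-\psi(|\xi|/2^{k-1})$ for integers $k\ge0$ and $\psi_{-1}(\xi)=\psi(2|\xi|)$. For $k\ge-1$, $P_k$ is the Fourier multiplier with symbol $\psi_k$. Constants $C$ depend only on $\beta_1,\beta_2,p$ (and $\psi$). *)

theory Defs
  imports "HOL-Analysis.Analysis" "HOL-Probability.Essential_Supremum"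
begin

type_synonym R3 = "real^3"

section \<open>Lebesgue norms\<close>

definition ennreal_rpow :: "ennreal \<Rightarrow> real \<Rightarrow> ennreal" where
  "ennreal_rpow x a = (if x = \<infinity> then \<infinity> else ennreal (enn2real x powr a))"

text \<open>The norm of a nonnegative extended-real function in \<open>L\<^sup>q\<close>, for \<open>0 < q \<le> \<infinity>\<close>.
  It takes values in \<^typ>\<open>ennreal\<close>, so that it can be iterated and an inequality whose
  right-hand side is infinite holds trivially.\<close>

definition Lq_norm :: "'a measure \<Rightarrow> ennreal \<Rightarrow> ('a \<Rightarrow> ennreal) \<Rightarrow> ennreal" where
  "Lq_norm M q h =
     (if q = \<infinity> then esssup M h
      else ennreal_rpow (\<integral>\<^sup>+x. ennreal_rpow (h x) (enn2real q) \<partial>M) (1 / enn2real q))"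

definition mixed_norm ::
    "real \<Rightarrow> real \<Rightarrow> real \<Rightarrow> ennreal \<Rightarrow> (real \<Rightarrow> R3 \<Rightarrow> ennreal) \<Rightarrow> ennreal" where
  "mixed_norm t0 t p r h =
     Lq_norm (restrict_space lborel {t0..t}) (ennreal p) (\<lambda>s. Lq_norm lborel r (h s))"

definition jbracket :: "R3 \<Rightarrow> real" where
  "jbracket x = sqrt (1 + (norm x)\<^sup>2)"


section \<open>The Fourier transform\<close>

definition fourier :: "(R3 \<Rightarrow> complex) \<Rightarrow> R3 \<Rightarrow> complex" where
  "fourier \<phi> \<xi> = (\<integral>x. cis (- (x \<bullet> \<xi>)) * \<phi> x \<partial>lborel)"

definition inv_fourier :: "(R3 \<Rightarrow> complex) \<Rightarrow> R3 \<Rightarrow> complex" where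
  "inv_fourier g x = (\<integral>\<xi>. cis (x \<bullet> \<xi>) * g \<xi> \<partial>lborel) / (2 * pi) ^ 3"

fun iter_deriv :: "R3 list \<Rightarrow> (R3 \<Rightarrow> complex) \<Rightarrow> R3 \<Rightarrow> complex" where
  "iter_deriv [] \<phi> = \<phi>"
| "iter_deriv (v # vs) \<phi> = (\<lambda>x. frechet_derivative (iter_deriv vs \<phi>) (at x) v)"

definition schwartz :: "(R3 \<Rightarrow> complex) \<Rightarrow> bool" where
  "schwartz \<phi> \<longleftrightarrow>
     (\<forall>vs \<in> lists Basis.
        iter_deriv vs \<phi> differentiable_on UNIV \<and>
        (\<forall>N::nat. bounded (range (\<lambda>x. (1 + norm x) ^ N *\<^sub>R iter_deriv vs \<phi> x))))"

text \<open>The functions on which Fourier multipliers are considered: those which define a tempered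
  distribution by integration. All \<open>L\<^sup>q\<close> functions, \<open>1 \<le> q \<le> \<infinity>\<close>, are of this kind.\<close>

definition tempered :: "(R3 \<Rightarrow> complex) \<Rightarrow> bool" where
  "tempered f \<longleftrightarrow> (\<exists>N::nat. integrable lebesgue (\<lambda>x. f x / complex_of_real ((1 + norm x) ^ N)))"

text \<open>The Fourier transform of a tempered \<open>f\<close>, as a distribution: \<open>\<langle>f^, \<phi>\<rangle> = \<langle>f, \<phi>^\<rangle>\<close>.\<close>

definition fourier_dist :: "(R3 \<Rightarrow> complex) \<Rightarrow> (R3 \<Rightarrow> complex) \<Rightarrow> complex" where
  "fourier_dist f \<phi> = (\<integral>x. f x * fourier \<phi> x \<partial>lebesgue)"


section \<open>Littlewood--Paley projections and frequency-localised multipliers\<close>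

definition lp_cutoff :: "(real \<Rightarrow> real) \<Rightarrow> bool" where
  "lp_cutoff \<psi> \<longleftrightarrow>
     (\<forall>n. (deriv ^^ n) \<psi> differentiable_on UNIV) \<and>
     range \<psi> \<subseteq> {0..1} \<and>
     (\<forall>x \<in> {-5/4..5/4}. \<psi> x = 1) \<and>
     (\<forall>x. x \<notin> {-8/5..8/5} \<longrightarrow> \<psi> x = 0)"

definition lp_symbol :: "(real \<Rightarrow> real) \<Rightarrow> int \<Rightarrow> R3 \<Rightarrow> real" where
  "lp_symbol \<psi> k \<xi> =
     (if k = -1 then \<psi> (2 * norm \<xi>)
      else \<psi> (norm \<xi> / 2 powi k) - \<psi> (norm \<xi> / 2 powi (k - 1)))"

text \<open>\<open>H\<close> is the distribution \<open>\<psi>\<^sub>k f^\<close>, and it is a square-integrable function; equivalently (by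
  Plancherel) \<open>P\<^sub>k f\<close> belongs to \<open>L\<^sup>2\<close>. For \<open>f \<in> L\<^sup>2\<close> this always holds with
  \<open>H = \<psi>\<^sub>k f^\<close> almost everywhere. As \<open>\<psi>\<^sub>k\<close> has compact support, \<open>H\<close> is also integrable.\<close>

definition is_lp_fourier ::
    "(real \<Rightarrow> real) \<Rightarrow> int \<Rightarrow> (R3 \<Rightarrow> complex) \<Rightarrow> (R3 \<Rightarrow> complex) \<Rightarrow> bool" where
  "is_lp_fourier \<psi> k f H \<longleftrightarrow>
     H \<in> borel_measurable lborel \<and>
     integrable lborel (\<lambda>\<xi>. (norm (H \<xi>))\<^sup>2) \<and>
     (\<forall>\<phi>. schwartz \<phi> \<longrightarrow>
        (\<integral>\<xi>. H \<xi> * \<phi> \<xi> \<partial>lborel)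
          = fourier_dist f (\<lambda>\<xi>. complex_of_real (lp_symbol \<psi> k \<xi>) * \<phi> \<xi>))"

definition lp_fourier :: "(real \<Rightarrow> real) \<Rightarrow> int \<Rightarrow> (R3 \<Rightarrow> complex) \<Rightarrow> R3 \<Rightarrow> complex" where
  "lp_fourier \<psi> k f = (SOME H. is_lp_fourier \<psi> k f H)"

text \<open>The functions \<open>f\<close> with \<open>P\<^sub>k f \<in> L\<^sup>2\<close>. This is implied by finiteness of any
  norm of \<open>\<langle>x\<rangle>\<^sup>a P\<^sub>k f\<close> in \<open>L\<^sup>2\<close> with \<open>a \<ge> 0\<close>.\<close>

definition lp_domain :: "(real \<Rightarrow> real) \<Rightarrow> int \<Rightarrow> (R3 \<Rightarrow> complex) set" where
  "lp_domain \<psi> k = {f. tempered f \<and> (\<exists>H. is_lp_fourier \<psi> k f H)}"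

text \<open>\<open>P\<^sub>k m(D)\<close>, the Fourier multiplier with symbol \<open>\<psi>\<^sub>k m\<close>. Multiplying \<open>f^\<close> by
  \<open>\<psi>\<^sub>k\<close> first gives a meaning to symbols \<open>m\<close> that are not smooth at the origin.\<close>

definition lp_multiplier ::
    "(real \<Rightarrow> real) \<Rightarrow> int \<Rightarrow> (R3 \<Rightarrow> complex) \<Rightarrow> (R3 \<Rightarrow> complex) \<Rightarrow> R3 \<Rightarrow> complex" where
  "lp_multiplier \<psi> k m f = inv_fourier (\<lambda>\<xi>. m \<xi> * lp_fourier \<psi> k f \<xi>)"

definition lp_proj :: "(real \<Rightarrow> real) \<Rightarrow> int \<Rightarrow> (R3 \<Rightarrow> complex) \<Rightarrow> R3 \<Rightarrow> complex" where
  "lp_proj \<psi> k f = lp_multiplier \<psi> k (\<lambda>_. 1) f"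

definition half_wave_symbol :: "real \<Rightarrow> real \<Rightarrow> R3 \<Rightarrow> complex" where
  "half_wave_symbol \<sigma> s \<xi> = cis (\<sigma> * s * norm \<xi>)"

definition inv_grad_symbol :: "R3 \<Rightarrow> complex" where
  "inv_grad_symbol \<xi> = complex_of_real (1 / norm \<xi>)"

end

theory Submission
  imports Defs "HOL-Probability.Characteristic_Functions" "HOL-Probability.Sinc_Integral"
begin

text \<open>After rescaling a frequency shell \<open>|\<xi>| ~ \<lambda> = 2\<^sup>k\<^sup>+\<^sup>1\<^sup>-\<^sup>m\<close> to unit size, \<open>e\<^sup>\<plusminus>\<^sup>i\<^sup>t\<^sup>|\<^sup>\<nabla>\<^sup>|\<close> is the convolution
  with a kernel bounded by \<open>(1 + |t|)\<^sup>-\<^sup>1 (1 + ||t| - |x||)\<^sup>-\<^sup>N\<close>. Let the data be supported in a ball of radius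
  \<open>R \<ge> 1\<close>. For times up to about \<open>R\<^sup>2\<close>, the \<open>TT\<^sup>*\<close> method gives the endpoint bound in \<open>L\<^sup>2\<^sub>t L\<^sup>\<infinity>\<^sub>x\<close> with a
  logarithmic loss, and the weight costs \<open>R\<^sup>2\<^sup>\<beta>\<close>. For later times the light cone meets the ball in a flat slab, of
  volume \<open>O(R\<^sup>2)\<close>, and Cauchy--Schwarz gives \<open>t\<^sup>-\<^sup>2 R\<^sup>2\<close>, which is summable against the weight \<open>t\<^sup>\<beta>\<close>. So the
  weighted norm loses at most \<open>R\<^sup>\<eta>\<close>, for any \<open>\<eta> > 2\<beta>\<close>. Interpolation with the \<open>L\<^sup>2\<close> bound gives the other
  exponents. Cutting \<open>P\<^sub>k f\<close> into dyadic spatial shells \<open>|y| ~ 2\<^sup>j\<close>, the bounds sum geometrically in \<open>j\<close> because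
  \<open>\<eta>\<close> can be taken below \<open>2\<beta>\<^sub>2\<close>, and in \<open>m\<close> because \<open>\<theta>p < 2 - \<beta>\<^sub>1 + 2\<beta>\<^sub>2\<close>, where \<open>\<theta>\<close> is 0 or 1 according
  to the power of \<open>|\<nabla>|\<^sup>-\<^sup>1\<close>.\<close>

text \<open>In dimension three a radial Fourier integral is one-dimensional: the kernel at
  \<open>z\<close> is a difference of two oscillatory integrals on the line, at \<tau> + |z| and
  \<tau> - |z|, divided by |z|. So the kernel bound needs only integration by parts. The time R^2 is
  dictated by curvature: inside a ball of radius R, a sphere of radius t leaves its tangent plane by
  about R^2/t. Both time regimes then cost the same power, as R^2 times the sum of n^(\<beta>-2)
  over n > R^2 is of size R^(2\<beta>); only the logarithm forces \<eta> > 2\<beta>. The obstacle in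
  the summation is a doubly infinite family of pieces, each with its own time unit 1/\<lambda>. Each
  piece is therefore recorded by two numbers, a sum over time slabs of weighted suprema and an L^2
  bound, and a summable geometric family of weights distributes the sum over the pieces. Undoing the
  rescaling costs \<lambda>^(-\<beta>) in the weight, and the p-th power of the norm of a piece
  finally carries \<lambda>^(2+\<eta>-\<beta>-\<theta>p). That this exponent can be made positive is
  the condition on \<theta>p; it makes the low frequencies summable.\<close>

section \<open>Finite smoothness of functions of one real variable\<close>

text \<open>C^n regularity through an existentially quantified derivative: closure properties follow
  by induction on \<open>n\<close>, with no iterated \<open>deriv\<close> to compute.\<close>

fun ck :: "nat \<Rightarrow> (real \<Rightarrow> real) \<Rightarrow> bool" where
  "ck 0 f \<longleftrightarrow> continuous_on UNIV f"
| "ck (Suc n) f \<longleftrightarrow> (\<exists>f'. (\<forall>x. (f has_real_derivative f' x) (at x)) \<and> ck n f')"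

lemma ck_imp_continuous: "ck n f \<Longrightarrow> continuous_on UNIV f"
  by (cases n) (auto intro!: continuous_at_imp_continuous_on intro: DERIV_isCont)

lemma ck_SucD: "ck (Suc n) f \<Longrightarrow> ck n f"
proof (induction n arbitrary: f)
  case 0
  then show ?case using ck_imp_continuous by (metis ck.simps(1))
next
  case (Suc n)
  then obtain f' where "\<And>x. (f has_real_derivative f' x) (at x)" "ck (Suc n) f'"
    by (metis ck.simps(2))
  then show ?case using Suc.IH by (metis ck.simps(2))
qed

lemma ck_const: "ck n (\<lambda>x. c)"
proof (induction n arbitrary: c)
  case (Suc n)
  show ?case using Suc[of 0] by (auto intro!: exI[of _ "\<lambda>x. 0"] derivative_eq_intros)
qed auto

lemma ck_ident: "ck n (\<lambda>x. x)"
proof (cases n)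
  case (Suc m)
  show ?thesis unfolding Suc using ck_const[of m 1] by (auto intro!: exI[of _ "\<lambda>x. 1"] derivative_eq_intros)
qed auto

lemma ck_add:
  assumes "ck n f" "ck n g"
  shows "ck n (\<lambda>x. f x + g x)"
  using assms
proof (induction n arbitrary: f g)
  case 0
  then show ?case by (auto intro: continuous_on_add)
next
  case (Suc n)
  from Suc.prems obtain f' g' where
    "\<And>x. (f has_real_derivative f' x) (at x)" "ck n f'"
    "\<And>x. (g has_real_derivative g' x) (at x)" "ck n g'" by auto
  then show ?case using Suc.IH[of f' g'] by (auto intro!: exI[of _ "\<lambda>x. f' x + g' x"] derivative_intros)
qed

lemma ck_mult:
  assumes "ck n f" "ck n g"
  shows "ck n (\<lambda>x. f x * g x)"
  using assms
proof (induction n arbitrary: f g)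
  case 0
  then show ?case by (auto intro: continuous_on_mult)
next
  case (Suc n)
  from Suc.prems obtain f' g' where d:
    "\<And>x. (f has_real_derivative f' x) (at x)" "ck n f'"
    "\<And>x. (g has_real_derivative g' x) (at x)" "ck n g'" by auto
  have "ck n (\<lambda>x. f' x * g x + g' x * f x)"
    using Suc.IH d ck_add Suc.prems[THEN ck_SucD] by simp
  then show ?case using d by (auto intro!: exI[of _ "\<lambda>x. f' x * g x + g' x * f x"] derivative_eq_intros)
qed

lemma ck_cmult: "ck n f \<Longrightarrow> ck n (\<lambda>x. c * f x)"
  using ck_mult[OF ck_const[of n c]] by simp

lemma ck_diff: "ck n f \<Longrightarrow> ck n g \<Longrightarrow> ck n (\<lambda>x. f x - g x)"
  using ck_add[of n f "\<lambda>x. (-1) * g x"] ck_cmult[of n g "-1"] by simp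

lemma ck_power: "ck n f \<Longrightarrow> ck n (\<lambda>x. f x ^ m)"
  by (induction m) (auto intro: ck_const ck_mult)

lemma ck_affine:
  assumes "ck n f"
  shows "ck n (\<lambda>x. f (a * x + b))"
  using assms
proof (induction n arbitrary: f)
  case 0
  then show ?case by (auto intro!: continuous_on_compose2[of UNIV f] continuous_intros)
next
  case (Suc n)
  from Suc.prems obtain f' where d:
    "\<And>x. (f has_real_derivative f' x) (at x)" "ck n f'" by auto
  have "((\<lambda>x. f (a * x + b)) has_real_derivative a * f' (a * x + b)) (at x)" for x
  proof -
    have "((\<lambda>x. a * x + b) has_real_derivative a) (at x)" by (auto intro!: derivative_eq_intros)
    from DERIV_chain2[where f=f, OF d(1) this] show ?thesis by (simp only: mult.commute)
  qed
  then show ?case unfolding ck.simps using ck_cmult[OF Suc.IH[OF d(2)], of a] by (intro exI conjI allI)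
qed

text \<open>The quotient is identically 0 to the left of \<open>c\<close> > 0, so the singularity at
  0 is invisible. Its derivative f'/x^m - m f/x^(m+1) is a combination of quotients of the same
  kind, with exponents \<open>m\<close> and \<open>m + 1\<close>; hence the induction generalises
  over \<open>m\<close>.\<close>

lemma ck_divide_power:
  assumes "ck n f" and "\<And>x. x < c \<Longrightarrow> f x = 0" and "c > 0"
  shows "ck n (\<lambda>x. f x / x ^ m)"
  using assms(1,2)
proof (induction n arbitrary: f m)
  case 0
  show ?case unfolding ck.simps
  proof (rule continuous_at_imp_continuous_on, rule ballI)
    fix x :: real
    show "isCont (\<lambda>x. f x / x ^ m) x"
    proof (cases "x < c")
      case True
      have "\<forall>\<^sub>F y in nhds x. y \<in> {..<c}" using True by (intro eventually_nhds_in_open) auto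
      then have "\<forall>\<^sub>F y in nhds x. f y / y ^ m = 0"
        by eventually_elim (auto simp: 0)
      then show ?thesis using isCont_cong[of "\<lambda>x. f x / x ^ m" "\<lambda>_. 0" x] by simp
    next
      case False
      then have "x > 0" using \<open>c > 0\<close> by auto
      moreover have "isCont f x" using 0 by (simp add: continuous_on_eq_continuous_at)
      ultimately show ?thesis by (auto intro!: continuous_intros)
    qed
  qed
next
  case (Suc n)
  from Suc.prems obtain f' where d:
    "\<And>x. (f has_real_derivative f' x) (at x)" "ck n f'" by auto
  have z: "f' x = 0" if "x < c" for x
  proof -
    have "((\<lambda>_. 0) has_real_derivative 0) (at x)" by simp
    then have "(f has_real_derivative 0) (at x)"
      by (rule has_field_derivative_transform_within_open[where S="{..<c}"]) (use that Suc.prems in auto)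
    then show ?thesis using d(1) DERIV_unique by blast
  qed
  let ?g = "\<lambda>x. f' x / x ^ m - real m * (f x / x ^ Suc m)"
  have "ck n ?g"
    using Suc.IH[OF d(2) z, of m] Suc.IH[OF ck_SucD[OF Suc.prems(1)] Suc.prems(2), of "Suc m"]
    by (intro ck_diff ck_cmult) auto
  moreover have "((\<lambda>x. f x / x ^ m) has_real_derivative ?g x) (at x)" for x
  proof (cases "x < c")
    case True
    have "((\<lambda>_. 0) has_real_derivative 0) (at x)" by simp
    then have "((\<lambda>x. f x / x ^ m) has_real_derivative 0) (at x)"
      by (rule has_field_derivative_transform_within_open[where S="{..<c}"]) (use True Suc.prems in auto)
    then show ?thesis using True z Suc.prems by simp
  next
    case False
    then have x: "x > 0" using \<open>c > 0\<close> by auto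
    have "((\<lambda>x. f x / x ^ m) has_real_derivative (f' x * x ^ m - f x * (real m * x ^ (m - 1))) / (x ^ m * x ^ m)) (at x)"
      by (rule derivative_eq_intros d refl | use x in simp)+
    moreover have "(f' x * x ^ m - f x * (real m * x ^ (m - 1))) / (x ^ m * x ^ m) = ?g x"
      using x by (cases m) (auto simp: field_simps)
    ultimately show ?thesis by simp
  qed
  ultimately show ?case unfolding ck.simps by (intro exI[of _ ?g] conjI allI)
qed

text \<open>The complement of a closed interval is open, so \<open>f\<close> is locally constant 0
  at each point outside, and the derivative vanishes there too.\<close>

lemma ck_deriv_support:
  assumes "ck (Suc n) f" and "\<And>x. x \<notin> {a..b} \<Longrightarrow> f x = 0"
  obtains f' where "\<And>x. (f has_real_derivative f' x) (at x)" "ck n f'" "\<And>x. x \<notin> {a..b} \<Longrightarrow> f' x = 0"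
proof -
  from assms obtain f' where d: "\<And>x. (f has_real_derivative f' x) (at x)" "ck n f'" by auto
  have "f' x = 0" if "x \<notin> {a..b}" for x
  proof -
    have "((\<lambda>_. 0) has_real_derivative 0) (at x)" by simp
    then have "(f has_real_derivative 0) (at x)"
      by (rule has_field_derivative_transform_within_open[where S="-{a..b}"]) (use that assms in auto)
    then show ?thesis using d(1) DERIV_unique by blast
  qed
  then show ?thesis using d that by blast
qed

text \<open>The induction runs over all iterated derivatives at once, since the derivative of each
  is the next one.\<close>

lemma lp_cutoff_ck:
  assumes "lp_cutoff \<psi>"
  shows "ck n \<psi>"
proof -
  have "ck n ((deriv ^^ m) \<psi>)" for m
  proof (induction n arbitrary: m)
    case 0
    then show ?case using assms by (auto simp: lp_cutoff_def intro: differentiable_imp_continuous_on)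
  next
    case (Suc n)
    have "((deriv ^^ m) \<psi> has_real_derivative (deriv ^^ Suc m) \<psi> x) (at x)" for x
    proof -
      have "(deriv ^^ m) \<psi> field_differentiable (at x)"
        using assms unfolding lp_cutoff_def
        by (metis DERIV_def UNIV_I differentiable_on_def field_differentiable_def real_differentiable_def)
      then show ?thesis by (simp add: field_differentiable_derivI)
    qed
    then show ?case using Suc[of "Suc m"] by auto
  qed
  from this[of 0] show ?thesis by simp
qed

section \<open>One-dimensional oscillatory integrals\<close>

text \<open>The inverse Fourier transform on the line, without its normalising factor. All kernels
  in space are expressed through its values.\<close>

definition osc :: "(real \<Rightarrow> real) \<Rightarrow> real \<Rightarrow> complex" where
  "osc h \<tau> = (\<integral>\<rho>. complex_of_real (h \<rho>) * cis (\<rho> * \<tau>) \<partial>lborel)"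

lemma continuous_on_cis' [continuous_intros]:
  "continuous_on S f \<Longrightarrow> continuous_on S (\<lambda>x. cis (f x))"
  by (simp add: cis_conv_exp continuous_intros)

lemma measurable_cis [measurable]: "cis \<in> borel_measurable borel"
  by (intro borel_measurable_continuous_onI continuous_intros)

lemma integrable_continuous_support:
  fixes f :: "'a::euclidean_space \<Rightarrow> 'b::{banach,second_countable_topology}"
  assumes "continuous_on UNIV f" "compact S" "\<And>x. x \<notin> S \<Longrightarrow> f x = 0"
  shows "integrable lborel f"
proof -
  have "integrable lborel (\<lambda>x. indicator S x *\<^sub>R f x)"
    by (rule borel_integrable_compact[OF assms(2)]) (use assms(1) continuous_on_subset in blast)
  moreover have "(\<lambda>x. indicator S x *\<^sub>R f x) = f" using assms(3) by (auto simp: indicator_def)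
  ultimately show ?thesis by simp
qed

lemma integrable_osc:
  assumes "continuous_on UNIV h" "\<And>x. x \<notin> {a..b} \<Longrightarrow> h x = 0"
  shows "integrable lborel (\<lambda>\<rho>. complex_of_real (h \<rho>) * cis (\<rho> * \<tau>))"
  by (rule integrable_continuous_support[of _ "{a..b}"]) (use assms in \<open>auto intro!: continuous_intros\<close>)

lemma osc_bound:
  assumes "continuous_on UNIV h" "\<And>x. x \<notin> {a..b} \<Longrightarrow> h x = 0"
  shows "norm (osc h \<tau>) \<le> (\<integral>\<rho>. \<bar>h \<rho>\<bar> \<partial>lborel)"
proof -
  have "norm (osc h \<tau>) \<le> (\<integral>\<rho>. norm (complex_of_real (h \<rho>) * cis (\<rho> * \<tau>)) \<partial>lborel)"
    unfolding osc_def by (rule integral_norm_bound)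
  then show ?thesis by (simp add: norm_mult)
qed

lemma integral_deriv_support:
  fixes f :: "real \<Rightarrow> complex"
  assumes d: "\<And>x. (f has_vector_derivative f' x) (at x)" and c: "continuous_on UNIV f'"
    and z: "\<And>x. x \<notin> {a..b} \<Longrightarrow> f x = 0" "\<And>x. x \<notin> {a..b} \<Longrightarrow> f' x = 0" and "a \<le> b"
  shows "(\<integral>x. f' x \<partial>lborel) = 0"
proof -
  \<comment> \<open>The interval is enlarged by 1 at both ends: the hypotheses give the vanishing of
    \<open>f\<close> outside [a, b], not at the endpoints.\<close>
  have "has_bochner_integral lborel (\<lambda>x. indicator {a-1..b+1} x *\<^sub>R f' x) (f (b+1) - f (a-1))"
    by (rule has_bochner_integral_FTC_Icc)
       (use assms in \<open>auto intro: has_vector_derivative_at_within continuous_on_subset\<close>)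
  moreover have "(\<lambda>x. indicator {a-1..b+1} x *\<^sub>R f' x) = f'"
  proof
    show "indicator {a-1..b+1} x *\<^sub>R f' x = f' x" for x
      using z(2)[of x] by (cases "x \<in> {a..b}") (auto simp: indicator_def)
  qed
  ultimately show ?thesis using z \<open>a \<le> b\<close> by (simp add: has_bochner_integral_iff)
qed

text \<open>The derivative of h(x) cis(x\<tau>) integrates to 0 because the function has compact
  support. In this multiplicative form the identity needs no exception for \<tau> = 0.\<close>

lemma osc_by_parts:
  assumes d: "\<And>x. (h has_real_derivative h' x) (at x)" and c: "continuous_on UNIV h'"
    and z: "\<And>x. x \<notin> {a..b} \<Longrightarrow> h x = 0" "\<And>x. x \<notin> {a..b} \<Longrightarrow> h' x = 0" and "a \<le> b"
  shows "\<i> * complex_of_real \<tau> * osc h \<tau> = - osc h' \<tau>"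
proof -
  have ch: "continuous_on UNIV h" using d by (auto intro!: continuous_at_imp_continuous_on DERIV_isCont)
  let ?f' = "\<lambda>x. complex_of_real (h x) * (\<i> * complex_of_real \<tau> * cis (x * \<tau>)) + complex_of_real (h' x) * cis (x * \<tau>)"
  have "(\<integral>x. ?f' x \<partial>lborel) = 0"
  proof (rule integral_deriv_support[where f="\<lambda>x. complex_of_real (h x) * cis (x * \<tau>)" and a=a and b=b])
    fix x
    have 1: "((\<lambda>x. complex_of_real (h x)) has_vector_derivative complex_of_real (h' x)) (at x)"
      using d[of x] by (auto intro!: has_vector_derivative_of_real simp: has_real_derivative_iff_has_vector_derivative)
    have 2: "((\<lambda>x. cis (x * \<tau>)) has_vector_derivative (\<i> * complex_of_real \<tau> * cis (x * \<tau>))) (at x)"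
      unfolding cis_conv_exp
      by (rule has_vector_derivative_real_field derivative_eq_intros refl | simp)+
    show "((\<lambda>x. complex_of_real (h x) * cis (x * \<tau>)) has_vector_derivative ?f' x) (at x)"
      using has_vector_derivative_mult[OF 1 2] by simp
  qed (use c ch z \<open>a \<le> b\<close> in \<open>auto intro!: continuous_intros\<close>)
  moreover have "(\<integral>x. ?f' x \<partial>lborel) = \<i> * complex_of_real \<tau> * osc h \<tau> + osc h' \<tau>"
  proof -
    have "integrable lborel (\<lambda>x. complex_of_real (h x) * cis (x * \<tau>))" "integrable lborel (\<lambda>x. complex_of_real (h' x) * cis (x * \<tau>))"
      using integrable_osc[OF ch z(1)] integrable_osc[OF c z(2)] by auto
    moreover have "?f' = (\<lambda>x. \<i> * complex_of_real \<tau> * (complex_of_real (h x) * cis (x * \<tau>)) + complex_of_real (h' x) * cis (x * \<tau>))"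
      by (auto simp: algebra_simps)
    ultimately show ?thesis unfolding osc_def by simp
  qed
  ultimately show ?thesis by (simp add: eq_neg_iff_add_eq_0)
qed

lemma osc_power_bound:
  assumes "ck n h" "\<And>x. x \<notin> {a..b} \<Longrightarrow> h x = 0" "a \<le> b"
  shows "\<exists>C. \<forall>\<tau>. \<bar>\<tau>\<bar> ^ n * norm (osc h \<tau>) \<le> C"
  using assms(1,2)
proof (induction n arbitrary: h)
  case 0
  then show ?case using osc_bound[of h a b] by auto
next
  case (Suc n)
  obtain h' where h': "\<And>x. (h has_real_derivative h' x) (at x)" "ck n h'" "\<And>x. x \<notin> {a..b} \<Longrightarrow> h' x = 0"
    using ck_deriv_support[OF Suc.prems] by blast
  obtain C where C: "\<And>\<tau>. \<bar>\<tau>\<bar> ^ n * norm (osc h' \<tau>) \<le> C" using Suc.IH[OF h'(2,3)] by auto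
  have "\<bar>\<tau>\<bar> ^ Suc n * norm (osc h \<tau>) \<le> C" for \<tau>
  proof -
    have "\<i> * complex_of_real \<tau> * osc h \<tau> = - osc h' \<tau>"
      by (rule osc_by_parts[where a=a and b=b]) (use h' Suc.prems ck_imp_continuous \<open>a \<le> b\<close> in auto)
    then have "\<bar>\<tau>\<bar> * norm (osc h \<tau>) = norm (osc h' \<tau>)"
      by (metis norm_minus_cancel norm_mult norm_of_real norm_ii mult_1)
    then have "\<bar>\<tau>\<bar> ^ Suc n * norm (osc h \<tau>) = \<bar>\<tau>\<bar> ^ n * norm (osc h' \<tau>)"
      by (metis power_Suc2 mult.assoc)
    then show ?thesis using C[of \<tau>] by linarith
  qed
  then show ?case by blast
qed

text \<open>The bound by |\<tau>|^(-n) from n integrations by parts is combined with the trivial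
  bound near \<tau> = 0, through (1 + |\<tau>|)^n \<le> 2^n (1 + |\<tau>|^n).\<close>

lemma osc_decay:
  assumes "ck n h" "\<And>x. x \<notin> {a..b} \<Longrightarrow> h x = 0" "a \<le> b"
  shows "\<exists>C>0. \<forall>\<tau>. norm (osc h \<tau>) \<le> C / (1 + \<bar>\<tau>\<bar>) ^ n"
proof -
  have "continuous_on UNIV h" using assms(1) by (rule ck_imp_continuous)
  obtain C where C: "\<And>\<tau>. \<bar>\<tau>\<bar> ^ n * norm (osc h \<tau>) \<le> C" using osc_power_bound[OF assms] by auto
  obtain D where D: "\<And>\<tau>. norm (osc h \<tau>) \<le> D" using osc_bound[OF \<open>continuous_on UNIV h\<close> assms(2)] by blast
  have "norm (osc h \<tau>) \<le> (2 ^ n * (\<bar>C\<bar> + \<bar>D\<bar> + 1)) / (1 + \<bar>\<tau>\<bar>) ^ n" for \<tau>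
  proof -
    have "(1 + \<bar>\<tau>\<bar>) ^ n \<le> 2 ^ n * (1 + \<bar>\<tau>\<bar> ^ n)"
    proof (cases "\<bar>\<tau>\<bar> \<le> 1")
      case True
      then have "(1 + \<bar>\<tau>\<bar>) ^ n \<le> 2 ^ n" by (intro power_mono) auto
      then show ?thesis by (smt (verit) mult_left_mono mult_cancel_left2 zero_le_power abs_ge_zero)
    next
      case False
      then have "(1 + \<bar>\<tau>\<bar>) ^ n \<le> (2 * \<bar>\<tau>\<bar>) ^ n" by (intro power_mono) auto
      also have "\<dots> \<le> 2 ^ n * (1 + \<bar>\<tau>\<bar> ^ n)" by (simp add: power_mult_distrib)
      finally show ?thesis .
    qed
    then have "(1 + \<bar>\<tau>\<bar>) ^ n * norm (osc h \<tau>) \<le> 2 ^ n * (1 + \<bar>\<tau>\<bar> ^ n) * norm (osc h \<tau>)"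
      by (rule mult_right_mono) simp
    also have "\<dots> = 2 ^ n * (norm (osc h \<tau>) + \<bar>\<tau>\<bar> ^ n * norm (osc h \<tau>))" by (simp add: algebra_simps)
    also have "\<dots> \<le> 2 ^ n * (\<bar>C\<bar> + \<bar>D\<bar> + 1)"
      using C[of \<tau>] D[of \<tau>] by (intro mult_left_mono) auto
    finally show ?thesis by (simp add: pos_le_divide_eq mult.commute add_pos_nonneg)
  qed
  then show ?thesis by (intro exI[of _ "2 ^ n * (\<bar>C\<bar> + \<bar>D\<bar> + 1)"]) (auto intro!: add_nonneg_pos)
qed

text \<open>Needed near the spatial origin, where the kernel is a difference quotient of
  \<open>osc\<close>. Differentiation under the integral applies after restriction to the compact
  support.\<close>

lemma osc_deriv:
  assumes c: "continuous_on UNIV h" and z: "\<And>x. x \<notin> {a..b} \<Longrightarrow> h x = 0"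
  shows "(osc h has_vector_derivative \<i> * osc (\<lambda>x. x * h x) \<tau>) (at \<tau>)"
proof -
  have eq: "osc h t = integral (cbox a b) (\<lambda>\<rho>. complex_of_real (h \<rho>) * cis (\<rho> * t))" 
    if "continuous_on UNIV h" "\<And>x. x \<notin> {a..b} \<Longrightarrow> h x = 0" for t h
  proof -
    have "osc h t = integral UNIV (\<lambda>\<rho>. complex_of_real (h \<rho>) * cis (\<rho> * t))"
      unfolding osc_def by (rule integral_lborel[symmetric]) (rule integrable_osc[OF that])
    also have "\<dots> = integral (cbox a b) (\<lambda>\<rho>. complex_of_real (h \<rho>) * cis (\<rho> * t))"
      using that by (intro integral_spike_set[symmetric] integral_subset_negligible) (auto simp: cbox_interval intro!: empty_imp_negligible)
    finally show ?thesis .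
  qed
  have "((\<lambda>t. integral (cbox a b) (\<lambda>\<rho>. complex_of_real (h \<rho>) * cis (\<rho> * t))) has_vector_derivative
     integral (cbox a b) (\<lambda>\<rho>. \<i> * (complex_of_real (\<rho> * h \<rho>) * cis (\<rho> * \<tau>)))) (at \<tau> within UNIV)"
  proof (rule leibniz_rule_vector_derivative)
    fix t \<rho> :: real
    have 2: "((\<lambda>t. cis (\<rho> * t)) has_vector_derivative (\<i> * complex_of_real \<rho> * cis (\<rho> * t))) (at t)"
      unfolding cis_conv_exp
      by (rule has_vector_derivative_real_field derivative_eq_intros refl | simp)+
    show "((\<lambda>t. complex_of_real (h \<rho>) * cis (\<rho> * t)) has_vector_derivative \<i> * (complex_of_real (\<rho> * h \<rho>) * cis (\<rho> * t))) (at t within UNIV)"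
      using has_vector_derivative_mult_right[OF 2, of "complex_of_real (h \<rho>)"] by (simp add: algebra_simps)
  next
    show "(\<lambda>\<rho>. complex_of_real (h \<rho>) * cis (\<rho> * t)) integrable_on cbox a b" for t
      using c continuous_on_subset by (intro integrable_continuous) (auto intro!: continuous_intros)
  next
    show "continuous_on (UNIV \<times> cbox a b) (\<lambda>(x, t). \<i> * (complex_of_real (t * h t) * cis (t * x)))"
      unfolding case_prod_beta
      by (intro continuous_intros continuous_on_compose2[OF c]) auto
  qed auto
  moreover have "integral (cbox a b) (\<lambda>\<rho>. \<i> * (complex_of_real (\<rho> * h \<rho>) * cis (\<rho> * \<tau>))) = \<i> * osc (\<lambda>x. x * h x) \<tau>"
    using c z by (subst eq) (auto intro!: continuous_intros)
  moreover have "(\<lambda>t. integral (cbox a b) (\<lambda>\<rho>. complex_of_real (h \<rho>) * cis (\<rho> * t))) = osc h"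
    using eq[OF c z] by auto
  ultimately show ?thesis by simp
qed

section \<open>Radial integrals on the three-dimensional space\<close>

text \<open>Coordinates as a nested product, on which product measures and Fubini operate.\<close>

definition vec3 :: "real \<times> real \<times> real \<Rightarrow> R3" where
  "vec3 v = vector [fst v, fst (snd v), snd (snd v)]"

lemma vec3_nth [simp]: "vec3 v $ 1 = fst v" "vec3 v $ 2 = fst (snd v)" "vec3 v $ 3 = snd (snd v)"
  by (auto simp: vec3_def)

lemma continuous_on_vec3: "continuous_on UNIV vec3"
proof -
  have "continuous_on UNIV (\<lambda>v. \<chi> i. vec3 v $ i)"
  proof (rule continuous_on_vec_lambda)
    fix i :: 3
    have "i = 1 \<or> i = 2 \<or> i = 3" by (metis exhaust_3)
    then show "continuous_on UNIV (\<lambda>v. vec3 v $ i)"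
      by (elim disjE) (simp_all add: continuous_on_fst continuous_on_snd continuous_on_id)
  qed
  then show ?thesis by simp
qed

lemma measurable_vec3 [measurable]: "vec3 \<in> borel_measurable borel"
  by (intro borel_measurable_continuous_onI continuous_on_vec3)

lemma prod_Basis_R3: "(\<Prod>b\<in>(Basis :: R3 set). f b) = f (axis 1 1) * f (axis 2 1) * f (axis 3 1)"
proof -
  have B: "(Basis :: R3 set) = range (\<lambda>i. axis i 1)" by (auto simp: Basis_vec_def)
  have "inj (\<lambda>i::3. axis i (1::real))" by (auto simp: inj_on_def axis_eq_axis)
  then have "(\<Prod>b\<in>(Basis :: R3 set). f b) = (\<Prod>i\<in>(UNIV::3 set). f (axis i 1))"
    unfolding B by (subst prod.reindex) (simp_all add: o_def)
  also have "\<dots> = f (axis 1 1) * f (axis 2 1) * f (axis 3 1)"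
    unfolding UNIV_3 by (simp add: mult.assoc)
  finally show ?thesis .
qed

lemma lborel_vec3: "lborel = distr lborel borel vec3"
proof (rule lborel_eqI)
  fix l u :: R3
  assume lu: "\<And>b. b \<in> Basis \<Longrightarrow> l \<bullet> b \<le> u \<bullet> b"
  have l: "l $ i \<le> u $ i" for i using lu[of "axis i 1"] by (simp add: axis_in_Basis_iff inner_axis)
  have "vec3 -` box l u = box (l $ 1, l $ 2, l $ 3) (u $ 1, u $ 2, u $ 3)"
    by (auto simp: box_prod mem_box_cart forall_3)
  then have "emeasure (distr lborel borel vec3) (box l u) = emeasure lborel (box (l $ 1, l $ 2, l $ 3) (u $ 1, u $ 2, u $ 3))"
    by (subst emeasure_distr) auto
  also have "\<dots> = ennreal (u $ 1 - l $ 1) * (ennreal (u $ 2 - l $ 2) * ennreal (u $ 3 - l $ 3))"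
    by (simp add: box_prod lborel_prod[symmetric] lborel.emeasure_pair_measure_Times lborel_pair.emeasure_pair_measure_Times l)
  finally show "emeasure (distr lborel borel vec3) (box l u) = ennreal (\<Prod>b\<in>Basis. (u - l) \<bullet> b)"
    by (simp add: prod_Basis_R3 inner_axis ennreal_mult l mult.assoc)
qed simp

lemma integral_R3:
  fixes f :: "R3 \<Rightarrow> 'b::{banach,second_countable_topology}"
  assumes [measurable]: "f \<in> borel_measurable borel"
  shows "(\<integral>\<xi>. f \<xi> \<partial>lborel) = (\<integral>v. f (vec3 v) \<partial>lborel)"
  by (subst lborel_vec3) (simp add: integral_distr)

lemma integrable_R3:
  fixes f :: "R3 \<Rightarrow> 'b::{banach,second_countable_topology}"
  assumes [measurable]: "f \<in> borel_measurable borel"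
  shows "integrable lborel f \<longleftrightarrow> integrable lborel (\<lambda>v. f (vec3 v))"
  by (subst lborel_vec3) (simp add: integrable_distr_eq)

lemma nn_integral_R3:
  assumes [measurable]: "f \<in> borel_measurable borel"
  shows "(\<integral>\<^sup>+\<xi>. f \<xi> \<partial>lborel) = (\<integral>\<^sup>+v. f (vec3 v) \<partial>lborel)"
  by (subst lborel_vec3) (simp add: nn_integral_distr)

text \<open>Lebesgue measure is determined by boxes, and the preimage of a box is its image under
  the inverse isometry, which has the same measure.\<close>

lemma lborel_orthogonal:
  fixes T :: "R3 \<Rightarrow> R3"
  assumes T: "orthogonal_transformation T"
  shows "lborel = distr lborel borel T"
proof (rule lborel_eqI)
  have [measurable]: "T \<in> borel_measurable borel"
    using T by (intro borel_measurable_continuous_onI linear_continuous_on)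
      (auto simp: orthogonal_transformation_linear linear_linear)
  fix l u :: R3
  assume lu: "\<And>b. b \<in> Basis \<Longrightarrow> l \<bullet> b \<le> u \<bullet> b"
  have eq: "T -` box l u = inv T ` box l u"
    using T by (simp add: bij_vimage_eq_inv_image orthogonal_transformation_bij)
  have T': "orthogonal_transformation (inv T)" using T by (rule orthogonal_transformation_inv)
  have m: "T -` box l u \<in> sets borel" using measurable_sets[of T borel borel "box l u"] by simp
  have lm: "T -` box l u \<in> lmeasurable" unfolding eq by (rule measurable_orthogonal_image[OF T']) simp
  have "emeasure (distr lborel borel T) (box l u) = emeasure lborel (T -` box l u)"
    by (subst emeasure_distr) auto
  also have "\<dots> = emeasure lebesgue (T -` box l u)" using m by simp
  also have "\<dots> = measure lebesgue (T -` box l u)" by (rule emeasure_eq_measure2[OF lm])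
  also have "\<dots> = measure lebesgue (box l u)" unfolding eq by (subst measure_orthogonal_image[OF T']) auto
  also have "\<dots> = emeasure lebesgue (box l u)" by (rule emeasure_eq_measure2[symmetric]) simp
  finally show "emeasure (distr lborel borel T) (box l u) = ennreal (\<Prod>b\<in>Basis. (u - l) \<bullet> b)"
    using lu by (simp add: emeasure_lborel_box)
qed simp

text \<open>A disc of squared radius a has area \<pi> a, so the squared norm spreads planar measure
  uniformly over the half-line. This replaces polar coordinates. Half-lines {..a} form an
  intersection-stable generator on which the two measures are compared.\<close>

lemma distr_norm_square_plane:
  "distr lborel borel (\<lambda>\<eta>::real \<times> real. (norm \<eta>)\<^sup>2) = density lborel (\<lambda>t. ennreal (pi * indicator {0..} t))"
proof -
  have sb: "sets borel = sigma_sets UNIV (range (atMost :: real \<Rightarrow> real set))"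
    unfolding borel_eq_atMost by (rule sets_measure_of) simp
  show ?thesis
proof (rule measure_eqI_generator_eq[where E="range atMost" and \<Omega>=UNIV and A="\<lambda>n. {..real n}"])
  fix X :: "real set" assume "X \<in> range atMost"
  then obtain a where X: "X = {..a}" by auto
  have "emeasure (distr lborel borel (\<lambda>\<eta>::real \<times> real. (norm \<eta>)\<^sup>2)) X = emeasure lborel {\<eta>::real \<times> real. (norm \<eta>)\<^sup>2 \<le> a}"
    unfolding X by (subst emeasure_distr) (auto simp: vimage_def)
  also have "\<dots> = ennreal (pi * max 0 a)"
  proof (cases "a \<ge> 0")
    case True
    have "{\<eta>::real \<times> real. (norm \<eta>)\<^sup>2 \<le> a} = cball 0 (sqrt a)"
      using real_sqrt_le_iff[of "(norm (\<eta>::real \<times> real))\<^sup>2" a for \<eta>] by auto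
    then show ?thesis using True by (simp add: emeasure_cball eval_unit_ball_vol)
  next
    case False
    then have e: "{\<eta>::real \<times> real. (norm \<eta>)\<^sup>2 \<le> a} = {}" by (auto simp: not_le intro: less_le_trans)
    show ?thesis unfolding e using False by simp
  qed
  also have "\<dots> = emeasure (density lborel (\<lambda>t. ennreal (pi * indicator {0..} t))) X"
  proof -
    have "emeasure (density lborel (\<lambda>t. ennreal (pi * indicator {0..} t))) X = (\<integral>\<^sup>+t. ennreal pi * indicator {0..a} t \<partial>lborel)"
      unfolding X by (subst emeasure_density) (auto intro!: nn_integral_cong simp: indicator_def)
    also have "\<dots> = ennreal pi * ennreal (max 0 a)" by (simp add: nn_integral_cmult_indicator emeasure_lborel_Icc_eq max_def)
    finally show ?thesis by (simp add: ennreal_mult)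
  qed
  finally show "emeasure (distr lborel borel (\<lambda>\<eta>::real \<times> real. (norm \<eta>)\<^sup>2)) X = emeasure (density lborel (\<lambda>t. ennreal (pi * indicator {0..} t))) X" .
next
  show "emeasure (distr lborel borel (\<lambda>\<eta>::real \<times> real. (norm \<eta>)\<^sup>2)) {..real n} \<noteq> \<infinity>" for n
  proof -
    have "emeasure (distr lborel borel (\<lambda>\<eta>::real \<times> real. (norm \<eta>)\<^sup>2)) {..real n} = emeasure lborel {\<eta>::real \<times> real. (norm \<eta>)\<^sup>2 \<le> real n}"
      by (subst emeasure_distr) (auto simp: vimage_def)
    also have "\<dots> \<le> emeasure lborel (cball (0::real \<times> real) (sqrt n))"
      by (rule emeasure_mono) (auto intro: real_le_rsqrt)
    also have "\<dots> < \<infinity>" by (simp add: emeasure_cball ennreal_mult_less_top eval_unit_ball_vol)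
    finally show ?thesis by simp
  qed
  show "sets (distr lborel borel (\<lambda>\<eta>::real \<times> real. (norm \<eta>)\<^sup>2)) = sigma_sets UNIV (range atMost)"
    by (subst sets_distr, rule sb)
  show "sets (density lborel (\<lambda>t. ennreal (pi * indicator {0..} t))) = sigma_sets UNIV (range (atMost :: real \<Rightarrow> _))"
    by (subst sets_density, subst sets_lborel, rule sb)
qed (auto simp: Int_stable_def real_arch_simple)
qed

lemma integral_norm_square_plane:
  fixes f :: "real \<Rightarrow> complex"
  assumes [measurable]: "f \<in> borel_measurable borel"
  shows "(\<integral>\<eta>. f ((norm (\<eta>::real \<times> real))\<^sup>2) \<partial>lborel) = (\<integral>t. (pi * indicator {0..} t) *\<^sub>R f t \<partial>lborel)"
proof -
  have "(\<integral>\<eta>. f ((norm (\<eta>::real \<times> real))\<^sup>2) \<partial>lborel) = (\<integral>t. f t \<partial>distr lborel borel (\<lambda>\<eta>::real \<times> real. (norm \<eta>)\<^sup>2))"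
    by (simp add: integral_distr)
  also have "\<dots> = (\<integral>t. (pi * indicator {0..} t) *\<^sub>R f t \<partial>lborel)"
    unfolding distr_norm_square_plane by (rule integral_density) auto
  finally show ?thesis .
qed

lemma integral_square_substitution:
  fixes f :: "real \<Rightarrow> complex"
  assumes c: "continuous_on UNIV f" and z: "\<And>w. w \<notin> {a\<^sup>2..b\<^sup>2} \<Longrightarrow> f w = 0" and ab: "0 \<le> a" "a \<le> b"
  shows "(\<integral>w. f w \<partial>lborel) = (\<integral>\<rho>. (2 * \<rho> * indicator {a..b} \<rho>) *\<^sub>R f (\<rho>\<^sup>2) \<partial>lborel)"
proof -
  have "((\<lambda>\<rho>. (2 * \<rho>) *\<^sub>R f (\<rho>\<^sup>2)) has_integral integral {a\<^sup>2..b\<^sup>2} f) {a..b}"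
    by (rule has_integral_substitution[where c="a\<^sup>2" and d="b\<^sup>2"])
       (use ab c in \<open>auto intro!: continuous_intros derivative_eq_intros power_mono integrable_continuous_real simp: has_real_derivative_iff_has_vector_derivative[symmetric] intro: continuous_on_subset\<close>)
  moreover have "integral {a\<^sup>2..b\<^sup>2} f = (\<integral>w. f w \<partial>lborel)"
  proof -
    have "integral {a\<^sup>2..b\<^sup>2} f = integral UNIV f"
      using z by (intro integral_spike_set integral_subset_negligible) (auto intro!: empty_imp_negligible)
    also have "\<dots> = (\<integral>w. f w \<partial>lborel)"
      by (rule integral_lborel) (rule integrable_continuous_support[OF c compact_Icc z])
    finally show ?thesis .
  qed
  moreover have "integral {a..b} (\<lambda>\<rho>. (2 * \<rho>) *\<^sub>R f (\<rho>\<^sup>2)) = (LINT \<rho>:{a..b}|lborel. (2 * \<rho>) *\<^sub>R f (\<rho>\<^sup>2))"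
    by (rule set_borel_integral_eq_integral(2)[symmetric], rule borel_integrable_atLeastAtMost')
       (use c in \<open>auto intro!: continuous_intros continuous_on_compose2[OF c]\<close>)
  ultimately show ?thesis
    by (simp add: integral_unique set_lebesgue_integral_def mult.commute)
qed

section \<open>Half-wave kernels\<close>

text \<open>Staying away from 0 keeps the symbol off the origin, where |\<xi>| is not smooth; the
  fixed interval [1/2, 2] is unit frequency after rescaling.\<close>

definition bump :: "(real \<Rightarrow> real) \<Rightarrow> bool" where
  "bump \<kappa> \<longleftrightarrow> (\<forall>n. ck n \<kappa>) \<and> (\<forall>x. x \<notin> {1/2..2} \<longrightarrow> \<kappa> x = 0)"

definition wave_symbol :: "(real \<Rightarrow> real) \<Rightarrow> real \<Rightarrow> R3 \<Rightarrow> complex" where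
  "wave_symbol \<kappa> \<tau> \<xi> = complex_of_real (\<kappa> (norm \<xi>)) * cis (\<tau> * norm \<xi>)"

definition ker :: "(real \<Rightarrow> real) \<Rightarrow> real \<Rightarrow> R3 \<Rightarrow> complex" where
  "ker \<kappa> \<tau> = inv_fourier (wave_symbol \<kappa> \<tau>)"

lemma bump_continuous: "bump \<kappa> \<Longrightarrow> continuous_on UNIV \<kappa>"
  using ck_imp_continuous by (auto simp: bump_def)

lemma bump_support: "bump \<kappa> \<Longrightarrow> x \<notin> {1/2..2} \<Longrightarrow> \<kappa> x = 0"
  by (auto simp: bump_def)

lemma bump_continuous_compose:
  assumes "bump \<kappa>" "continuous_on S f"
  shows "continuous_on S (\<lambda>x. \<kappa> (f x))"
  by (rule continuous_on_compose2[OF bump_continuous[OF assms(1)] assms(2)]) auto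

lemma continuous_wave_symbol:
  assumes "bump \<kappa>"
  shows "continuous_on UNIV (wave_symbol \<kappa> \<tau>)"
  unfolding wave_symbol_def
  by (intro continuous_intros bump_continuous_compose[OF assms])

lemma wave_symbol_support: "bump \<kappa> \<Longrightarrow> \<xi> \<notin> cball 0 2 \<Longrightarrow> wave_symbol \<kappa> \<tau> \<xi> = 0"
  by (simp add: wave_symbol_def bump_support)

lemma integrable_wave_symbol: "bump \<kappa> \<Longrightarrow> integrable lborel (wave_symbol \<kappa> \<tau>)"
  by (rule integrable_continuous_support[OF continuous_wave_symbol compact_cball[of 0 2]])
     (auto simp: wave_symbol_support)

lemma measurable_wave_symbol [measurable]: "bump \<kappa> \<Longrightarrow> wave_symbol \<kappa> \<tau> \<in> borel_measurable borel"
  by (intro borel_measurable_continuous_onI continuous_wave_symbol)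

lemma integral_symmetric_cis:
  assumes "a > 0" "b \<ge> 0"
  shows "(\<integral>x. indicator {-b..b} x *\<^sub>R cis (a * x) \<partial>lborel) = complex_of_real (2 * sin (a * b) / a)"
proof -
  let ?f = "\<lambda>x. cis (a * x) / (\<i> * complex_of_real a)"
  have "has_bochner_integral lborel (\<lambda>x. indicator {-b..b} x *\<^sub>R cis (a * x)) (?f b - ?f (-b))"
  proof (rule has_bochner_integral_FTC_Icc)
    fix x
    have "((\<lambda>x. cis (x * a)) has_vector_derivative (\<i> * complex_of_real a * cis (x * a))) (at x)"
      unfolding cis_conv_exp
      by (rule has_vector_derivative_real_field derivative_eq_intros refl | simp)+
    then have "((\<lambda>x. cis (x * a) * (1 / (\<i> * complex_of_real a))) has_vector_derivative (\<i> * complex_of_real a * cis (x * a)) * (1 / (\<i> * complex_of_real a))) (at x)"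
      by (rule has_vector_derivative_mult_left)
    then show "(?f has_vector_derivative cis (a * x)) (at x within {- b..b})"
      using \<open>a > 0\<close> by (auto simp: mult.commute intro: has_vector_derivative_at_within)
  qed (use assms in \<open>auto intro!: continuous_intros\<close>)
  moreover have "?f b - ?f (-b) = complex_of_real (2 * sin (a * b) / a)"
    using \<open>a > 0\<close> by (simp add: complex_eq_iff Re_divide Im_divide power2_eq_square field_simps)
  ultimately show ?thesis by (simp add: has_bochner_integral_iff)
qed

text \<open>A rotation carries |z| times the first basis vector to \<open>z\<close>; the radial
  factor and the measure do not see it.\<close>

lemma integral_rotate_first_axis:
  fixes G :: "real \<Rightarrow> complex" and z :: R3
  assumes [measurable]: "G \<in> borel_measurable borel"
  shows "(\<integral>\<xi>. cis (z \<bullet> \<xi>) * G ((norm \<xi>)\<^sup>2) \<partial>lborel) = (\<integral>\<xi>. cis (norm z * (\<xi>::R3) $ 1) * G ((norm \<xi>)\<^sup>2) \<partial>lborel)"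
proof -
  have "norm (norm z *\<^sub>R axis 1 1 :: R3) = norm z" by simp
  then obtain T :: "R3 \<Rightarrow> R3" where T: "orthogonal_transformation T" "T (norm z *\<^sub>R axis 1 1) = z"
    using orthogonal_transformation_exists by metis
  have [measurable]: "T \<in> borel_measurable borel"
    using T by (intro borel_measurable_continuous_onI linear_continuous_on)
      (auto simp: orthogonal_transformation_linear linear_linear)
  have "(\<integral>\<xi>. cis (z \<bullet> \<xi>) * G ((norm \<xi>)\<^sup>2) \<partial>lborel) = (\<integral>\<xi>. cis (z \<bullet> \<xi>) * G ((norm \<xi>)\<^sup>2) \<partial>distr lborel borel T)"
    using lborel_orthogonal[OF T(1)] by simp
  also have "\<dots> = (\<integral>\<xi>. cis (z \<bullet> T \<xi>) * G ((norm (T \<xi>))\<^sup>2) \<partial>lborel)"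
    by (subst integral_distr) auto
  also have "(\<lambda>\<xi>. z \<bullet> T \<xi>) = (\<lambda>\<xi>. norm z * \<xi> $ 1)"
    by (rule ext, subst (1) T(2)[symmetric]) (use T(1) in \<open>simp add: orthogonal_transformation_def inner_axis' del: T(2)\<close>)
  finally show ?thesis using T(1) by (simp add: orthogonal_transformation_norm)
qed

text \<open>Write \<xi> = (x, \<eta>) with \<eta> in the plane. The law of |\<eta>|^2 turns the
  planar integral into one over w = |\<xi>|^2 \<ge> x^2; after exchanging the order, x ranges over
  [-sqrt w, sqrt w] for fixed w, and the phase integrates to 2 sin(a sqrt w)/a. The substitution w =
  \<rho>^2 finishes.\<close>

lemma integral_radial:
  fixes G :: "real \<Rightarrow> complex"
  assumes c: "continuous_on UNIV G" and z: "\<And>w. w \<notin> {r\<^sup>2..R\<^sup>2} \<Longrightarrow> G w = 0" and r: "0 \<le> r" "r \<le> R" and a: "a > 0"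
  shows "(\<integral>\<xi>. cis (a * (\<xi>::R3) $ 1) * G ((norm \<xi>)\<^sup>2) \<partial>lborel)
    = (4 * pi / a) * (\<integral>\<rho>. indicator {r..R} \<rho> *\<^sub>R (complex_of_real (\<rho> * sin (a * \<rho>)) * G (\<rho>\<^sup>2)) \<partial>lborel)"
proof -
  have [measurable]: "G \<in> borel_measurable borel" using c by (rule borel_measurable_continuous_onI)
  have cG: "continuous_on S (\<lambda>x. G (f x))" if "continuous_on S f" for f :: "'x::topological_space \<Rightarrow> real" and S
    by (rule continuous_on_compose2[OF c that]) auto
  have n: "(norm (vec3 v))\<^sup>2 = (fst v)\<^sup>2 + (norm (snd v))\<^sup>2" for v
    unfolding power2_norm_eq_inner by (simp add: inner_vec_def sum_3 inner_prod_def power2_eq_square)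
  let ?F = "\<lambda>x (\<eta>::real \<times> real). cis (a * x) * G (x\<^sup>2 + (norm \<eta>)\<^sup>2)"
  have int1: "integrable (lborel \<Otimes>\<^sub>M lborel) (\<lambda>v. ?F (fst v) (snd v))"
    unfolding lborel_prod
  proof (rule integrable_continuous_support[of _ "cball 0 R"])
    show "continuous_on UNIV (\<lambda>v. ?F (fst v) (snd v))" by (intro continuous_intros cG)
    fix v :: "real \<times> real \<times> real" assume "v \<notin> cball 0 R"
    then have "R < norm v" by simp
    then have "R\<^sup>2 < (norm v)\<^sup>2" using r by (intro power_strict_mono) auto
    then have "R\<^sup>2 < (fst v)\<^sup>2 + (norm (snd v))\<^sup>2" by (simp add: norm_prod_def)
    then show "?F (fst v) (snd v) = 0" using z by auto
  qed simp
  have "(\<integral>\<xi>. cis (a * (\<xi>::R3) $ 1) * G ((norm \<xi>)\<^sup>2) \<partial>lborel) = (\<integral>v. ?F (fst v) (snd v) \<partial>(lborel \<Otimes>\<^sub>M lborel))"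
    by (subst integral_R3) (auto simp: n lborel_prod)
  also have "\<dots> = (\<integral>x. \<integral>\<eta>. ?F x \<eta> \<partial>lborel \<partial>lborel)"
    using lborel_pair.integral_fst'[OF int1] by simp
  also have "(\<lambda>x. \<integral>\<eta>. ?F x \<eta> \<partial>lborel) = (\<lambda>x. \<integral>w. (pi * indicator {x\<^sup>2..} w) *\<^sub>R (cis (a * x) * G w) \<partial>lborel)"
  proof
    fix x :: real
    have "(\<integral>\<eta>. ?F x \<eta> \<partial>lborel) = (\<integral>t. (pi * indicator {0..} t) *\<^sub>R (cis (a * x) * G (x\<^sup>2 + t)) \<partial>lborel)"
      by (rule integral_norm_square_plane[of "\<lambda>t. cis (a * x) * G (x\<^sup>2 + t)"]) measurable
    also have "\<dots> = (\<integral>w. (pi * indicator {x\<^sup>2..} w) *\<^sub>R (cis (a * x) * G w) \<partial>lborel)"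
      by (subst lborel_integral_real_affine[where c=1 and t="-x\<^sup>2"])
         (auto intro!: Bochner_Integration.integral_cong simp: indicator_def)
    finally show "(\<integral>\<eta>. ?F x \<eta> \<partial>lborel) = (\<integral>w. (pi * indicator {x\<^sup>2..} w) *\<^sub>R (cis (a * x) * G w) \<partial>lborel)" .
  qed
  also have "(\<integral>x. \<integral>w. (pi * indicator {x\<^sup>2..} w) *\<^sub>R (cis (a * x) * G w) \<partial>lborel \<partial>lborel)
     = (\<integral>w. \<integral>x. (pi * indicator {x\<^sup>2..} w) *\<^sub>R (cis (a * x) * G w) \<partial>lborel \<partial>lborel)"
  proof (rule lborel_pair.Fubini_integral[symmetric])
    \<comment> \<open>The majorant for Fubini lives on a rectangle: x^2 \<le> w \<le> R^2 forces |x|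
      \<le> R.\<close>
    have "integrable lborel (\<lambda>p::real \<times> real. indicator ({-R..R} \<times> {r\<^sup>2..R\<^sup>2}) p *\<^sub>R (pi * norm (G (snd p))))"
      by (rule borel_integrable_compact) (auto intro!: compact_Times continuous_intros cG)
    then have b: "integrable (lborel \<Otimes>\<^sub>M lborel) (\<lambda>p::real \<times> real. indicator ({-R..R} \<times> {r\<^sup>2..R\<^sup>2}) p *\<^sub>R (pi * norm (G (snd p))))"
      by (simp add: lborel_prod)
    have m: "(\<lambda>p::real \<times> real. (pi * (if (fst p)\<^sup>2 \<le> snd p then 1 else 0)) *\<^sub>R (cis (a * fst p) * G (snd p))) \<in> borel_measurable (lborel \<Otimes>\<^sub>M lborel)"
      by measurable
    have "integrable (lborel \<Otimes>\<^sub>M lborel) (\<lambda>p::real \<times> real. (pi * (if (fst p)\<^sup>2 \<le> snd p then 1 else 0)) *\<^sub>R (cis (a * fst p) * G (snd p)))"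
    proof (rule Bochner_Integration.integrable_bound[OF b m], rule AE_I2)
      fix p :: "real \<times> real"
      have "\<bar>fst p\<bar> \<le> R" if "(fst p)\<^sup>2 \<le> snd p" "snd p \<le> R\<^sup>2"
        using that r by (metis abs_le_square_iff abs_of_nonneg order_trans)
      then show "norm ((pi * (if (fst p)\<^sup>2 \<le> snd p then 1 else 0)) *\<^sub>R (cis (a * fst p) * G (snd p)))
        \<le> norm (indicator ({-R..R} \<times> {r\<^sup>2..R\<^sup>2}) p *\<^sub>R (pi * norm (G (snd p))))"
        using z[of "snd p"] by (cases "snd p \<in> {r\<^sup>2..R\<^sup>2}"; cases p) (auto simp: indicator_def norm_mult abs_le_iff)
    qed
    then show "integrable (lborel \<Otimes>\<^sub>M lborel) (\<lambda>(x, w). (pi * indicator {x\<^sup>2..} w) *\<^sub>R (cis (a * x) * G w))"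
      by (rule Bochner_Integration.integrable_cong[THEN iffD1, rotated -1]) (auto simp: indicator_def)
  qed
  also have "(\<lambda>w. \<integral>x. (pi * indicator {x\<^sup>2..} w) *\<^sub>R (cis (a * x) * G w) \<partial>lborel) = (\<lambda>w. G w * complex_of_real (pi * (2 * sin (a * sqrt w) / a)))"
  proof
    fix w :: real
    show "(\<integral>x. (pi * indicator {x\<^sup>2..} w) *\<^sub>R (cis (a * x) * G w) \<partial>lborel) = G w * complex_of_real (pi * (2 * sin (a * sqrt w) / a))"
  proof (cases "w \<ge> 0")
    case True
    have ab: "x\<^sup>2 \<le> w \<longleftrightarrow> \<bar>x\<bar> \<le> sqrt w" for x
      using real_sqrt_le_iff[of "x\<^sup>2" w] by simp
    have "indicator {x\<^sup>2..} w = (indicator {- sqrt w..sqrt w} x :: real)" for x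
      using ab[of x] by (auto simp: indicator_def)
    then have "(\<integral>x. (pi * indicator {x\<^sup>2..} w) *\<^sub>R (cis (a * x) * G w) \<partial>lborel)
      = (\<integral>x. (pi * G w) * (indicator {- sqrt w..sqrt w} x *\<^sub>R cis (a * x)) \<partial>lborel)"
      by (intro Bochner_Integration.integral_cong) (auto simp: indicator_def scaleR_conv_of_real)
    also have "\<dots> = (pi * G w) * complex_of_real (2 * sin (a * sqrt w) / a)"
      unfolding integral_mult_right_zero integral_symmetric_cis[OF a real_sqrt_ge_zero[OF True]] ..
    finally show ?thesis by (simp add: algebra_simps)
  next
    case False
    then have "G w = 0" using z[of w] by (smt (verit) atLeastAtMost_iff zero_le_power2)
    then show ?thesis by simp
  qed
  qed
  also have "(\<integral>w. G w * complex_of_real (pi * (2 * sin (a * sqrt w) / a)) \<partial>lborel)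
     = (\<integral>\<rho>. (2 * \<rho> * indicator {r..R} \<rho>) *\<^sub>R (G (\<rho>\<^sup>2) * complex_of_real (pi * (2 * sin (a * sqrt (\<rho>\<^sup>2)) / a))) \<partial>lborel)"
    by (rule integral_square_substitution[OF _ _ r]) (use z a in \<open>auto intro!: continuous_intros c\<close>)
  also have "\<dots> = (\<integral>\<rho>. (4 * pi / a) * (indicator {r..R} \<rho> *\<^sub>R (complex_of_real (\<rho> * sin (a * \<rho>)) * G (\<rho>\<^sup>2))) \<partial>lborel)"
    using r by (intro Bochner_Integration.integral_cong) (auto simp: indicator_def scaleR_conv_of_real)
  finally show ?thesis by (simp only: integral_mult_right_zero)
qed

text \<open>The sine in the radial formula splits into two exponentials, which combine with the
  phase cis(\<tau>\<rho>) to give an incoming and an outgoing wave. The extra factor \<rho> in the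
  profile is what the radial formula leaves after the division by |z|.\<close>

lemma ker_eq:
  assumes "bump \<kappa>" "z \<noteq> 0"
  shows "ker \<kappa> \<tau> z = (osc (\<lambda>\<rho>. \<rho> * \<kappa> \<rho>) (\<tau> + norm z) - osc (\<lambda>\<rho>. \<rho> * \<kappa> \<rho>) (\<tau> - norm z)) / (\<i> * norm z * (2 * pi)\<^sup>2)"
proof -
  let ?G = "\<lambda>w. complex_of_real (\<kappa> (sqrt w)) * cis (\<tau> * sqrt w)"
  let ?a = "norm z" let ?h = "\<lambda>\<rho>. \<rho> * \<kappa> \<rho>"
  have a: "?a > 0" using assms by simp
  have c: "continuous_on UNIV ?G"
    by (intro continuous_intros bump_continuous_compose[OF assms(1)])
  have zz: "?G w = 0" if "w \<notin> {(1/2)\<^sup>2..2\<^sup>2}" for w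
  proof -
    have "sqrt w \<notin> {1/2..2}"
    proof
      assume "sqrt w \<in> {1/2..2}"
      then have le: "1/2 \<le> sqrt w" "sqrt w \<le> 2" by auto
      then have "0 < sqrt w" by linarith
      then have "w > 0" by simp
      moreover have "(1/2)\<^sup>2 \<le> (sqrt w)\<^sup>2" by (rule power_mono) (use le in \<open>linarith | simp\<close>)+
      moreover have "(sqrt w)\<^sup>2 \<le> 2\<^sup>2" by (rule power_mono) (use le in \<open>linarith | simp\<close>)+
      ultimately show False using that by auto
    qed
    then show ?thesis using assms(1) by (simp add: bump_support)
  qed
  have h0: "?h x = 0" if "x \<notin> {1/2..2}" for x using assms(1) that by (simp add: bump_support)
  have ch: "continuous_on UNIV ?h" using bump_continuous[OF assms(1)] by (auto intro!: continuous_intros)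
  have "ker \<kappa> \<tau> z * (2 * pi) ^ 3 = (\<integral>\<xi>. cis (z \<bullet> \<xi>) * ?G ((norm \<xi>)\<^sup>2) \<partial>lborel)"
    by (simp add: ker_def inv_fourier_def wave_symbol_def)
  also have "\<dots> = (\<integral>\<xi>. cis (?a * (\<xi>::R3) $ 1) * ?G ((norm \<xi>)\<^sup>2) \<partial>lborel)"
    by (rule integral_rotate_first_axis) (rule borel_measurable_continuous_onI[OF c])
  also have "\<dots> = (4 * pi / ?a) * (\<integral>\<rho>. indicator {1/2..2} \<rho> *\<^sub>R (complex_of_real (\<rho> * sin (?a * \<rho>)) * ?G (\<rho>\<^sup>2)) \<partial>lborel)"
    by (rule integral_radial[OF c zz _ _ a]) auto
  also have "(\<integral>\<rho>. indicator {1/2..2} \<rho> *\<^sub>R (complex_of_real (\<rho> * sin (?a * \<rho>)) * ?G (\<rho>\<^sup>2)) \<partial>lborel)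
    = (\<integral>\<rho>. (complex_of_real (?h \<rho>) * cis (\<rho> * (\<tau> + ?a)) - complex_of_real (?h \<rho>) * cis (\<rho> * (\<tau> - ?a))) / (2 * \<i>) \<partial>lborel)"
  proof (rule Bochner_Integration.integral_cong[OF refl])
    fix \<rho> :: real
    have s: "2 * \<i> * complex_of_real (sin (?a * \<rho>)) = cis (\<rho> * ?a) - cis (- (\<rho> * ?a))"
      by (simp add: complex_eq_iff mult.commute)
    have e: "cis (\<rho> * (\<tau> + ?a)) - cis (\<rho> * (\<tau> - ?a)) = cis (\<tau> * \<rho>) * (cis (\<rho> * ?a) - cis (- (\<rho> * ?a)))"
      by (simp add: cis_mult algebra_simps)
    show "indicator {1/2..2} \<rho> *\<^sub>R (complex_of_real (\<rho> * sin (?a * \<rho>)) * ?G (\<rho>\<^sup>2))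
      = (complex_of_real (?h \<rho>) * cis (\<rho> * (\<tau> + ?a)) - complex_of_real (?h \<rho>) * cis (\<rho> * (\<tau> - ?a))) / (2 * \<i>)"
    proof (cases "\<rho> \<in> {1/2..2}")
      case True
      have "complex_of_real (?h \<rho>) * cis (\<rho> * (\<tau> + ?a)) - complex_of_real (?h \<rho>) * cis (\<rho> * (\<tau> - ?a))
        = complex_of_real (?h \<rho>) * (cis (\<tau> * \<rho>) * (2 * \<i> * complex_of_real (sin (?a * \<rho>))))"
        unfolding s e[symmetric] by (simp add: algebra_simps)
      then show ?thesis using True by (simp add: algebra_simps)
    qed (use h0 in auto)
  qed
  also have "\<dots> = (osc ?h (\<tau> + ?a) - osc ?h (\<tau> - ?a)) / (2 * \<i>)"
    unfolding osc_def
    by (simp only: integral_divide_zero Bochner_Integration.integral_diff[OF integrable_osc[OF ch h0] integrable_osc[OF ch h0]])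
  finally have "ker \<kappa> \<tau> z * (2 * pi) ^ 3 = (4 * pi / ?a) * ((osc ?h (\<tau> + ?a) - osc ?h (\<tau> - ?a)) / (2 * \<i>))" .
  then have "ker \<kappa> \<tau> z = (4 * pi / ?a) * ((osc ?h (\<tau> + ?a) - osc ?h (\<tau> - ?a)) / (2 * \<i>)) / (2 * pi) ^ 3"
    by (metis nonzero_mult_div_cancel_right mult_eq_0_iff of_real_eq_0_iff pi_neq_zero power_not_zero zero_neq_numeral of_real_numeral)
  also have "\<dots> = (osc ?h (\<tau> + ?a) - osc ?h (\<tau> - ?a)) / (\<i> * ?a * (2 * pi)\<^sup>2)"
    using a by (simp add: field_simps power2_eq_square power3_eq_cube)
  finally show ?thesis .
qed

lemma continuous_inv_fourier:
  assumes "integrable lborel g"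
  shows "continuous_on UNIV (inv_fourier g)"
  unfolding inv_fourier_def continuous_on_sequentially
proof (intro ballI allI impI)
  fix u :: "nat \<Rightarrow> R3" and x :: R3 assume u: "(\<forall>n. u n \<in> UNIV) \<and> u \<longlonglongrightarrow> x"
  have [measurable]: "g \<in> borel_measurable borel" using assms by auto
  have "(\<lambda>n. \<integral>\<xi>. cis (u n \<bullet> \<xi>) * g \<xi> \<partial>lborel) \<longlonglongrightarrow> (\<integral>\<xi>. cis (x \<bullet> \<xi>) * g \<xi> \<partial>lborel)"
  proof (rule integral_dominated_convergence[where w="\<lambda>\<xi>. norm (g \<xi>)"])
    show "AE \<xi> in lborel. (\<lambda>n. cis (u n \<bullet> \<xi>) * g \<xi>) \<longlonglongrightarrow> cis (x \<bullet> \<xi>) * g \<xi>"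
    proof (rule AE_I2)
      fix \<xi>
      have "isCont cis (x \<bullet> \<xi>)" using continuous_on_cis'[OF continuous_on_id, of UNIV]
        by (simp add: continuous_on_eq_continuous_at)
      moreover have "(\<lambda>n. u n \<bullet> \<xi>) \<longlonglongrightarrow> x \<bullet> \<xi>" using u by (intro tendsto_intros) auto
      ultimately have "(\<lambda>n. cis (u n \<bullet> \<xi>)) \<longlonglongrightarrow> cis (x \<bullet> \<xi>)"
        by (rule isCont_tendsto_compose)
      then show "(\<lambda>n. cis (u n \<bullet> \<xi>) * g \<xi>) \<longlonglongrightarrow> cis (x \<bullet> \<xi>) * g \<xi>"
        by (rule tendsto_mult_right)
    qed
  qed (use assms in \<open>auto simp: norm_mult\<close>)
  then show "((\<lambda>x. (\<integral>\<xi>. cis (x \<bullet> \<xi>) * g \<xi> \<partial>lborel) / complex_of_real ((2 * pi) ^ 3)) \<circ> u) \<longlonglongrightarrow> (\<integral>\<xi>. cis (x \<bullet> \<xi>) * g \<xi> \<partial>lborel) / complex_of_real ((2 * pi) ^ 3)"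
    unfolding o_def by (rule tendsto_divide[OF _ tendsto_const]) auto
qed

lemma continuous_ker: "bump \<kappa> \<Longrightarrow> continuous_on UNIV (ker \<kappa> \<tau>)"
  unfolding ker_def by (rule continuous_inv_fourier[OF integrable_wave_symbol])

text \<open>For |z| \<ge> 1 both arguments \<tau> \<plusminus> |z| have modulus at least d =
  ||\<tau>| - |z||, and 1 + |\<tau>| \<le> 2 |z| (1 + d) converts the division by |z| into time
  decay. For |z| < 1 the two oscillatory integrals nearly cancel, and the mean value theorem removes
  the division by |z|.\<close>

lemma ker_bound:
  assumes "bump \<kappa>"
  shows "\<exists>C>0. \<forall>\<tau> z. norm (ker \<kappa> \<tau> z) \<le> C / ((1 + \<bar>\<tau>\<bar>) * (1 + \<bar>\<bar>\<tau>\<bar> - norm z\<bar>) ^ N)"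
proof -
  let ?h = "\<lambda>\<rho>. \<rho> * \<kappa> \<rho>" and ?h1 = "\<lambda>\<rho>. \<rho> * (\<rho> * \<kappa> \<rho>)"
  have ck: "ck n \<kappa>" for n using assms by (simp add: bump_def)
  have ckh1: "ck n ?h" for n using ck_mult[OF ck_ident ck] .
  have ckh2: "ck n ?h1" for n using ck_mult[OF ck_ident ckh1] .
  note ckh = ckh1 ckh2
  have h0: "?h x = 0" "?h1 x = 0" if "x \<notin> {1/2..2}" for x using assms that by (simp_all add: bump_support)
  \<comment> \<open>One power beyond N: it pays for the factor 1 + |\<tau>| in both cases.\<close>
  define M where "M = N + 1"
  obtain D where D: "D > 0" "\<And>\<tau>. norm (osc ?h \<tau>) \<le> D / (1 + \<bar>\<tau>\<bar>) ^ M"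
    using osc_decay[OF ckh(1)[of M], of "1/2" 2] h0(1) by auto
  obtain E where E: "E > 0" "\<And>\<tau>. norm (osc ?h1 \<tau>) \<le> E / (1 + \<bar>\<tau>\<bar>) ^ M"
    using osc_decay[OF ckh(2)[of M], of "1/2" 2] h0(2) by auto
  \<comment> \<open>4 D serves |z| \<ge> 1. In the other term, 2 comes from the distance 2|z| of the
    two arguments, 2^M from 1 + |\<tau>| \<le> 2(1 + |t|) between them, and 2^N from 1 + d \<le> 2(1
    + |\<tau>|).\<close>
  define C where "C = 4 * D + 2 * 2 ^ (N+M) * E"
  have C: "C > 0" using D E by (simp add: C_def add_pos_pos)
  have nz: "norm (ker \<kappa> \<tau> z) \<le> C / ((1 + \<bar>\<tau>\<bar>) * (1 + \<bar>\<bar>\<tau>\<bar> - norm z\<bar>) ^ N)" if "z \<noteq> 0" for \<tau> z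
  proof -
    let ?a = "norm z" define d where "d = \<bar>\<bar>\<tau>\<bar> - norm z\<bar>"
    have a: "?a > 0" using that by simp
    have d0: "d \<ge> 0" by (simp add: d_def)
    have pi1: "(2 * pi)\<^sup>2 \<ge> 1" using pi_gt3 by (intro one_le_power) auto
    have k: "norm (ker \<kappa> \<tau> z) \<le> norm (osc ?h (\<tau> + ?a) - osc ?h (\<tau> - ?a)) / ?a"
    proof -
      have "norm (ker \<kappa> \<tau> z) = norm (osc ?h (\<tau> + ?a) - osc ?h (\<tau> - ?a)) / (?a * (2 * pi)\<^sup>2)"
        unfolding ker_eq[OF assms that] by (simp add: norm_divide norm_mult norm_power)
      also have "\<dots> \<le> norm (osc ?h (\<tau> + ?a) - osc ?h (\<tau> - ?a)) / ?a"
        using a pi1 by (intro divide_left_mono) auto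
      finally show ?thesis .
    qed
    show ?thesis
    proof (cases "?a \<ge> 1")
      case True
      have "norm (osc ?h (\<tau> + ?a)) \<le> D / (1 + d) ^ M" "norm (osc ?h (\<tau> - ?a)) \<le> D / (1 + d) ^ M"
      proof -
        have "d \<le> \<bar>\<tau> + ?a\<bar>" "d \<le> \<bar>\<tau> - ?a\<bar>" using a unfolding d_def by linarith+
        then have "(1 + d) ^ M \<le> (1 + \<bar>\<tau> + ?a\<bar>) ^ M" "(1 + d) ^ M \<le> (1 + \<bar>\<tau> - ?a\<bar>) ^ M"
          using d0 by (auto intro!: power_mono)
        then have "D / (1 + \<bar>\<tau> + ?a\<bar>) ^ M \<le> D / (1 + d) ^ M" "D / (1 + \<bar>\<tau> - ?a\<bar>) ^ M \<le> D / (1 + d) ^ M"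
          using D(1) d0 by (auto intro!: divide_left_mono mult_pos_pos zero_less_power)
        then show "norm (osc ?h (\<tau> + ?a)) \<le> D / (1 + d) ^ M" "norm (osc ?h (\<tau> - ?a)) \<le> D / (1 + d) ^ M"
          using D(2) order_trans by blast+
      qed
      then have "norm (osc ?h (\<tau> + ?a) - osc ?h (\<tau> - ?a)) \<le> 2 * D / (1 + d) ^ M"
        using norm_triangle_ineq4[of "osc ?h (\<tau> + ?a)" "osc ?h (\<tau> - ?a)"] by auto
      then have "norm (ker \<kappa> \<tau> z) \<le> 2 * D / (1 + d) ^ M / ?a"
        using k a by (meson divide_right_mono order_trans less_imp_le)
      also have "\<dots> = 2 * D / (?a * (1 + d) * (1 + d) ^ N)" by (simp add: mult_ac M_def)
      also have "\<dots> \<le> 4 * D / ((1 + \<bar>\<tau>\<bar>) * (1 + d) ^ N)"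
      proof -
        have "1 + \<bar>\<tau>\<bar> \<le> 1 + ?a + d" by (auto simp: d_def)
        also have "\<dots> \<le> 2 * (?a * (1 + d))" using True d0 mult_right_mono[of 1 ?a d] by (simp add: algebra_simps)
        finally have "(1 + \<bar>\<tau>\<bar>) * (1 + d) ^ N \<le> 2 * (?a * (1 + d)) * (1 + d) ^ N"
          using d0 by (intro mult_right_mono) auto
        moreover have "0 < (1 + \<bar>\<tau>\<bar>) * (1 + d) ^ N" using d0 by (intro mult_pos_pos zero_less_power) auto
        ultimately have "4 * D / (2 * (?a * (1 + d)) * (1 + d) ^ N) \<le> 4 * D / ((1 + \<bar>\<tau>\<bar>) * (1 + d) ^ N)"
          using D(1) d0 that by (intro divide_left_mono mult_pos_pos zero_less_power) auto
        moreover have "4 * D / (2 * (?a * (1 + d)) * (1 + d) ^ N) = 2 * D / (?a * (1 + d) * (1 + d) ^ N)"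
          using mult_divide_mult_cancel_left[of "2::real" "2 * D" "?a * (1 + d) * (1 + d) ^ N"] by (simp only: mult.assoc) simp
        ultimately show ?thesis by simp
      qed
      also have "\<dots> \<le> C / ((1 + \<bar>\<tau>\<bar>) * (1 + d) ^ N)"
        using d0 E by (intro divide_right_mono) (auto simp: C_def)
      finally show ?thesis by (simp add: d_def)
    next
      case False
      let ?B = "E * 2 ^ M / (1 + \<bar>\<tau>\<bar>) ^ M"
      \<comment> \<open>The derivative of \<open>osc ?h\<close> is controlled by
        \<open>osc ?h1\<close>, which decays at the same rate; over the interval of radius |z| < 1
        around \<tau> this decay is comparable to that at \<tau>.\<close>
      have "norm (osc ?h (\<tau> + ?a) - osc ?h (\<tau> - ?a)) \<le> ?B * norm ((\<tau> + ?a) - (\<tau> - ?a))"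
      proof (rule differentiable_bound[where f'="\<lambda>t x. x *\<^sub>R (\<i> * osc ?h1 t)" and S="{\<tau> - ?a..\<tau> + ?a}"])
        fix t assume t: "t \<in> {\<tau> - ?a..\<tau> + ?a}"
        have "(osc ?h has_vector_derivative \<i> * osc ?h1 t) (at t)"
          by (rule osc_deriv[OF ck_imp_continuous[OF ckh(1)] h0(1)])
        then show "(osc ?h has_derivative (\<lambda>x. x *\<^sub>R (\<i> * osc ?h1 t))) (at t within {\<tau> - ?a..\<tau> + ?a})"
          unfolding has_vector_derivative_def by (rule has_derivative_at_withinI)
        have "1 + \<bar>\<tau>\<bar> \<le> 2 * (1 + \<bar>t\<bar>)" 
        proof -
          have "\<bar>\<tau> - t\<bar> \<le> ?a" using t by (intro abs_leI) auto
          moreover have "A - B \<le> D \<Longrightarrow> D \<le> n \<Longrightarrow> \<not> 1 \<le> n \<Longrightarrow> 0 \<le> B \<Longrightarrow> 1 + A \<le> 2 * (1 + B)" for A B D n :: real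
            by argo
          ultimately show ?thesis using False abs_triangle_ineq2[of \<tau> t] abs_ge_zero[of t] by blast
        qed
        then have "(1 + \<bar>\<tau>\<bar>) ^ M \<le> (2 * (1 + \<bar>t\<bar>)) ^ M" by (intro power_mono) auto
        also have "\<dots> = 2 ^ M * (1 + \<bar>t\<bar>) ^ M" by (rule power_mult_distrib)
        finally have "E * 2 ^ M / (2 ^ M * (1 + \<bar>t\<bar>) ^ M) \<le> ?B"
          using E(1) by (intro divide_left_mono mult_pos_pos zero_less_power) auto
        then have "norm (osc ?h1 t) \<le> ?B" using E(2)[of t] by (simp add: mult.commute)
        then show "onorm (\<lambda>x. x *\<^sub>R (\<i> * osc ?h1 t)) \<le> ?B"
          by (intro onorm_le) (simp add: norm_mult mult_left_mono mult.commute[of ?B] del: times_divide_eq_right times_divide_eq_left)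
      qed auto
      also have "norm ((\<tau> + ?a) - (\<tau> - ?a)) = 2 * ?a" by simp
      finally have "norm (ker \<kappa> \<tau> z) \<le> ?B * (2 * ?a) / ?a"
        by (intro order_trans[OF k divide_right_mono[OF _ norm_ge_zero]])
      also have "\<dots> = 2 * ?B" using a by simp
      also have "\<dots> = 2 * E * 2 ^ M / ((1 + \<bar>\<tau>\<bar>) * (1 + \<bar>\<tau>\<bar>) ^ N)" by (simp add: M_def)
      also have "\<dots> \<le> 2 * E * 2 ^ M / ((1 + \<bar>\<tau>\<bar>) * ((1 + d) / 2) ^ N)"
      proof (rule divide_left_mono)
        have "1 + d \<le> 2 * (1 + \<bar>\<tau>\<bar>)" 
        proof -
          have "\<bar>\<bar>\<tau>\<bar> - ?a\<bar> \<le> \<bar>\<tau>\<bar> + ?a" by (rule abs_leI) auto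
          moreover have "D \<le> A + n \<Longrightarrow> \<not> 1 \<le> n \<Longrightarrow> 0 \<le> A \<Longrightarrow> 1 + D \<le> 2 * (1 + A)" for A D n :: real
            by argo
          ultimately show ?thesis using False abs_ge_zero[of \<tau>] unfolding d_def by blast
        qed
        then show "(1 + \<bar>\<tau>\<bar>) * ((1 + d) / 2) ^ N \<le> (1 + \<bar>\<tau>\<bar>) * (1 + \<bar>\<tau>\<bar>) ^ N"
          using d0 by (intro mult_left_mono power_mono) auto
      qed (use d0 E in \<open>auto intro!: mult_pos_pos zero_less_power\<close>)
      also have "\<dots> = 2 * 2 ^ (N+M) * E / ((1 + \<bar>\<tau>\<bar>) * (1 + d) ^ N)"
        unfolding power_divide power_add by (simp add: mult_ac)
      also have "\<dots> \<le> C / ((1 + \<bar>\<tau>\<bar>) * (1 + d) ^ N)"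
        using d0 D by (intro divide_right_mono) (auto simp: C_def)
      finally show ?thesis by (simp add: d_def)
    qed
  qed
  \<comment> \<open>The explicit formula excludes z = 0; there the bound passes to the limit along a
    sequence of nonzero points, as the kernel is continuous.\<close>
  have "norm (ker \<kappa> \<tau> 0) \<le> C / ((1 + \<bar>\<tau>\<bar>) * (1 + \<bar>\<bar>\<tau>\<bar> - norm (0::R3)\<bar>) ^ N)" for \<tau>
  proof -
    define u :: "nat \<Rightarrow> R3" where "u n = (1 / real (Suc n)) *\<^sub>R axis 1 1" for n
    have u: "u \<longlonglongrightarrow> 0 *\<^sub>R axis 1 1"
      unfolding u_def by (intro tendsto_intros) (rule LIMSEQ_Suc[OF lim_1_over_n])
    then have u: "u \<longlonglongrightarrow> 0" by simp
    have "u n \<noteq> 0" for n by (simp add: u_def)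
    then have le: "norm (ker \<kappa> \<tau> (u n)) \<le> C / ((1 + \<bar>\<tau>\<bar>) * (1 + \<bar>\<bar>\<tau>\<bar> - norm (u n)\<bar>) ^ N)" for n
      by (rule nz)
    have "(\<lambda>n. norm (ker \<kappa> \<tau> (u n))) \<longlonglongrightarrow> norm (ker \<kappa> \<tau> 0)"
      by (rule tendsto_norm, rule isCont_tendsto_compose[OF _ u])
        (use continuous_ker[OF assms, of \<tau>] in \<open>simp add: continuous_on_eq_continuous_at\<close>)
    moreover have "(\<lambda>n. C / ((1 + \<bar>\<tau>\<bar>) * (1 + \<bar>\<bar>\<tau>\<bar> - norm (u n)\<bar>) ^ N)) \<longlonglongrightarrow> C / ((1 + \<bar>\<tau>\<bar>) * (1 + \<bar>\<bar>\<tau>\<bar> - norm (0::R3)\<bar>) ^ N)"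
      by (intro tendsto_intros u) (auto simp: add_nonneg_eq_0_iff)
    ultimately show ?thesis using le by (intro LIMSEQ_le) auto
  qed
  then show ?thesis using nz C by metis
qed

section \<open>Changes of variables and products\<close>

lemma nn_integral_affine:
  fixes f :: "'a::euclidean_space \<Rightarrow> ennreal"
  assumes [measurable]: "f \<in> borel_measurable borel" and c: "c \<noteq> 0"
  shows "(\<integral>\<^sup>+x. f x \<partial>lborel) = ennreal (\<bar>c\<bar> ^ DIM('a)) * (\<integral>\<^sup>+x. f (t + c *\<^sub>R x) \<partial>lborel)"
  by (subst lborel_affine[OF c, of t])
     (simp add: nn_integral_density nn_integral_distr nn_integral_cmult)

lemma integral_affine:
  fixes f :: "'a::euclidean_space \<Rightarrow> 'b::{banach,second_countable_topology}"
  assumes [measurable]: "f \<in> borel_measurable borel" and c: "c \<noteq> 0"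
  shows "(\<integral>x. f x \<partial>lborel) = (\<bar>c\<bar> ^ DIM('a)) *\<^sub>R (\<integral>x. f (t + c *\<^sub>R x) \<partial>lborel)"
  by (subst lborel_affine[OF c, of t]) (simp add: integral_density integral_distr)

lemma integrable_affine:
  fixes f :: "'a::euclidean_space \<Rightarrow> 'b::{banach,second_countable_topology}"
  assumes f: "integrable lborel f" and c: "c \<noteq> 0"
  shows "integrable lborel (\<lambda>x. f (t + c *\<^sub>R x))"
proof -
  have [measurable]: "f \<in> borel_measurable borel" using f by auto
  from f have "integrable (density (distr lborel borel (\<lambda>x. t + c *\<^sub>R x)) (\<lambda>_. ennreal (\<bar>c\<bar> ^ DIM('a)))) f"
    using lborel_affine[OF c, of t] by simp
  then have "integrable lborel (\<lambda>x. \<bar>c\<bar> ^ DIM('a) *\<^sub>R f (t + c *\<^sub>R x))"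
    by (simp add: integrable_density integrable_distr_eq)
  from integrable_scaleR_right[OF this, of "inverse (\<bar>c\<bar> ^ DIM('a))"] show ?thesis using c by simp
qed

lemma integrable_reflect:
  fixes f :: "'a::euclidean_space \<Rightarrow> 'b::{banach,second_countable_topology}"
  shows "integrable lborel f \<Longrightarrow> integrable lborel (\<lambda>y. f (x - y))"
  using integrable_affine[of f "-1" x] by simp

lemma integral_reflect:
  fixes f :: "'a::euclidean_space \<Rightarrow> 'b::{banach,second_countable_topology}"
  shows "f \<in> borel_measurable borel \<Longrightarrow> (\<integral>y. f (x - y) \<partial>lborel) = (\<integral>y. f y \<partial>lborel)"
  using integral_affine[of f "-1" x] by simp

text \<open>By Tonelli the modulus integrates to the product of the two L^1 norms. The pair is
  ordered (y, x) so that the inner integral is the translation-invariant one.\<close>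

lemma integrable_convolution:
  fixes f g :: "'a::euclidean_space \<Rightarrow> complex"
  assumes f: "integrable lborel f" and g: "integrable lborel g"
  shows "integrable (lborel \<Otimes>\<^sub>M lborel) (\<lambda>(y, x). f (x - y) * g y)"
proof (rule lborel_pair.Fubini_integrable)
  have [measurable]: "f \<in> borel_measurable borel" "g \<in> borel_measurable borel" using f g by auto
  show "(\<lambda>(y, x). f (x - y) * g y) \<in> borel_measurable (lborel \<Otimes>\<^sub>M lborel)" by measurable
  have i: "integrable lborel (\<lambda>x. f (x - y))" for y
    using integrable_affine[OF f, of 1 "-y"] by simp
  have "(\<integral>x. norm (f (x - y) * g y) \<partial>lborel) = (\<integral>x. norm (f x) \<partial>lborel) * norm (g y)" for y
    using integral_affine[of "\<lambda>x. norm (f x)" 1 "-y"] by (simp add: norm_mult)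
  then show "integrable lborel (\<lambda>y. \<integral>x. norm (case (y, x) of (y, x) \<Rightarrow> f (x - y) * g y) \<partial>lborel)"
    using g by simp
  show "AE y in lborel. integrable lborel (\<lambda>x. case (y, x) of (y, x) \<Rightarrow> f (x - y) * g y)"
    using i by simp
qed

lemma integrable_tensor:
  fixes f :: "'a::euclidean_space \<Rightarrow> complex" and g :: "'b::euclidean_space \<Rightarrow> complex"
  assumes f: "integrable lborel f" and g: "integrable lborel g"
  shows "integrable (lborel \<Otimes>\<^sub>M lborel) (\<lambda>(x, y). f x * g y)"
proof (rule lborel_pair.Fubini_integrable)
  have [measurable]: "f \<in> borel_measurable borel" "g \<in> borel_measurable borel" using f g by auto
  show "(\<lambda>(x, y). f x * g y) \<in> borel_measurable (lborel \<Otimes>\<^sub>M lborel)" by measurable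
  show "integrable lborel (\<lambda>x. \<integral>y. norm (case (x, y) of (x, y) \<Rightarrow> f x * g y) \<partial>lborel)"
    using f by (simp add: norm_mult)
  show "AE x in lborel. integrable lborel (\<lambda>y. case (x, y) of (x, y) \<Rightarrow> f x * g y)"
    using g by simp
qed

lemma integral_tensor:
  fixes f :: "'a::euclidean_space \<Rightarrow> complex" and g :: "'b::euclidean_space \<Rightarrow> complex"
  assumes f: "integrable lborel f" and g: "integrable lborel g"
  shows "integrable lborel (\<lambda>p. f (fst p) * g (snd p))"
    and "(\<integral>p. f (fst p) * g (snd p) \<partial>lborel) = (\<integral>x. f x \<partial>lborel) * (\<integral>y. g y \<partial>lborel)"
proof -
  have i: "integrable (lborel \<Otimes>\<^sub>M lborel) (\<lambda>(x, y). f x * g y)" by (rule integrable_tensor[OF f g])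
  then show "integrable lborel (\<lambda>p. f (fst p) * g (snd p))" by (simp only: lborel_prod case_prod_beta')
  have "(\<integral>p. f (fst p) * g (snd p) \<partial>lborel) = (\<integral>p. (case p of (x, y) \<Rightarrow> f x * g y) \<partial>(lborel \<Otimes>\<^sub>M lborel))"
    by (simp add: lborel_prod case_prod_beta)
  also have "\<dots> = (\<integral>x. \<integral>y. f x * g y \<partial>lborel \<partial>lborel)"
    using lborel_pair.integral_fst'[OF i] by simp
  also have "\<dots> = (\<integral>x. f x \<partial>lborel) * (\<integral>y. g y \<partial>lborel)" by simp
  finally show "(\<integral>p. f (fst p) * g (snd p) \<partial>lborel) = (\<integral>x. f x \<partial>lborel) * (\<integral>y. g y \<partial>lborel)" .
qed

lemma integral_tensor_R3:
  fixes f g h :: "real \<Rightarrow> complex"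
  assumes f: "integrable lborel f" and g: "integrable lborel g" and h: "integrable lborel h"
  shows "integrable lborel (\<lambda>z::R3. f (z $ 1) * (g (z $ 2) * h (z $ 3)))"
    and "(\<integral>z. f ((z::R3) $ 1) * (g (z $ 2) * h (z $ 3)) \<partial>lborel)
      = (\<integral>x. f x \<partial>lborel) * ((\<integral>x. g x \<partial>lborel) * (\<integral>x. h x \<partial>lborel))"
proof -
  have [measurable]: "f \<in> borel_measurable borel" "g \<in> borel_measurable borel" "h \<in> borel_measurable borel"
    using f g h by auto
  note gh = integral_tensor[OF g h]
  note fgh = integral_tensor[OF f gh(1)]
  have m: "(\<lambda>z::R3. f (z $ 1) * (g (z $ 2) * h (z $ 3))) \<in> borel_measurable borel" by measurable
  show "integrable lborel (\<lambda>z::R3. f (z $ 1) * (g (z $ 2) * h (z $ 3)))"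
    using fgh(1) by (subst integrable_R3[OF m]) simp
  show "(\<integral>z. f ((z::R3) $ 1) * (g (z $ 2) * h (z $ 3)) \<partial>lborel)
      = (\<integral>x. f x \<partial>lborel) * ((\<integral>x. g x \<partial>lborel) * (\<integral>x. h x \<partial>lborel))"
    unfolding integral_R3[OF m] using fgh(2) gh(2) by simp
qed

lemma inner_R3: "(x::R3) \<bullet> y = x $ 1 * y $ 1 + x $ 2 * y $ 2 + x $ 3 * y $ 3"
  by (simp add: inner_vec_def sum_3)

lemma norm_square_R3: "(norm (x::R3))\<^sup>2 = (x $ 1)\<^sup>2 + (x $ 2)\<^sup>2 + (x $ 3)\<^sup>2"
  unfolding power2_norm_eq_inner inner_R3 by (simp add: power2_eq_square)

text \<open>The power 6 is what three factors 1 + z_i^2 \<le> (1 + |z|)^2 produce; each of their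
  reciprocals is integrable on the line.\<close>

lemma integrable_norm_decay: "integrable lborel (\<lambda>z::R3. 1 / (1 + norm z) ^ 6)"
proof -
  let ?q = "\<lambda>x::real. complex_of_real (inverse (1 + x\<^sup>2))"
  have "integrable lborel (\<lambda>x::real. inverse (1 + x\<^sup>2))"
    using integrable_inverse_1_plus_square by (simp add: set_integrable_def)
  then have q: "integrable lborel ?q" by (rule integrable_of_real)
  have nn: "(0::real) < 1 + x\<^sup>2" for x by (simp add: add_pos_nonneg)
  show ?thesis
  proof (rule Bochner_Integration.integrable_bound[OF integral_tensor_R3(1)[OF q q q]])
    show "AE z in lborel. norm (1 / (1 + norm (z::R3)) ^ 6) \<le> norm (?q (z $ 1) * (?q (z $ 2) * ?q (z $ 3)))"
    proof (rule AE_I2)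
      fix z :: R3
      have le: "1 + (z $ i)\<^sup>2 \<le> (1 + norm z)\<^sup>2" for i
      proof -
        have "\<bar>z $ i\<bar> \<le> norm z" by (rule component_le_norm_cart)
        then have "(z $ i)\<^sup>2 \<le> (norm z)\<^sup>2" by (metis abs_le_square_iff abs_norm_cancel)
        then show ?thesis by (simp add: power2_sum add_increasing2)
      qed
      have "(1 + (z $ 1)\<^sup>2) * ((1 + (z $ 2)\<^sup>2) * (1 + (z $ 3)\<^sup>2)) \<le> (1 + norm z)\<^sup>2 * ((1 + norm z)\<^sup>2 * (1 + norm z)\<^sup>2)"
        using nn by (intro mult_mono le) (auto simp: less_imp_le)
      also have "\<dots> = (1 + norm z) ^ 6" by (simp add: power_add[symmetric])
      finally have "1 / (1 + norm z) ^ 6 \<le> 1 / ((1 + (z $ 1)\<^sup>2) * ((1 + (z $ 2)\<^sup>2) * (1 + (z $ 3)\<^sup>2)))"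
        using nn by (intro divide_left_mono mult_pos_pos zero_less_power) (auto simp: add_pos_nonneg)
      also have "\<dots> = norm (?q (z $ 1) * (?q (z $ 2) * ?q (z $ 3)))"
        unfolding of_real_mult[symmetric] norm_of_real
        using nn[of "z $ 1"] nn[of "z $ 2"] nn[of "z $ 3"] by (simp add: inverse_eq_divide abs_mult)
      finally show "norm (1 / (1 + norm z) ^ 6) \<le> norm (?q (z $ 1) * (?q (z $ 2) * ?q (z $ 3)))"
        by (simp add: norm_power)
    qed
  qed measurable
qed

section \<open>Fourier inversion for integrable transforms\<close>

text \<open>The standard Gaussian as a product of normal densities, so that its transform can be
  read off from the characteristic function of the normal distribution.\<close>

definition gauss :: "R3 \<Rightarrow> complex" where
  "gauss z = complex_of_real (std_normal_density (z $ 1)) *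
     (complex_of_real (std_normal_density (z $ 2)) * complex_of_real (std_normal_density (z $ 3)))"

lemma gauss_eq: "gauss z = complex_of_real (exp (- (norm z)\<^sup>2 / 2) / sqrt (2 * pi) ^ 3)"
  by (simp add: gauss_def std_normal_density_def norm_square_R3 power3_eq_cube exp_add[symmetric] add_divide_distrib diff_divide_distrib flip: of_real_mult)
    (simp add: algebra_simps)

lemma fourier_gauss:
  shows "integrable lborel gauss"
    and "(\<integral>z. cis (w \<bullet> z) * gauss z \<partial>lborel) = complex_of_real (exp (- (norm w)\<^sup>2 / 2))"
proof -
  let ?n = "\<lambda>t x. cis (t * x) * complex_of_real (std_normal_density x)"
  have i1: "integrable lborel (\<lambda>x. complex_of_real (std_normal_density x))"
    using integrable_std_normal_moment[of 0] by simp
  have i: "integrable lborel (?n t)" for t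
    by (rule Bochner_Integration.integrable_bound[OF i1]) (auto simp: norm_mult)
  have e: "(\<integral>x. ?n t x \<partial>lborel) = complex_of_real (exp (- t\<^sup>2 / 2))" for t
  proof -
    have "char std_normal_distribution t = (\<integral>x. std_normal_density x *\<^sub>R exp (\<i> * complex_of_real (t * x)) \<partial>lborel)"
      unfolding char_def by (subst integral_density) (auto simp: normal_density_nonneg)
    then show ?thesis
      unfolding char_std_normal_distribution by (simp add: cis_conv_exp scaleR_conv_of_real mult.commute)
  qed
  show "integrable lborel gauss"
    unfolding gauss_def[abs_def] by (rule integral_tensor_R3(1)[OF i1 i1 i1])
  have "(\<lambda>z. cis (w \<bullet> z) * gauss z) = (\<lambda>z. ?n (w $ 1) (z $ 1) * (?n (w $ 2) (z $ 2) * ?n (w $ 3) (z $ 3)))"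
    by (rule ext) (simp add: gauss_def inner_R3 cis_mult[symmetric] mult_ac)
  then have "(\<integral>z. cis (w \<bullet> z) * gauss z \<partial>lborel)
    = complex_of_real (exp (- (w $ 1)\<^sup>2 / 2)) * (complex_of_real (exp (- (w $ 2)\<^sup>2 / 2)) * complex_of_real (exp (- (w $ 3)\<^sup>2 / 2)))"
    by (simp only: integral_tensor_R3(2)[OF i i i] e)
  also have "\<dots> = complex_of_real (exp (- (norm w)\<^sup>2 / 2))"
    by (simp add: norm_square_R3 exp_add[symmetric] add_divide_distrib diff_divide_distrib flip: of_real_mult)
  finally show "(\<integral>z. cis (w \<bullet> z) * gauss z \<partial>lborel) = complex_of_real (exp (- (norm w)\<^sup>2 / 2))" .
qed

text \<open>Gaussian regularisation: a factor exp(-\<epsilon>^2 |z|^2/2) permits Fubini and turns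
  the left side into the average of \<open>m\<close> against a Gaussian of width \<epsilon> around
  \<eta>. As \<epsilon> tends to 0, the left side converges because the inverse transform is
  integrable, the right side because \<open>m\<close> is bounded and continuous.\<close>

lemma fourier_inversion:
  assumes c: "continuous_on UNIV m" and i: "integrable lborel m" and b: "\<And>\<xi>. norm (m \<xi>) \<le> B"
    and k: "integrable lborel (inv_fourier m)"
  shows "(\<integral>z. inv_fourier m z * cis (- (z \<bullet> \<eta>)) \<partial>lborel) = m \<eta>"
proof -
  have [measurable]: "m \<in> borel_measurable borel" using i by auto
  have [measurable]: "inv_fourier m \<in> borel_measurable borel" using k by auto
  have [measurable]: "gauss \<in> borel_measurable borel" using fourier_gauss(1) by auto
  define e where "e n = 1 / real (Suc n)" for n
  have e: "e n > 0" for n by (simp add: e_def)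
  have e0: "e \<longlonglongrightarrow> 0" unfolding e_def by (rule LIMSEQ_Suc[OF lim_1_over_n])
  \<comment> \<open>Rescales the Gaussian density to the value 1 at the origin, so that the inserted
    factor tends to 1.\<close>
  let ?c = "complex_of_real (sqrt (2 * pi) ^ 3)"
  let ?A = "\<lambda>n. \<integral>z. inv_fourier m z * cis (- (z \<bullet> \<eta>)) * (?c * gauss (e n *\<^sub>R z)) \<partial>lborel"
  have "sqrt (2 * pi) > 0" by simp
  then have cne: "?c \<noteq> 0" by (metis less_irrefl of_real_eq_0_iff power_eq_0_iff)
  have cg: "?c * gauss z = complex_of_real (exp (- (norm z)\<^sup>2 / 2))" for z
    using cne unfolding gauss_eq of_real_divide by simp
  have "?A \<longlonglongrightarrow> (\<integral>z. inv_fourier m z * cis (- (z \<bullet> \<eta>)) \<partial>lborel)"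
  proof (rule integral_dominated_convergence[where w="\<lambda>z. norm (inv_fourier m z)"])
    show "AE z in lborel. (\<lambda>n. inv_fourier m z * cis (- (z \<bullet> \<eta>)) * (?c * gauss (e n *\<^sub>R z))) \<longlonglongrightarrow> inv_fourier m z * cis (- (z \<bullet> \<eta>))"
    proof (rule AE_I2)
      fix z :: R3
      have "(\<lambda>n. exp (- (norm (e n *\<^sub>R z))\<^sup>2 / 2)) \<longlonglongrightarrow> exp (- (norm (0 *\<^sub>R z))\<^sup>2 / 2)"
        by (intro tendsto_intros e0) simp
      then have "(\<lambda>n. ?c * gauss (e n *\<^sub>R z)) \<longlonglongrightarrow> complex_of_real (exp (- (norm (0 *\<^sub>R z))\<^sup>2 / 2))"
        unfolding cg by (rule tendsto_of_real)
      from tendsto_mult_left[OF this, of "inv_fourier m z * cis (- (z \<bullet> \<eta>))"]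
      show "(\<lambda>n. inv_fourier m z * cis (- (z \<bullet> \<eta>)) * (?c * gauss (e n *\<^sub>R z))) \<longlonglongrightarrow> inv_fourier m z * cis (- (z \<bullet> \<eta>))"
        by simp
    qed
    show "AE z in lborel. norm (inv_fourier m z * cis (- (z \<bullet> \<eta>)) * (?c * gauss (e n *\<^sub>R z))) \<le> norm (inv_fourier m z)" for n
      unfolding cg by (rule AE_I2) (simp add: norm_mult mult_left_le)
  qed (use k in auto)
  moreover have "?A n = (\<integral>\<zeta>. m (\<eta> + e n *\<^sub>R \<zeta>) * gauss \<zeta> \<partial>lborel)" for n
  proof -
    let ?g = "\<lambda>z. gauss (e n *\<^sub>R z)"
    have ig: "integrable lborel ?g" using integrable_affine[OF fourier_gauss(1), of "e n" 0] e[of n] by simp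
    have "?A n = (\<integral>z. \<integral>\<xi>. (m \<xi> * (?c * ?g z / (2 * pi) ^ 3)) * cis (z \<bullet> (\<xi> - \<eta>)) \<partial>lborel \<partial>lborel)"
    proof (rule Bochner_Integration.integral_cong[OF refl])
      fix z :: R3
      have "inv_fourier m z * cis (- (z \<bullet> \<eta>)) * (?c * ?g z)
        = (\<integral>\<xi>. cis (z \<bullet> \<xi>) * m \<xi> \<partial>lborel) * (cis (- (z \<bullet> \<eta>)) * (?c * ?g z) / (2 * pi) ^ 3)"
        unfolding inv_fourier_def by simp
      also have "\<dots> = (\<integral>\<xi>. cis (z \<bullet> \<xi>) * m \<xi> * (cis (- (z \<bullet> \<eta>)) * (?c * ?g z) / (2 * pi) ^ 3) \<partial>lborel)"
        by (rule integral_mult_left_zero[symmetric])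
      also have "\<dots> = (\<integral>\<xi>. (m \<xi> * (?c * ?g z / (2 * pi) ^ 3)) * cis (z \<bullet> (\<xi> - \<eta>)) \<partial>lborel)"
      proof (rule Bochner_Integration.integral_cong[OF refl])
        fix \<xi> :: R3
        have "cis (z \<bullet> (\<xi> - \<eta>)) = cis (z \<bullet> \<xi>) * cis (- (z \<bullet> \<eta>))" by (simp add: cis_mult inner_diff_right)
        then show "cis (z \<bullet> \<xi>) * m \<xi> * (cis (- (z \<bullet> \<eta>)) * (?c * ?g z) / (2 * pi) ^ 3) = (m \<xi> * (?c * ?g z / (2 * pi) ^ 3)) * cis (z \<bullet> (\<xi> - \<eta>))"
          by (simp add: mult_ac)
      qed
      finally show "inv_fourier m z * cis (- (z \<bullet> \<eta>)) * (?c * ?g z) = (\<integral>\<xi>. (m \<xi> * (?c * ?g z / (2 * pi) ^ 3)) * cis (z \<bullet> (\<xi> - \<eta>)) \<partial>lborel)" .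
    qed
    also have "\<dots> = (\<integral>\<xi>. \<integral>z. (m \<xi> * (?c * ?g z / (2 * pi) ^ 3)) * cis (z \<bullet> (\<xi> - \<eta>)) \<partial>lborel \<partial>lborel)"
    proof (rule lborel_pair.Fubini_integral)
      have "integrable (lborel \<Otimes>\<^sub>M lborel) (\<lambda>(\<xi>, z). m \<xi> * (?c * ?g z / (2 * pi) ^ 3))"
        by (rule integrable_tensor) (use i ig in auto)
      then show "integrable (lborel \<Otimes>\<^sub>M lborel) (\<lambda>(\<xi>, z). (m \<xi> * (?c * ?g z / (2 * pi) ^ 3)) * cis (z \<bullet> (\<xi> - \<eta>)))"
      proof (rule Bochner_Integration.integrable_bound)
        show "(\<lambda>(\<xi>, z). (m \<xi> * (?c * ?g z / (2 * pi) ^ 3)) * cis (z \<bullet> (\<xi> - \<eta>))) \<in> borel_measurable (lborel \<Otimes>\<^sub>M lborel)"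
          by measurable
      qed (auto simp: norm_mult norm_divide intro!: AE_I2)
    qed
    \<comment> \<open>The inner integral is the transform of a dilated Gaussian: an approximate
      identity centred at \<eta>.\<close>
    also have "\<dots> = (\<integral>\<xi>. m \<xi> * (complex_of_real (1 / e n ^ 3) * gauss ((1 / e n) *\<^sub>R (\<xi> - \<eta>))) \<partial>lborel)"
    proof (rule Bochner_Integration.integral_cong[OF refl])
      fix \<xi> :: R3
      let ?w = "\<xi> - \<eta>"
      have "(\<integral>z. cis (?w \<bullet> z) * ?g z \<partial>lborel) = \<bar>1 / e n\<bar> ^ 3 *\<^sub>R (\<integral>z. cis (?w \<bullet> ((1 / e n) *\<^sub>R z)) * gauss (e n *\<^sub>R ((1 / e n) *\<^sub>R z)) \<partial>lborel)"
        using integral_affine[of "\<lambda>z. cis (?w \<bullet> z) * ?g z" "1 / e n" 0] e[of n] by simp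
      also have "\<dots> = (1 / e n) ^ 3 *\<^sub>R (\<integral>z. cis (((1 / e n) *\<^sub>R ?w) \<bullet> z) * gauss z \<partial>lborel)"
        using e[of n] by simp
      also have "\<dots> = (1 / e n) ^ 3 *\<^sub>R (?c * gauss ((1 / e n) *\<^sub>R ?w))"
        unfolding cg fourier_gauss(2) ..
      finally have g: "(\<integral>z. cis (?w \<bullet> z) * ?g z \<partial>lborel) = (1 / e n) ^ 3 *\<^sub>R (?c * gauss ((1 / e n) *\<^sub>R ?w))" .
      have "(\<integral>z. (m \<xi> * (?c * ?g z / (2 * pi) ^ 3)) * cis (z \<bullet> ?w) \<partial>lborel) = (\<integral>z. (m \<xi> * (?c / (2 * pi) ^ 3)) * (cis (?w \<bullet> z) * ?g z) \<partial>lborel)"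
        by (rule Bochner_Integration.integral_cong[OF refl]) (simp add: inner_commute mult_ac)
      also have "\<dots> = (m \<xi> * (?c / (2 * pi) ^ 3)) * ((1 / e n) ^ 3 *\<^sub>R (?c * gauss ((1 / e n) *\<^sub>R ?w)))"
        by (simp only: integral_mult_right_zero g)
      also have "\<dots> = (?c * ?c / complex_of_real ((2 * pi) ^ 3)) * (m \<xi> * (complex_of_real ((1 / e n) ^ 3) * gauss ((1 / e n) *\<^sub>R ?w)))"
        by (simp add: scaleR_conv_of_real mult_ac)
      \<comment> \<open>One factor (2\<pi>)^(3/2) comes from the regularising factor, the other from
        its transform; together they cancel the normalisation of \<open>inv_fourier\<close>.\<close>
      also have "?c * ?c / complex_of_real ((2 * pi) ^ 3) = 1"
      proof -
        have "sqrt (2 * pi) ^ 3 * sqrt (2 * pi) ^ 3 = (2 * pi) ^ 3"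
          by (simp add: power_mult_distrib[symmetric])
        then show ?thesis by (simp only: of_real_mult[symmetric] of_real_divide[symmetric]) simp
      qed
      finally show "(\<integral>z. (m \<xi> * (?c * ?g z / (2 * pi) ^ 3)) * cis (z \<bullet> (\<xi> - \<eta>)) \<partial>lborel) = m \<xi> * (complex_of_real (1 / e n ^ 3) * gauss ((1 / e n) *\<^sub>R (\<xi> - \<eta>)))"
        by (simp add: power_one_over)
    qed
    also have "\<dots> = \<bar>e n\<bar> ^ 3 *\<^sub>R (\<integral>\<zeta>. m (\<eta> + e n *\<^sub>R \<zeta>) * (complex_of_real (1 / e n ^ 3) * gauss ((1 / e n) *\<^sub>R ((\<eta> + e n *\<^sub>R \<zeta>) - \<eta>))) \<partial>lborel)"
      using integral_affine[of "\<lambda>\<xi>. m \<xi> * (complex_of_real (1 / e n ^ 3) * gauss ((1 / e n) *\<^sub>R (\<xi> - \<eta>)))" "e n" \<eta>] e[of n] by simp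
    also have "\<dots> = (\<integral>\<zeta>. complex_of_real (\<bar>e n\<bar> ^ 3) * (m (\<eta> + e n *\<^sub>R \<zeta>) * (complex_of_real (1 / e n ^ 3) * gauss ((1 / e n) *\<^sub>R ((\<eta> + e n *\<^sub>R \<zeta>) - \<eta>)))) \<partial>lborel)"
      by (simp only: integral_mult_right_zero scaleR_conv_of_real)
    also have "\<dots> = (\<integral>\<zeta>. m (\<eta> + e n *\<^sub>R \<zeta>) * gauss \<zeta> \<partial>lborel)"
      using e[of n] by (intro Bochner_Integration.integral_cong[OF refl]) simp
    finally show ?thesis .
  qed
  moreover have "(\<lambda>n. \<integral>\<zeta>. m (\<eta> + e n *\<^sub>R \<zeta>) * gauss \<zeta> \<partial>lborel) \<longlonglongrightarrow> (\<integral>\<zeta>. m \<eta> * gauss \<zeta> \<partial>lborel)"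
  proof (rule integral_dominated_convergence[where w="\<lambda>\<zeta>. B * norm (gauss \<zeta>)"])
    show "AE \<zeta> in lborel. (\<lambda>n. m (\<eta> + e n *\<^sub>R \<zeta>) * gauss \<zeta>) \<longlonglongrightarrow> m \<eta> * gauss \<zeta>"
    proof (rule AE_I2)
      fix \<zeta> :: R3
      have "(\<lambda>n. \<eta> + e n *\<^sub>R \<zeta>) \<longlonglongrightarrow> \<eta> + 0 *\<^sub>R \<zeta>" by (intro tendsto_intros e0)
      then have "(\<lambda>n. \<eta> + e n *\<^sub>R \<zeta>) \<longlonglongrightarrow> \<eta>" by simp
      moreover have "isCont m \<eta>" using c by (simp add: continuous_on_eq_continuous_at)
      ultimately have "(\<lambda>n. m (\<eta> + e n *\<^sub>R \<zeta>)) \<longlonglongrightarrow> m \<eta>" using isCont_tendsto_compose by blast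
      then show "(\<lambda>n. m (\<eta> + e n *\<^sub>R \<zeta>) * gauss \<zeta>) \<longlonglongrightarrow> m \<eta> * gauss \<zeta>" by (rule tendsto_mult_right)
    qed
    show "AE \<zeta> in lborel. norm (m (\<eta> + e n *\<^sub>R \<zeta>) * gauss \<zeta>) \<le> B * norm (gauss \<zeta>)" for n
      by (rule AE_I2) (simp add: norm_mult mult_right_mono b)
  qed (use fourier_gauss(1) in auto)
  moreover have "(\<integral>\<zeta>. m \<eta> * gauss \<zeta> \<partial>lborel) = m \<eta>"
    using fourier_gauss(2)[of 0] by simp
  ultimately show ?thesis using LIMSEQ_unique by (simp only:)
qed

section \<open>Convolution with the half-wave kernels\<close>

lemma bump_square: "bump \<kappa> \<Longrightarrow> bump (\<lambda>x. (\<kappa> x)\<^sup>2)"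
  unfolding bump_def by (auto intro: ck_power)

lemma ker_even: "bump \<kappa> \<Longrightarrow> ker \<kappa> \<tau> (- z) = ker \<kappa> \<tau> z"
  by (cases "z = 0") (simp_all add: ker_eq)

lemma measurable_ker: "bump \<kappa> \<Longrightarrow> ker \<kappa> \<tau> \<in> borel_measurable borel"
  by (intro borel_measurable_continuous_onI continuous_ker)

lemma ker_bounded:
  assumes "bump \<kappa>"
  shows "\<exists>C>0. \<forall>\<tau> z. norm (ker \<kappa> \<tau> z) \<le> C / (1 + \<bar>\<tau>\<bar>)"
  using ker_bound[OF assms, of 0] by simp

text \<open>From 1 + |z| \<le> (1 + |\<tau>|)(1 + ||\<tau>| - |z||), decay away from the light cone
  gives decay in |z| for fixed \<tau>. Power 6 is the integrable one available here; the dependence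
  on \<tau> is harmless.\<close>

lemma integrable_ker:
  assumes "bump \<kappa>"
  shows "integrable lborel (ker \<kappa> \<tau>)"
proof -
  obtain C where C: "C > 0" "\<And>\<tau> z. norm (ker \<kappa> \<tau> z) \<le> C / ((1 + \<bar>\<tau>\<bar>) * (1 + \<bar>\<bar>\<tau>\<bar> - norm z\<bar>) ^ 6)"
    using ker_bound[OF assms, of 6] by auto
  let ?t = "1 + \<bar>\<tau>\<bar>"
  have "integrable lborel (\<lambda>z::R3. C * ?t ^ 6 * (1 / (1 + norm z) ^ 6))"
    using integrable_norm_decay by (rule integrable_mult_right)
  then show ?thesis
  proof (rule Bochner_Integration.integrable_bound)
    show "AE z in lborel. norm (ker \<kappa> \<tau> z) \<le> norm (C * ?t ^ 6 * (1 / (1 + norm z) ^ 6))"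
    proof (rule AE_I2)
      fix z :: R3
      let ?d = "1 + \<bar>\<bar>\<tau>\<bar> - norm z\<bar>"
      have "1 + norm z \<le> ?t + \<bar>\<bar>\<tau>\<bar> - norm z\<bar>" by (simp add: abs_if)
      also have "\<dots> \<le> ?t * ?d" by (simp add: algebra_simps)
      finally have "(1 + norm z) ^ 6 \<le> (?t * ?d) ^ 6" by (intro power_mono) auto
      also have "\<dots> = ?t ^ 6 * ?d ^ 6" by (rule power_mult_distrib)
      finally have le: "(1 + norm z) ^ 6 \<le> ?t ^ 6 * ?d ^ 6" .
      have pos: "0 < ?d ^ 6" "0 < (1 + norm z) ^ 6" "0 < ?t ^ 6"
        by (intro zero_less_power add_pos_nonneg; simp)+
      have "norm (ker \<kappa> \<tau> z) \<le> C / (?t * ?d ^ 6)" by (rule C(2))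
      also have "\<dots> \<le> C / ?d ^ 6"
        using C(1) pos by (intro divide_left_mono) (auto intro!: mult_pos_pos)
      also have "\<dots> = C * ?t ^ 6 / (?t ^ 6 * ?d ^ 6)" using pos by simp
      also have "\<dots> \<le> C * ?t ^ 6 / (1 + norm z) ^ 6"
        using C(1) pos le by (intro divide_left_mono mult_nonneg_nonneg mult_pos_pos) auto
      finally show "norm (ker \<kappa> \<tau> z) \<le> norm (C * ?t ^ 6 * (1 / (1 + norm z) ^ 6))"
        using C(1) pos by simp
    qed
  qed (simp add: measurable_ker[OF assms])
qed

lemma wave_symbol_bounded:
  assumes "bump \<kappa>"
  obtains B where "\<And>\<tau> \<xi>. norm (wave_symbol \<kappa> \<tau> \<xi>) \<le> B"
proof -
  have cp: "compact (\<kappa> ` {1/2..2})"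
    using bump_continuous[OF assms] by (intro compact_continuous_image) (auto intro: continuous_on_subset)
  obtain B where B: "\<And>x. x \<in> {1/2..2} \<Longrightarrow> \<bar>\<kappa> x\<bar> \<le> B"
    using compact_imp_bounded[OF cp] unfolding bounded_iff by (simp only: ball_simps real_norm_def) blast
  have "\<bar>\<kappa> x\<bar> \<le> \<bar>B\<bar>" for x
    using B[of x] bump_support[OF assms, of x] by (cases "x \<in> {1/2..2}") auto
  then show ?thesis using that[of "\<bar>B\<bar>"] by (simp add: wave_symbol_def norm_mult)
qed

lemma fourier_ker:
  assumes "bump \<kappa>"
  shows "(\<integral>z. ker \<kappa> \<tau> z * cis (- (z \<bullet> \<eta>)) \<partial>lborel) = wave_symbol \<kappa> \<tau> \<eta>"
proof -
  obtain B where "\<And>\<tau> \<xi>. norm (wave_symbol \<kappa> \<tau> \<xi>) \<le> B" using wave_symbol_bounded[OF assms] by blast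
  then show ?thesis
    unfolding ker_def
    using fourier_inversion[OF continuous_wave_symbol[OF assms] integrable_wave_symbol[OF assms]]
      integrable_ker[OF assms] unfolding ker_def by blast
qed

lemma fourier_ker_shift:
  assumes "bump \<kappa>"
  shows "(\<integral>y. ker \<kappa> \<tau> (x - y) * cis (y \<bullet> \<xi>) \<partial>lborel) = cis (x \<bullet> \<xi>) * wave_symbol \<kappa> \<tau> \<xi>"
proof -
  have [measurable]: "ker \<kappa> \<tau> \<in> borel_measurable borel" by (rule measurable_ker[OF assms])
  have "(\<integral>y. ker \<kappa> \<tau> (x - y) * cis (y \<bullet> \<xi>) \<partial>lborel) = (\<integral>y. (\<lambda>z. ker \<kappa> \<tau> z * cis ((x - z) \<bullet> \<xi>)) (x - y) \<partial>lborel)"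
    by simp
  also have "\<dots> = (\<integral>z. ker \<kappa> \<tau> z * cis ((x - z) \<bullet> \<xi>) \<partial>lborel)"
    by (rule integral_reflect) measurable
  also have "\<dots> = (\<integral>z. cis (x \<bullet> \<xi>) * (ker \<kappa> \<tau> z * cis (- (z \<bullet> \<xi>))) \<partial>lborel)"
  proof (rule Bochner_Integration.integral_cong[OF refl])
    fix z :: R3
    have "cis ((x - z) \<bullet> \<xi>) = cis (x \<bullet> \<xi>) * cis (- (z \<bullet> \<xi>))" by (simp add: cis_mult inner_diff_left)
    then show "ker \<kappa> \<tau> z * cis ((x - z) \<bullet> \<xi>) = cis (x \<bullet> \<xi>) * (ker \<kappa> \<tau> z * cis (- (z \<bullet> \<xi>)))" by simp
  qed
  also have "\<dots> = cis (x \<bullet> \<xi>) * wave_symbol \<kappa> \<tau> \<xi>"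
    by (simp only: integral_mult_right_zero fourier_ker[OF assms])
  finally show ?thesis .
qed

text \<open>The composition of one propagator with the adjoint of another is the multiplier with
  symbol \<kappa>^2 and time difference \<tau> - \<tau>'. Expanding only the second kernel as a
  Fourier integral leaves an integrable function of each variable, so Fubini applies.\<close>

lemma ker_gram:
  assumes "bump \<kappa>"
  shows "(\<integral>y. ker \<kappa> \<tau> (x - y) * cnj (ker \<kappa> \<tau>' (x' - y)) \<partial>lborel) = ker (\<lambda>\<rho>. (\<kappa> \<rho>)\<^sup>2) (\<tau> - \<tau>') (x - x')"
proof -
  have [measurable]: "ker \<kappa> \<tau> \<in> borel_measurable borel" "wave_symbol \<kappa> \<tau>' \<in> borel_measurable borel"
    by (rule measurable_ker[OF assms], rule measurable_wave_symbol[OF assms])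
  have [measurable]: "(\<lambda>z. cnj z) \<in> borel_measurable borel"
    by (intro borel_measurable_continuous_onI continuous_intros)
  let ?c = "complex_of_real ((2 * pi) ^ 3)"
  let ?m = "wave_symbol \<kappa> \<tau>'"
  let ?F = "\<lambda>y \<xi>. (ker \<kappa> \<tau> (x - y) * (cnj (?m \<xi>) / ?c)) * cis ((y - x') \<bullet> \<xi>)"
  have "(\<integral>y. ker \<kappa> \<tau> (x - y) * cnj (ker \<kappa> \<tau>' (x' - y)) \<partial>lborel) = (\<integral>y. \<integral>\<xi>. ?F y \<xi> \<partial>lborel \<partial>lborel)"
  proof (rule Bochner_Integration.integral_cong[OF refl])
    fix y :: R3
    have "cnj (ker \<kappa> \<tau>' (x' - y)) = cnj (\<integral>\<xi>. cis ((x' - y) \<bullet> \<xi>) * ?m \<xi> \<partial>lborel) / ?c"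
      unfolding ker_def inv_fourier_def by simp
    also have "cnj (\<integral>\<xi>. cis ((x' - y) \<bullet> \<xi>) * ?m \<xi> \<partial>lborel) = (\<integral>\<xi>. cnj (cis ((x' - y) \<bullet> \<xi>) * ?m \<xi>) \<partial>lborel)"
      by (rule Bochner_Integration.integral_cnj[symmetric])
    also have "(\<integral>\<xi>. cnj (cis ((x' - y) \<bullet> \<xi>) * ?m \<xi>) \<partial>lborel) = (\<integral>\<xi>. cis ((y - x') \<bullet> \<xi>) * cnj (?m \<xi>) \<partial>lborel)"
      by (rule Bochner_Integration.integral_cong) (auto simp: cis_cnj inner_diff_left)
    finally have e: "cnj (ker \<kappa> \<tau>' (x' - y)) = (\<integral>\<xi>. cis ((y - x') \<bullet> \<xi>) * cnj (?m \<xi>) \<partial>lborel) / ?c" .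
    show "ker \<kappa> \<tau> (x - y) * cnj (ker \<kappa> \<tau>' (x' - y)) = (\<integral>\<xi>. ?F y \<xi> \<partial>lborel)"
      unfolding e integral_divide_zero[symmetric] integral_mult_right_zero[symmetric]
      by (rule Bochner_Integration.integral_cong) (auto simp: mult_ac)
  qed
  also have "\<dots> = (\<integral>\<xi>. \<integral>y. ?F y \<xi> \<partial>lborel \<partial>lborel)"
  proof (rule lborel_pair.Fubini_integral[symmetric])
    have "integrable (lborel \<Otimes>\<^sub>M lborel) (\<lambda>(y, \<xi>). ker \<kappa> \<tau> (x - y) * (cnj (?m \<xi>) / ?c))"
      using integrable_ker[OF assms] integrable_wave_symbol[OF assms]
      by (intro integrable_tensor integrable_reflect integrable_divide_zero integrable_cnj) auto
    then show "integrable (lborel \<Otimes>\<^sub>M lborel) (\<lambda>(y, \<xi>). ?F y \<xi>)"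
    proof (rule Bochner_Integration.integrable_bound)
      show "(\<lambda>(y, \<xi>). ?F y \<xi>) \<in> borel_measurable (lborel \<Otimes>\<^sub>M lborel)" by measurable
    qed (auto simp: norm_mult norm_divide intro!: AE_I2)
  qed
  also have "\<dots> = (\<integral>\<xi>. cis ((x - x') \<bullet> \<xi>) * wave_symbol (\<lambda>\<rho>. (\<kappa> \<rho>)\<^sup>2) (\<tau> - \<tau>') \<xi> / ?c \<partial>lborel)"
  proof (rule Bochner_Integration.integral_cong[OF refl])
    fix \<xi> :: R3
    have "(\<integral>y. ?F y \<xi> \<partial>lborel) = (\<integral>y. (cnj (?m \<xi>) / ?c * cis (- (x' \<bullet> \<xi>))) * (ker \<kappa> \<tau> (x - y) * cis (y \<bullet> \<xi>)) \<partial>lborel)"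
    proof (rule Bochner_Integration.integral_cong[OF refl])
      fix y :: R3
      have "cis ((y - x') \<bullet> \<xi>) = cis (- (x' \<bullet> \<xi>)) * cis (y \<bullet> \<xi>)" by (simp add: cis_mult inner_diff_left)
      then show "?F y \<xi> = (cnj (?m \<xi>) / ?c * cis (- (x' \<bullet> \<xi>))) * (ker \<kappa> \<tau> (x - y) * cis (y \<bullet> \<xi>))"
        by (simp add: mult_ac)
    qed
    also have "\<dots> = (cnj (?m \<xi>) / ?c * cis (- (x' \<bullet> \<xi>))) * (cis (x \<bullet> \<xi>) * wave_symbol \<kappa> \<tau> \<xi>)"
      by (simp only: integral_mult_right_zero fourier_ker_shift[OF assms])
    also have "\<dots> = (cis (x \<bullet> \<xi>) * cis (- (x' \<bullet> \<xi>))) * (wave_symbol \<kappa> \<tau> \<xi> * cnj (?m \<xi>)) / ?c"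
      by (simp add: mult_ac)
    also have "cis (x \<bullet> \<xi>) * cis (- (x' \<bullet> \<xi>)) = cis ((x - x') \<bullet> \<xi>)" by (simp add: cis_mult inner_diff_left)
    also have "wave_symbol \<kappa> \<tau> \<xi> * cnj (?m \<xi>) = wave_symbol (\<lambda>\<rho>. (\<kappa> \<rho>)\<^sup>2) (\<tau> - \<tau>') \<xi>"
    proof -
      have "cis (\<tau> * norm \<xi>) * cis (- (\<tau>' * norm \<xi>)) = cis ((\<tau> - \<tau>') * norm \<xi>)"
        by (simp add: cis_mult left_diff_distrib)
      then show ?thesis
        by (simp add: wave_symbol_def cis_cnj power2_eq_square mult_ac)
    qed
    finally show "(\<integral>y. ?F y \<xi> \<partial>lborel) = cis ((x - x') \<bullet> \<xi>) * wave_symbol (\<lambda>\<rho>. (\<kappa> \<rho>)\<^sup>2) (\<tau> - \<tau>') \<xi> / ?c" .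
  qed
  also have "\<dots> = ker (\<lambda>\<rho>. (\<kappa> \<rho>)\<^sup>2) (\<tau> - \<tau>') (x - x')"
    by (simp only: integral_divide_zero ker_def inv_fourier_def)
  finally show ?thesis .
qed

definition wave :: "(real \<Rightarrow> real) \<Rightarrow> real \<Rightarrow> (R3 \<Rightarrow> complex) \<Rightarrow> R3 \<Rightarrow> complex" where
  "wave \<kappa> \<tau> g x = (\<integral>y. ker \<kappa> \<tau> (x - y) * g y \<partial>lborel)"

definition sqint :: "(R3 \<Rightarrow> complex) \<Rightarrow> bool" where
  "sqint g \<longleftrightarrow> g \<in> borel_measurable borel \<and> integrable lborel (\<lambda>y. (norm (g y))\<^sup>2)"

definition sqnorm :: "(R3 \<Rightarrow> complex) \<Rightarrow> real" where
  "sqnorm g = (\<integral>y. (norm (g y))\<^sup>2 \<partial>lborel)"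

lemma sqnorm_nonneg: "0 \<le> sqnorm g"
  by (simp add: sqnorm_def)

lemma sqint_ker:
  assumes "bump \<kappa>"
  shows "sqint (\<lambda>y. ker \<kappa> \<tau> (x - y))"
proof -
  have [measurable]: "ker \<kappa> \<tau> \<in> borel_measurable borel" by (rule measurable_ker[OF assms])
  obtain C where C: "C > 0" "\<And>z. norm (ker \<kappa> \<tau> z) \<le> C / (1 + \<bar>\<tau>\<bar>)"
    using ker_bounded[OF assms] by blast
  have i: "integrable lborel (\<lambda>y. (C / (1 + \<bar>\<tau>\<bar>)) * norm (ker \<kappa> \<tau> (x - y)))"
    using integrable_reflect[OF integrable_ker[OF assms]] by simp
  have "integrable lborel (\<lambda>y. (norm (ker \<kappa> \<tau> (x - y)))\<^sup>2)"
  proof (rule Bochner_Integration.integrable_bound[OF i])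
    have "norm (ker \<kappa> \<tau> z) * norm (ker \<kappa> \<tau> z) \<le> (C / (1 + \<bar>\<tau>\<bar>)) * norm (ker \<kappa> \<tau> z)" for z
      using C(2) by (rule mult_right_mono) simp
    then show "AE y in lborel. norm ((norm (ker \<kappa> \<tau> (x - y)))\<^sup>2) \<le> norm ((C / (1 + \<bar>\<tau>\<bar>)) * norm (ker \<kappa> \<tau> (x - y)))"
      using C(1) by (intro AE_I2) (simp add: power2_eq_square)
  qed measurable
  then show ?thesis by (simp add: sqint_def)
qed

lemma integrable_mult_sqint:
  assumes "sqint f" "sqint g"
  shows "integrable lborel (\<lambda>y. f y * g y)"
proof -
  have [measurable]: "f \<in> borel_measurable borel" "g \<in> borel_measurable borel"
    using assms by (auto simp: sqint_def)
  have "integrable lborel (\<lambda>y. (norm (f y))\<^sup>2 + (norm (g y))\<^sup>2)" using assms by (auto simp: sqint_def)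
  then show ?thesis
  proof (rule Bochner_Integration.integrable_bound)
    have "norm a * norm b \<le> (norm a)\<^sup>2 + (norm b)\<^sup>2" for a b :: complex
      using sum_squares_bound[of "norm a" "norm b"] mult_nonneg_nonneg[OF norm_ge_zero[of a] norm_ge_zero[of b]] by linarith
    then show "AE y in lborel. norm (f y * g y) \<le> norm ((norm (f y))\<^sup>2 + (norm (g y))\<^sup>2)"
      by (simp add: norm_mult)
  qed simp
qed

lemma sqint_cnj: "sqint g \<Longrightarrow> sqint (\<lambda>y. cnj (g y))"
proof -
  assume g: "sqint g"
  have [measurable]: "g \<in> borel_measurable borel" using g by (simp add: sqint_def)
  have "(\<lambda>z. cnj z) \<in> borel_measurable borel"
    by (intro borel_measurable_continuous_onI continuous_intros)
  then have "(\<lambda>y. cnj (g y)) \<in> borel_measurable borel" by (rule measurable_compose[rotated]) measurable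
  then show ?thesis using g by (simp add: sqint_def)
qed

lemma integrable_sqint_support:
  assumes "sqint g" "\<And>y. R < norm y \<Longrightarrow> g y = 0"
  shows "integrable lborel g"
proof -
  have [measurable]: "g \<in> borel_measurable borel" using assms by (auto simp: sqint_def)
  have "integrable lborel (\<lambda>y::R3. indicator (cball 0 R) y *\<^sub>R (1::real))"
    by (rule borel_integrable_compact) auto
  then have "integrable lborel (\<lambda>y. indicator (cball 0 R) y + (norm (g y))\<^sup>2)" using assms by (simp add: sqint_def)
  then show ?thesis
  proof (rule Bochner_Integration.integrable_bound)
    have "norm a \<le> 1 + (norm a)\<^sup>2" for a :: complex
    proof -
      have "2 * norm a \<le> (norm a)\<^sup>2 + 1" using sum_squares_bound[of "norm a" 1] by simp
      then show ?thesis using norm_ge_zero[of a] by linarith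
    qed
    then show "AE y in lborel. norm (g y) \<le> norm (indicator (cball 0 R) y + (norm (g y))\<^sup>2)"
      using assms(2) by (auto simp: indicator_def not_le intro!: AE_I2)
  qed simp
qed

text \<open>The dual form of the TT^* argument. Expand the nonnegative square of the norm of g -
  (1/B) sum_i W_i cnj(k_i), where W_i is the pairing of k_i with g: the cross terms give -2S/B, and
  by Schur's test the Gram form is at most B S, contributing at most S/B. Here S is the sum of the
  |W_i|^2.\<close>

lemma bessel_schur:
  fixes k :: "'i \<Rightarrow> R3 \<Rightarrow> complex"
  assumes fin: "finite I" and g: "sqint g" and k: "\<And>i. i \<in> I \<Longrightarrow> sqint (k i)" and B: "B > 0"
    and row: "\<And>i. i \<in> I \<Longrightarrow> (\<Sum>j\<in>I. norm (\<integral>y. k i y * cnj (k j y) \<partial>lborel)) \<le> B"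
  shows "(\<Sum>i\<in>I. (norm (\<integral>y. k i y * g y \<partial>lborel))\<^sup>2) \<le> B * sqnorm g"
proof -
  define W where "W i = (\<integral>y. k i y * g y \<partial>lborel)" for i
  define G where "G i j = (\<integral>y. k i y * cnj (k j y) \<partial>lborel)" for i j
  define S where "S = (\<Sum>i\<in>I. (norm (W i))\<^sup>2)"
  have iW: "integrable lborel (\<lambda>y. k i y * g y)" if "i \<in> I" for i using integrable_mult_sqint[OF k[OF that] g] .
  have iG: "integrable lborel (\<lambda>y. k i y * cnj (k j y))" if "i \<in> I" "j \<in> I" for i j
    using integrable_mult_sqint[OF k[OF that(1)] sqint_cnj[OF k[OF that(2)]]] .
  have ig: "integrable lborel (\<lambda>y. g y * cnj (g y))" using integrable_mult_sqint[OF g sqint_cnj[OF g]] .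
  have gg: "(\<integral>y. g y * cnj (g y) \<partial>lborel) = complex_of_real (sqnorm g)"
    by (simp add: sqnorm_def complex_norm_square[symmetric] del: of_real_power)
  have iWc: "integrable lborel (\<lambda>y. cnj (k i y) * cnj (g y))" if "i \<in> I" for i
    using integrable_cnj[OF iW[OF that]] by simp
  have Wc: "(\<integral>y. cnj (k i y) * cnj (g y) \<partial>lborel) = cnj (W i)" for i
  proof -
    have "cnj (W i) = (\<integral>y. cnj (k i y * g y) \<partial>lborel)" unfolding W_def by (rule Bochner_Integration.integral_cnj[symmetric])
    then show ?thesis by simp
  qed
  \<comment> \<open>The conjugates appear because \<open>W i\<close> pairs \<open>k i\<close> with
    \<open>g\<close> bilinearly. The step 1/B balances the linear gain against the quadratic
    term.\<close>
  define h where "h y = g y - (\<Sum>i\<in>I. W i / B * cnj (k i y))" for y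
  have hh: "h y * cnj (h y) = g y * cnj (g y) - (\<Sum>i\<in>I. W i / B * (cnj (k i y) * cnj (g y)))
      - (\<Sum>i\<in>I. cnj (W i) / B * (k i y * g y)) + (\<Sum>i\<in>I. \<Sum>j\<in>I. W j * cnj (W i) / B\<^sup>2 * (k i y * cnj (k j y)))" for y
  proof -
    have c: "cnj (h y) = cnj (g y) - (\<Sum>i\<in>I. cnj (W i) / B * k i y)" by (simp add: h_def)
    have p: "(\<Sum>i\<in>I. cnj (W i) / B * k i y) * (\<Sum>i\<in>I. W i / B * cnj (k i y))
      = (\<Sum>i\<in>I. \<Sum>j\<in>I. W j * cnj (W i) / B\<^sup>2 * (k i y * cnj (k j y)))"
      unfolding sum_product by (intro sum.cong refl) (simp add: power2_eq_square)
    have "h y * cnj (h y) = g y * cnj (g y) - (\<Sum>i\<in>I. W i / B * cnj (k i y)) * cnj (g y)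
       - (\<Sum>i\<in>I. cnj (W i) / B * k i y) * g y + (\<Sum>i\<in>I. cnj (W i) / B * k i y) * (\<Sum>i\<in>I. W i / B * cnj (k i y))"
      unfolding c unfolding h_def by (simp add: algebra_simps)
    moreover have "(\<Sum>i\<in>I. W i / B * cnj (k i y)) * cnj (g y) = (\<Sum>i\<in>I. W i / B * (cnj (k i y) * cnj (g y)))"
      by (simp only: sum_distrib_right mult.assoc)
    moreover have "(\<Sum>i\<in>I. cnj (W i) / B * k i y) * g y = (\<Sum>i\<in>I. cnj (W i) / B * (k i y * g y))"
      by (simp only: sum_distrib_right mult.assoc)
    ultimately show ?thesis unfolding p by simp
  qed
  have "(\<integral>y. h y * cnj (h y) \<partial>lborel) = complex_of_real (sqnorm g) - (\<Sum>i\<in>I. W i / B * cnj (W i))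
     - (\<Sum>i\<in>I. cnj (W i) / B * W i) + (\<Sum>i\<in>I. \<Sum>j\<in>I. W j * cnj (W i) / B\<^sup>2 * G i j)"
  proof -
    let ?a = "\<lambda>y. \<Sum>i\<in>I. W i / B * (cnj (k i y) * cnj (g y))"
    let ?b = "\<lambda>y. \<Sum>i\<in>I. cnj (W i) / B * (k i y * g y)"
    let ?d = "\<lambda>y. \<Sum>i\<in>I. \<Sum>j\<in>I. W j * cnj (W i) / B\<^sup>2 * (k i y * cnj (k j y))"
    have a1: "integrable lborel (\<lambda>y. W i / B * (cnj (k i y) * cnj (g y)))" if "i \<in> I" for i
      using iWc[OF that] by (rule integrable_mult_right)
    have b1: "integrable lborel (\<lambda>y. cnj (W i) / B * (k i y * g y))" if "i \<in> I" for i
      using iW[OF that] by (rule integrable_mult_right)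
    have d1: "integrable lborel (\<lambda>y. W j * cnj (W i) / B\<^sup>2 * (k i y * cnj (k j y)))" if "i \<in> I" "j \<in> I" for i j
      using iG[OF that] by (rule integrable_mult_right)
    have a: "integrable lborel ?a" "(\<integral>y. ?a y \<partial>lborel) = (\<Sum>i\<in>I. W i / B * cnj (W i))"
      using a1 by (simp_all only: Bochner_Integration.integrable_sum Bochner_Integration.integral_sum integral_mult_right_zero Wc cong: sum.cong)
    have b: "integrable lborel ?b" "(\<integral>y. ?b y \<partial>lborel) = (\<Sum>i\<in>I. cnj (W i) / B * W i)"
      using b1 by (simp_all only: Bochner_Integration.integrable_sum Bochner_Integration.integral_sum integral_mult_right_zero W_def[symmetric] cong: sum.cong)
    have d2: "integrable lborel (\<lambda>y. \<Sum>j\<in>I. W j * cnj (W i) / B\<^sup>2 * (k i y * cnj (k j y)))" if "i \<in> I" for i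
      using d1[OF that] by (rule Bochner_Integration.integrable_sum)
    have d3: "(\<integral>y. (\<Sum>j\<in>I. W j * cnj (W i) / B\<^sup>2 * (k i y * cnj (k j y))) \<partial>lborel) = (\<Sum>j\<in>I. W j * cnj (W i) / B\<^sup>2 * G i j)" if "i \<in> I" for i
      using Bochner_Integration.integral_sum[OF d1[OF that]] by (simp only: integral_mult_right_zero G_def)
    have d: "integrable lborel ?d" using d2 by (rule Bochner_Integration.integrable_sum)
    have d': "(\<integral>y. ?d y \<partial>lborel) = (\<Sum>i\<in>I. \<Sum>j\<in>I. W j * cnj (W i) / B\<^sup>2 * G i j)"
      by (subst Bochner_Integration.integral_sum[OF d2], assumption, rule sum.cong[OF refl d3])
    show ?thesis unfolding hh
      using ig a b d d' gg by simp
  qed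
  also have "\<dots> = complex_of_real (sqnorm g - 2 * S / B) + (\<Sum>i\<in>I. \<Sum>j\<in>I. W j * cnj (W i) / B\<^sup>2 * G i j)"
  proof -
    have "(\<Sum>i\<in>I. W i / B * cnj (W i)) = complex_of_real (S / B)"
      unfolding S_def by (simp add: sum_divide_distrib complex_norm_square del: of_real_power)
    moreover have "(\<Sum>i\<in>I. cnj (W i) / B * W i) = complex_of_real (S / B)"
      unfolding S_def by (simp add: sum_divide_distrib complex_norm_square mult.commute del: of_real_power)
    ultimately show ?thesis by simp
  qed
  finally have E: "(\<integral>y. h y * cnj (h y) \<partial>lborel) = complex_of_real (sqnorm g - 2 * S / B) + (\<Sum>i\<in>I. \<Sum>j\<in>I. W j * cnj (W i) / B\<^sup>2 * G i j)" .
  have "0 \<le> Re (\<integral>y. h y * cnj (h y) \<partial>lborel)"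
  proof -
    have "(\<integral>y. h y * cnj (h y) \<partial>lborel) = complex_of_real (\<integral>y. (norm (h y))\<^sup>2 \<partial>lborel)"
      by (simp add: complex_norm_square[symmetric] del: of_real_power)
    then show ?thesis by simp
  qed
  moreover have "Re (\<Sum>i\<in>I. \<Sum>j\<in>I. W j * cnj (W i) / B\<^sup>2 * G i j) \<le> S / B"
  proof -
    have sym: "norm (G i j) = norm (G j i)" for i j
    proof -
      have "cnj (G i j) = (\<integral>y. cnj (k i y * cnj (k j y)) \<partial>lborel)" unfolding G_def by (rule Bochner_Integration.integral_cnj[symmetric])
      then have "cnj (G i j) = G j i" unfolding G_def by (simp add: mult.commute)
      then show ?thesis by (metis complex_mod_cnj)
    qed
    have "Re (\<Sum>i\<in>I. \<Sum>j\<in>I. W j * cnj (W i) / B\<^sup>2 * G i j) \<le> norm (\<Sum>i\<in>I. \<Sum>j\<in>I. W j * cnj (W i) / B\<^sup>2 * G i j)"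
      by (rule complex_Re_le_cmod)
    also have "\<dots> \<le> (\<Sum>i\<in>I. \<Sum>j\<in>I. norm (W j * cnj (W i) / B\<^sup>2 * G i j))"
      by (intro order_trans[OF norm_sum] sum_mono) simp
    \<comment> \<open>Schur's test: split |W_i||W_j| by the arithmetic-geometric mean, use |G_ij| =
      |G_ji|, and exchange the summations so that both halves become row sums.\<close>
    also have "\<dots> \<le> (\<Sum>i\<in>I. \<Sum>j\<in>I. ((norm (W i))\<^sup>2 * norm (G i j) + (norm (W j))\<^sup>2 * norm (G j i)) / (2 * B\<^sup>2))"
    proof (intro sum_mono)
      fix i j
      have "norm (W j) * norm (W i) * norm (G i j) \<le> ((norm (W i))\<^sup>2 + (norm (W j))\<^sup>2) / 2 * norm (G i j)"
        using sum_squares_bound[of "norm (W j)" "norm (W i)"] by (intro mult_right_mono) auto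
      then have "norm (W j) * norm (W i) * norm (G i j) / B\<^sup>2 \<le> ((norm (W i))\<^sup>2 + (norm (W j))\<^sup>2) / 2 * norm (G i j) / B\<^sup>2"
        by (rule divide_right_mono) simp
      then show "norm (W j * cnj (W i) / B\<^sup>2 * G i j) \<le> ((norm (W i))\<^sup>2 * norm (G i j) + (norm (W j))\<^sup>2 * norm (G j i)) / (2 * B\<^sup>2)"
        unfolding sym[of j i] by (simp add: norm_mult norm_divide norm_power algebra_simps)
    qed
    also have "\<dots> = (\<Sum>i\<in>I. \<Sum>j\<in>I. (norm (W i))\<^sup>2 * norm (G i j) / (2 * B\<^sup>2)) + (\<Sum>i\<in>I. \<Sum>j\<in>I. (norm (W j))\<^sup>2 * norm (G j i) / (2 * B\<^sup>2))"
      by (simp add: sum.distrib add_divide_distrib)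
    also have "(\<Sum>i\<in>I. \<Sum>j\<in>I. (norm (W j))\<^sup>2 * norm (G j i) / (2 * B\<^sup>2)) = (\<Sum>i\<in>I. \<Sum>j\<in>I. (norm (W i))\<^sup>2 * norm (G i j) / (2 * B\<^sup>2))"
      by (rule sum.swap)
    also have "(\<Sum>i\<in>I. \<Sum>j\<in>I. (norm (W i))\<^sup>2 * norm (G i j) / (2 * B\<^sup>2)) = (\<Sum>i\<in>I. (norm (W i))\<^sup>2 * (\<Sum>j\<in>I. norm (G i j)) / (2 * B\<^sup>2))"
      by (simp add: sum_distrib_left sum_divide_distrib)
    also have "\<dots> \<le> (\<Sum>i\<in>I. (norm (W i))\<^sup>2 * B / (2 * B\<^sup>2))"
      using row by (intro sum_mono divide_right_mono mult_left_mono) (auto simp: G_def)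
    also have "\<dots> = S / (2 * B)"
      using B unfolding S_def by (simp add: sum_divide_distrib power2_eq_square)
    finally show ?thesis using B by (simp add: field_simps)
  qed
  ultimately have "0 \<le> sqnorm g - 2 * S / B + S / B" unfolding E by simp
  then have "S / B \<le> sqnorm g" by (simp add: field_simps)
  then show ?thesis using B by (simp add: S_def W_def pos_divide_le_eq mult.commute)
qed

lemma norm_integral_le_nn_integral:
  fixes f :: "'a \<Rightarrow> 'b::{banach,second_countable_topology}"
  shows "ennreal (norm (integral\<^sup>L M f)) \<le> (\<integral>\<^sup>+x. ennreal (norm (f x)) \<partial>M)"
  by (cases "integrable M f") (simp_all add: integral_norm_bound_ennreal not_integrable_integral_eq)

lemma nn_integral_sqnorm: "sqint g \<Longrightarrow> (\<integral>\<^sup>+y. ennreal ((norm (g y))\<^sup>2) \<partial>lborel) = ennreal (sqnorm g)"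
  unfolding sqint_def sqnorm_def by (intro nn_integral_eq_integral) auto

lemma measurable_wave:
  assumes "bump \<kappa>" and [measurable]: "g \<in> borel_measurable borel"
  shows "wave \<kappa> \<tau> g \<in> borel_measurable borel"
proof -
  have [measurable]: "ker \<kappa> \<tau> \<in> borel_measurable borel" by (rule measurable_ker[OF assms(1)])
  have "(\<lambda>x. \<integral>y. ker \<kappa> \<tau> (x - y) * g y \<partial>lborel) \<in> borel_measurable borel" by measurable
  then show ?thesis by (simp add: wave_def[abs_def])
qed

text \<open>Cauchy-Schwarz with the indicator of the support kept on the kernel: only the part of
  the light cone that meets the ball counts, and this is the source of the gain at late
  times.\<close>

lemma wave_square_le:
  assumes "bump \<kappa>" "sqint g" and supp: "\<And>y. R < norm y \<Longrightarrow> g y = 0"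
  shows "ennreal ((norm (wave \<kappa> \<tau> g x))\<^sup>2)
    \<le> (\<integral>\<^sup>+y. indicator (cball 0 R) y * ennreal ((norm (ker \<kappa> \<tau> (x - y)))\<^sup>2) \<partial>lborel) * ennreal (sqnorm g)"
proof -
  have [measurable]: "ker \<kappa> \<tau> \<in> borel_measurable borel" "g \<in> borel_measurable borel"
    using measurable_ker[OF assms(1)] assms(2) by (auto simp: sqint_def)
  have [measurable]: "cball (0::R3) R \<in> sets borel" by simp
  have "ennreal (norm (wave \<kappa> \<tau> g x)) \<le> (\<integral>\<^sup>+y. ennreal (norm (ker \<kappa> \<tau> (x - y) * g y)) \<partial>lborel)"
    unfolding wave_def by (rule norm_integral_le_nn_integral)
  also have "\<dots> = (\<integral>\<^sup>+y. (indicator (cball 0 R) y * ennreal (norm (ker \<kappa> \<tau> (x - y)))) * ennreal (norm (g y)) \<partial>lborel)"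
    using supp by (intro nn_integral_cong) (auto simp: norm_mult ennreal_mult indicator_def not_le)
  finally have "(ennreal (norm (wave \<kappa> \<tau> g x)))\<^sup>2 \<le> (\<integral>\<^sup>+y. (indicator (cball 0 R) y * ennreal (norm (ker \<kappa> \<tau> (x - y)))) * ennreal (norm (g y)) \<partial>lborel)\<^sup>2"
    by (rule power_mono) simp
  also have "\<dots> \<le> (\<integral>\<^sup>+y. (indicator (cball 0 R) y * ennreal (norm (ker \<kappa> \<tau> (x - y))))\<^sup>2 \<partial>lborel) * (\<integral>\<^sup>+y. (ennreal (norm (g y)))\<^sup>2 \<partial>lborel)"
    by (rule Cauchy_Schwarz_nn_integral; measurable)
  also have "(\<integral>\<^sup>+y. (ennreal (norm (g y)))\<^sup>2 \<partial>lborel) = ennreal (sqnorm g)"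
    using nn_integral_sqnorm[OF assms(2)] by (simp add: ennreal_power)
  also have "(\<integral>\<^sup>+y. (indicator (cball 0 R) y * ennreal (norm (ker \<kappa> \<tau> (x - y))))\<^sup>2 \<partial>lborel)
    = (\<integral>\<^sup>+y. indicator (cball 0 R) y * ennreal ((norm (ker \<kappa> \<tau> (x - y)))\<^sup>2) \<partial>lborel)"
    by (intro nn_integral_cong) (auto simp: indicator_def ennreal_power)
  finally show ?thesis by (simp add: ennreal_power)
qed

text \<open>The squared norm is a quadratic form of \<open>g\<close> with the kernel of \<kappa>^2
  at time 0, independent of \<tau>; Young's inequality bounds it by the L^1 norm of that kernel. The
  bounded support makes \<open>g\<close> integrable and so justifies the exchanges, while the
  constant does not depend on the radius.\<close>

lemma wave_L2:
  assumes bk: "bump \<kappa>"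
  shows "\<exists>C\<ge>0. \<forall>g R \<tau>. sqint g \<longrightarrow> (\<forall>y. R < norm y \<longrightarrow> g y = 0) \<longrightarrow>
    sqint (wave \<kappa> \<tau> g) \<and> sqnorm (wave \<kappa> \<tau> g) \<le> C * sqnorm g"
proof (intro exI conjI allI impI)
  let ?Q = "ker (\<lambda>\<rho>. (\<kappa> \<rho>)\<^sup>2) 0"
  let ?C = "\<integral>z. norm (?Q z) \<partial>lborel"
  have iQ: "integrable lborel ?Q" by (rule integrable_ker[OF bump_square[OF bk]])
  show "?C \<ge> 0" by simp
  fix g R \<tau> assume g: "sqint g" and supp: "\<forall>y. R < norm y \<longrightarrow> g y = 0"
  let ?K = "ker \<kappa> \<tau>" and ?W = "wave \<kappa> \<tau> g"
  have [measurable]: "?K \<in> borel_measurable borel" "g \<in> borel_measurable borel" "?Q \<in> borel_measurable borel"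
    using measurable_ker[OF bk] g iQ by (auto simp: sqint_def)
  have [measurable]: "?W \<in> borel_measurable borel" by (rule measurable_wave[OF bk]) measurable
  have [measurable]: "(\<lambda>z. cnj z) \<in> borel_measurable borel"
    by (intro borel_measurable_continuous_onI continuous_intros)
  obtain B where B: "\<And>z. norm (?K z) \<le> B / (1 + \<bar>\<tau>\<bar>)" using ker_bounded[OF bk] by blast
  define B' where "B' = B / (1 + \<bar>\<tau>\<bar>)"
  have B: "norm (?K z) \<le> B'" for z using B by (simp add: B'_def)
  have ig: "integrable lborel g" using integrable_sqint_support[OF g] supp by blast
  have iK: "integrable lborel ?K" by (rule integrable_ker[OF bk])
  have conv: "integrable (lborel \<Otimes>\<^sub>M lborel) (\<lambda>(y, x). ?K (x - y) * g y)"
    by (rule integrable_convolution[OF iK ig])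
  have iW: "integrable lborel ?W"
    using lborel_pair.integrable_snd[OF conv] by (simp add: wave_def[abs_def])
  define D where "D = B' * (\<integral>y. norm (g y) \<partial>lborel)"
  have WD: "norm (?W x) \<le> D" for x
  proof -
    have "norm (?W x) \<le> (\<integral>y. norm (?K (x - y) * g y) \<partial>lborel)"
      unfolding wave_def by (rule integral_norm_bound)
    also have "\<dots> \<le> (\<integral>y. B' * norm (g y) \<partial>lborel)"
    proof (rule integral_mono)
      show "integrable lborel (\<lambda>y. norm (?K (x - y) * g y))"
        by (rule integrable_norm, rule integrable_mult_sqint[OF sqint_ker[OF bk] g])
    qed (use ig B in \<open>auto simp: norm_mult intro!: mult_right_mono\<close>)
    finally have "norm (?W x) \<le> (\<integral>y. B' * norm (g y) \<partial>lborel)" .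
    then show ?thesis by (simp add: D_def)
  qed
  have D0: "D \<ge> 0" using WD norm_ge_zero order_trans by blast
  have isq: "integrable lborel (\<lambda>x. (norm (?W x))\<^sup>2)"
  proof (rule Bochner_Integration.integrable_bound)
    show "integrable lborel (\<lambda>x. D * norm (?W x))" using iW by simp
    show "AE x in lborel. norm ((norm (?W x))\<^sup>2) \<le> norm (D * norm (?W x))"
      using WD D0 by (intro AE_I2) (simp add: power2_eq_square mult_right_mono)
  qed measurable
  then show "sqint ?W" by (simp add: sqint_def)
  have "complex_of_real (sqnorm ?W) = (\<integral>x. ?W x * cnj (?W x) \<partial>lborel)"
    by (simp add: sqnorm_def complex_norm_square[symmetric] del: of_real_power)
  also have "\<dots> = (\<integral>x. \<integral>y. (?K (x - y) * g y) * cnj (?W x) \<partial>lborel \<partial>lborel)"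
    by (simp only: integral_mult_left_zero wave_def)
  also have "\<dots> = (\<integral>y. \<integral>x. (?K (x - y) * g y) * cnj (?W x) \<partial>lborel \<partial>lborel)"
  proof (rule lborel_pair.Fubini_integral)
    have "integrable (lborel \<Otimes>\<^sub>M lborel) (\<lambda>p. D *\<^sub>R (case p of (y, x) \<Rightarrow> ?K (x - y) * g y))"
      using conv by (rule integrable_scaleR_right)
    then show "integrable (lborel \<Otimes>\<^sub>M lborel) (\<lambda>(y, x). (?K (x - y) * g y) * cnj (?W x))"
    proof (rule Bochner_Integration.integrable_bound)
      show "(\<lambda>(y, x). (?K (x - y) * g y) * cnj (?W x)) \<in> borel_measurable (lborel \<Otimes>\<^sub>M lborel)" by measurable
      have "norm (?K (x - y)) * norm (g y) * norm (?W x) \<le> \<bar>D\<bar> * (norm (?K (x - y)) * norm (g y))" for x y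
        using mult_left_mono[OF WD[of x], of "norm (?K (x - y)) * norm (g y)"] D0 by (simp add: mult.commute)
      then show "AE p in lborel \<Otimes>\<^sub>M lborel. norm (case p of (y, x) \<Rightarrow> (?K (x - y) * g y) * cnj (?W x))
          \<le> norm (D *\<^sub>R (case p of (y, x) \<Rightarrow> ?K (x - y) * g y))"
        by (intro AE_I2) (auto simp: norm_mult split: prod.split)
    qed
  qed
  also have "\<dots> = (\<integral>y. g y * (\<integral>y'. cnj (g y') * ?Q (y - y') \<partial>lborel) \<partial>lborel)"
  proof (rule Bochner_Integration.integral_cong[OF refl])
    fix y :: R3
    have "(\<integral>x. (?K (x - y) * g y) * cnj (?W x) \<partial>lborel) = (\<integral>x. g y * (?K (x - y) * cnj (?W x)) \<partial>lborel)"
      by (rule Bochner_Integration.integral_cong) (auto simp: mult_ac)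
    also have "\<dots> = g y * (\<integral>x. ?K (x - y) * cnj (?W x) \<partial>lborel)" by (rule integral_mult_right_zero)
    also have "(\<integral>x. ?K (x - y) * cnj (?W x) \<partial>lborel) = (\<integral>x. \<integral>y'. ?K (x - y) * cnj (?K (x - y') * g y') \<partial>lborel \<partial>lborel)"
      by (simp only: integral_mult_right_zero wave_def Bochner_Integration.integral_cnj)
    also have "\<dots> = (\<integral>y'. \<integral>x. ?K (x - y) * cnj (?K (x - y') * g y') \<partial>lborel \<partial>lborel)"
    proof (rule lborel_pair.Fubini_integral)
      have "integrable (lborel \<Otimes>\<^sub>M lborel) (\<lambda>p. B' *\<^sub>R (case p of (y', x) \<Rightarrow> ?K (x - y') * g y'))"
        using conv by (rule integrable_scaleR_right)
      then show "integrable (lborel \<Otimes>\<^sub>M lborel) (\<lambda>(y', x). ?K (x - y) * cnj (?K (x - y') * g y'))"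
      proof (rule Bochner_Integration.integrable_bound)
        show "(\<lambda>(y', x). ?K (x - y) * cnj (?K (x - y') * g y')) \<in> borel_measurable (lborel \<Otimes>\<^sub>M lborel)" by measurable
        have "norm (?K (x - y)) * (norm (?K (x - y')) * norm (g y')) \<le> \<bar>B'\<bar> * (norm (?K (x - y')) * norm (g y'))" for x y'
          using B[of "x - y"] by (intro mult_right_mono) auto
        then show "AE p in lborel \<Otimes>\<^sub>M lborel. norm (case p of (y', x) \<Rightarrow> ?K (x - y) * cnj (?K (x - y') * g y'))
            \<le> norm (B' *\<^sub>R (case p of (y', x) \<Rightarrow> ?K (x - y') * g y'))"
          by (intro AE_I2) (auto simp: norm_mult split: prod.split)
      qed
    qed
    also have "\<dots> = (\<integral>y'. cnj (g y') * ?Q (y - y') \<partial>lborel)"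
    proof (rule Bochner_Integration.integral_cong[OF refl])
      fix y' :: R3
      \<comment> \<open>Evenness brings the integral over x into the form of the Gram identity,
        where the integration variable is subtracted.\<close>
      have ev: "?K (x - y) = ?K (y - x)" for x y
        using ker_even[OF bk, of \<tau> "y - x"] by simp
      have "(\<integral>x. ?K (x - y) * cnj (?K (x - y') * g y') \<partial>lborel) = (\<integral>x. cnj (g y') * (?K (y - x) * cnj (?K (y' - x))) \<partial>lborel)"
        by (rule Bochner_Integration.integral_cong[OF refl]) (simp only: ev[of _ y] ev[of _ y'] complex_cnj_mult mult_ac)
      also have "\<dots> = cnj (g y') * ?Q (y - y')"
        by (simp only: integral_mult_right_zero ker_gram[OF bk] diff_self)
      finally show "(\<integral>x. ?K (x - y) * cnj (?K (x - y') * g y') \<partial>lborel) = cnj (g y') * ?Q (y - y')" .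
    qed
    finally show "(\<integral>x. (?K (x - y) * g y) * cnj (?W x) \<partial>lborel) = g y * (\<integral>y'. cnj (g y') * ?Q (y - y') \<partial>lborel)" .
  qed
  finally have E: "complex_of_real (sqnorm ?W) = (\<integral>y. g y * (\<integral>y'. cnj (g y') * ?Q (y - y') \<partial>lborel) \<partial>lborel)" .
  \<comment> \<open>The factor in ab \<le> h a^2 + h b^2, which splits the double integral into two
    equal halves.\<close>
  obtain h :: real where h: "h = 1/2" by blast
  then have h0: "h \<ge> 0" by simp
  have "ennreal (sqnorm ?W) = ennreal (norm (complex_of_real (sqnorm ?W)))" by (simp add: sqnorm_nonneg)
  also have "\<dots> \<le> (\<integral>\<^sup>+y. ennreal (norm (g y * (\<integral>y'. cnj (g y') * ?Q (y - y') \<partial>lborel))) \<partial>lborel)"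
    unfolding E by (rule norm_integral_le_nn_integral)
  also have "\<dots> \<le> (\<integral>\<^sup>+y. \<integral>\<^sup>+y'. ennreal (norm (g y)) * ennreal (norm (cnj (g y') * ?Q (y - y'))) \<partial>lborel \<partial>lborel)"
  proof (rule nn_integral_mono)
    fix y :: R3
    have "ennreal (norm (g y * (\<integral>y'. cnj (g y') * ?Q (y - y') \<partial>lborel)))
      = ennreal (norm (g y)) * ennreal (norm (\<integral>y'. cnj (g y') * ?Q (y - y') \<partial>lborel))"
      by (simp add: norm_mult ennreal_mult)
    also have "\<dots> \<le> ennreal (norm (g y)) * (\<integral>\<^sup>+y'. ennreal (norm (cnj (g y') * ?Q (y - y'))) \<partial>lborel)"
      by (intro mult_left_mono norm_integral_le_nn_integral) simp
    also have "\<dots> = (\<integral>\<^sup>+y'. ennreal (norm (g y)) * ennreal (norm (cnj (g y') * ?Q (y - y'))) \<partial>lborel)"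
      by (rule nn_integral_cmult[symmetric]) measurable
    finally show "ennreal (norm (g y * (\<integral>y'. cnj (g y') * ?Q (y - y') \<partial>lborel)))
      \<le> (\<integral>\<^sup>+y'. ennreal (norm (g y)) * ennreal (norm (cnj (g y') * ?Q (y - y'))) \<partial>lborel)" .
  qed
  also have "\<dots> \<le> (\<integral>\<^sup>+y. \<integral>\<^sup>+y'. (ennreal h * ennreal ((norm (g y))\<^sup>2)) * ennreal (norm (?Q (y - y')))
       + (ennreal h * ennreal ((norm (g y'))\<^sup>2)) * ennreal (norm (?Q (y - y'))) \<partial>lborel \<partial>lborel)"
  proof (intro nn_integral_mono)
    fix y y' :: R3
    have "norm (g y) * norm (g y') * norm (?Q (y - y')) \<le> (h * (norm (g y))\<^sup>2 + h * (norm (g y'))\<^sup>2) * norm (?Q (y - y'))"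
      using sum_squares_bound[of "norm (g y)" "norm (g y')"] unfolding h by (intro mult_right_mono) auto
    then have "ennreal (norm (g y) * norm (g y') * norm (?Q (y - y'))) \<le> ennreal ((h * (norm (g y))\<^sup>2 + h * (norm (g y'))\<^sup>2) * norm (?Q (y - y')))"
      by (rule ennreal_leI)
    then show "ennreal (norm (g y)) * ennreal (norm (cnj (g y') * ?Q (y - y'))) \<le> (ennreal h * ennreal ((norm (g y))\<^sup>2)) * ennreal (norm (?Q (y - y')))
       + (ennreal h * ennreal ((norm (g y'))\<^sup>2)) * ennreal (norm (?Q (y - y')))"
      using h0 by (simp add: norm_mult ennreal_mult[symmetric] ennreal_plus[symmetric] algebra_simps del: ennreal_plus)
  qed
  also have "\<dots> = (\<integral>\<^sup>+y. \<integral>\<^sup>+y'. (ennreal h * ennreal ((norm (g y))\<^sup>2)) * ennreal (norm (?Q (y - y'))) \<partial>lborel \<partial>lborel)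
      + (\<integral>\<^sup>+y. \<integral>\<^sup>+y'. (ennreal h * ennreal ((norm (g y'))\<^sup>2)) * ennreal (norm (?Q (y - y'))) \<partial>lborel \<partial>lborel)"
    by (simp add: nn_integral_add)
  also have "(\<integral>\<^sup>+y. \<integral>\<^sup>+y'. (ennreal h * ennreal ((norm (g y'))\<^sup>2)) * ennreal (norm (?Q (y - y'))) \<partial>lborel \<partial>lborel)
      = (\<integral>\<^sup>+y'. \<integral>\<^sup>+y. (ennreal h * ennreal ((norm (g y'))\<^sup>2)) * ennreal (norm (?Q (y - y'))) \<partial>lborel \<partial>lborel)"
    by (rule lborel_pair.Fubini') measurable
  also have "(\<lambda>y'. \<integral>\<^sup>+y. (ennreal h * ennreal ((norm (g y'))\<^sup>2)) * ennreal (norm (?Q (y - y'))) \<partial>lborel)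
     = (\<lambda>y'. (ennreal h * ennreal ((norm (g y'))\<^sup>2)) * ennreal ?C)"
  proof
    fix y' :: R3
    have "(\<integral>\<^sup>+y. ennreal (norm (?Q (y - y'))) \<partial>lborel) = (\<integral>\<^sup>+y. ennreal (norm (?Q y)) \<partial>lborel)"
      using nn_integral_affine[of "\<lambda>y. ennreal (norm (?Q y))" 1 "-y'"] by simp
    also have "\<dots> = ennreal ?C" using iQ by (intro nn_integral_eq_integral) auto
    finally show "(\<integral>\<^sup>+y. (ennreal h * ennreal ((norm (g y'))\<^sup>2)) * ennreal (norm (?Q (y - y'))) \<partial>lborel) = (ennreal h * ennreal ((norm (g y'))\<^sup>2)) * ennreal ?C"
      by (simp add: nn_integral_cmult)
  qed
  also have "(\<lambda>y. \<integral>\<^sup>+y'. (ennreal h * ennreal ((norm (g y))\<^sup>2)) * ennreal (norm (?Q (y - y'))) \<partial>lborel)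
     = (\<lambda>y. (ennreal h * ennreal ((norm (g y))\<^sup>2)) * ennreal ?C)"
  proof
    fix y :: R3
    have "(\<integral>\<^sup>+y'. ennreal (norm (?Q (y - y'))) \<partial>lborel) = (\<integral>\<^sup>+y. ennreal (norm (?Q y)) \<partial>lborel)"
      using nn_integral_affine[of "\<lambda>y. ennreal (norm (?Q y))" "-1" y] by simp
    also have "\<dots> = ennreal ?C" using iQ by (intro nn_integral_eq_integral) auto
    finally show "(\<integral>\<^sup>+y'. (ennreal h * ennreal ((norm (g y))\<^sup>2)) * ennreal (norm (?Q (y - y'))) \<partial>lborel) = (ennreal h * ennreal ((norm (g y))\<^sup>2)) * ennreal ?C"
      by (simp add: nn_integral_cmult)
  qed
  also have "(\<integral>\<^sup>+y. (ennreal h * ennreal ((norm (g y))\<^sup>2)) * ennreal ?C \<partial>lborel) = ennreal (h * sqnorm g * ?C)"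
    using h0 by (simp add: nn_integral_multc nn_integral_cmult nn_integral_sqnorm[OF g] ennreal_mult sqnorm_nonneg)
  also have "ennreal (h * sqnorm g * ?C) + ennreal (h * sqnorm g * ?C) = ennreal (?C * sqnorm g)"
    using h0 by (simp add: ennreal_plus[symmetric] sqnorm_nonneg del: ennreal_plus) (simp add: h)
  finally show "sqnorm ?W \<le> ?C * sqnorm g"
    by (subst (asm) ennreal_le_iff) (simp_all add: sqnorm_nonneg)
qed

section \<open>The logarithmic endpoint Strichartz estimate\<close>

text \<open>Each distance from \<open>n\<close> is attained at most twice, once on either
  side.\<close>

lemma sum_distance_le:
  fixes f :: "nat \<Rightarrow> real"
  assumes "\<And>j. f j \<ge> 0" "n < N"
  shows "(\<Sum>m<N. f (if m \<le> n then n - m else m - n)) \<le> 2 * (\<Sum>j<N. f j)"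
proof -
  have e: "{..<N} = {..n} \<union> {n<..<N}" using assms(2) by auto
  have "(\<Sum>m<N. f (if m \<le> n then n - m else m - n)) = (\<Sum>m\<le>n. f (if m \<le> n then n - m else m - n)) + (\<Sum>m\<in>{n<..<N}. f (if m \<le> n then n - m else m - n))"
    unfolding e by (rule sum.union_disjoint) auto
  also have "(\<Sum>m\<le>n. f (if m \<le> n then n - m else m - n)) = (\<Sum>m\<in>(\<lambda>m. n - m) ` {..n}. f m)"
    by (subst sum.reindex) (auto simp: inj_on_def)
  also have "\<dots> \<le> (\<Sum>j<N. f j)" by (rule sum_mono2) (use assms in auto)
  also have "(\<Sum>m\<in>{n<..<N}. f (if m \<le> n then n - m else m - n)) = (\<Sum>m\<in>(\<lambda>m. m - n) ` {n<..<N}. f m)"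
    by (subst sum.reindex) (auto simp: inj_on_def)
  also have "\<dots> \<le> (\<Sum>j<N. f j)" by (rule sum_mono2) (use assms in auto)
  finally show ?thesis by simp
qed

text \<open>The Gram entries decay like the reciprocal of the time difference uniformly in space, so
  the points \<open>x n\<close> may be chosen freely; this freedom later produces the supremum. The
  row sums are harmonic sums, hence the logarithm. The slack -1 in the separation allows one time
  from each of the closed unit intervals [n, n+1].\<close>

lemma strichartz_discrete:
  assumes bk: "bump \<kappa>"
  shows "\<exists>C>0. \<forall>g N \<tau> x. sqint g \<longrightarrow>
     (\<forall>n<N. \<forall>m<N. \<bar>real n - real m\<bar> - 1 \<le> \<bar>\<tau> n - \<tau> m\<bar>) \<longrightarrow>
     (\<Sum>n<N. (norm (wave \<kappa> (\<tau> n) g (x n)))\<^sup>2) \<le> C * (\<Sum>n<N. 1 / (1 + real n)) * sqnorm g"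
proof -
  obtain D where D: "D > 0" "\<And>\<tau> z. norm (ker (\<lambda>\<rho>. (\<kappa> \<rho>)\<^sup>2) \<tau> z) \<le> D / (1 + \<bar>\<tau>\<bar>)"
    using ker_bounded[OF bump_square[OF bk]] by blast
  have "(\<Sum>n<N. (norm (wave \<kappa> (\<tau> n) g (x n)))\<^sup>2) \<le> (4 * D) * (\<Sum>n<N. 1 / (1 + real n)) * sqnorm g"
    if g: "sqint g" and sep: "\<forall>n<N. \<forall>m<N. \<bar>real n - real m\<bar> - 1 \<le> \<bar>\<tau> n - \<tau> m\<bar>" for g N and \<tau> :: "nat \<Rightarrow> real" and x
  proof (cases "N = 0")
    case False
    have H: "(\<Sum>n<N. 1 / (1 + real n)) > 0" by (rule sum_pos) (use False in auto)
    show ?thesis unfolding wave_def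
    proof (rule bessel_schur[OF finite_lessThan g])
      show "0 < 4 * D * (\<Sum>n<N. 1 / (1 + real n))" using D H by simp
      show "sqint (\<lambda>y. ker \<kappa> (\<tau> n) (x n - y))" for n by (rule sqint_ker[OF bk])
      fix n assume "n \<in> {..<N}" then have n: "n < N" by simp
      have "(\<Sum>m<N. norm (\<integral>y. ker \<kappa> (\<tau> n) (x n - y) * cnj (ker \<kappa> (\<tau> m) (x m - y)) \<partial>lborel))
        \<le> (\<Sum>m<N. 2 * D * (1 / (1 + real (if m \<le> n then n - m else m - n))))"
      proof (rule sum_mono)
        fix m assume "m \<in> {..<N}" then have m: "m < N" by simp
        have d: "real (if m \<le> n then n - m else m - n) = \<bar>real n - real m\<bar>" by (auto simp: of_nat_diff)
        have "\<bar>real n - real m\<bar> - 1 \<le> \<bar>\<tau> n - \<tau> m\<bar>" using sep n m by blast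
        \<comment> \<open>If the separation bound |n - m| - 1 is of no use, then |n - m| \<le> 1 and
          the left side is at most 1.\<close>
        then have le: "(1 + \<bar>real n - real m\<bar>) / 2 \<le> 1 + \<bar>\<tau> n - \<tau> m\<bar>"
          using abs_ge_zero[of "\<tau> n - \<tau> m"] by argo
        have "norm (ker (\<lambda>\<rho>. (\<kappa> \<rho>)\<^sup>2) (\<tau> n - \<tau> m) (x n - x m)) \<le> D / (1 + \<bar>\<tau> n - \<tau> m\<bar>)" by (rule D(2))
        also have "\<dots> \<le> D / ((1 + \<bar>real n - real m\<bar>) / 2)"
          using D(1) le by (intro divide_left_mono mult_pos_pos) auto
        also have "\<dots> = 2 * D * (1 / (1 + real (if m \<le> n then n - m else m - n)))" unfolding d by simp
        finally show "norm (\<integral>y. ker \<kappa> (\<tau> n) (x n - y) * cnj (ker \<kappa> (\<tau> m) (x m - y)) \<partial>lborel)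
          \<le> 2 * D * (1 / (1 + real (if m \<le> n then n - m else m - n)))"
          unfolding ker_gram[OF bk] .
      qed
      also have "\<dots> = 2 * D * (\<Sum>m<N. 1 / (1 + real (if m \<le> n then n - m else m - n)))"
        by (rule sum_distrib_left[symmetric])
      also have "\<dots> \<le> 2 * D * (2 * (\<Sum>n<N. 1 / (1 + real n)))"
        using D(1) sum_distance_le[of "\<lambda>j. 1 / (1 + real j)", OF _ n] by (intro mult_left_mono) auto
      finally show "(\<Sum>m<N. norm (\<integral>y. ker \<kappa> (\<tau> n) (x n - y) * cnj (ker \<kappa> (\<tau> m) (x m - y)) \<partial>lborel)) \<le> 4 * D * (\<Sum>n<N. 1 / (1 + real n))"
        by simp
    qed
  qed simp
  then show ?thesis using D(1) by (intro exI[of _ "4 * D"]) auto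
qed

text \<open>On each time slab a point is picked where at least half the supremum is reached, and the
  discrete estimate is applied to these points. \<open>Z\<close> is the supremum itself; the factor
  2 goes into the constant.\<close>

lemma strichartz_sup:
  assumes bk: "bump \<kappa>"
  shows "\<exists>C>0. \<forall>g N \<sigma>. sqint g \<longrightarrow> \<bar>\<sigma>\<bar> = 1 \<longrightarrow>
     (\<exists>Z::nat \<Rightarrow> real. (\<forall>n. 0 \<le> Z n) \<and>
       (\<forall>n t x. real n \<le> t \<longrightarrow> t \<le> real n + 1 \<longrightarrow> (norm (wave \<kappa> (\<sigma> * t) g x))\<^sup>2 \<le> Z n) \<and>
       (\<Sum>n<N. Z n) \<le> C * (\<Sum>n<N. 1 / (1 + real n)) * sqnorm g)"
proof -
  obtain C where C: "C > 0" and str: "\<And>g N \<tau> x. sqint g \<Longrightarrow>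
     (\<forall>n<N. \<forall>m<N. \<bar>real n - real m\<bar> - 1 \<le> \<bar>\<tau> n - \<tau> m\<bar>) \<Longrightarrow>
     (\<Sum>n<N. (norm (wave \<kappa> (\<tau> n) g (x n)))\<^sup>2) \<le> C * (\<Sum>n<N. 1 / (1 + real n)) * sqnorm g"
    using strichartz_discrete[OF bk] by blast
  have "\<exists>Z::nat \<Rightarrow> real. (\<forall>n. 0 \<le> Z n) \<and>
       (\<forall>n t x. real n \<le> t \<longrightarrow> t \<le> real n + 1 \<longrightarrow> (norm (wave \<kappa> (\<sigma> * t) g x))\<^sup>2 \<le> Z n) \<and>
       (\<Sum>n<N. Z n) \<le> (2 * C) * (\<Sum>n<N. 1 / (1 + real n)) * sqnorm g"
    if g: "sqint g" and \<sigma>: "\<bar>\<sigma>\<bar> = 1" for g N \<sigma>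
  proof -
    define f where "f = (\<lambda>(t, x). (norm (wave \<kappa> (\<sigma> * t) g x))\<^sup>2)"
    \<comment> \<open>A single point, that is N = 1, in the discrete estimate bounds the function
      everywhere, so the suprema are finite.\<close>
    have bnd: "f p \<le> C * sqnorm g" for p
    proof (cases p)
      case (Pair t x)
      show ?thesis using str[OF g, of 1 "\<lambda>_. \<sigma> * t" "\<lambda>_. x"] by (simp add: f_def Pair)
    qed
    have f0: "0 \<le> f p" for p by (simp add: f_def split: prod.split)
    define A where "A n = {real n..real n + 1} \<times> (UNIV :: R3 set)" for n
    have Ane: "A n \<noteq> {}" for n by (auto simp: A_def)
    define Z where "Z n = (SUP p\<in>A n. f p)" for n
    have bdd: "bdd_above (f ` A n)" for n using bnd by (auto intro!: bdd_aboveI2)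
    have up: "f p \<le> Z n" if "p \<in> A n" for n p unfolding Z_def using that bdd by (rule cSUP_upper)
    have Z0: "0 \<le> Z n" for n using up f0 Ane[of n] by (meson all_not_in_conv order_trans)
    \<comment> \<open>The supremum need not be attained, as x ranges over the whole space; half of
      it is, also when it is 0.\<close>
    have "\<exists>p\<in>A n. Z n \<le> 2 * f p" for n
    proof (cases "Z n = 0")
      case True
      then show ?thesis using Ane[of n] f0 by fastforce
    next
      case False
      then have "Z n / 2 < Z n" using Z0[of n] by simp
      then obtain p where "p \<in> A n" "Z n / 2 < f p"
        unfolding Z_def using less_cSUP_iff[OF Ane bdd] by blast
      then show ?thesis by (intro bexI[of _ p]) auto
    qed
    then obtain p where p: "\<And>n. p n \<in> A n" "\<And>n. Z n \<le> 2 * f (p n)" by metis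
    have fp: "f (p n) = (norm (wave \<kappa> (\<sigma> * fst (p n)) g (snd (p n))))\<^sup>2" for n by (simp add: f_def case_prod_beta)
    have "(\<Sum>n<N. Z n) \<le> (\<Sum>n<N. 2 * f (p n))" by (intro sum_mono p)
    also have "\<dots> = 2 * (\<Sum>n<N. (norm (wave \<kappa> (\<sigma> * fst (p n)) g (snd (p n))))\<^sup>2)" by (simp add: sum_distrib_left fp)
    also have "\<dots> \<le> 2 * (C * (\<Sum>n<N. 1 / (1 + real n)) * sqnorm g)"
    proof (intro mult_left_mono str g allI impI)
      fix n m :: nat
      have "real n \<le> fst (p n)" "fst (p n) \<le> real n + 1" "real m \<le> fst (p m)" "fst (p m) \<le> real m + 1"
        using p(1)[of n] p(1)[of m] by (auto simp: A_def mem_Times_iff)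
      then have "\<bar>real n - real m\<bar> - 1 \<le> \<bar>fst (p n) - fst (p m)\<bar>" by (auto simp: abs_if)
      also have "\<dots> = \<bar>\<sigma> * fst (p n) - \<sigma> * fst (p m)\<bar>"
        using \<sigma> by (simp add: right_diff_distrib[symmetric] abs_mult)
      finally show "\<bar>real n - real m\<bar> - 1 \<le> \<bar>\<sigma> * fst (p n) - \<sigma> * fst (p m)\<bar>" .
    qed simp
    finally have "(\<Sum>n<N. Z n) \<le> (2 * C) * (\<Sum>n<N. 1 / (1 + real n)) * sqnorm g" by simp
    moreover have "(norm (wave \<kappa> (\<sigma> * t) g x))\<^sup>2 \<le> Z n" if "real n \<le> t" "t \<le> real n + 1" for n t x
      using up[of "(t, x)" n] that by (simp add: A_def f_def)
    ultimately show ?thesis using Z0 by blast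
  qed
  then show ?thesis using C by (intro exI[of _ "2 * C"]) auto
qed

section \<open>Harmonic sums, power tails and the volume of slabs\<close>

lemma powr_le_self: "1 \<le> x \<Longrightarrow> \<beta> \<le> 1 \<Longrightarrow> x powr \<beta> \<le> (x::real)"
  using powr_mono[of \<beta> 1 x] by simp

lemma emeasure_cball_R3: "0 \<le> R \<Longrightarrow> emeasure lborel (cball (0::R3) R) \<le> ennreal (6 * R ^ 3)"
proof -
  assume R: "0 \<le> R"
  have "emeasure lborel (cball (0::R3) R) = ennreal (4 / 3 * pi * R ^ 3)"
    using R by (simp add: emeasure_cball eval_unit_ball_vol)
  also have "\<dots> \<le> ennreal (6 * R ^ 3)"
    using R pi_less_4 by (intro ennreal_leI mult_right_mono) auto
  finally show ?thesis .
qed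

lemma harmonic_le_ln: "N \<ge> 1 \<Longrightarrow> (\<Sum>n<N. 1 / (1 + real n)) \<le> 1 + ln (real N)"
proof (induction N rule: nat_induct_at_least)
  case (Suc N)
  have "ln (real N / (real N + 1)) \<le> real N / (real N + 1) - 1" using Suc by (intro ln_le_minus_one) auto
  moreover have "ln (real N / (real N + 1)) = ln (real N) - ln (real N + 1)" using Suc by (simp add: ln_div)
  moreover have "real N / (real N + 1) - 1 = - (1 / (1 + real N))" by (simp add: field_simps)
  ultimately show ?case using Suc by (simp add: add.commute)
qed simp

text \<open>Trades the logarithm for an arbitrarily small power, which the strict inequality
  2\<beta> < \<eta> can absorb.\<close>

lemma harmonic_le_powr:
  assumes "\<epsilon> > 0" "N \<ge> 1"
  shows "(\<Sum>n<N. 1 / (1 + real n)) \<le> (1 + 1 / \<epsilon>) * real N powr \<epsilon>"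
proof -
  have "ln (real N) \<le> real N powr \<epsilon> / \<epsilon>" using assms by (intro ln_powr_bound) auto
  moreover have "1 \<le> real N powr \<epsilon>" using assms by (intro ge_one_powr_ge_zero) auto
  ultimately show ?thesis using harmonic_le_ln[OF assms(2)] by (simp add: algebra_simps)
qed

text \<open>By the mean value theorem each term is at most the decrement of
  x^(\<beta>-1)/(1-\<beta>) over a unit step; the comparison series telescopes.\<close>

lemma powr_tail:
  fixes \<beta> :: real
  assumes "\<beta> < 1" "N \<ge> 1"
  shows "summable (\<lambda>n. (1 + real (n + N)) powr (\<beta> - 2))"
    and "(\<Sum>n. (1 + real (n + N)) powr (\<beta> - 2)) \<le> real N powr (\<beta> - 1) / (1 - \<beta>)"
proof -
  define a where "a n = real (n + N) powr (\<beta> - 1) / (1 - \<beta>)" for n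
  have st: "(1 + real (n + N)) powr (\<beta> - 2) \<le> a n - a (Suc n)" for n
  proof -
    let ?x = "real (n + N)"
    have x: "?x > 0" using assms by simp
    have d: "((\<lambda>a. a powr (\<beta> - 1)) has_real_derivative (\<beta> - 1) * y powr (\<beta> - 2)) (at y)" if "y > 0" for y
      using has_real_derivative_powr[OF that, of "\<beta> - 1"] by simp
    have "\<exists>z>?x. z < ?x + 1 \<and> (?x + 1) powr (\<beta> - 1) - ?x powr (\<beta> - 1) = (?x + 1 - ?x) * ((\<beta> - 1) * z powr (\<beta> - 2))"
      by (rule MVT2) (use x in \<open>auto intro!: d\<close>)
    then obtain z where z: "?x < z" "z < ?x + 1" "(?x + 1) powr (\<beta> - 1) - ?x powr (\<beta> - 1) = (\<beta> - 1) * z powr (\<beta> - 2)"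
      by auto
    have "(1 + ?x) powr (\<beta> - 2) \<le> z powr (\<beta> - 2)"
      using z x assms by (intro powr_mono2') auto
    moreover have "a n - a (Suc n) = z powr (\<beta> - 2)"
    proof -
      have "a n - a (Suc n) = - ((?x + 1) powr (\<beta> - 1) - ?x powr (\<beta> - 1)) / (1 - \<beta>)"
        unfolding a_def by (simp add: diff_divide_distrib add_ac)
      also have "\<dots> = z powr (\<beta> - 2)" unfolding z(3) using assms by (simp add: field_simps)
      finally show ?thesis .
    qed
    ultimately show ?thesis by simp
  qed
  have a0: "a n \<ge> 0" for n using assms by (simp add: a_def)
  have part: "(\<Sum>n<m. (1 + real (n + N)) powr (\<beta> - 2)) \<le> a 0" for m
  proof -
    have "(\<Sum>n<m. (1 + real (n + N)) powr (\<beta> - 2)) \<le> (\<Sum>n<m. a n - a (Suc n))" by (intro sum_mono st)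
    also have "\<dots> = a 0 - a m" by (rule sum_lessThan_telescope')
    finally show ?thesis using a0[of m] by linarith
  qed
  show s: "summable (\<lambda>n. (1 + real (n + N)) powr (\<beta> - 2))"
    by (rule summableI_nonneg_bounded[OF _ part]) simp
  show "(\<Sum>n. (1 + real (n + N)) powr (\<beta> - 2)) \<le> real N powr (\<beta> - 1) / (1 - \<beta>)"
    using suminf_le_const[OF s part] by (simp add: a_def)
qed

lemma nn_integral_tensor_R3:
  fixes f g h :: "real \<Rightarrow> ennreal"
  assumes [measurable]: "f \<in> borel_measurable borel" "g \<in> borel_measurable borel" "h \<in> borel_measurable borel"
  shows "(\<integral>\<^sup>+z. f ((z::R3) $ 1) * (g (z $ 2) * h (z $ 3)) \<partial>lborel)
    = (\<integral>\<^sup>+x. f x \<partial>lborel) * ((\<integral>\<^sup>+x. g x \<partial>lborel) * (\<integral>\<^sup>+x. h x \<partial>lborel))"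
proof -
  have m: "(\<lambda>v::real \<times> real \<times> real. f (fst v) * (g (fst (snd v)) * h (snd (snd v)))) \<in> borel_measurable borel"
  proof -
    have "continuous_on UNIV (\<lambda>v::real \<times> real \<times> real. fst v)" "continuous_on UNIV (\<lambda>v::real \<times> real \<times> real. fst (snd v))"
      "continuous_on UNIV (\<lambda>v::real \<times> real \<times> real. snd (snd v))"
      by (intro continuous_intros)+
    note c = this[THEN borel_measurable_continuous_onI]
    have [measurable]: "(\<lambda>v::real \<times> real \<times> real. f (fst v)) \<in> borel_measurable borel"
      "(\<lambda>v::real \<times> real \<times> real. g (fst (snd v))) \<in> borel_measurable borel"
      "(\<lambda>v::real \<times> real \<times> real. h (snd (snd v))) \<in> borel_measurable borel"
      using measurable_compose[OF c(1) assms(1)] measurable_compose[OF c(2) assms(2)] measurable_compose[OF c(3) assms(3)]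
      by simp_all
    show ?thesis by measurable
  qed
  have "(\<integral>\<^sup>+z. f ((z::R3) $ 1) * (g (z $ 2) * h (z $ 3)) \<partial>lborel)
    = (\<integral>\<^sup>+v. f (fst v) * (g (fst (snd v)) * h (snd (snd v))) \<partial>(lborel \<Otimes>\<^sub>M (lborel \<Otimes>\<^sub>M lborel)))"
    by (subst nn_integral_R3) (simp_all add: lborel_prod)
  also have "\<dots> = (\<integral>\<^sup>+x. \<integral>\<^sup>+v. f x * (g (fst v) * h (snd v)) \<partial>(lborel \<Otimes>\<^sub>M lborel) \<partial>lborel)"
    unfolding lborel_prod[where 'a=real and 'b=real]
    by (subst lborel.nn_integral_fst[symmetric]) (simp_all add: lborel_prod m)
  also have "\<dots> = (\<integral>\<^sup>+x. f x * (\<integral>\<^sup>+v. g (fst v) * h (snd v) \<partial>(lborel \<Otimes>\<^sub>M lborel)) \<partial>lborel)"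
    by (intro nn_integral_cong nn_integral_cmult) measurable
  also have "(\<integral>\<^sup>+v. g (fst v) * h (snd v) \<partial>(lborel \<Otimes>\<^sub>M lborel)) = (\<integral>\<^sup>+x. g x \<partial>lborel) * (\<integral>\<^sup>+x. h x \<partial>lborel)"
    by (subst lborel.nn_integral_fst[symmetric]) (simp_all add: nn_integral_cmult nn_integral_multc)
  finally show ?thesis by (simp add: nn_integral_multc)
qed

text \<open>After rotating \<open>e\<close> to the first axis, the ball is contained in a column of
  square cross-section with side 2R. The first coordinate contributes a constant whatever the shift
  \<open>c\<close>, so the size is R^2 instead of R^3.\<close>

lemma slab_integral:
  "\<exists>P>0. \<forall>R>0. \<forall>c. \<forall>e::R3. norm e = 1 \<longrightarrow>
     (\<integral>\<^sup>+y. indicator (cball 0 R) y * ennreal (1 / (1 + (c + y \<bullet> e)\<^sup>2)) \<partial>lborel) \<le> ennreal (P * R\<^sup>2)"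
proof -
  let ?q = "\<lambda>u::real. 1 / (1 + u\<^sup>2)"
  have iq: "integrable lborel ?q"
    using integrable_inverse_1_plus_square by (simp add: set_integrable_def inverse_eq_divide)
  define P where "P = (\<integral>u. ?q u \<partial>lborel)"
  have P: "P \<ge> 0" unfolding P_def by (intro Bochner_Integration.integral_nonneg) simp
  have Pn: "(\<integral>\<^sup>+u. ennreal (?q (c + u)) \<partial>lborel) = ennreal P" for c
  proof -
    have "(\<integral>\<^sup>+u. ennreal (?q u) \<partial>lborel) = (\<integral>\<^sup>+u. ennreal (?q (c + u)) \<partial>lborel)"
      using nn_integral_real_affine[of "\<lambda>u. ennreal (?q u)" 1 c] by simp
    then show ?thesis using iq by (simp add: nn_integral_eq_integral P_def)
  qed
  have "(\<integral>\<^sup>+y. indicator (cball 0 R) y * ennreal (?q (c + y \<bullet> e)) \<partial>lborel) \<le> ennreal ((4 * P + 1) * R\<^sup>2)"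
    if R: "R > 0" and e: "norm e = 1" for R c and e :: R3
  proof -
    obtain T :: "R3 \<Rightarrow> R3" where T: "orthogonal_transformation T" "T (axis 1 1) = e"
      using orthogonal_transformation_exists[of "axis 1 1 :: R3" e] e by auto
    have [measurable]: "T \<in> borel_measurable borel"
      using T by (intro borel_measurable_continuous_onI linear_continuous_on)
        (auto simp: orthogonal_transformation_linear linear_linear)
    have [measurable]: "cball (0::R3) R \<in> sets borel" by simp
    have Te: "T y \<bullet> e = y $ 1" for y
      unfolding T(2)[symmetric] using T(1) by (simp add: orthogonal_transformation_def inner_axis)
    have "(\<integral>\<^sup>+y. indicator (cball 0 R) y * ennreal (?q (c + y \<bullet> e)) \<partial>lborel)
      = (\<integral>\<^sup>+y. indicator (cball 0 R) y * ennreal (?q (c + y \<bullet> e)) \<partial>distr lborel borel T)"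
      using lborel_orthogonal[OF T(1)] by simp
    also have "\<dots> = (\<integral>\<^sup>+y. indicator (cball 0 R) (T y) * ennreal (?q (c + T y \<bullet> e)) \<partial>lborel)"
      by (subst nn_integral_distr) auto
    also have "\<dots> \<le> (\<integral>\<^sup>+y. ennreal (?q (c + (y::R3) $ 1)) * (indicator {-R..R} (y $ 2) * indicator {-R..R} (y $ 3)) \<partial>lborel)"
    proof (rule nn_integral_mono)
      fix y :: R3
      have Ty: "norm (T y) = norm y" by (rule orthogonal_transformation_norm[OF T(1)])
      have "indicator (cball 0 R) (T y) \<le> (indicator {-R..R} (y $ 2) * indicator {-R..R} (y $ 3) :: ennreal)"
      proof (cases "norm y \<le> R")
        case True
        then have "\<bar>y $ 2\<bar> \<le> R" "\<bar>y $ 3\<bar> \<le> R"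
          by (rule order_trans[OF component_le_norm_cart])+
        then have "y $ 2 \<in> {-R..R}" "y $ 3 \<in> {-R..R}" by (simp_all add: abs_le_iff)
        then show ?thesis by (simp add: indicator_def)
      next
        case False
        then show ?thesis using Ty by (simp add: indicator_def)
      qed
      then show "indicator (cball 0 R) (T y) * ennreal (?q (c + T y \<bullet> e)) \<le> ennreal (?q (c + y $ 1)) * (indicator {-R..R} (y $ 2) * indicator {-R..R} (y $ 3))"
        unfolding Te by (subst mult.commute, intro mult_left_mono) auto
    qed
    also have "\<dots> = ennreal P * (ennreal (2 * R) * ennreal (2 * R))"
      using R by (subst nn_integral_tensor_R3) (simp_all add: Pn)
    also have "\<dots> = ennreal (4 * P * R\<^sup>2)"
      using R P by (simp add: ennreal_mult[symmetric] power2_eq_square mult_ac del: ennreal_numeral)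
    also have "\<dots> \<le> ennreal ((4 * P + 1) * R\<^sup>2)" by (intro ennreal_leI mult_right_mono) auto
    finally show ?thesis .
  qed
  then show ?thesis using P by (intro exI[of _ "4 * P + 1"]) auto
qed

lemma shift_abs_le: "b \<le> n \<Longrightarrow> n \<le> b + 1 \<Longrightarrow> 1 + \<bar>t - b\<bar> \<le> 2 * (1 + \<bar>t - n\<bar>)" for b n t :: real
  by (cases "t \<le> b"; cases "t \<le> n") (simp_all add: abs_if)

text \<open>For \<open>t \<ge> 4 R\<^sup>2\<close> a sphere of radius \<open>t\<close> meets the ball of radius \<open>R\<close> in a set that is
  flat up to an error \<open>O(1)\<close>, so that its unit neighbourhood in the ball lies in a slab.\<close>

lemma shell_integral:
  "\<exists>P>0. \<forall>R\<ge>1. \<forall>t\<ge>4 * R\<^sup>2. \<forall>x::R3.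
     (\<integral>\<^sup>+y. indicator (cball 0 R) y * ennreal (1 / (1 + \<bar>t - norm (x - y)\<bar>)\<^sup>2) \<partial>lborel) \<le> ennreal (P * R\<^sup>2)"
proof -
  obtain P where P: "P > 0" and slab: "\<And>R c e. R > 0 \<Longrightarrow> norm (e::R3) = 1 \<Longrightarrow>
     (\<integral>\<^sup>+y. indicator (cball 0 R) y * ennreal (1 / (1 + (c + y \<bullet> e)\<^sup>2)) \<partial>lborel) \<le> ennreal (P * R\<^sup>2)"
    using slab_integral by blast
  have "(\<integral>\<^sup>+y. indicator (cball 0 R) y * ennreal (1 / (1 + \<bar>t - norm (x - y)\<bar>)\<^sup>2) \<partial>lborel) \<le> ennreal ((4 * P + 6) * R\<^sup>2)"
    if R: "R \<ge> 1" and t: "t \<ge> 4 * R\<^sup>2" for R t and x :: R3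
  proof (cases "norm x < t / 2")
    case True
    have RR: "R \<le> R\<^sup>2" using R by (simp add: power2_eq_square)
    have "(\<integral>\<^sup>+y. indicator (cball 0 R) y * ennreal (1 / (1 + \<bar>t - norm (x - y)\<bar>)\<^sup>2) \<partial>lborel)
      \<le> (\<integral>\<^sup>+y. ennreal (1 / R) * indicator (cball 0 R) (y::R3) \<partial>lborel)"
    proof (rule nn_integral_mono)
      fix y :: R3
      \<comment> \<open>For |x| < t/2 the ball lies at distance at least t/2 - R \<ge> 2R^2 - R
        \<ge> R from the sphere; one factor 1/R already reduces the volume R^3 to R^2.\<close>
      have "1 / (1 + \<bar>t - norm (x - y)\<bar>)\<^sup>2 \<le> 1 / R" if y: "norm y \<le> R"
      proof -
        have "norm (x - y) \<le> norm x + norm y" by (rule norm_triangle_ineq4)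
        then have "R \<le> t - norm (x - y)" using y True t RR by linarith
        then have "R \<le> 1 + \<bar>t - norm (x - y)\<bar>" by linarith
        then have "R * 1 \<le> (1 + \<bar>t - norm (x - y)\<bar>) * (1 + \<bar>t - norm (x - y)\<bar>)"
          using R by (intro mult_mono) auto
        then show ?thesis using R by (intro divide_left_mono) (auto simp: power2_eq_square intro!: mult_pos_pos add_pos_nonneg)
      qed
      then show "indicator (cball 0 R) y * ennreal (1 / (1 + \<bar>t - norm (x - y)\<bar>)\<^sup>2) \<le> ennreal (1 / R) * indicator (cball 0 R) y"
        by (auto simp: indicator_def intro!: ennreal_leI)
    qed
    also have "\<dots> = ennreal (1 / R) * emeasure lborel (cball (0::R3) R)" by (rule nn_integral_cmult_indicator) simp
    also have "\<dots> \<le> ennreal (1 / R) * ennreal (6 * R ^ 3)"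
      using R by (intro mult_left_mono emeasure_cball_R3) auto
    also have "\<dots> = ennreal (6 * R\<^sup>2)"
      using R by (simp add: ennreal_mult[symmetric] power2_eq_square power3_eq_cube del: ennreal_numeral)
    also have "\<dots> \<le> ennreal ((4 * P + 6) * R\<^sup>2)" using P by (intro ennreal_leI mult_right_mono) auto
    finally show ?thesis .
  next
    case False
    let ?a = "norm x" define e where "e = x /\<^sub>R ?a"
    have RR: "R \<le> R\<^sup>2" "1 \<le> R\<^sup>2" using R by (auto simp: power2_eq_square mult_ge1_I)
    have a: "2 * R\<^sup>2 \<le> ?a" using False t by linarith
    then have a0: "?a > 0" using RR by linarith
    have e: "norm e = 1" using a0 by (simp add: e_def)
    have xe: "x = ?a *\<^sub>R e" using a0 by (simp add: e_def)
    have "(\<integral>\<^sup>+y. indicator (cball 0 R) y * ennreal (1 / (1 + \<bar>t - norm (x - y)\<bar>)\<^sup>2) \<partial>lborel)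
      \<le> (\<integral>\<^sup>+y. ennreal 4 * (indicator (cball 0 R) y * ennreal (1 / (1 + ((t - ?a) + y \<bullet> e)\<^sup>2))) \<partial>lborel)"
    proof (rule nn_integral_mono)
      fix y :: R3
      have "1 / (1 + \<bar>t - norm (x - y)\<bar>)\<^sup>2 \<le> 4 * (1 / (1 + ((t - ?a) + y \<bullet> e)\<^sup>2))" if y: "norm y \<le> R"
      proof -
        have ye: "\<bar>y \<bullet> e\<bar> \<le> R" using Cauchy_Schwarz_ineq2[of y e] e y by simp
        let ?b = "?a - y \<bullet> e" let ?n = "norm (x - y)"
        have b: "?b \<ge> R\<^sup>2" using a ye RR by linarith
        \<comment> \<open>Pythagoras: the distance exceeds its linearisation b = |x| - y.e only
          through the part of y orthogonal to e. That part is at most R in norm and b \<ge> R^2, so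
          the excess is at most 1.\<close>
        have n2: "?n\<^sup>2 = ?b\<^sup>2 + ((norm y)\<^sup>2 - (y \<bullet> e)\<^sup>2)"
        proof -
          have "?n\<^sup>2 = (norm x)\<^sup>2 - 2 * (x \<bullet> y) + (norm y)\<^sup>2"
            by (simp add: power2_norm_eq_inner inner_diff_left inner_diff_right inner_commute)
          also have "x \<bullet> y = ?a * (y \<bullet> e)" by (subst xe) (simp add: inner_commute)
          finally show ?thesis by (simp add: power2_eq_square algebra_simps)
        qed
        have ye2: "(y \<bullet> e)\<^sup>2 \<le> (norm y)\<^sup>2"
          using Cauchy_Schwarz_ineq2[of y e] e by (metis abs_le_square_iff abs_norm_cancel mult.right_neutral)
        have "?b\<^sup>2 \<le> ?n\<^sup>2" using n2 ye2 by linarith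
        then have bn: "?b \<le> ?n" by (rule power2_le_imp_le) simp
        have nR: "?n\<^sup>2 \<le> ?b\<^sup>2 + R\<^sup>2"
        proof -
          have "(norm y)\<^sup>2 \<le> R\<^sup>2" using y by (intro power_mono) auto
          then show ?thesis using n2 zero_le_power2[of "y \<bullet> e"] by linarith
        qed
        have "?n\<^sup>2 \<le> (?b + 1)\<^sup>2"
        proof -
          have "(?b + 1)\<^sup>2 = ?b\<^sup>2 + ?b + ?b + 1" by (simp add: power2_eq_square algebra_simps)
          then show ?thesis using nR b RR by linarith
        qed
        then have nb: "?n \<le> ?b + 1" by (rule power2_le_imp_le) (use b RR in linarith)
        let ?u = "(t - ?a) + y \<bullet> e" let ?d = "\<bar>t - ?n\<bar>"
        \<comment> \<open>Replacing the sphere by the plane changes the distance by at most 1, which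
          costs a factor 2, hence 4 after squaring.\<close>
        have ud: "1 + \<bar>?u\<bar> \<le> 2 * (1 + ?d)"
        proof -
          have u: "?u = t - ?b" by simp
          show ?thesis unfolding u by (rule shift_abs_le[OF bn nb])
        qed
        have "1 + v\<^sup>2 \<le> (1 + \<bar>v\<bar>)\<^sup>2" for v :: real by (simp add: power2_sum)
        then have "1 + ?u\<^sup>2 \<le> (1 + \<bar>?u\<bar>)\<^sup>2" .
        also have "\<dots> \<le> (2 * (1 + ?d))\<^sup>2" using ud by (intro power_mono) auto
        also have "\<dots> = 4 * (1 + ?d)\<^sup>2" unfolding power_mult_distrib by simp
        finally have le: "1 + ?u\<^sup>2 \<le> 4 * (1 + ?d)\<^sup>2" .
        have aux: "0 < X \<Longrightarrow> 0 < U \<Longrightarrow> U \<le> 4 * X \<Longrightarrow> 1 / X \<le> 4 * (1 / U)" for X U :: real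
          by (simp add: field_simps)
        have "0 < 1 + ?d" by (rule add_pos_nonneg) simp_all
        then have "0 < (1 + ?d)\<^sup>2" by (rule zero_less_power)
        moreover have "0 < 1 + ?u\<^sup>2" by (rule add_pos_nonneg) simp_all
        ultimately show ?thesis using le by (rule aux)
      qed
      then have "norm y \<le> R \<Longrightarrow> ennreal (1 / (1 + \<bar>t - norm (x - y)\<bar>)\<^sup>2) \<le> ennreal 4 * ennreal (1 / (1 + ((t - ?a) + y \<bullet> e)\<^sup>2))"
        by (subst ennreal_mult[symmetric]) (auto intro!: ennreal_leI simp del: ennreal_numeral)
      then show "indicator (cball 0 R) y * ennreal (1 / (1 + \<bar>t - norm (x - y)\<bar>)\<^sup>2) \<le> ennreal 4 * (indicator (cball 0 R) y * ennreal (1 / (1 + ((t - ?a) + y \<bullet> e)\<^sup>2)))"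
        by (auto simp: indicator_def simp del: ennreal_numeral)
    qed
    moreover have "cball (0::R3) R \<in> sets borel" by simp
    then have "(\<lambda>y. indicator (cball 0 R) y * ennreal (1 / (1 + ((t - ?a) + y \<bullet> e)\<^sup>2))) \<in> borel_measurable lborel" by measurable
    then have "(\<integral>\<^sup>+y. ennreal 4 * (indicator (cball 0 R) y * ennreal (1 / (1 + ((t - ?a) + y \<bullet> e)\<^sup>2))) \<partial>lborel)
      = ennreal 4 * (\<integral>\<^sup>+y. indicator (cball 0 R) y * ennreal (1 / (1 + ((t - ?a) + y \<bullet> e)\<^sup>2)) \<partial>lborel)"
      by (rule nn_integral_cmult)
    ultimately have "(\<integral>\<^sup>+y. indicator (cball 0 R) y * ennreal (1 / (1 + \<bar>t - norm (x - y)\<bar>)\<^sup>2) \<partial>lborel)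
      \<le> ennreal 4 * (\<integral>\<^sup>+y. indicator (cball 0 R) y * ennreal (1 / (1 + ((t - ?a) + y \<bullet> e)\<^sup>2)) \<partial>lborel)" by (simp only:)
    also have "\<dots> \<le> ennreal 4 * ennreal (P * R\<^sup>2)"
      using R by (intro mult_left_mono slab e) auto
    also have "\<dots> = ennreal (4 * P * R\<^sup>2)" using P by (simp add: ennreal_mult[symmetric] mult_ac del: ennreal_numeral)
    also have "\<dots> \<le> ennreal ((4 * P + 6) * R\<^sup>2)" using P by (intro ennreal_leI mult_right_mono) auto
    finally show ?thesis .
  qed
  then show ?thesis using P by (intro exI[of _ "4 * P + 6"]) auto
qed

section \<open>Weighted bounds at unit frequency\<close>

text \<open>Separates the use of Cauchy-Schwarz from the geometry: the weight is absorbed pointwise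
  into the squared kernel, and only the integral of the profile \<open>q\<close> over the support
  remains to be estimated.\<close>

lemma wave_weighted_le:
  assumes bk: "bump \<kappa>" and g: "sqint g" and supp: "\<And>y. R < norm y \<Longrightarrow> g y = 0"
    and pt: "\<And>y. norm y \<le> R \<Longrightarrow> w * (norm (ker \<kappa> \<tau> (x - y)))\<^sup>2 \<le> A * q y"
    and q: "q \<in> borel_measurable borel" "\<And>y. q y \<ge> 0" and wA: "w \<ge> 0" "A \<ge> 0" "I \<ge> 0"
    and I: "(\<integral>\<^sup>+y. indicator (cball 0 R) y * ennreal (q y) \<partial>lborel) \<le> ennreal I"
  shows "w * (norm (wave \<kappa> \<tau> g x))\<^sup>2 \<le> A * I * sqnorm g"
proof -
  have [measurable]: "ker \<kappa> \<tau> \<in> borel_measurable borel" "q \<in> borel_measurable borel" "cball (0::R3) R \<in> sets borel"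
    using measurable_ker[OF bk] q by auto
  have "ennreal (w * (norm (wave \<kappa> \<tau> g x))\<^sup>2) = ennreal w * ennreal ((norm (wave \<kappa> \<tau> g x))\<^sup>2)"
    using wA by (simp add: ennreal_mult)
  also have "\<dots> \<le> ennreal w * ((\<integral>\<^sup>+y. indicator (cball 0 R) y * ennreal ((norm (ker \<kappa> \<tau> (x - y)))\<^sup>2) \<partial>lborel) * ennreal (sqnorm g))"
    by (intro mult_left_mono wave_square_le[OF bk g supp]) auto
  also have "\<dots> = (\<integral>\<^sup>+y. ennreal w * (indicator (cball 0 R) y * ennreal ((norm (ker \<kappa> \<tau> (x - y)))\<^sup>2)) \<partial>lborel) * ennreal (sqnorm g)"
    by (simp add: nn_integral_cmult mult.assoc)
  also have "\<dots> \<le> (\<integral>\<^sup>+y. ennreal A * (indicator (cball 0 R) y * ennreal (q y)) \<partial>lborel) * ennreal (sqnorm g)"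
  proof (intro mult_right_mono nn_integral_mono)
    fix y :: R3
    have "ennreal w * ennreal ((norm (ker \<kappa> \<tau> (x - y)))\<^sup>2) \<le> ennreal A * ennreal (q y)" if "norm y \<le> R"
      using pt[OF that] wA q(2) by (simp add: ennreal_mult[symmetric] ennreal_leI)
    then show "ennreal w * (indicator (cball 0 R) y * ennreal ((norm (ker \<kappa> \<tau> (x - y)))\<^sup>2)) \<le> ennreal A * (indicator (cball 0 R) y * ennreal (q y))"
      by (auto simp: indicator_def)
  qed simp
  also have "\<dots> = ennreal A * (\<integral>\<^sup>+y. indicator (cball 0 R) y * ennreal (q y) \<partial>lborel) * ennreal (sqnorm g)"
    by (simp add: nn_integral_cmult)
  also have "\<dots> \<le> ennreal A * ennreal I * ennreal (sqnorm g)"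
    using I by (intro mult_right_mono mult_left_mono) auto
  also have "\<dots> = ennreal (A * I * sqnorm g)" using wA by (simp add: ennreal_mult sqnorm_nonneg)
  finally show ?thesis using wA by (subst (asm) ennreal_le_iff) (auto simp: sqnorm_nonneg)
qed

text \<open>Once R^2 is dominated by 1 + t, the weight is at most 6 (1 + t) d, where d is 1 plus the
  distance to the light cone. Powers of d are plentiful in the kernel bound: one pays for the
  weight, two remain for the slab integral.\<close>

lemma weight_ker_le:
  assumes C: "C > 0" "norm (ker \<kappa> (\<sigma> * t) (x - y)) \<le> C / ((1 + \<bar>\<sigma> * t\<bar>) * (1 + \<bar>\<bar>\<sigma> * t\<bar> - norm (x - y)\<bar>) ^ 8)"
    and \<sigma>: "\<bar>\<sigma>\<bar> = 1" and t: "t \<ge> 0" and \<beta>: "0 < \<beta>" "\<beta> < 1"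
    and y: "norm y \<le> R" and R: "1 + R\<^sup>2 + R \<le> 3 * (1 + t)"
  shows "(1 + R\<^sup>2 + t + norm x) powr \<beta> * (norm (ker \<kappa> (\<sigma> * t) (x - y)))\<^sup>2
    \<le> (6 * C\<^sup>2 * (1 + t) powr (\<beta> - 2)) * (1 / (1 + \<bar>t - norm (x - y)\<bar>)\<^sup>2)"
proof -
  define d where "d = 1 + \<bar>t - norm (x - y)\<bar>"
  define T where "T = 1 + t"
  have st: "\<bar>\<sigma> * t\<bar> = t" using \<sigma> t by (simp add: abs_mult)
  have d: "d \<ge> 1" and T: "T \<ge> 1" using t by (auto simp: d_def T_def)
  have "norm x \<le> norm (x - y) + norm y" using norm_triangle_ineq[of "x - y" y] by simp
  moreover have "norm (x - y) \<le> T + d" by (simp add: T_def d_def abs_if)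
  moreover have "1 + R\<^sup>2 + R \<le> 3 * T" using R by (simp add: T_def)
  moreover have "t \<le> T" by (simp add: T_def)
  moreover have "T \<le> T * d" "d \<le> T * d" using d T by simp_all
  \<comment> \<open>3T bounds the terms in R, T bounds t, and T + d bounds |x - y|; in total 5T + d,
    with T and d both at least 1.\<close>
  ultimately have w: "1 + R\<^sup>2 + t + norm x \<le> 6 * (T * d)" using y by linarith
  have "(1 + R\<^sup>2 + t + norm x) powr \<beta> \<le> (6 * (T * d)) powr \<beta>"
    using w \<beta> t by (intro powr_mono2) auto
  also have "\<dots> = 6 powr \<beta> * (T powr \<beta> * d powr \<beta>)"
    using T d by (simp add: powr_mult)
  also have "\<dots> \<le> 6 * (T powr \<beta> * d)"
    using \<beta> d powr_le_self[of 6 \<beta>] powr_le_self[of d \<beta>] by (intro mult_mono) auto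
  finally have 1: "(1 + R\<^sup>2 + t + norm x) powr \<beta> \<le> 6 * (T powr \<beta> * d)" .
  have "norm (ker \<kappa> (\<sigma> * t) (x - y)) \<le> C / (T * d ^ 8)" using C(2) unfolding st T_def d_def .
  then have "(norm (ker \<kappa> (\<sigma> * t) (x - y)))\<^sup>2 \<le> (C / (T * d ^ 8))\<^sup>2" by (rule power_mono) simp
  also have "\<dots> = C\<^sup>2 / T\<^sup>2 * (1 / d ^ 16)"
    by (simp only: power_divide power_mult_distrib power_mult[symmetric]) simp
  also have "\<dots> \<le> C\<^sup>2 / T\<^sup>2 * (1 / d ^ 3)"
  proof (rule mult_left_mono)
    have "d ^ 3 \<le> d ^ 16" using d by (intro power_increasing) auto
    moreover have "0 < d ^ 3" using d by (intro zero_less_power) linarith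
    ultimately show "1 / d ^ 16 \<le> 1 / d ^ 3" by (simp add: frac_le)
  qed simp
  finally have 2: "(norm (ker \<kappa> (\<sigma> * t) (x - y)))\<^sup>2 \<le> C\<^sup>2 / T\<^sup>2 * (1 / d ^ 3)" .
  have "(1 + R\<^sup>2 + t + norm x) powr \<beta> * (norm (ker \<kappa> (\<sigma> * t) (x - y)))\<^sup>2
    \<le> (6 * (T powr \<beta> * d)) * (C\<^sup>2 / T\<^sup>2 * (1 / d ^ 3))"
    by (rule mult_mono[OF 1 2]) (use d in auto)
  also have "\<dots> = 6 * C\<^sup>2 * (T powr \<beta> / T\<^sup>2) * (d / d ^ 3)" by (simp add: mult_ac)
  also have "T powr \<beta> / T\<^sup>2 = T powr (\<beta> - 2)"
  proof -
    have "T powr 2 = T\<^sup>2" using T powr_realpow[of T 2] by simp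
    then show ?thesis by (simp add: powr_diff)
  qed
  also have "d / d ^ 3 = 1 / d\<^sup>2"
  proof -
    have "d \<noteq> 0" using d by linarith
    then show ?thesis by (simp add: power3_eq_cube power2_eq_square)
  qed
  finally show ?thesis by (simp only: T_def d_def)
qed

lemma cancel_aux: "X \<noteq> 0 \<Longrightarrow> (2 * X) * (c / ((X / 2) * r)) = (4 * c / r) * (1::real)"
  by (cases "r = 0") (simp_all add: field_simps)

text \<open>\<open>M n\<close> dominates the weighted square on the whole slab n \<le> t \<le> n +
  1, uniformly in x, so that the time integral becomes a series. R^2 is included in the weight
  because it reappears when a piece of another frequency is rescaled. Radii below 1 are also
  required, since low frequencies shrink the support.\<close>

theorem unit_estimate:
  assumes bk: "bump \<kappa>" and \<beta>: "0 < \<beta>" "\<beta> < 1" and \<eta>: "2 * \<beta> < \<eta>" "\<eta> \<le> 2"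
  shows "\<exists>C>0. \<forall>R>0. \<forall>g \<sigma>. sqint g \<longrightarrow> (\<forall>y. R < norm y \<longrightarrow> g y = 0) \<longrightarrow> \<bar>\<sigma>\<bar> = 1 \<longrightarrow>
    (\<exists>M::nat \<Rightarrow> real. (\<forall>n. 0 \<le> M n) \<and>
      (\<forall>n t x. real n \<le> t \<longrightarrow> t \<le> real n + 1 \<longrightarrow> (1 + R\<^sup>2 + t + norm x) powr \<beta> * (norm (wave \<kappa> (\<sigma> * t) g x))\<^sup>2 \<le> M n) \<and>
      summable M \<and> suminf M \<le> C * R powr \<eta> * sqnorm g)"
proof -
  obtain C where C: "C > 0" "\<And>\<tau> z. norm (ker \<kappa> \<tau> z) \<le> C / ((1 + \<bar>\<tau>\<bar>) * (1 + \<bar>\<bar>\<tau>\<bar> - norm z\<bar>) ^ 8)"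
    using ker_bound[OF bk, of 8] by blast
  obtain P where P: "P > 0" and shell: "\<And>R t x. R \<ge> 1 \<Longrightarrow> t \<ge> 4 * R\<^sup>2 \<Longrightarrow>
     (\<integral>\<^sup>+y. indicator (cball 0 R) y * ennreal (1 / (1 + \<bar>t - norm ((x::R3) - y)\<bar>)\<^sup>2) \<partial>lborel) \<le> ennreal (P * R\<^sup>2)"
    using shell_integral by blast
  obtain D where D: "D > 0" and str: "\<And>g N \<sigma>. sqint g \<Longrightarrow> \<bar>\<sigma>\<bar> = 1 \<Longrightarrow>
     (\<exists>Z::nat \<Rightarrow> real. (\<forall>n. 0 \<le> Z n) \<and>
       (\<forall>n t x. real n \<le> t \<longrightarrow> t \<le> real n + 1 \<longrightarrow> (norm (wave \<kappa> (\<sigma> * t) g x))\<^sup>2 \<le> Z n) \<and>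
       (\<Sum>n<N. Z n) \<le> D * (\<Sum>n<N. 1 / (1 + real n)) * sqnorm g)"
    using strichartz_sup[OF bk] by blast
  \<comment> \<open>Half the room between 2\<beta> and \<eta>: the logarithm over about R^2 slabs
    becomes R^(2\<epsilon>), and 2\<beta> + 2\<epsilon> = \<eta>.\<close>
  define \<epsilon> where "\<epsilon> = (\<eta> - 2 * \<beta>) / 2"
  have \<epsilon>: "\<epsilon> > 0" using \<eta> by (simp add: \<epsilon>_def)
  have b2: "\<beta> - 2 < -1" using \<beta> by simp
  define S where "S = (\<Sum>n. (1 + real n) powr (\<beta> - 2))"
  have sS: "summable (\<lambda>n. (1 + real n) powr (\<beta> - 2))"
  proof -
    have "summable (\<lambda>n. (1 + real (n + 1)) powr (\<beta> - 2))" by (rule powr_tail(1)) (use \<beta> in auto)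
    then show ?thesis using summable_iff_shift[of "\<lambda>n. (1 + real n) powr (\<beta> - 2)" 1] by simp
  qed
  have S0: "S \<ge> 0" unfolding S_def by (rule suminf_nonneg[OF sS]) simp
  define C1 where "C1 = 36 * C\<^sup>2 * S"
  \<comment> \<open>The three terms come from early times near the origin, early times far out, and
    the tail of late times.\<close>
  define C2 where "C2 = 23 * D * (1 + 1 / \<epsilon>) * 5 powr \<epsilon> + 120 * C\<^sup>2 + 6 * C\<^sup>2 * P / (1 - \<beta>)"
  have C12: "C1 \<ge> 0" "C2 > 0" using C D P S0 \<beta> \<epsilon> by (auto simp: C1_def C2_def intro!: add_pos_nonneg add_nonneg_pos mult_nonneg_nonneg)
  have pm: "(\<lambda>y. 1 / (1 + \<bar>t - norm (x - y)\<bar>)\<^sup>2) \<in> borel_measurable borel" for t and x :: R3 by measurable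
  have "\<exists>M::nat \<Rightarrow> real. (\<forall>n. 0 \<le> M n) \<and>
      (\<forall>n t x. real n \<le> t \<longrightarrow> t \<le> real n + 1 \<longrightarrow> (1 + R\<^sup>2 + t + norm x) powr \<beta> * (norm (wave \<kappa> (\<sigma> * t) g x))\<^sup>2 \<le> M n) \<and>
      summable M \<and> suminf M \<le> (C1 + C2) * R powr \<eta> * sqnorm g"
    if R0: "R > 0" and g: "sqint g" and supp: "\<forall>y. R < norm y \<longrightarrow> g y = 0" and \<sigma>: "\<bar>\<sigma>\<bar> = 1" for R g \<sigma>
  proof -
    have gn: "sqnorm g \<ge> 0" by (rule sqnorm_nonneg)
    have supp: "\<And>y. R < norm y \<Longrightarrow> g y = 0" using supp by blast
    have tn: "(1 + t) powr (\<beta> - 2) \<le> (1 + real n) powr (\<beta> - 2)" if "real n \<le> t" for n t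
      using that \<beta> by (intro powr_mono2') auto
    show ?thesis
    proof (cases "R \<le> 1")
      case True
      \<comment> \<open>For R \<le> 1 the late-time argument works from t = 0, with the volume of
        the ball in place of the slab; 36 = 6 * 6. In the end R^3 \<le> R^\<eta>.\<close>
      define M where "M n = 36 * C\<^sup>2 * R ^ 3 * sqnorm g * (1 + real n) powr (\<beta> - 2)" for n
      have M0: "0 \<le> M n" for n using R0 gn by (simp add: M_def)
      have bound: "(1 + R\<^sup>2 + t + norm x) powr \<beta> * (norm (wave \<kappa> (\<sigma> * t) g x))\<^sup>2 \<le> M n"
        if n: "real n \<le> t" "t \<le> real n + 1" for n t x
      proof -
        have t: "t \<ge> 0" using n by linarith
        have R2: "R\<^sup>2 \<le> 1" using True R0 by (simp add: power_le_one)
        have c: "1 + R\<^sup>2 + R \<le> 3 * (1 + t)" using R2 True t by simp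
        have "(1 + R\<^sup>2 + t + norm x) powr \<beta> * (norm (wave \<kappa> (\<sigma> * t) g x))\<^sup>2
          \<le> (6 * C\<^sup>2 * (1 + t) powr (\<beta> - 2)) * (6 * R ^ 3) * sqnorm g"
        proof (rule wave_weighted_le[OF bk g supp, where q="\<lambda>y. 1 / (1 + \<bar>t - norm (x - y)\<bar>)\<^sup>2"])
          show "(1 + R\<^sup>2 + t + norm x) powr \<beta> * (norm (ker \<kappa> (\<sigma> * t) (x - y)))\<^sup>2
             \<le> 6 * C\<^sup>2 * (1 + t) powr (\<beta> - 2) * (1 / (1 + \<bar>t - norm (x - y)\<bar>)\<^sup>2)" if "norm y \<le> R" for y
            by (rule weight_ker_le[OF C(1) C(2) \<sigma> t \<beta> that c])
          have "(\<integral>\<^sup>+y. indicator (cball 0 R) y * ennreal (1 / (1 + \<bar>t - norm (x - y)\<bar>)\<^sup>2) \<partial>lborel) \<le> (\<integral>\<^sup>+y. indicator (cball (0::R3) R) y \<partial>lborel)"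
          proof (rule nn_integral_mono)
            fix y :: R3
            have "1 \<le> (1 + \<bar>t - norm (x - y)\<bar>)\<^sup>2" by (rule one_le_power) simp
            then have "1 / (1 + \<bar>t - norm (x - y)\<bar>)\<^sup>2 \<le> 1" by (simp add: divide_le_eq_1)
            then show "indicator (cball 0 R) y * ennreal (1 / (1 + \<bar>t - norm (x - y)\<bar>)\<^sup>2) \<le> indicator (cball 0 R) y"
              by (simp add: indicator_def)
          qed
          also have "\<dots> = emeasure lborel (cball (0::R3) R)" by simp
          also have "\<dots> \<le> ennreal (6 * R ^ 3)" using R0 by (intro emeasure_cball_R3) simp
          finally show "(\<integral>\<^sup>+y. indicator (cball 0 R) y * ennreal (1 / (1 + \<bar>t - norm (x - y)\<bar>)\<^sup>2) \<partial>lborel) \<le> ennreal (6 * R ^ 3)" .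
        qed (use pm R0 in auto)
        also have "\<dots> = 36 * C\<^sup>2 * R ^ 3 * sqnorm g * (1 + t) powr (\<beta> - 2)" by simp
        also have "\<dots> \<le> M n" unfolding M_def using R0 gn by (intro mult_left_mono tn n) auto
        finally show ?thesis .
      qed
      have sM: "summable M" unfolding M_def by (intro summable_mult sS)
      have "suminf M = 36 * C\<^sup>2 * R ^ 3 * sqnorm g * S" unfolding M_def S_def by (rule suminf_mult[OF sS])
      also have "\<dots> = C1 * R ^ 3 * sqnorm g" by (simp add: C1_def)
      also have "\<dots> \<le> (C1 + C2) * R powr \<eta> * sqnorm g"
      proof -
        have "R ^ 3 = R powr 3" using R0 powr_realpow[of R 3] by simp
        also have "\<dots> \<le> R powr \<eta>" using R0 True \<eta> by (intro powr_mono') auto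
        finally show ?thesis using C12 R0 gn by (intro mult_right_mono mult_mono) auto
      qed
      finally show ?thesis using M0 bound sM by blast
    next
      case False
      then have R: "R \<ge> 1" by simp
      have RR: "1 \<le> R\<^sup>2" "R \<le> R\<^sup>2" using R by (auto simp: power2_eq_square mult_ge1_I)
      \<comment> \<open>Slabs from N on start after time 4R^2; rounding up costs at most R^2, as R
        \<ge> 1.\<close>
      define N where "N = nat \<lceil>4 * R\<^sup>2\<rceil>"
      have N: "4 * R\<^sup>2 \<le> real N" "real N \<le> 5 * R\<^sup>2" "N \<ge> 1"
        using RR unfolding N_def by linarith+
      obtain Z where Z: "\<And>n. 0 \<le> Z n" 
         "\<And>n t x. real n \<le> t \<Longrightarrow> t \<le> real n + 1 \<Longrightarrow> (norm (wave \<kappa> (\<sigma> * t) g x))\<^sup>2 \<le> Z n"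
         "(\<Sum>n<N. Z n) \<le> D * (\<Sum>n<N. 1 / (1 + real n)) * sqnorm g"
        using str[OF g \<sigma>, of N] by blast
      \<comment> \<open>Below N the near and the far contribution are added, so that one bound
        serves all x.\<close>
      define M where "M n = (if n < N then 23 * R powr (2 * \<beta>) * Z n + 24 * C\<^sup>2 / R\<^sup>2 * sqnorm g
         else 6 * C\<^sup>2 * P * R\<^sup>2 * sqnorm g * (1 + real n) powr (\<beta> - 2))" for n
      have M0: "0 \<le> M n" for n using R0 gn Z(1) P by (simp add: M_def)
      have R2b: "(R\<^sup>2) powr \<gamma> = R powr (2 * \<gamma>)" for \<gamma>
        using R0 by (simp add: powr_powr[symmetric])
      have bound: "(1 + R\<^sup>2 + t + norm x) powr \<beta> * (norm (wave \<kappa> (\<sigma> * t) g x))\<^sup>2 \<le> M n"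
        if n: "real n \<le> t" "t \<le> real n + 1" for n t x
      proof -
        have t: "t \<ge> 0" using n by linarith
        show ?thesis
        proof (cases "n < N")
          case nN: True
          have n4: "real n \<le> 4 * R\<^sup>2" using nN unfolding N_def by linarith
          then have t5: "t \<le> 5 * R\<^sup>2" using n RR by linarith
          show ?thesis
          proof (cases "norm x \<le> 16 * R\<^sup>2")
            case True
            \<comment> \<open>23 = 1 + 1 + 5 + 16, the bounds of the four summands in units of
              R^2.\<close>
            have "(1 + R\<^sup>2 + t + norm x) powr \<beta> \<le> (23 * R\<^sup>2) powr \<beta>"
              using True t5 RR \<beta> t by (intro powr_mono2) auto
            also have "\<dots> = 23 powr \<beta> * R powr (2 * \<beta>)" by (simp add: powr_mult R2b)
            also have "\<dots> \<le> 23 * R powr (2 * \<beta>)" using \<beta> by (intro mult_right_mono powr_le_self) auto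
            finally have "(1 + R\<^sup>2 + t + norm x) powr \<beta> * (norm (wave \<kappa> (\<sigma> * t) g x))\<^sup>2 \<le> 23 * R powr (2 * \<beta>) * Z n"
              using Z(2)[OF n, of x] by (intro mult_mono) auto
            also have "\<dots> \<le> M n" using nN gn by (simp add: M_def)
            finally show ?thesis .
          next
            case False
            then have x: "16 * R\<^sup>2 < norm x" by simp
            let ?X = "norm x"
            \<comment> \<open>Far outside the cone the distance d is at least |x|/2 and at least R.
              One factor d cancels the weight, five more give R^(-5); against the volume R^3 this
              leaves R^(-2) per slab, so the O(R^2) early slabs contribute O(1).\<close>
            have "(1 + R\<^sup>2 + t + ?X) powr \<beta> * (norm (wave \<kappa> (\<sigma> * t) g x))\<^sup>2 \<le> (4 * C\<^sup>2 / R ^ 5) * (6 * R ^ 3) * sqnorm g"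
            proof (rule wave_weighted_le[OF bk g supp, where q="\<lambda>y. 1"])
              fix y :: R3 assume y: "norm y \<le> R"
              define d where "d = 1 + \<bar>t - norm (x - y)\<bar>"
              have d1: "d \<ge> 1" by (simp add: d_def)
              have dx: "norm (x - y) - t \<le> d" by (simp add: d_def)
              have "1 + R\<^sup>2 + t + ?X \<le> 2 * ?X" using x t5 RR by linarith
              then have "(1 + R\<^sup>2 + t + ?X) powr \<beta> \<le> (2 * ?X) powr \<beta>" using t \<beta> by (intro powr_mono2) auto
              also have "\<dots> \<le> 2 * ?X" using x RR \<beta> by (intro powr_le_self) auto
              finally have 1: "(1 + R\<^sup>2 + t + ?X) powr \<beta> \<le> 2 * ?X" .
              have "?X \<le> norm (x - y) + norm y" using norm_triangle_ineq[of "x - y" y] by simp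
              then have d: "?X / 2 \<le> d" using y x t5 RR dx by linarith
              have dR: "R \<le> d" using d x RR by linarith
              have "norm (ker \<kappa> (\<sigma> * t) (x - y)) \<le> C / ((1 + t) * d ^ 8)"
                using C(2)[of "\<sigma> * t" "x - y"] \<sigma> t by (simp add: abs_mult d_def)
              also have "\<dots> \<le> C / (1 * d ^ 8)"
                using C(1) t d1 by (intro divide_left_mono mult_right_mono mult_pos_pos zero_less_power) auto
              finally have "(norm (ker \<kappa> (\<sigma> * t) (x - y)))\<^sup>2 \<le> (C / d ^ 8)\<^sup>2" by (intro power_mono) auto
              also have "\<dots> = C\<^sup>2 / d ^ 16" by (simp only: power_divide power_mult[symmetric]) simp
              also have "\<dots> \<le> C\<^sup>2 / ((?X / 2) * R ^ 5)"
              proof (rule divide_left_mono)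
                have "d * d ^ 5 \<le> d ^ 16" unfolding power_Suc[symmetric] using d1 by (intro power_increasing) auto
                moreover have "(?X / 2) * R ^ 5 \<le> d * d ^ 5"
                  using d dR R by (intro mult_mono power_mono) auto
                ultimately show "(?X / 2) * R ^ 5 \<le> d ^ 16" by linarith
                have "?X / 2 > 0" using x RR by linarith
                moreover have "d > 0" using d1 by linarith
                ultimately show "0 < d ^ 16 * ((?X / 2) * R ^ 5)" using R by (intro mult_pos_pos zero_less_power) auto
              qed simp
              finally have 2: "(norm (ker \<kappa> (\<sigma> * t) (x - y)))\<^sup>2 \<le> C\<^sup>2 / ((?X / 2) * R ^ 5)" .
              have "(1 + R\<^sup>2 + t + ?X) powr \<beta> * (norm (ker \<kappa> (\<sigma> * t) (x - y)))\<^sup>2 \<le> (2 * ?X) * (C\<^sup>2 / ((?X / 2) * R ^ 5))"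
                by (rule mult_mono[OF 1 2]) auto
              also have "\<dots> = (4 * C\<^sup>2 / R ^ 5) * 1"
              proof -
                have "?X \<noteq> 0" using x RR by auto
                then show ?thesis by (rule cancel_aux)
              qed
              finally show "(1 + R\<^sup>2 + t + ?X) powr \<beta> * (norm (ker \<kappa> (\<sigma> * t) (x - y)))\<^sup>2 \<le> (4 * C\<^sup>2 / R ^ 5) * 1" .
            next
              have "(\<integral>\<^sup>+y. indicator (cball (0::R3) R) y * ennreal 1 \<partial>lborel) = emeasure lborel (cball (0::R3) R)" by simp
              also have "\<dots> \<le> ennreal (6 * R ^ 3)" using R0 by (intro emeasure_cball_R3) simp
              finally show "(\<integral>\<^sup>+y. indicator (cball (0::R3) R) y * ennreal 1 \<partial>lborel) \<le> ennreal (6 * R ^ 3)" .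
            qed (use R0 in auto)
            also have "(4 * C\<^sup>2 / R ^ 5) * (6 * R ^ 3) * sqnorm g = 24 * C\<^sup>2 / R\<^sup>2 * sqnorm g"
              using R0 by (simp add: eval_nat_numeral)
            also have "\<dots> \<le> M n" using nN Z(1) by (simp add: M_def)
            finally show ?thesis .
          qed
        next
          case nN: False
          then have t4: "4 * R\<^sup>2 \<le> t" using N(1) n by linarith
          have c: "1 + R\<^sup>2 + R \<le> 3 * (1 + t)"
          proof -
            have "3 * (1 + t) = 3 + t + t + t" by simp
            then show ?thesis using t4 t RR by linarith
          qed
          have "(1 + R\<^sup>2 + t + norm x) powr \<beta> * (norm (wave \<kappa> (\<sigma> * t) g x))\<^sup>2
            \<le> (6 * C\<^sup>2 * (1 + t) powr (\<beta> - 2)) * (P * R\<^sup>2) * sqnorm g"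
          proof (rule wave_weighted_le[OF bk g supp, where q="\<lambda>y. 1 / (1 + \<bar>t - norm (x - y)\<bar>)\<^sup>2"])
            show "(1 + R\<^sup>2 + t + norm x) powr \<beta> * (norm (ker \<kappa> (\<sigma> * t) (x - y)))\<^sup>2
               \<le> 6 * C\<^sup>2 * (1 + t) powr (\<beta> - 2) * (1 / (1 + \<bar>t - norm (x - y)\<bar>)\<^sup>2)" if "norm y \<le> R" for y
              by (rule weight_ker_le[OF C(1) C(2) \<sigma> t \<beta> that c])
            show "(\<integral>\<^sup>+y. indicator (cball 0 R) y * ennreal (1 / (1 + \<bar>t - norm (x - y)\<bar>)\<^sup>2) \<partial>lborel) \<le> ennreal (P * R\<^sup>2)"
              by (rule shell[OF R t4])
          qed (use pm R0 P in auto)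
          also have "\<dots> = 6 * C\<^sup>2 * P * R\<^sup>2 * sqnorm g * (1 + t) powr (\<beta> - 2)" by simp
          also have "\<dots> \<le> 6 * C\<^sup>2 * P * R\<^sup>2 * sqnorm g * (1 + real n) powr (\<beta> - 2)"
            using P gn by (intro mult_left_mono tn n) auto
          also have "\<dots> = M n" using nN by (simp add: M_def)
          finally show ?thesis .
        qed
      qed
      have MN: "M (n + N) = 6 * C\<^sup>2 * P * R\<^sup>2 * sqnorm g * (1 + real (n + N)) powr (\<beta> - 2)" for n
        by (simp add: M_def)
      note tail = powr_tail[OF \<beta>(2) N(3)]
      have sMN: "summable (\<lambda>n. M (n + N))" unfolding MN by (intro summable_mult tail)
      then have sM: "summable M" by (simp only: summable_iff_shift)
      have RbE: "R powr (2 * \<beta>) \<le> R powr \<eta>" using R \<eta> by (intro powr_mono) auto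
      have "suminf M = (\<Sum>n. M (n + N)) + (\<Sum>n<N. M n)" by (rule suminf_split_initial_segment[OF sM])
      also have "(\<Sum>n. M (n + N)) = 6 * C\<^sup>2 * P * R\<^sup>2 * sqnorm g * (\<Sum>n. (1 + real (n + N)) powr (\<beta> - 2))"
        unfolding MN by (rule suminf_mult[OF tail(1)])
      \<comment> \<open>R^2 from the slab times the tail (R^2)^(\<beta>-1) is R^(2\<beta>).\<close>
      also have "\<dots> \<le> 6 * C\<^sup>2 * P / (1 - \<beta>) * R powr \<eta> * sqnorm g"
      proof -
        have "real N powr (\<beta> - 1) \<le> (R\<^sup>2) powr (\<beta> - 1)" using N RR R0 \<beta> by (intro powr_mono2') auto
        also have "\<dots> = R powr (2 * (\<beta> - 1))" by (rule R2b)
        finally have 1: "real N powr (\<beta> - 1) \<le> R powr (2 * (\<beta> - 1))" .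
        have "R\<^sup>2 * R powr (2 * (\<beta> - 1)) = R powr (2 * \<beta>)"
        proof -
          have "R\<^sup>2 = R powr 2" using R0 powr_realpow[of R 2] by simp
          then show ?thesis by (simp add: powr_add[symmetric])
        qed
        then have 2: "R\<^sup>2 * real N powr (\<beta> - 1) \<le> R powr \<eta>"
          using mult_left_mono[OF 1, of "R\<^sup>2"] RbE by simp
        have "6 * C\<^sup>2 * P * R\<^sup>2 * sqnorm g * (\<Sum>n. (1 + real (n + N)) powr (\<beta> - 2)) \<le> 6 * C\<^sup>2 * P * R\<^sup>2 * sqnorm g * (real N powr (\<beta> - 1) / (1 - \<beta>))"
          using P gn by (intro mult_left_mono tail) auto
        also have "\<dots> = 6 * C\<^sup>2 * P / (1 - \<beta>) * (R\<^sup>2 * real N powr (\<beta> - 1)) * sqnorm g" by simp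
        also have "\<dots> \<le> 6 * C\<^sup>2 * P / (1 - \<beta>) * R powr \<eta> * sqnorm g"
          using P gn \<beta> 2 by (intro mult_right_mono mult_left_mono) auto
        finally show ?thesis .
      qed
      also have "(\<Sum>n<N. M n) = 23 * R powr (2 * \<beta>) * (\<Sum>n<N. Z n) + real N * (24 * C\<^sup>2 / R\<^sup>2 * sqnorm g)"
      proof -
        have "(\<Sum>n<N. M n) = (\<Sum>n<N. 23 * R powr (2 * \<beta>) * Z n + 24 * C\<^sup>2 / R\<^sup>2 * sqnorm g)"
          by (rule sum.cong) (auto simp: M_def)
        then show ?thesis by (simp add: sum.distrib sum_distrib_left)
      qed
      also have "\<dots> \<le> (23 * D * (1 + 1 / \<epsilon>) * 5 powr \<epsilon> + 120 * C\<^sup>2) * R powr \<eta> * sqnorm g"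
      proof -
        have "real N powr \<epsilon> \<le> (5 * R\<^sup>2) powr \<epsilon>" using N \<epsilon> by (intro powr_mono2) auto
        also have "\<dots> = 5 powr \<epsilon> * R powr (2 * \<epsilon>)" by (simp add: powr_mult R2b)
        finally have "(\<Sum>n<N. 1 / (1 + real n)) \<le> (1 + 1 / \<epsilon>) * (5 powr \<epsilon> * R powr (2 * \<epsilon>))"
          using harmonic_le_powr[OF \<epsilon> N(3)] \<epsilon> by (smt (verit) mult_left_mono divide_nonneg_pos)
        then have "D * (\<Sum>n<N. 1 / (1 + real n)) * sqnorm g \<le> D * ((1 + 1 / \<epsilon>) * (5 powr \<epsilon> * R powr (2 * \<epsilon>))) * sqnorm g"
          using D gn by (intro mult_right_mono mult_left_mono) auto
        then have "(\<Sum>n<N. Z n) \<le> D * ((1 + 1 / \<epsilon>) * (5 powr \<epsilon> * R powr (2 * \<epsilon>))) * sqnorm g" using Z(3) by linarith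
        then have "23 * R powr (2 * \<beta>) * (\<Sum>n<N. Z n) \<le> 23 * R powr (2 * \<beta>) * (D * ((1 + 1 / \<epsilon>) * (5 powr \<epsilon> * R powr (2 * \<epsilon>))) * sqnorm g)"
          by (rule mult_left_mono) simp
        also have "\<dots> = 23 * D * (1 + 1 / \<epsilon>) * 5 powr \<epsilon> * (R powr (2 * \<beta>) * R powr (2 * \<epsilon>)) * sqnorm g" by simp
        also have "R powr (2 * \<beta>) * R powr (2 * \<epsilon>) = R powr \<eta>"
        proof -
          have "2 * \<beta> + 2 * \<epsilon> = \<eta>" by (simp add: \<epsilon>_def field_simps)
          then show ?thesis by (simp only: powr_add[symmetric])
        qed
        finally have 1: "23 * R powr (2 * \<beta>) * (\<Sum>n<N. Z n) \<le> 23 * D * (1 + 1 / \<epsilon>) * 5 powr \<epsilon> * R powr \<eta> * sqnorm g" .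
        have "real N * (24 * C\<^sup>2 / R\<^sup>2 * sqnorm g) \<le> (5 * R\<^sup>2) * (24 * C\<^sup>2 / R\<^sup>2 * sqnorm g)"
          using N gn by (intro mult_right_mono) auto
        also have "\<dots> = 120 * C\<^sup>2 * 1 * sqnorm g" using R0 by simp
        also have "\<dots> \<le> 120 * C\<^sup>2 * R powr \<eta> * sqnorm g"
          using R \<eta> \<beta> gn by (intro mult_right_mono mult_left_mono ge_one_powr_ge_zero) auto
        finally have "real N * (24 * C\<^sup>2 / R\<^sup>2 * sqnorm g) \<le> 120 * C\<^sup>2 * R powr \<eta> * sqnorm g" .
        from add_mono[OF 1 this] show ?thesis by (simp only: distrib_right)
      qed
      finally have "suminf M \<le> 6 * C\<^sup>2 * P / (1 - \<beta>) * R powr \<eta> * sqnorm g + (23 * D * (1 + 1 / \<epsilon>) * 5 powr \<epsilon> + 120 * C\<^sup>2) * R powr \<eta> * sqnorm g"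
        by simp
      also have "\<dots> = C2 * R powr \<eta> * sqnorm g" by (simp only: C2_def distrib_right add_ac)
      also have "\<dots> \<le> (C1 + C2) * R powr \<eta> * sqnorm g" using C12 gn by (intro mult_right_mono) auto
      finally show ?thesis using M0 bound sM by blast
    qed
  qed
  then show ?thesis using C12 by (intro exI[of _ "C1 + C2"]) auto
qed

section \<open>The frequency support of Littlewood--Paley pieces\<close>

text \<open>\<open>f\<close> vanishes around 0, so discarding the negative half-line creates no
  kink. The derivative of the cut function is the cut derivative, which again vanishes around
  0.\<close>

lemma ck_cut:
  assumes "ck n f" and "\<And>x. \<bar>x\<bar> < c \<Longrightarrow> f x = 0" and "c > 0"
  shows "ck n (\<lambda>x. if x \<ge> 0 then f x else 0)"
  using assms(1,2)
proof (induction n arbitrary: f)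
  case 0
  have "isCont (\<lambda>x. if x \<ge> 0 then f x else 0) x" for x
  proof -
    consider "x < 0" | "\<bar>x\<bar> < c" | "x > 0" using \<open>c > 0\<close> by (cases "x < 0"; cases "x > 0") auto
    then show ?thesis
    proof cases
      case 1
      then have "\<forall>\<^sub>F y in nhds x. y \<in> {..<0}" by (intro eventually_nhds_in_open) auto
      then have "\<forall>\<^sub>F y in nhds x. (if y \<ge> 0 then f y else 0) = 0" by eventually_elim auto
      then show ?thesis using isCont_cong[of "\<lambda>x. if x \<ge> 0 then f x else 0" "\<lambda>_. 0" x] by simp
    next
      case 2
      then have "\<forall>\<^sub>F y in nhds x. y \<in> {-c<..<c}" by (intro eventually_nhds_in_open) auto
      then have "\<forall>\<^sub>F y in nhds x. (if y \<ge> 0 then f y else 0) = 0" by eventually_elim (auto simp: 0)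
      then show ?thesis using isCont_cong[of "\<lambda>x. if x \<ge> 0 then f x else 0" "\<lambda>_. 0" x] by simp
    next
      case 3
      then have "\<forall>\<^sub>F y in nhds x. y \<in> {0<..}" by (intro eventually_nhds_in_open) auto
      then have "\<forall>\<^sub>F y in nhds x. (if y \<ge> 0 then f y else 0) = f y" by eventually_elim auto
      moreover have "isCont f x" using 0 by (simp add: continuous_on_eq_continuous_at)
      ultimately show ?thesis using isCont_cong[of "\<lambda>x. if x \<ge> 0 then f x else 0" f x] by simp
    qed
  qed
  then show ?case by (simp add: continuous_at_imp_continuous_on)
next
  case (Suc n)
  from Suc.prems obtain f' where d:
    "\<And>x. (f has_real_derivative f' x) (at x)" "ck n f'" by auto
  have z: "f' x = 0" if "\<bar>x\<bar> < c" for x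
  proof -
    have "((\<lambda>_. 0) has_real_derivative 0) (at x)" by simp
    then have "(f has_real_derivative 0) (at x)"
      by (rule has_field_derivative_transform_within_open[where S="{-c<..<c}"]) (use that Suc.prems in auto)
    then show ?thesis using d(1) DERIV_unique by blast
  qed
  let ?g = "\<lambda>x. if x \<ge> 0 then f' x else 0"
  have "((\<lambda>x. if x \<ge> 0 then f x else 0) has_real_derivative ?g x) (at x)" for x
  proof -
    consider "x < 0" | "\<bar>x\<bar> < c" | "x > 0" using \<open>c > 0\<close> by (cases "x < 0"; cases "x > 0") auto
    then show ?thesis
    proof cases
      case 1
      have "((\<lambda>_. 0) has_real_derivative 0) (at x)" by simp
      then have "((\<lambda>x. if x \<ge> 0 then f x else 0) has_real_derivative 0) (at x)"
        by (rule has_field_derivative_transform_within_open[where S="{..<0}"]) (use 1 in auto)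
      then show ?thesis using 1 by simp
    next
      case 2
      have "((\<lambda>_. 0) has_real_derivative 0) (at x)" by simp
      then have "((\<lambda>x. if x \<ge> 0 then f x else 0) has_real_derivative 0) (at x)"
        by (rule has_field_derivative_transform_within_open[where S="{-c<..<c}"]) (use 2 Suc.prems in auto)
      then show ?thesis using z[OF 2] by simp
    next
      case 3
      have "((\<lambda>x. if x \<ge> 0 then f x else 0) has_real_derivative f' x) (at x)"
        by (rule has_field_derivative_transform_within_open[where S="{0<..}", OF d(1)]) (use 3 in auto)
      then show ?thesis using 3 by simp
    qed
  qed
  moreover have "ck n ?g" by (rule Suc.IH[OF d(2) z])
  ultimately show ?case unfolding ck.simps by (intro exI[of _ ?g] conjI allI)
qed

text \<open>A smooth step from 0 at -2 to 1 at 0, manufactured from the given cutoff: it is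
  \<open>\<psi>\<close> on the negative half-line and 1 beyond. The form as a sum exhibits the cut
  function 1 - \<psi>, which vanishes near 0.\<close>

definition edge :: "(real \<Rightarrow> real) \<Rightarrow> real \<Rightarrow> real" where
  "edge \<psi> x = \<psi> x + (if x \<ge> 0 then 1 - \<psi> x else 0)"

lemma edge:
  assumes "lp_cutoff \<psi>"
  shows "ck n (edge \<psi>)" "x \<ge> 0 \<Longrightarrow> edge \<psi> x = 1" "x \<le> -2 \<Longrightarrow> edge \<psi> x = 0" "0 \<le> edge \<psi> x" "edge \<psi> x \<le> 1"
proof -
  have "range \<psi> \<subseteq> {0..1}" using assms by (simp add: lp_cutoff_def)
  then have "\<psi> x \<in> {0..1}" by blast
  then have r: "0 \<le> \<psi> x" "\<psi> x \<le> 1" by auto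
  have one: "\<psi> x = 1" if "\<bar>x\<bar> < 5/4" for x
  proof -
    have "x \<in> {-5/4..5/4}" using that by auto
    then show ?thesis using assms unfolding lp_cutoff_def by blast
  qed
  show "ck n (edge \<psi>)"
    unfolding edge_def[abs_def]
    by (intro ck_add ck_cut[where c="5/4"] ck_diff ck_const lp_cutoff_ck assms)
       (use one in auto)
  show "x \<ge> 0 \<Longrightarrow> edge \<psi> x = 1" "0 \<le> edge \<psi> x" "edge \<psi> x \<le> 1" using r by (auto simp: edge_def)
  show "x \<le> -2 \<Longrightarrow> edge \<psi> x = 0" using assms by (auto simp: edge_def lp_cutoff_def)
qed

section \<open>Tensor-product test functions\<close>

definition tbump :: "real \<Rightarrow> (real \<Rightarrow> real) \<Rightarrow> bool" where
  "tbump A b \<longleftrightarrow> (\<forall>n. ck n b) \<and> (\<forall>x. x \<notin> {-A..A} \<longrightarrow> b x = 0)"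

lemma tbump_deriv:
  assumes "tbump A b"
  obtains b' where "\<And>x. (b has_real_derivative b' x) (at x)" "tbump A b'"
proof -
  have ck: "ck n b" and z: "\<And>x. x \<notin> {-A..A} \<Longrightarrow> b x = 0" for n using assms by (auto simp: tbump_def)
  obtain b' where b': "\<And>x. (b has_real_derivative b' x) (at x)" "\<And>x. x \<notin> {-A..A} \<Longrightarrow> b' x = 0"
    using ck_deriv_support[OF ck[of "Suc 0"] z] by blast
  have "ck n b'" for n
  proof -
    obtain f' where f': "\<And>x. (b has_real_derivative f' x) (at x)" "ck n f'" using ck[of "Suc n"] by auto
    have "f' = b'" using DERIV_unique[OF f'(1) b'(1)] by blast
    then show ?thesis using f'(2) by simp
  qed
  then show ?thesis using b' by (intro that[of b']) (auto simp: tbump_def)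
qed

text \<open>Tensor products are closed under partial derivatives, so every iterated derivative in
  the definition of \<open>schwartz\<close> is again of this form with the same support
  bound.\<close>

definition prod3 :: "(real \<Rightarrow> real) \<Rightarrow> (real \<Rightarrow> real) \<Rightarrow> (real \<Rightarrow> real) \<Rightarrow> R3 \<Rightarrow> complex" where
  "prod3 a b c \<xi> = complex_of_real (a (\<xi> $ 1) * (b (\<xi> $ 2) * c (\<xi> $ 3)))"

lemma prod3_has_derivative:
  assumes a: "\<And>x. (a has_real_derivative a' x) (at x)" and b: "\<And>x. (b has_real_derivative b' x) (at x)"
    and c: "\<And>x. (c has_real_derivative c' x) (at x)"
  shows "(prod3 a b c has_derivative (\<lambda>h. complex_of_real
     (a (\<xi> $ 1) * (b (\<xi> $ 2) * (c' (\<xi> $ 3) * h $ 3) + b' (\<xi> $ 2) * h $ 2 * c (\<xi> $ 3)) + a' (\<xi> $ 1) * h $ 1 * (b (\<xi> $ 2) * c (\<xi> $ 3))))) (at \<xi>)"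
proof -
  have n: "((\<lambda>\<xi>::R3. \<xi> $ i) has_derivative (\<lambda>h. h $ i)) (at \<xi>)" for i
    by (rule bounded_linear_imp_has_derivative[OF bounded_linear_vec_nth])
  have f: "((\<lambda>\<xi>::R3. f (\<xi> $ i)) has_derivative (\<lambda>h. f' (\<xi> $ i) * h $ i)) (at \<xi>)"
    if "\<And>x. (f has_real_derivative f' x) (at x)" for f f' i
    by (rule has_derivative_compose[OF n]) (rule has_field_derivative_imp_has_derivative[OF that])
  show ?thesis unfolding prod3_def[abs_def]
    by (rule has_derivative_of_real, rule has_derivative_mult[OF f[OF a] has_derivative_mult[OF f[OF b] f[OF c]]])
qed

lemma iter_deriv_prod3:
  assumes "vs \<in> lists Basis" "tbump A a" "tbump A b" "tbump A c"
  shows "\<exists>a' b' c'. tbump A a' \<and> tbump A b' \<and> tbump A c' \<and> iter_deriv vs (prod3 a b c) = prod3 a' b' c'"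
  using assms(1)
proof (induction vs)
  case Nil
  then show ?case using assms by auto
next
  case (Cons v vs)
  then obtain a1 b1 c1 where t: "tbump A a1" "tbump A b1" "tbump A c1"
    and e: "iter_deriv vs (prod3 a b c) = prod3 a1 b1 c1" by auto
  obtain a' where a': "\<And>x. (a1 has_real_derivative a' x) (at x)" "tbump A a'" using tbump_deriv[OF t(1)] by blast
  obtain b' where b': "\<And>x. (b1 has_real_derivative b' x) (at x)" "tbump A b'" using tbump_deriv[OF t(2)] by blast
  obtain c' where c': "\<And>x. (c1 has_real_derivative c' x) (at x)" "tbump A c'" using tbump_deriv[OF t(3)] by blast
  have fd: "frechet_derivative (prod3 a1 b1 c1) (at \<xi>) = (\<lambda>h. complex_of_real
     (a1 (\<xi> $ 1) * (b1 (\<xi> $ 2) * (c' (\<xi> $ 3) * h $ 3) + b' (\<xi> $ 2) * h $ 2 * c1 (\<xi> $ 3)) + a' (\<xi> $ 1) * h $ 1 * (b1 (\<xi> $ 2) * c1 (\<xi> $ 3))))" for \<xi>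
    using frechet_derivative_at[OF prod3_has_derivative[OF a'(1) b'(1) c'(1)]] by simp
  have "v \<in> Basis" using Cons by auto
  then obtain i where v: "v = axis i 1" by (auto simp: Basis_vec_def)
  have "i = 1 \<or> i = 2 \<or> i = 3" by (metis exhaust_3)
  then show ?case
  proof (elim disjE)
    assume "i = 1"
    then have "iter_deriv (v # vs) (prod3 a b c) = prod3 a' b1 c1"
      by (auto simp: e fd v axis_def prod3_def)
    then show ?thesis using a' t by blast
  next
    assume "i = 2"
    then have "iter_deriv (v # vs) (prod3 a b c) = prod3 a1 b' c1"
      by (auto simp: e fd v axis_def prod3_def)
    then show ?thesis using b' t by blast
  next
    assume "i = 3"
    then have "iter_deriv (v # vs) (prod3 a b c) = prod3 a1 b1 c'"
      by (auto simp: e fd v axis_def prod3_def)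
    then show ?thesis using c' t by blast
  qed
qed

lemma prod3_support:
  assumes "tbump A a" "tbump A b" "tbump A c" "prod3 a b c \<xi> \<noteq> 0"
  shows "norm \<xi> \<le> 3 * A"
proof -
  have "\<xi> $ 1 \<in> {-A..A}" "\<xi> $ 2 \<in> {-A..A}" "\<xi> $ 3 \<in> {-A..A}"
    using assms unfolding tbump_def prod3_def by (metis mult_zero_left mult_zero_right of_real_0)+
  then have "\<bar>\<xi> $ 1\<bar> \<le> A" "\<bar>\<xi> $ 2\<bar> \<le> A" "\<bar>\<xi> $ 3\<bar> \<le> A" by (auto simp: abs_le_iff)
  moreover have "norm \<xi> \<le> \<bar>\<xi> $ 1\<bar> + \<bar>\<xi> $ 2\<bar> + \<bar>\<xi> $ 3\<bar>"
    using norm_le_l1_cart[of \<xi>] by (simp add: sum_3)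
  ultimately show ?thesis by linarith
qed

lemma prod3_differentiable:
  assumes "tbump A a" "tbump A b" "tbump A c"
  shows "prod3 a b c differentiable (at \<xi>)"
proof -
  obtain a' where a': "\<And>x. (a has_real_derivative a' x) (at x)" using tbump_deriv[OF assms(1)] by blast
  obtain b' where b': "\<And>x. (b has_real_derivative b' x) (at x)" using tbump_deriv[OF assms(2)] by blast
  obtain c' where c': "\<And>x. (c has_real_derivative c' x) (at x)" using tbump_deriv[OF assms(3)] by blast
  show ?thesis using prod3_has_derivative[OF a' b' c'] unfolding differentiable_def by blast
qed

lemma schwartz_prod3:
  assumes "tbump A a" "tbump A b" "tbump A c"
  shows "schwartz (prod3 a b c)"
  unfolding schwartz_def
proof (intro ballI conjI allI)
  fix vs :: "R3 list" and N :: nat assume "vs \<in> lists Basis"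
  then obtain a' b' c' where t: "tbump A a'" "tbump A b'" "tbump A c'"
    and e: "iter_deriv vs (prod3 a b c) = prod3 a' b' c'"
    using iter_deriv_prod3[OF _ assms] by blast
  show "iter_deriv vs (prod3 a b c) differentiable_on UNIV"
    unfolding e differentiable_on_def using prod3_differentiable[OF t] by simp
  have "continuous_on UNIV (prod3 a' b' c')"
    using prod3_differentiable[OF t] differentiable_imp_continuous_within
    by (auto intro!: continuous_at_imp_continuous_on)
  then have "continuous_on (cball 0 (3 * A)) (\<lambda>x. (1 + norm x) ^ N *\<^sub>R prod3 a' b' c' x)"
    by (intro continuous_intros) (auto intro: continuous_on_subset)
  then have "bounded ((\<lambda>x. (1 + norm x) ^ N *\<^sub>R prod3 a' b' c' x) ` cball 0 (3 * A))"
    by (intro compact_imp_bounded compact_continuous_image) auto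
  \<comment> \<open>The inserted 0 accounts for the values outside the ball.\<close>
  then have "bounded (insert 0 ((\<lambda>x. (1 + norm x) ^ N *\<^sub>R prod3 a' b' c' x) ` cball 0 (3 * A)))" by simp
  moreover have "range (\<lambda>x. (1 + norm x) ^ N *\<^sub>R prod3 a' b' c' x) \<subseteq> insert 0 ((\<lambda>x. (1 + norm x) ^ N *\<^sub>R prod3 a' b' c' x) ` cball 0 (3 * A))"
    using prod3_support[OF t] by force
  ultimately show "bounded (range (\<lambda>x. (1 + norm x) ^ N *\<^sub>R iter_deriv vs (prod3 a b c) x))"
    unfolding e by (rule bounded_subset)
qed

text \<open>A rising and a falling edge of slope \<open>n\<close>: the function is 0 outside (a, b)
  and equals 1 at distance at least 2/n from both ends. Hence it tends pointwise to the indicator of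
  the open interval, always from inside.\<close>

definition box_bump :: "(real \<Rightarrow> real) \<Rightarrow> nat \<Rightarrow> real \<Rightarrow> real \<Rightarrow> real \<Rightarrow> real" where
  "box_bump \<psi> n a b x = edge \<psi> (real n * x + (- real n * a - 2)) * edge \<psi> (- real n * x + (real n * b - 2))"

lemma box_bump:
  assumes "lp_cutoff \<psi>"
  shows "\<bar>a\<bar> + \<bar>b\<bar> \<le> A \<Longrightarrow> tbump A (box_bump \<psi> n a b)"
    and "box_bump \<psi> n a b x \<noteq> 0 \<Longrightarrow> a < x \<and> x < b"
    and "0 \<le> box_bump \<psi> n a b x" and "box_bump \<psi> n a b x \<le> 1"
    and "(\<lambda>n. box_bump \<psi> n a b x) \<longlonglongrightarrow> indicator {a<..<b} x"
proof -
  note ed = edge[OF assms]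
  show nz: "box_bump \<psi> n a b x \<noteq> 0 \<Longrightarrow> a < x \<and> x < b" for x n
  proof (rule ccontr)
    assume h: "box_bump \<psi> n a b x \<noteq> 0" and "\<not> (a < x \<and> x < b)"
    then consider "x \<le> a" | "b \<le> x" by linarith
    then show False
    proof cases
      case 1
      then have "real n * x + (- real n * a - 2) \<le> -2" using mult_left_mono[OF 1, of "real n"] by simp
      then show ?thesis using ed(3) h by (simp add: box_bump_def)
    next
      case 2
      then have "- real n * x + (real n * b - 2) \<le> -2" using mult_left_mono[OF 2, of "real n"] by simp
      then show ?thesis using ed(3) h by (simp add: box_bump_def)
    qed
  qed
  have ck: "ck m (box_bump \<psi> n a b)" for m
    unfolding box_bump_def[abs_def] by (intro ck_mult ck_affine ed)
  show "tbump A (box_bump \<psi> n a b)" if "\<bar>a\<bar> + \<bar>b\<bar> \<le> A"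
    unfolding tbump_def
  proof (intro conjI allI impI ck)
    fix x assume x: "x \<notin> {-A..A}"
    show "box_bump \<psi> n a b x = 0"
    proof (rule ccontr)
      assume "box_bump \<psi> n a b x \<noteq> 0"
      then have "a < x" "x < b" using nz by auto
      then have "x \<in> {-A..A}" using that by (auto simp: abs_if split: if_splits)
      then show False using x by blast
    qed
  qed
  show "0 \<le> box_bump \<psi> n a b x" "box_bump \<psi> n a b x \<le> 1"
    using ed(4,5) by (auto simp: box_bump_def intro!: mult_le_one)
  show "(\<lambda>n. box_bump \<psi> n a b x) \<longlonglongrightarrow> indicator {a<..<b} x"
  proof (cases "a < x \<and> x < b")
    case True
    obtain N1 where N1: "2 < real N1 * (x - a)" using reals_Archimedean3[of "x - a"] True by auto
    obtain N2 where N2: "2 < real N2 * (b - x)" using reals_Archimedean3[of "b - x"] True by auto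
    have "box_bump \<psi> n a b x = 1" if n: "n \<ge> max N1 N2" for n
    proof -
      have "real N1 * (x - a) \<le> real n * (x - a)" "real N2 * (b - x) \<le> real n * (b - x)"
        using n True by (auto intro!: mult_right_mono)
      then have "0 \<le> real n * x + (- real n * a - 2)" "0 \<le> - real n * x + (real n * b - 2)"
        using N1 N2 by (auto simp: algebra_simps)
      then show ?thesis using ed(2) by (simp add: box_bump_def)
    qed
    then have "\<forall>\<^sub>F n in sequentially. box_bump \<psi> n a b x = 1" unfolding eventually_sequentially by blast
    then show ?thesis using True by (simp add: tendsto_eventually)
  next
    case False
    then have "box_bump \<psi> n a b x = 0" for n using nz by blast
    then show ?thesis using False by (auto simp: indicator_def)
  qed
qed

text \<open>Boxes are an intersection-stable generator of the Borel sets, so vanishing integrals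
  extend from boxes to all Borel sets. The total integral is a separate hypothesis, needed for
  complements.\<close>

lemma AE_zero_of_boxes:
  fixes h :: "'a::euclidean_space \<Rightarrow> complex"
  assumes h: "integrable lborel h" and U: "(\<integral>x. h x \<partial>lborel) = 0"
    and bx: "\<And>a b. (\<integral>x. indicator (box a b) x *\<^sub>R h x \<partial>lborel) = 0"
  shows "AE x in lborel. h x = 0"
proof (rule sigma_finite_measure.density_zero[OF lborel.sigma_finite_measure_axioms h])
  have si: "set_integrable lborel A h" if "A \<in> sets borel" for A
    unfolding set_integrable_def using h that by (intro integrable_mult_indicator) auto
  have sb: "sigma_sets UNIV (range (\<lambda>(a, b). box a b :: 'a set)) = sets borel"
    unfolding borel_eq_box by (rule sets_measure_of[symmetric]) simp
  have st: "Int_stable (range (\<lambda>(a, b). box a b :: 'a set))"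
    by (auto simp: Int_stable_def box_Int_box)
  fix A :: "'a set" assume "A \<in> sets lborel"
  then have "A \<in> sigma_sets UNIV (range (\<lambda>(a, b). box a b))" unfolding sb by simp
  have "range (\<lambda>(a, b). box a b :: 'a set) \<subseteq> Pow UNIV" by simp
  from st this \<open>A \<in> sigma_sets UNIV _\<close> show "set_lebesgue_integral lborel A h = 0"
  proof (induction rule: sigma_sets_induct_disjoint)
    case (basic A)
    then show ?case using bx by (auto simp: set_lebesgue_integral_def)
  next
    case empty
    show ?case by (simp add: set_lebesgue_integral_def)
  next
    case (compl A)
    then have A: "A \<in> sets borel" using sb by simp
    have "set_lebesgue_integral lborel (UNIV - A) h = (\<integral>x. h x - indicator A x *\<^sub>R h x \<partial>lborel)"
      unfolding set_lebesgue_integral_def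
      by (rule Bochner_Integration.integral_cong) (auto simp: indicator_def)
    also have "\<dots> = 0"
      using h si[OF A] U compl by (simp add: set_integrable_def set_lebesgue_integral_def)
    finally show ?case .
  next
    case (union A)
    then have A: "A i \<in> sets borel" for i using sb by auto
    have "(LINT x:(\<Union>i. A i)|lborel. h x) = (\<Sum>i. (LINT x:(A i)|lborel. h x))"
      by (rule lebesgue_integral_countable_add)
         (use A union in \<open>auto simp: disjoint_family_on_def intro!: si\<close>)
    then show ?case using union by simp
  qed
qed

lemma lp_symbol_support:
  assumes "lp_cutoff \<psi>" "-1 \<le> k" "8/5 * 2 powi k < norm \<xi>"
  shows "lp_symbol \<psi> k \<xi> = 0"
proof (cases "k = -1")
  case True
  then show ?thesis using assms by (auto simp: lp_symbol_def lp_cutoff_def)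
next
  case False
  have p: "(2::real) powi (k - 1) > 0" "(2::real) powi k = 2 * 2 powi (k - 1)"
    by (simp, subst power_int_minus_mult[of 2 k, symmetric], simp_all add: mult.commute)
  have "8/5 < norm \<xi> / 2 powi k" using assms(3) by (simp add: pos_less_divide_eq mult.commute)
  moreover have "8/5 < norm \<xi> / 2 powi (k - 1)"
  proof -
    have "8/5 * 2 powi (k - 1) < norm \<xi>" using assms(3) p(1) unfolding p(2) by linarith
    then show ?thesis using p(1) by (simp add: pos_less_divide_eq)
  qed
  ultimately show ?thesis using assms(1) False by (auto simp: lp_symbol_def lp_cutoff_def)
qed

text \<open>\<open>H\<close> is known only through its pairing with Schwartz functions. Smooth
  approximations of a box lying in |\<xi>| > 8/5 * 2^k are annihilated by the symbol, so the
  integral of \<open>H\<close> over such a box is 0 in the limit; countably many boxes cover the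
  region.\<close>

lemma lp_fourier_support:
  assumes cut: "lp_cutoff \<psi>" and k: "-1 \<le> k" and H: "is_lp_fourier \<psi> k f H"
  shows "AE \<xi> in lborel. 8/5 * 2 powi k < norm \<xi> \<longrightarrow> H \<xi> = 0"
proof -
  let ?r = "8/5 * 2 powi k :: real"
  have [measurable]: "H \<in> borel_measurable borel" using H by (simp add: is_lp_fourier_def)
  have sH: "sqint H" using H by (simp add: is_lp_fourier_def sqint_def)
  let ?U = "{\<xi>::R3. ?r < norm \<xi>}"
  have "open ?U" by (intro open_Collect_less continuous_intros)
  have iB: "integrable lborel (\<lambda>\<xi>. indicator (box l u) \<xi> *\<^sub>R H \<xi>)" for l u
  proof -
    obtain B where B: "\<And>\<xi>. \<xi> \<in> box l u \<Longrightarrow> norm \<xi> \<le> B" using bounded_box[of l u] unfolding bounded_iff by blast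
    have "integrable lborel (\<lambda>\<xi>. (norm (H \<xi>))\<^sup>2)" using sH by (simp add: sqint_def)
    then have "integrable lborel (\<lambda>\<xi>. (norm (indicator (box l u) \<xi> *\<^sub>R H \<xi>))\<^sup>2)"
      by (rule Bochner_Integration.integrable_bound) (auto simp: indicator_def)
    then have "sqint (\<lambda>\<xi>. indicator (box l u) \<xi> *\<^sub>R H \<xi>)" by (simp add: sqint_def)
    then show ?thesis by (rule integrable_sqint_support[of _ B]) (use B in \<open>fastforce simp: indicator_def\<close>)
  qed
  have zero: "(\<integral>\<xi>. indicator (box l u) \<xi> *\<^sub>R H \<xi> \<partial>lborel) = 0" if sub: "box l u \<subseteq> ?U" for l u
  proof -
    let ?\<phi> = "\<lambda>n. prod3 (box_bump \<psi> n (l $ 1) (u $ 1)) (box_bump \<psi> n (l $ 2) (u $ 2)) (box_bump \<psi> n (l $ 3) (u $ 3))"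
    define A where "A = (\<bar>l $ 1\<bar> + \<bar>u $ 1\<bar>) + (\<bar>l $ 2\<bar> + \<bar>u $ 2\<bar>) + (\<bar>l $ 3\<bar> + \<bar>u $ 3\<bar>)"
    have tb: "tbump A (box_bump \<psi> n (l $ 1) (u $ 1))" "tbump A (box_bump \<psi> n (l $ 2) (u $ 2))" "tbump A (box_bump \<psi> n (l $ 3) (u $ 3))" for n
      by (rule box_bump(1)[OF cut], simp add: A_def)+
    have sch: "schwartz (?\<phi> n)" for n by (rule schwartz_prod3[OF tb])
    have m: "?\<phi> n \<in> borel_measurable borel" for n
      using prod3_differentiable[OF tb] differentiable_imp_continuous_within
      by (intro borel_measurable_continuous_onI continuous_at_imp_continuous_on) blast
    have bb: "\<bar>box_bump \<psi> n a b x\<bar> \<le> 1" for n a b x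
      using box_bump(3)[OF cut, of n a b x] box_bump(4)[OF cut, of n a b x] by simp
    have inbox: "\<xi> \<in> box l u" if "?\<phi> n \<xi> \<noteq> 0" for n \<xi>
    proof -
      have "l $ i < \<xi> $ i \<and> \<xi> $ i < u $ i" for i
      proof -
        have nz: "box_bump \<psi> n (l $ 1) (u $ 1) (\<xi> $ 1) \<noteq> 0" "box_bump \<psi> n (l $ 2) (u $ 2) (\<xi> $ 2) \<noteq> 0"
          "box_bump \<psi> n (l $ 3) (u $ 3) (\<xi> $ 3) \<noteq> 0" using that by (auto simp: prod3_def)
        have "i = 1 \<or> i = 2 \<or> i = 3" by (metis exhaust_3)
        then show ?thesis using nz[THEN box_bump(2)[OF cut]] by (elim disjE) simp_all
      qed
      then show ?thesis by (simp add: mem_box_cart)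
    qed
    have z: "(\<integral>\<xi>. H \<xi> * ?\<phi> n \<xi> \<partial>lborel) = 0" for n
    proof -
      have "(\<integral>\<xi>. H \<xi> * ?\<phi> n \<xi> \<partial>lborel) = fourier_dist f (\<lambda>\<xi>. complex_of_real (lp_symbol \<psi> k \<xi>) * ?\<phi> n \<xi>)"
        using H sch[of n] by (simp only: is_lp_fourier_def)
      also have "(\<lambda>\<xi>. complex_of_real (lp_symbol \<psi> k \<xi>) * ?\<phi> n \<xi>) = (\<lambda>_. 0)"
      proof
        fix \<xi>
        show "complex_of_real (lp_symbol \<psi> k \<xi>) * ?\<phi> n \<xi> = 0"
        proof (cases "?\<phi> n \<xi> = 0")
          case False
          then have "?r < norm \<xi>" using inbox sub by blast
          then show ?thesis using lp_symbol_support[OF cut k] by simp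
        qed simp
      qed
      also have "fourier_dist f (\<lambda>_. 0) = 0" by (simp add: fourier_dist_def fourier_def)
      finally show ?thesis .
    qed
    have "(\<lambda>n. \<integral>\<xi>. H \<xi> * ?\<phi> n \<xi> \<partial>lborel) \<longlonglongrightarrow> (\<integral>\<xi>. indicator (box l u) \<xi> *\<^sub>R H \<xi> \<partial>lborel)"
    proof (rule integral_dominated_convergence[where w="\<lambda>\<xi>. norm (indicator (box l u) \<xi> *\<^sub>R H \<xi>)"])
      show "AE \<xi> in lborel. (\<lambda>n. H \<xi> * ?\<phi> n \<xi>) \<longlonglongrightarrow> indicator (box l u) \<xi> *\<^sub>R H \<xi>"
      proof (rule AE_I2)
        fix \<xi>
        have "(\<lambda>n. ?\<phi> n \<xi>) \<longlonglongrightarrow> complex_of_real (indicator {l $ 1<..<u $ 1} (\<xi> $ 1) * (indicator {l $ 2<..<u $ 2} (\<xi> $ 2) * indicator {l $ 3<..<u $ 3} (\<xi> $ 3)))"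
          unfolding prod3_def by (rule tendsto_of_real, intro tendsto_mult box_bump(5)[OF cut])
        also have "(indicator {l $ 1<..<u $ 1} (\<xi> $ 1) * (indicator {l $ 2<..<u $ 2} (\<xi> $ 2) * indicator {l $ 3<..<u $ 3} (\<xi> $ 3)) :: real) = indicator (box l u) \<xi>"
          by (auto simp: indicator_def mem_box_cart forall_3)
        finally have "(\<lambda>n. H \<xi> * ?\<phi> n \<xi>) \<longlonglongrightarrow> H \<xi> * complex_of_real (indicator (box l u) \<xi>)"
          by (rule tendsto_mult_left)
        then show "(\<lambda>n. H \<xi> * ?\<phi> n \<xi>) \<longlonglongrightarrow> indicator (box l u) \<xi> *\<^sub>R H \<xi>"
          by (simp add: scaleR_conv_of_real mult.commute)
      qed
      show "AE \<xi> in lborel. norm (H \<xi> * ?\<phi> n \<xi>) \<le> norm (indicator (box l u) \<xi> *\<^sub>R H \<xi>)" for n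
      proof (rule AE_I2)
        fix \<xi>
        have "norm (?\<phi> n \<xi>) \<le> indicator (box l u) \<xi>"
        proof (cases "?\<phi> n \<xi> = 0")
          case False
          have "norm (?\<phi> n \<xi>) \<le> 1"
            unfolding prod3_def norm_of_real abs_mult
            by (intro mult_le_one bb mult_nonneg_nonneg abs_ge_zero)
          then show ?thesis using inbox[OF False] by simp
        qed simp
        then have "norm (H \<xi>) * norm (?\<phi> n \<xi>) \<le> norm (H \<xi>) * indicator (box l u) \<xi>" by (rule mult_left_mono) simp
        also have "norm (H \<xi>) * indicator (box l u) \<xi> = norm (indicator (box l u) \<xi> *\<^sub>R H \<xi>)"
          by (simp add: indicator_def)
        finally show "norm (H \<xi> * ?\<phi> n \<xi>) \<le> norm (indicator (box l u) \<xi> *\<^sub>R H \<xi>)"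
          unfolding norm_mult .
      qed
      show "(\<lambda>\<xi>. H \<xi> * ?\<phi> n \<xi>) \<in> borel_measurable lborel" for n
        by (intro borel_measurable_times) (use m in simp_all)
      show "integrable lborel (\<lambda>\<xi>. norm (indicator (box l u) \<xi> *\<^sub>R H \<xi>))" using iB by (rule integrable_norm)
    qed measurable
    then show ?thesis unfolding z by (simp add: LIMSEQ_const_iff)
  qed
  have AEbox: "AE \<xi> in lborel. \<xi> \<in> box l u \<longrightarrow> H \<xi> = 0" if sub: "box l u \<subseteq> ?U" for l u
  proof -
    have "AE \<xi> in lborel. indicator (box l u) \<xi> *\<^sub>R H \<xi> = 0"
    \<comment> \<open>Applied to the restriction of \<open>H\<close> to one box: a test box
      intersects it in a box contained in the same region.\<close>
    proof (rule AE_zero_of_boxes[OF iB zero[OF sub]])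
      fix a b :: R3
      obtain l' u' where e: "box a b \<inter> box l u = box l' u'" using box_Int_box[of a b l u] by blast
      have "(\<integral>x. indicator (box a b) x *\<^sub>R indicator (box l u) x *\<^sub>R H x \<partial>lborel) = (\<integral>x. indicator (box l' u') x *\<^sub>R H x \<partial>lborel)"
        unfolding e[symmetric] indicator_inter_arith scaleR_scaleR ..
      also have "\<dots> = 0" by (rule zero) (use e sub in blast)
      finally show "(\<integral>x. indicator (box a b) x *\<^sub>R indicator (box l u) x *\<^sub>R H x \<partial>lborel) = 0" .
    qed
    then show ?thesis by eventually_elim (auto simp: indicator_def)
  qed
  obtain \<D> where \<D>: "countable \<D>" "\<D> \<subseteq> Pow ?U" "\<And>X. X \<in> \<D> \<Longrightarrow> \<exists>a b. X = box a b" "\<Union>\<D> = ?U"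
    using open_countable_Union_open_box[OF \<open>open ?U\<close>] by blast
  have "\<forall>X\<in>\<D>. AE \<xi> in lborel. \<xi> \<in> X \<longrightarrow> H \<xi> = 0"
  proof
    fix X assume X: "X \<in> \<D>"
    then obtain a b where "X = box a b" using \<D>(3) by blast
    then show "AE \<xi> in lborel. \<xi> \<in> X \<longrightarrow> H \<xi> = 0" using AEbox[of a b] X \<D>(2) by blast
  qed
  then have "AE \<xi> in lborel. \<forall>X\<in>\<D>. \<xi> \<in> X \<longrightarrow> H \<xi> = 0"
    by (simp only: AE_ball_countable[OF \<D>(1)])
  then show ?thesis by eventually_elim (use \<D>(4) in blast)
qed

section \<open>Dyadic decomposition in frequency and space\<close>

lemma measurable_inv_fourier: "integrable lborel H \<Longrightarrow> inv_fourier H \<in> borel_measurable borel"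
  by (intro borel_measurable_continuous_onI continuous_inv_fourier)

text \<open>Replaces the chosen representative by one that vanishes everywhere, not just almost
  everywhere, beyond the frequency bound. The inverse transforms agree at every point, and the same
  \<open>H\<close> serves all multipliers, including the projection itself.\<close>

lemma lp_multiplier_eq:
  assumes cut: "lp_cutoff \<psi>" and k: "-1 \<le> k" and f: "f \<in> lp_domain \<psi> k"
  obtains H where "sqint H" "\<And>\<xi>. 8/5 * 2 powi k < norm \<xi> \<Longrightarrow> H \<xi> = 0"
    "\<And>m. m \<in> borel_measurable borel \<Longrightarrow> lp_multiplier \<psi> k m f = inv_fourier (\<lambda>\<xi>. m \<xi> * H \<xi>)"
proof -
  let ?H = "lp_fourier \<psi> k f"
  have isH: "is_lp_fourier \<psi> k f ?H"
  proof -
    obtain H0 where "is_lp_fourier \<psi> k f H0" using f unfolding lp_domain_def by blast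
    then show ?thesis unfolding lp_fourier_def by (rule someI[of "is_lp_fourier \<psi> k f"])
  qed
  then have [measurable]: "?H \<in> borel_measurable borel" and sq: "integrable lborel (\<lambda>\<xi>. (norm (?H \<xi>))\<^sup>2)"
    by (auto simp: is_lp_fourier_def)
  define H where "H \<xi> = indicator {\<xi>. norm \<xi> \<le> 8/5 * 2 powi k} \<xi> *\<^sub>R ?H \<xi>" for \<xi>
  have [measurable]: "H \<in> borel_measurable borel" unfolding H_def[abs_def] by measurable
  have "integrable lborel (\<lambda>\<xi>. (norm (H \<xi>))\<^sup>2)"
    by (rule Bochner_Integration.integrable_bound[OF sq]) (auto simp: H_def indicator_def)
  then have "sqint H" by (simp add: sqint_def)
  moreover have "H \<xi> = 0" if "8/5 * 2 powi k < norm \<xi>" for \<xi> using that by (simp add: H_def)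
  moreover have "lp_multiplier \<psi> k m f = inv_fourier (\<lambda>\<xi>. m \<xi> * H \<xi>)" if [measurable]: "m \<in> borel_measurable borel" for m
  proof
    fix x
    have "(\<integral>\<xi>. cis (x \<bullet> \<xi>) * (m \<xi> * ?H \<xi>) \<partial>lborel) = (\<integral>\<xi>. cis (x \<bullet> \<xi>) * (m \<xi> * H \<xi>) \<partial>lborel)"
    proof (rule integral_cong_AE)
      show "AE \<xi> in lborel. cis (x \<bullet> \<xi>) * (m \<xi> * ?H \<xi>) = cis (x \<bullet> \<xi>) * (m \<xi> * H \<xi>)"
        using lp_fourier_support[OF cut k isH] by eventually_elim (auto simp: H_def indicator_def not_le)
    qed measurable
    then show "lp_multiplier \<psi> k m f x = inv_fourier (\<lambda>\<xi>. m \<xi> * H \<xi>) x"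
      by (simp add: lp_multiplier_def inv_fourier_def)
  qed
  ultimately show ?thesis using that by blast
qed

text \<open>The profile of one dyadic frequency shell, with the power of 1/|\<xi>| built in.
  Negative arguments are cut off because \<psi> is unconstrained in sign of its argument, while the
  profile must live on [1/2, 2].\<close>

definition annulus :: "(real \<Rightarrow> real) \<Rightarrow> nat \<Rightarrow> real \<Rightarrow> real" where
  "annulus \<psi> \<theta> \<rho> = (if \<rho> \<ge> 0 then \<psi> \<rho> - \<psi> (2 * \<rho>) else 0) / \<rho> ^ \<theta>"

lemma bump_annulus:
  assumes "lp_cutoff \<psi>"
  shows "bump (annulus \<psi> \<theta>)"
proof -
  have one: "\<psi> x = 1" if "x \<in> {-5/4..5/4}" for x using assms that by (auto simp: lp_cutoff_def)
  have zero: "\<psi> x = 0" if "x \<notin> {-8/5..8/5}" for x using assms that unfolding lp_cutoff_def by blast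
  have d0: "\<psi> x - \<psi> (2 * x) = 0" if "\<bar>x\<bar> < 5/8" for x
  proof -
    have "x \<in> {-5/4..5/4}" "2 * x \<in> {-5/4..5/4}" using that by auto
    then show ?thesis using one by simp
  qed
  have small: "(if x \<ge> 0 then \<psi> x - \<psi> (2 * x) else 0) = 0" if "x < 5/8" for x
  proof (cases "x \<ge> 0")
    case True
    then show ?thesis using that d0[of x] by simp
  qed simp
  have "ck n (\<lambda>x. \<psi> (2 * x))" for n using ck_affine[OF lp_cutoff_ck[OF assms], of n 2 0] by simp
  then have "ck n (\<lambda>x. if x \<ge> 0 then \<psi> x - \<psi> (2 * x) else 0)" for n
    by (intro ck_cut[where c="5/8"] ck_diff lp_cutoff_ck[OF assms] d0) auto
  then have "ck n (annulus \<psi> \<theta>)" for n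
    unfolding annulus_def[abs_def] by (rule ck_divide_power[where c="5/8"]) (use small in auto)
  moreover have "annulus \<psi> \<theta> x = 0" if "x \<notin> {1/2..2}" for x
  proof (cases "x < 5/8")
    case True
    then show ?thesis using small[of x] by (simp add: annulus_def)
  next
    case False
    then have "x \<notin> {-8/5..8/5}" "2 * x \<notin> {-8/5..8/5}" using that by auto
    then show ?thesis using zero by (simp add: annulus_def)
  qed
  ultimately show ?thesis by (simp add: bump_def)
qed

text \<open>Reduction to unit frequency: the dilated symbol is the Fourier transform of the
  unit-scale kernel at \<xi>/\<mu>, and exchanging the integrals turns multiplication into
  convolution with the dilated function.\<close>

lemma inv_fourier_wave_symbol:
  assumes bk: "bump \<kappa>" and H: "integrable lborel H" and \<mu>: "\<mu> > 0"
  shows "inv_fourier (\<lambda>\<xi>. wave_symbol \<kappa> \<tau> (\<xi> /\<^sub>R \<mu>) * H \<xi>) x = wave \<kappa> \<tau> (\<lambda>w. inv_fourier H (w /\<^sub>R \<mu>)) (\<mu> *\<^sub>R x)"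
proof -
  let ?c = "complex_of_real ((2 * pi) ^ 3)"
  have [measurable]: "ker \<kappa> \<tau> \<in> borel_measurable borel" "H \<in> borel_measurable borel" "inv_fourier H \<in> borel_measurable borel"
    using measurable_ker[OF bk] H measurable_inv_fourier[OF H] by auto
  let ?F = "\<lambda>z \<xi>. (ker \<kappa> \<tau> z * (H \<xi> / ?c)) * cis ((x - z /\<^sub>R \<mu>) \<bullet> \<xi>)"
  have ce: "cis ((x - z /\<^sub>R \<mu>) \<bullet> \<xi>) = cis (x \<bullet> \<xi>) * cis (- (z \<bullet> (\<xi> /\<^sub>R \<mu>)))" for z \<xi>
    by (simp add: cis_mult inner_diff_left)
  have "inv_fourier (\<lambda>\<xi>. wave_symbol \<kappa> \<tau> (\<xi> /\<^sub>R \<mu>) * H \<xi>) x = (\<integral>\<xi>. cis (x \<bullet> \<xi>) * (wave_symbol \<kappa> \<tau> (\<xi> /\<^sub>R \<mu>) * H \<xi>) / ?c \<partial>lborel)"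
    unfolding inv_fourier_def by (simp only: integral_divide_zero)
  also have "\<dots> = (\<integral>\<xi>. \<integral>z. ?F z \<xi> \<partial>lborel \<partial>lborel)"
  proof (rule Bochner_Integration.integral_cong[OF refl])
    fix \<xi> :: R3
    have "(\<integral>z. ?F z \<xi> \<partial>lborel) = (\<integral>z. (cis (x \<bullet> \<xi>) * H \<xi> / ?c) * (ker \<kappa> \<tau> z * cis (- (z \<bullet> (\<xi> /\<^sub>R \<mu>)))) \<partial>lborel)"
      unfolding ce by (rule Bochner_Integration.integral_cong) (auto simp: mult_ac)
    also have "\<dots> = (cis (x \<bullet> \<xi>) * H \<xi> / ?c) * wave_symbol \<kappa> \<tau> (\<xi> /\<^sub>R \<mu>)"
      by (simp only: integral_mult_right_zero fourier_ker[OF bk])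
    finally have e: "(\<integral>z. ?F z \<xi> \<partial>lborel) = (cis (x \<bullet> \<xi>) * H \<xi> / ?c) * wave_symbol \<kappa> \<tau> (\<xi> /\<^sub>R \<mu>)" .
    show "cis (x \<bullet> \<xi>) * (wave_symbol \<kappa> \<tau> (\<xi> /\<^sub>R \<mu>) * H \<xi>) / ?c = (\<integral>z. ?F z \<xi> \<partial>lborel)"
      unfolding e by simp
  qed
  also have "\<dots> = (\<integral>z. \<integral>\<xi>. ?F z \<xi> \<partial>lborel \<partial>lborel)"
  proof (rule lborel_pair.Fubini_integral)
    have "integrable (lborel \<Otimes>\<^sub>M lborel) (\<lambda>(z, \<xi>). ker \<kappa> \<tau> z * (H \<xi> / ?c))"
      using integrable_ker[OF bk] H by (intro integrable_tensor integrable_divide_zero) auto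
    then show "integrable (lborel \<Otimes>\<^sub>M lborel) (\<lambda>(z, \<xi>). ?F z \<xi>)"
    proof (rule Bochner_Integration.integrable_bound)
      show "(\<lambda>(z, \<xi>). ?F z \<xi>) \<in> borel_measurable (lborel \<Otimes>\<^sub>M lborel)" by measurable
    qed (auto simp: norm_mult norm_divide intro!: AE_I2)
  qed
  also have "\<dots> = (\<integral>z. ker \<kappa> \<tau> z * inv_fourier H (x - z /\<^sub>R \<mu>) \<partial>lborel)"
  proof (rule Bochner_Integration.integral_cong[OF refl])
    fix z :: R3
    have "(\<integral>\<xi>. ?F z \<xi> \<partial>lborel) = (\<integral>\<xi>. (ker \<kappa> \<tau> z / ?c) * (cis ((x - z /\<^sub>R \<mu>) \<bullet> \<xi>) * H \<xi>) \<partial>lborel)"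
      by (rule Bochner_Integration.integral_cong) (auto simp: mult_ac)
    also have "\<dots> = ker \<kappa> \<tau> z * inv_fourier H (x - z /\<^sub>R \<mu>)"
      by (simp add: inv_fourier_def)
    finally show "(\<integral>\<xi>. ?F z \<xi> \<partial>lborel) = ker \<kappa> \<tau> z * inv_fourier H (x - z /\<^sub>R \<mu>)" .
  qed
  also have "\<dots> = (\<integral>w. ker \<kappa> \<tau> (\<mu> *\<^sub>R x - w) * inv_fourier H (x - (\<mu> *\<^sub>R x - w) /\<^sub>R \<mu>) \<partial>lborel)"
    by (rule integral_reflect[symmetric]) measurable
  also have "(\<lambda>w. x - (\<mu> *\<^sub>R x - w) /\<^sub>R \<mu>) = (\<lambda>w. w /\<^sub>R \<mu>)" using \<mu> by (auto simp: scaleR_diff_right)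
  finally show ?thesis by (simp add: wave_def)
qed

text \<open>The triangle inequality in \<open>ennreal\<close>: the series of norms may diverge, so
  only convergence of the partial sums is asked for.\<close>

lemma norm_le_suminf_of_tendsto:
  fixes a :: "nat \<Rightarrow> complex"
  assumes "(\<lambda>M. \<Sum>m<M. a m) \<longlonglongrightarrow> u"
  shows "ennreal (norm u) \<le> (\<Sum>m. ennreal (norm (a m)))"
proof (rule LIMSEQ_le_const2)
  show "(\<lambda>M. ennreal (norm (\<Sum>m<M. a m))) \<longlonglongrightarrow> ennreal (norm u)"
    by (intro tendsto_ennrealI tendsto_norm assms)
  show "\<exists>N. \<forall>M\<ge>N. ennreal (norm (\<Sum>m<M. a m)) \<le> (\<Sum>m. ennreal (norm (a m)))"
  proof (intro exI allI impI)
    fix M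
    have "ennreal (norm (\<Sum>m<M. a m)) \<le> ennreal (\<Sum>m<M. norm (a m))" by (intro ennreal_leI norm_sum)
    also have "\<dots> = (\<Sum>m<M. ennreal (norm (a m)))" by simp
    also have "\<dots> \<le> (\<Sum>m. ennreal (norm (a m)))" by (rule sum_le_suminf) auto
    finally show "ennreal (norm (\<Sum>m<M. a m)) \<le> (\<Sum>m. ennreal (norm (a m)))" .
  qed
qed

text \<open>The scales descend from 2^(k+1), not 2^k: on |\<xi>| \<le> 8/5 * 2^k the ratio to the
  top scale is at most 4/5, where \<psi> is 1, so the telescoping sum starts at full
  strength.\<close>

definition lscale :: "int \<Rightarrow> nat \<Rightarrow> real" where
  "lscale k m = 2 powi (k + 1 - int m)"

lemma lscale_pos: "lscale k m > 0"
  by (simp add: lscale_def)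

lemma lscale_Suc: "lscale k (Suc m) = lscale k m / 2"
proof -
  have e: "k + 1 - int (Suc m) = (k + 1 - int m) - 1" by simp
  have "(2::real) powi ((k + 1 - int m) - 1) * 2 = 2 powi (k + 1 - int m)"
    by (rule power_int_minus_mult) simp
  then show ?thesis unfolding lscale_def e by linarith
qed

lemma lscale_eq: "lscale k m = lscale k 0 / 2 ^ m"
  by (induction m) (simp_all add: lscale_Suc)

lemma lscale_0: "lscale k 0 = 2 * 2 powi k"
  unfolding lscale_def by (simp add: power_int_add)

text \<open>Doubling the argument is passing to the next scale, and the powers of the scale cancel
  down to (1/r)^\<theta>.\<close>

lemma annulus_telescope:
  assumes "r \<ge> 0"
  shows "(\<Sum>m<M. 1 / lscale k m ^ \<theta> * annulus \<psi> \<theta> (r / lscale k m)) = (1 / r) ^ \<theta> * (\<psi> (r / lscale k 0) - \<psi> (r / lscale k M))"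
proof -
  have "1 / lscale k m ^ \<theta> * annulus \<psi> \<theta> (r / lscale k m) = (1 / r) ^ \<theta> * (\<psi> (r / lscale k m) - \<psi> (r / lscale k (Suc m)))" for m
  proof -
    have "r / lscale k m \<ge> 0" using assms lscale_pos[of k m] by simp
    moreover have "2 * (r / lscale k m) = r / lscale k (Suc m)" by (simp add: lscale_Suc)
    ultimately have "annulus \<psi> \<theta> (r / lscale k m) = (\<psi> (r / lscale k m) - \<psi> (r / lscale k (Suc m))) / (r / lscale k m) ^ \<theta>"
      by (simp add: annulus_def)
    then show ?thesis using lscale_pos[of k m] by (simp add: power_divide)
  qed
  then have "(\<Sum>m<M. 1 / lscale k m ^ \<theta> * annulus \<psi> \<theta> (r / lscale k m)) = (\<Sum>m<M. (1 / r) ^ \<theta> * (\<psi> (r / lscale k m) - \<psi> (r / lscale k (Suc m))))"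
    by simp
  also have "\<dots> = (1 / r) ^ \<theta> * (\<psi> (r / lscale k 0) - \<psi> (r / lscale k M))"
    unfolding sum_distrib_left[symmetric] by (subst sum_lessThan_telescope') simp
  finally show ?thesis .
qed

text \<open>\<open>H\<close> is cut off only from above, so all scales down to 0 are summed. In the
  resulting series every term is a unit-frequency wave with rescaled time, space and datum.\<close>

lemma frequency_decomposition:
  assumes cut: "lp_cutoff \<psi>" and H: "sqint H" and supp: "\<And>\<xi>. 8/5 * 2 powi k < norm \<xi> \<Longrightarrow> H \<xi> = 0"
  shows "ennreal (norm (inv_fourier (\<lambda>\<xi>. (complex_of_real (1 / norm \<xi>) ^ \<theta> * cis (\<tau> * norm \<xi>)) * H \<xi>) x))
    \<le> (\<Sum>m. ennreal (1 / lscale k m ^ \<theta> * norm (wave (annulus \<psi> \<theta>) (lscale k m * \<tau>) (\<lambda>w. inv_fourier H (w /\<^sub>R lscale k m)) (lscale k m *\<^sub>R x))))"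
proof -
  let ?\<kappa> = "annulus \<psi> \<theta>" and ?l = "lscale k"
  have bk: "bump ?\<kappa>" by (rule bump_annulus[OF cut])
  have [measurable]: "H \<in> borel_measurable borel" using H by (simp add: sqint_def)
  have [measurable]: "\<psi> \<in> borel_measurable borel"
    using ck_imp_continuous[OF lp_cutoff_ck[OF cut]] by (rule borel_measurable_continuous_onI)
  have iH: "integrable lborel H" by (rule integrable_sqint_support[OF H supp])
  let ?F = "\<lambda>\<xi>. cis (x \<bullet> \<xi>) * ((complex_of_real (1 / norm \<xi>) ^ \<theta> * cis (\<tau> * norm \<xi>)) * H \<xi>)"
  let ?c = "complex_of_real ((2 * pi) ^ 3)"
  define T where "T m \<xi> = complex_of_real (1 / ?l m ^ \<theta>) * (wave_symbol ?\<kappa> (?l m * \<tau>) (\<xi> /\<^sub>R ?l m) * H \<xi>)" for m \<xi>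
  have T: "T m \<xi> = complex_of_real (1 / ?l m ^ \<theta> * ?\<kappa> (norm \<xi> / ?l m)) * (cis (\<tau> * norm \<xi>) * H \<xi>)" for m \<xi>
    using lscale_pos[of k m] by (simp add: T_def wave_symbol_def field_simps)
  have uT: "inv_fourier (T m) x = complex_of_real (1 / ?l m ^ \<theta>) * wave ?\<kappa> (?l m * \<tau>) (\<lambda>w. inv_fourier H (w /\<^sub>R ?l m)) (?l m *\<^sub>R x)" for m
  proof -
    have "inv_fourier (T m) x = complex_of_real (1 / ?l m ^ \<theta>) * inv_fourier (\<lambda>\<xi>. wave_symbol ?\<kappa> (?l m * \<tau>) (\<xi> /\<^sub>R ?l m) * H \<xi>) x"
      unfolding inv_fourier_def T_def by (simp add: mult.left_commute[of "cis _"] del: of_real_divide)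
    then show ?thesis using inv_fourier_wave_symbol[OF bk iH lscale_pos] by simp
  qed
  have nT: "ennreal (norm (inv_fourier (T m) x)) = ennreal (1 / ?l m ^ \<theta> * norm (wave ?\<kappa> (?l m * \<tau>) (\<lambda>w. inv_fourier H (w /\<^sub>R ?l m)) (?l m *\<^sub>R x)))" for m
    unfolding uT norm_mult norm_of_real using lscale_pos[of k m] by (simp add: less_imp_le)
  show ?thesis
  proof (cases "integrable lborel ?F")
    case False
    \<comment> \<open>A non-integrable integrand has Bochner integral 0 by convention, and the bound
      is trivial.\<close>
    then have "inv_fourier (\<lambda>\<xi>. (complex_of_real (1 / norm \<xi>) ^ \<theta> * cis (\<tau> * norm \<xi>)) * H \<xi>) x = 0"
      unfolding inv_fourier_def by (simp add: not_integrable_integral_eq)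
    then show ?thesis by simp
  next
    case True
    obtain B where B: "\<And>\<tau> \<xi>. norm (wave_symbol ?\<kappa> \<tau> \<xi>) \<le> B" using wave_symbol_bounded[OF bk] by blast
    have iT: "integrable lborel (\<lambda>\<xi>. cis (x \<bullet> \<xi>) * T m \<xi>)" for m
    proof (rule Bochner_Integration.integrable_bound)
      show "integrable lborel (\<lambda>\<xi>. ((1 / ?l m ^ \<theta>) * B) * norm (H \<xi>))" using iH by simp
      have [measurable]: "wave_symbol ?\<kappa> (?l m * \<tau>) \<in> borel_measurable borel" by (rule measurable_wave_symbol[OF bk])
      show "(\<lambda>\<xi>. cis (x \<bullet> \<xi>) * T m \<xi>) \<in> borel_measurable lborel" unfolding T_def by measurable
      show "AE \<xi> in lborel. norm (cis (x \<bullet> \<xi>) * T m \<xi>) \<le> norm (((1 / ?l m ^ \<theta>) * B) * norm (H \<xi>))"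
      proof (rule AE_I2)
        fix \<xi>
        have l: "0 \<le> 1 / ?l m ^ \<theta>" using lscale_pos[of k m] by simp
        have "norm (cis (x \<bullet> \<xi>) * T m \<xi>) = (1 / ?l m ^ \<theta>) * (norm (wave_symbol ?\<kappa> (?l m * \<tau>) (\<xi> /\<^sub>R ?l m)) * norm (H \<xi>))"
          unfolding T_def norm_mult norm_of_real norm_cis using l by simp
        also have "\<dots> \<le> (1 / ?l m ^ \<theta>) * (B * norm (H \<xi>))"
          by (intro mult_left_mono mult_right_mono B l) simp
        also have "\<dots> = ((1 / ?l m ^ \<theta>) * B) * norm (H \<xi>)" by (simp only: mult.assoc)
        also have "\<dots> \<le> norm (((1 / ?l m ^ \<theta>) * B) * norm (H \<xi>))" unfolding real_norm_def by (rule abs_ge_self)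
        finally show "norm (cis (x \<bullet> \<xi>) * T m \<xi>) \<le> norm (((1 / ?l m ^ \<theta>) * B) * norm (H \<xi>))" .
      qed
    qed
    \<comment> \<open>The partial sums differ from the integrand by the factor 1 -
      \<psi>(|\<xi>|/\<lambda>_M) in [0, 1]: the integrand itself is the majorant.\<close>
    have sumT: "(\<Sum>m<M. cis (x \<bullet> \<xi>) * T m \<xi>) = complex_of_real (1 - \<psi> (norm \<xi> / ?l M)) * ?F \<xi>" for M \<xi>
    proof (cases "H \<xi> = 0")
      case True
      then show ?thesis by (simp add: T_def)
    next
      case False
      then have "norm \<xi> \<le> 8/5 * 2 powi k" using supp not_le by blast
      then have "norm \<xi> / ?l 0 \<le> 4/5" by (simp add: lscale_0 divide_le_eq)
      moreover have "0 \<le> norm \<xi> / ?l 0" using lscale_pos[of k 0] by simp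
      ultimately have "\<psi> (norm \<xi> / ?l 0) = 1" using cut by (auto simp: lp_cutoff_def)
      then have "(\<Sum>m<M. 1 / ?l m ^ \<theta> * ?\<kappa> (norm \<xi> / ?l m)) = (1 / norm \<xi>) ^ \<theta> * (1 - \<psi> (norm \<xi> / ?l M))"
        by (simp only: annulus_telescope[OF norm_ge_zero])
      then have e: "(\<Sum>m<M. complex_of_real (1 / ?l m ^ \<theta> * ?\<kappa> (norm \<xi> / ?l m))) = complex_of_real ((1 / norm \<xi>) ^ \<theta> * (1 - \<psi> (norm \<xi> / ?l M)))"
        by (simp only: of_real_sum[symmetric])
      have "(\<Sum>m<M. cis (x \<bullet> \<xi>) * T m \<xi>) = (\<Sum>m<M. complex_of_real (1 / ?l m ^ \<theta> * ?\<kappa> (norm \<xi> / ?l m))) * (cis (x \<bullet> \<xi>) * (cis (\<tau> * norm \<xi>) * H \<xi>))"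
        unfolding T sum_distrib_right by (intro sum.cong refl) (simp only: mult_ac)
      also have "\<dots> = complex_of_real (1 - \<psi> (norm \<xi> / ?l M)) * ?F \<xi>"
        unfolding e by (simp only: of_real_mult of_real_power mult_ac)
      finally show ?thesis .
    qed
    have "(\<lambda>M. \<integral>\<xi>. (\<Sum>m<M. cis (x \<bullet> \<xi>) * T m \<xi>) \<partial>lborel) \<longlonglongrightarrow> (\<integral>\<xi>. ?F \<xi> \<partial>lborel)"
    proof (rule integral_dominated_convergence[where w="\<lambda>\<xi>. norm (?F \<xi>)"])
      have "AE \<xi> in lborel. \<xi> \<noteq> (0::R3)" by (rule AE_lborel_singleton)
      then show "AE \<xi> in lborel. (\<lambda>M. \<Sum>m<M. cis (x \<bullet> \<xi>) * T m \<xi>) \<longlonglongrightarrow> ?F \<xi>"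
      proof eventually_elim
        fix \<xi> :: R3 assume "\<xi> \<noteq> 0"
        then have pos: "norm \<xi> / ?l 0 > 0" using lscale_pos[of k 0] by simp
        \<comment> \<open>Since N < 2^M for M \<ge> N, the ratio of |\<xi>| to the M-th scale
          exceeds 8/5 from then on and the cutoff is gone.\<close>
        obtain N where N: "8/5 < real N * (norm \<xi> / ?l 0)" using reals_Archimedean3[OF pos, rule_format, of "8/5"] by blast
        have "\<psi> (norm \<xi> / ?l M) = 0" if "M \<ge> N" for M
        proof -
          have "N < 2 ^ M" using that less_exp[of M] by linarith
          then have "real N \<le> 2 ^ M" by (metis of_nat_le_iff of_nat_numeral of_nat_power less_imp_le)
          then have "real N * (norm \<xi> / ?l 0) \<le> 2 ^ M * (norm \<xi> / ?l 0)" using pos by (intro mult_right_mono) auto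
          also have "\<dots> = norm \<xi> / ?l M" unfolding lscale_eq[of k M] by simp
          finally have "8/5 < norm \<xi> / ?l M" using N by linarith
          then have "norm \<xi> / ?l M \<notin> {-8/5..8/5}" by auto
          then show ?thesis using cut unfolding lp_cutoff_def by blast
        qed
        then have "\<forall>\<^sub>F M in sequentially. (\<Sum>m<M. cis (x \<bullet> \<xi>) * T m \<xi>) = ?F \<xi>"
          unfolding sumT eventually_sequentially by (intro exI[of _ N]) simp
        then show "(\<lambda>M. \<Sum>m<M. cis (x \<bullet> \<xi>) * T m \<xi>) \<longlonglongrightarrow> ?F \<xi>" by (rule tendsto_eventually)
      qed
      show "AE \<xi> in lborel. norm (\<Sum>m<M. cis (x \<bullet> \<xi>) * T m \<xi>) \<le> norm (?F \<xi>)" for M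
      proof (rule AE_I2)
        fix \<xi> :: R3
        have "\<psi> (norm \<xi> / ?l M) \<in> {0..1}" using cut unfolding lp_cutoff_def by blast
        then have "\<bar>1 - \<psi> (norm \<xi> / ?l M)\<bar> \<le> 1" by auto
        from mult_right_mono[OF this norm_ge_zero[of "?F \<xi>"]]
        show "norm (\<Sum>m<M. cis (x \<bullet> \<xi>) * T m \<xi>) \<le> norm (?F \<xi>)" unfolding sumT norm_mult[of "complex_of_real _"] norm_of_real by simp
      qed
      show "integrable lborel (\<lambda>\<xi>. norm (?F \<xi>))" using True by (rule integrable_norm)
      show "(\<lambda>\<xi>. ?F \<xi>) \<in> borel_measurable lborel" using True by (rule borel_measurable_integrable)
      show "(\<lambda>\<xi>. \<Sum>m<M. cis (x \<bullet> \<xi>) * T m \<xi>) \<in> borel_measurable lborel" for M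
        using iT by (intro borel_measurable_sum borel_measurable_integrable)
    qed
    moreover have "(\<integral>\<xi>. (\<Sum>m<M. cis (x \<bullet> \<xi>) * T m \<xi>) \<partial>lborel) = (\<Sum>m<M. \<integral>\<xi>. cis (x \<bullet> \<xi>) * T m \<xi> \<partial>lborel)" for M
      by (rule Bochner_Integration.integral_sum[OF iT])
    ultimately have "(\<lambda>M. (\<Sum>m<M. \<integral>\<xi>. cis (x \<bullet> \<xi>) * T m \<xi> \<partial>lborel)) \<longlonglongrightarrow> (\<integral>\<xi>. ?F \<xi> \<partial>lborel)"
      by (simp only:)
    then have "(\<lambda>M. (\<Sum>m<M. \<integral>\<xi>. cis (x \<bullet> \<xi>) * T m \<xi> \<partial>lborel) / ?c) \<longlonglongrightarrow> (\<integral>\<xi>. ?F \<xi> \<partial>lborel) / ?c"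
      by (rule tendsto_divide[OF _ tendsto_const]) simp
    then have "(\<lambda>M. \<Sum>m<M. inv_fourier (T m) x) \<longlonglongrightarrow> inv_fourier (\<lambda>\<xi>. (complex_of_real (1 / norm \<xi>) ^ \<theta> * cis (\<tau> * norm \<xi>)) * H \<xi>) x"
      unfolding inv_fourier_def sum_divide_distrib .
    from norm_le_suminf_of_tendsto[OF this] show ?thesis unfolding nT .
  qed
qed

text \<open>The shell of index 0 is the whole unit ball; the others are half-open, so that the
  shells partition the space.\<close>

definition shell :: "nat \<Rightarrow> R3 set" where
  "shell j = {y. norm y \<le> 2 ^ j \<and> (j = 0 \<or> 2 ^ (j - 1) < norm y)}"

lemma measurable_shell [measurable]: "shell j \<in> sets borel"
  unfolding shell_def by measurable

lemma sum_indicator_shell: "(\<Sum>j<Suc J. indicator (shell j) y) = (if norm y \<le> 2 ^ J then 1 else (0::real))"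
proof (induction J)
  case 0
  then show ?case by (simp add: shell_def indicator_def)
next
  case (Suc J)
  have "(2::real) ^ J \<le> 2 ^ Suc J" by simp
  have "(\<Sum>j<Suc (Suc J). indicator (shell j) y) = (\<Sum>j<Suc J. indicator (shell j) y) + (indicator (shell (Suc J)) y :: real)"
    by (rule sum.lessThan_Suc)
  also have "\<dots> = (if norm y \<le> 2 ^ J then 1 else 0) + indicator (shell (Suc J)) y" by (simp only: Suc)
  also have "\<dots> = (if norm y \<le> 2 ^ Suc J then 1 else 0)"
    using order_trans[OF _ \<open>2 ^ J \<le> 2 ^ Suc J\<close>, of "norm y"] by (auto simp: shell_def indicator_def simp del: power_Suc)
  finally show ?case .
qed

text \<open>A spatial shell of the datum, dilated by the frequency: its support has radius \<mu>
  2^j, the \<open>R\<close> of the unit estimate.\<close>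

definition piece :: "(R3 \<Rightarrow> complex) \<Rightarrow> real \<Rightarrow> nat \<Rightarrow> R3 \<Rightarrow> complex" where
  "piece g \<mu> j w = indicator (shell j) (w /\<^sub>R \<mu>) *\<^sub>R g (w /\<^sub>R \<mu>)"

text \<open>For fixed x the kernel times the datum is integrable, and the partial sums over shells
  are truncations of this product; dominated convergence applies.\<close>

lemma space_decomposition:
  assumes bk: "bump \<kappa>" and G: "sqint (\<lambda>w. g (w /\<^sub>R \<mu>))"
  shows "ennreal (norm (wave \<kappa> \<tau> (\<lambda>w. g (w /\<^sub>R \<mu>)) x)) \<le> (\<Sum>j. ennreal (norm (wave \<kappa> \<tau> (piece g \<mu> j) x)))"
proof (rule norm_le_suminf_of_tendsto)
  let ?F = "\<lambda>w. ker \<kappa> \<tau> (x - w) * g (w /\<^sub>R \<mu>)"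
  have iF: "integrable lborel ?F" by (rule integrable_mult_sqint[OF sqint_ker[OF bk] G])
  have pe: "ker \<kappa> \<tau> (x - w) * piece g \<mu> j w = indicator (shell j) (w /\<^sub>R \<mu>) *\<^sub>R ?F w" for w j by (simp add: piece_def)
  have m: "(\<lambda>w. w /\<^sub>R \<mu> :: R3) \<in> borel \<rightarrow>\<^sub>M borel" by measurable
  have iP: "integrable lborel (\<lambda>w. ker \<kappa> \<tau> (x - w) * piece g \<mu> j w)" for j
    unfolding pe
  proof (rule Bochner_Integration.integrable_bound[OF iF])
    have "(\<lambda>w. indicator (shell j) (w /\<^sub>R \<mu>) :: real) \<in> borel_measurable borel"
      by (rule measurable_compose[OF m]) measurable
    then show "(\<lambda>w. indicator (shell j) (w /\<^sub>R \<mu>) *\<^sub>R ?F w) \<in> borel_measurable lborel"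
      using borel_measurable_integrable[OF iF] by (intro borel_measurable_scaleR) auto
  qed (auto simp: indicator_def)
  have s: "(\<Sum>j<J. ker \<kappa> \<tau> (x - w) * piece g \<mu> j w) = (\<Sum>j<J. indicator (shell j) (w /\<^sub>R \<mu>)) *\<^sub>R ?F w" for J w
    unfolding pe by (simp only: scaleR_sum_left)
  have "(\<lambda>J. \<integral>w. (\<Sum>j<J. ker \<kappa> \<tau> (x - w) * piece g \<mu> j w) \<partial>lborel) \<longlonglongrightarrow> (\<integral>w. ?F w \<partial>lborel)"
  proof (rule integral_dominated_convergence[where w="\<lambda>w. norm (?F w)"])
    show "AE w in lborel. (\<lambda>J. \<Sum>j<J. ker \<kappa> \<tau> (x - w) * piece g \<mu> j w) \<longlonglongrightarrow> ?F w"
    proof (rule AE_I2)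
      fix w :: R3
      obtain N where N: "norm (w /\<^sub>R \<mu>) < real N" using reals_Archimedean2 by blast
      have "(\<Sum>j<J. indicator (shell j) (w /\<^sub>R \<mu>)) = (1::real)" if JN: "J \<ge> Suc N" for J
      proof -
        obtain J' where "J = Suc J'" using JN by (metis Suc_le_D)
        then have J': "J = Suc J'" "N \<le> J'" using JN by auto
        have "N < 2 ^ J'" using J'(2) less_exp[of J'] by linarith
        then have "real N \<le> 2 ^ J'" by (metis of_nat_le_iff of_nat_numeral of_nat_power less_imp_le)
        then have "norm (w /\<^sub>R \<mu>) \<le> 2 ^ J'" using N by linarith
        then show ?thesis unfolding J'(1) sum_indicator_shell by (simp only: if_True)
      qed
      then have "\<forall>\<^sub>F J in sequentially. (\<Sum>j<J. ker \<kappa> \<tau> (x - w) * piece g \<mu> j w) = ?F w"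
        unfolding s eventually_sequentially by (intro exI[of _ "Suc N"]) simp
      then show "(\<lambda>J. \<Sum>j<J. ker \<kappa> \<tau> (x - w) * piece g \<mu> j w) \<longlonglongrightarrow> ?F w" by (rule tendsto_eventually)
    qed
    show "AE w in lborel. norm (\<Sum>j<J. ker \<kappa> \<tau> (x - w) * piece g \<mu> j w) \<le> norm (?F w)" for J
    proof (rule AE_I2)
      fix w :: R3
      have "\<bar>\<Sum>j<J. indicator (shell j) (w /\<^sub>R \<mu>)\<bar> \<le> (1::real)"
        by (cases J) (simp_all only: sum_indicator_shell, auto)
      from mult_right_mono[OF this norm_ge_zero[of "?F w"]]
      show "norm (\<Sum>j<J. ker \<kappa> \<tau> (x - w) * piece g \<mu> j w) \<le> norm (?F w)" unfolding s norm_scaleR by simp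
    qed
    show "integrable lborel (\<lambda>w. norm (?F w))" using iF by (rule integrable_norm)
    show "?F \<in> borel_measurable lborel" using iF by (rule borel_measurable_integrable)
    show "(\<lambda>w. \<Sum>j<J. ker \<kappa> \<tau> (x - w) * piece g \<mu> j w) \<in> borel_measurable lborel" for J
      using iP by (intro borel_measurable_sum borel_measurable_integrable)
  qed
  moreover have "(\<integral>w. (\<Sum>j<J. ker \<kappa> \<tau> (x - w) * piece g \<mu> j w) \<partial>lborel) = (\<Sum>j<J. \<integral>w. ker \<kappa> \<tau> (x - w) * piece g \<mu> j w \<partial>lborel)" for J
    by (rule Bochner_Integration.integral_sum[OF iP])
  ultimately show "(\<lambda>J. \<Sum>j<J. wave \<kappa> \<tau> (piece g \<mu> j) x) \<longlonglongrightarrow> wave \<kappa> \<tau> (\<lambda>w. g (w /\<^sub>R \<mu>)) x"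
    unfolding wave_def by (simp only:)
qed

section \<open>Interpolation and summation of mixed norms\<close>

lemma ennreal_rpow_ennreal: "0 \<le> y \<Longrightarrow> ennreal_rpow (ennreal y) a = ennreal (y powr a)"
  by (simp add: ennreal_rpow_def)

lemma ennreal_rpow_mono:
  assumes "x \<le> y" "0 \<le> a"
  shows "ennreal_rpow x a \<le> ennreal_rpow y a"
proof (cases "y = \<infinity>")
  case False
  then have "x \<noteq> \<infinity>" "x < top" "y < top" using assms(1) by (auto simp: less_top top_unique)
  moreover have "enn2real x powr a \<le> enn2real y powr a"
    using assms False by (intro powr_mono2 enn2real_mono) (auto simp: less_top)
  ultimately show ?thesis using False by (auto simp: ennreal_rpow_def intro: ennreal_leI)
qed (simp add: ennreal_rpow_def)

lemma ennreal_rpow_rpow: "ennreal_rpow (ennreal_rpow x a) b = ennreal_rpow x (a * b)"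
  by (simp add: ennreal_rpow_def powr_powr)

lemma ennreal_le_suminf: "f n \<le> (\<Sum>n. f n)" for f :: "nat \<Rightarrow> ennreal"
  using sum_le_suminf[of f "{n}"] by simp

text \<open>If Y^q is the sum on the right, every term satisfies y_i \<le> \<omega>_i Y, and summing
  gives S Y. The argument is the same for q below and above 1, and both occur.\<close>

lemma ennreal_rpow_suminf:
  fixes y \<omega> :: "nat \<Rightarrow> real"
  assumes y: "\<And>i. 0 \<le> y i" and \<omega>: "\<And>i. 0 < \<omega> i" "summable \<omega>" "suminf \<omega> \<le> S" and q: "0 < q"
  shows "ennreal_rpow (\<Sum>i. ennreal (y i)) q \<le> ennreal (S powr q) * (\<Sum>i. ennreal ((y i / \<omega> i) powr q))"
proof -
  have "0 < suminf \<omega>" using suminf_pos[OF \<omega>(2)] \<omega>(1) by blast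
  then have S: "S > 0" using \<omega>(3) by linarith
  let ?X = "\<Sum>i. ennreal ((y i / \<omega> i) powr q)"
  show ?thesis
  proof (cases "?X = \<infinity>")
    case True
    have "ennreal (S powr q) \<noteq> 0" using S by simp
    then show ?thesis unfolding True by (simp add: ennreal_mult_top)
  next
    case False
    have "\<exists>c\<ge>0. z = ennreal c" if "z \<noteq> \<infinity>" for z using that by (cases z) auto
    from this[OF False] obtain X where X: "?X = ennreal X" "X \<ge> 0" by blast
    define Y where "Y = X powr (1 / q)"
    have Y: "Y \<ge> 0" "Y powr q = X" using X q by (simp_all add: Y_def powr_powr)
    have yi: "y i \<le> \<omega> i * Y" for i
    proof -
      have "ennreal ((y i / \<omega> i) powr q) \<le> ?X"
        by (rule ennreal_le_suminf)
      then have "(y i / \<omega> i) powr q \<le> X" unfolding X using X by simp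
      then have "((y i / \<omega> i) powr q) powr (1 / q) \<le> Y" unfolding Y_def using q by (intro powr_mono2) auto
      then have "y i / \<omega> i \<le> Y" using q y[of i] \<omega>(1)[of i] by (simp add: powr_powr)
      then show ?thesis unfolding pos_divide_le_eq[OF \<omega>(1)] by (simp only: mult.commute)
    qed
    have "(\<Sum>i. ennreal (y i)) \<le> (\<Sum>i. ennreal (\<omega> i * Y))"
      by (intro suminf_le ennreal_leI yi) auto
    also have "\<dots> = ennreal (suminf \<omega> * Y)"
      unfolding suminf_mult2[OF \<omega>(2)]
      by (rule suminf_ennreal2) (use \<omega>(1,2) Y(1) in \<open>auto intro!: summable_mult2 mult_nonneg_nonneg intro: less_imp_le\<close>)
    also have "\<dots> \<le> ennreal (S * Y)" using \<omega> Y by (intro ennreal_leI mult_right_mono)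
    finally have "(\<Sum>i. ennreal (y i)) \<le> ennreal (S * Y)" .
    then have "ennreal_rpow (\<Sum>i. ennreal (y i)) q \<le> ennreal_rpow (ennreal (S * Y)) q"
      by (rule ennreal_rpow_mono) (use q in simp)
    also have "\<dots> = ennreal (S powr q * X)" using S Y by (simp add: ennreal_rpow_ennreal powr_mult)
    also have "\<dots> = ennreal (S powr q) * ?X" unfolding X using X by (simp add: ennreal_mult)
    finally show ?thesis .
  qed
qed

text \<open>Each value of the step function is held for a time 1/l.\<close>

lemma nn_integral_floor_steps:
  fixes A :: "nat \<Rightarrow> real"
  assumes A: "\<And>n. 0 \<le> A n" "summable A" "suminf A \<le> a" and l: "0 < l"
  shows "(\<integral>\<^sup>+s. ennreal (A (nat \<lfloor>l * s\<rfloor>)) * indicator {0..} s \<partial>lborel) \<le> ennreal (a / l)"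
proof -
  have "(\<integral>\<^sup>+s. ennreal (A (nat \<lfloor>l * s\<rfloor>)) * indicator {0..} s \<partial>lborel)
    \<le> (\<integral>\<^sup>+s. (\<Sum>n. ennreal (A n) * indicator {real n / l..(real n + 1) / l} s) \<partial>lborel)"
  proof (rule nn_integral_mono)
    fix s :: real
    show "ennreal (A (nat \<lfloor>l * s\<rfloor>)) * indicator {0..} s \<le> (\<Sum>n. ennreal (A n) * indicator {real n / l..(real n + 1) / l} s)"
    proof (cases "s \<ge> 0")
      case True
      define n where "n = nat \<lfloor>l * s\<rfloor>"
      have "0 \<le> l * s" using True l by simp
      then have "real n \<le> l * s" "l * s \<le> real n + 1" unfolding n_def by linarith+
      then have "s \<in> {real n / l..(real n + 1) / l}" using l by (simp add: field_simps)
      then have "ennreal (A n) * indicator {0..} s = ennreal (A n) * indicator {real n / l..(real n + 1) / l} s"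
        using True by simp
      also have "\<dots> \<le> (\<Sum>n. ennreal (A n) * indicator {real n / l..(real n + 1) / l} s)"
        by (rule ennreal_le_suminf)
      finally show ?thesis unfolding n_def .
    qed simp
  qed
  also have "\<dots> = (\<Sum>n. \<integral>\<^sup>+s. ennreal (A n) * indicator {real n / l..(real n + 1) / l} s \<partial>lborel)"
    by (rule nn_integral_suminf) measurable
  also have "\<dots> = (\<Sum>n. ennreal (A n * (1 / l)))"
  proof (rule suminf_cong)
    fix n
    have "(\<integral>\<^sup>+s. ennreal (A n) * indicator {real n / l..(real n + 1) / l} s \<partial>lborel) = ennreal (A n) * emeasure lborel {real n / l..(real n + 1) / l}"
      by (rule nn_integral_cmult_indicator) simp
    also have "emeasure lborel {real n / l..(real n + 1) / l} = ennreal (1 / l)"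
      using l by (subst emeasure_lborel_Icc) (auto simp: divide_right_mono diff_divide_distrib[symmetric])
    finally show "(\<integral>\<^sup>+s. ennreal (A n) * indicator {real n / l..(real n + 1) / l} s \<partial>lborel) = ennreal (A n * (1 / l))"
      using A(1)[of n] l by (simp only: ennreal_mult zero_le_divide_1_iff less_imp_le)
  qed
  also have "\<dots> = ennreal (suminf A * (1 / l))"
    unfolding suminf_mult2[OF A(2)]
    by (rule suminf_ennreal2) (use A l in \<open>auto intro!: summable_mult2 summable_divide\<close>)
  also have "\<dots> \<le> ennreal (a / l)" using A l by (intro ennreal_leI) (simp add: divide_right_mono)
  finally show ?thesis .
qed

text \<open>The pointwise-in-time bound interpolates \<open>L\<^sup>r\<close> between the weighted supremum, controlled by
  \<open>A\<close>, and the \<open>L\<^sup>2\<close> norm, controlled by \<open>B\<close>. The weights \<open>\<omega>\<close> replace Minkowski's inequality.\<close>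

lemma interpolated_norm_le:
  fixes p :: real and r :: ennreal and v :: "nat \<Rightarrow> R3 \<Rightarrow> real" and W :: "R3 \<Rightarrow> real" and A B \<omega> :: "nat \<Rightarrow> real"
    and u :: "R3 \<Rightarrow> ennreal"
  assumes p: "2 \<le> p" and r: "ennreal (1 / p) + 1 / r = 1 / 2"
    and um: "u \<in> borel_measurable borel" and vm: "\<And>i. v i \<in> borel_measurable borel"
    and v0: "\<And>i x. 0 \<le> v i x" and W0: "\<And>x. 0 \<le> W x" and A0: "\<And>i. 0 \<le> A i" and B0: "\<And>i. 0 \<le> B i"
    and u: "\<And>x. u x \<le> (\<Sum>i. ennreal (W x powr (1 / p) * v i x))"
    and A: "\<And>i x. W x * (v i x)\<^sup>2 \<le> A i"
    and B: "\<And>i. (\<integral>\<^sup>+x. ennreal ((v i x)\<^sup>2) \<partial>lborel) \<le> ennreal (B i)"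
    and \<omega>: "\<And>i. 0 < \<omega> i" "summable \<omega>" "suminf \<omega> \<le> S"
  defines "q \<equiv> (p - 2) / 2"
  shows "ennreal_rpow (Lq_norm lborel r u) p
    \<le> ennreal (S powr (p + q)) * (\<Sum>i. ennreal (\<omega> i powr (- (p + q)) * (if p = 2 then 1 else B i powr q) * A i))"
proof (cases "p = 2")
  case True
  \<comment> \<open>At p = 2 the space exponent is infinite: only the weighted suprema enter, and no
    interpolation takes place.\<close>
  have "1 / r = 0"
  proof -
    have h: "(1::ennreal) / 2 = ennreal (1 / 2)" by (simp add: divide_ennreal_def)
    have "ennreal (1 / 2) + 1 / r = ennreal (1 / 2) + 0" using r unfolding True h by (simp only: add_0_right)
    from ennreal_add_left_cancel[THEN iffD1, OF this] show ?thesis by simp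
  qed
  then have rt: "r = \<infinity>" by (simp add: divide_ennreal_def)
  have q: "q = 0" using True by (simp add: q_def)
  have vA: "W x powr (1 / 2) * v i x \<le> sqrt (A i)" for i x
  proof (rule real_le_rsqrt)
    have "(W x powr (1 / 2))\<^sup>2 = W x" using W0[of x] by (simp add: powr_half_sqrt)
    then show "(W x powr (1 / 2) * v i x)\<^sup>2 \<le> A i" using A[of x i] by (simp add: power_mult_distrib)
  qed
  have "esssup lborel u \<le> (\<Sum>i. ennreal (sqrt (A i)))"
  proof (rule esssup_I)
    show "u \<in> borel_measurable lborel" using um by simp
    have "u x \<le> (\<Sum>i. ennreal (sqrt (A i)))" for x
      using u[of x] vA[of x] unfolding True by (intro order_trans[OF u[of x, unfolded True]] suminf_le ennreal_leI) auto
    then show "AE x in lborel. u x \<le> (\<Sum>i. ennreal (sqrt (A i)))" by simp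
  qed
  then have "ennreal_rpow (Lq_norm lborel r u) p \<le> ennreal_rpow (\<Sum>i. ennreal (sqrt (A i))) 2"
    using True by (simp add: Lq_norm_def rt ennreal_rpow_mono)
  also have "\<dots> \<le> ennreal (S powr 2) * (\<Sum>i. ennreal ((sqrt (A i) / \<omega> i) powr 2))"
    by (rule ennreal_rpow_suminf) (use A0 \<omega> in auto)
  also have "(\<lambda>i. ennreal ((sqrt (A i) / \<omega> i) powr 2)) = (\<lambda>i. ennreal (\<omega> i powr (- 2) * A i))"
  proof
    fix i
    have "(sqrt (A i) / \<omega> i) powr 2 = sqrt (A i) powr 2 / \<omega> i powr 2"
      using A0[of i] \<omega>(1)[of i] by (intro powr_divide)
    also have "sqrt (A i) powr 2 = A i" using A0[of i] by (cases "A i = 0") (simp_all add: powr_half_sqrt[symmetric] powr_powr)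
    finally show "ennreal ((sqrt (A i) / \<omega> i) powr 2) = ennreal (\<omega> i powr (- 2) * A i)"
      by (simp add: powr_minus divide_inverse mult.commute)
  qed
  finally show ?thesis by (simp add: True q)
next
  case False
  then have p2: "p > 2" using p by simp
  then have q: "q > 0" by (simp add: q_def)
  \<comment> \<open>The finite exponent dual to p in the relation 1/p + 1/r = 1/2; it satisfies r' q
    = p.\<close>
  define r' where "r' = 2 * p / (p - 2)"
  have r'0: "r' > 2" using p2 by (simp add: r'_def field_simps)
  have r'q: "r' * q = p" using p2 by (simp add: r'_def q_def)
  have rr: "r = ennreal r'"
  proof -
    have "(1::ennreal) / 2 = ennreal (1 / 2)" by (simp add: divide_ennreal_def)
    also have "\<dots> = ennreal (1 / p) + ennreal (1 / 2 - 1 / p)"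
      using p2 by (subst ennreal_plus[symmetric]) (auto simp: field_simps)
    finally have "ennreal (1 / p) + 1 / r = ennreal (1 / p) + ennreal (1 / 2 - 1 / p)" using r by (simp only:)
    from ennreal_add_left_cancel[THEN iffD1, OF this] have e: "1 / r = ennreal (1 / 2 - 1 / p)" by simp
    have pos: "1 / 2 - 1 / p > 0" using p2 by (simp add: field_simps)
    show ?thesis
    proof (cases r)
      case (real y)
      have "y \<noteq> 0"
      proof
        assume "y = 0"
        then have "1 / r = \<infinity>" using real by (simp add: divide_ennreal_def)
        then show False using e by simp
      qed
      then have y: "y > 0" using real by simp
      then have "ennreal (1 / y) = ennreal (1 / 2 - 1 / p)" using e real by (simp add: divide_ennreal[symmetric])
      then have "1 / y = 1 / 2 - 1 / p" using y pos by (subst (asm) ennreal_inj) auto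
      then have "y = r'" using y p2 by (simp add: r'_def field_simps)
      then show ?thesis using real by simp
    next
      case top
      then have "1 / r = 0" by (simp add: divide_ennreal_def)
      then show ?thesis using e pos by simp
    qed
  qed
  have S: "S \<ge> 0" using suminf_nonneg[OF \<omega>(2)] \<omega>(1,3) by (meson less_imp_le order_trans)
  define c where "c i = \<omega> i powr (- r') * (A i powr ((r' - 2) / 2) * B i)" for i
  have c0: "c i \<ge> 0" for i using B0 by (simp add: c_def)
  \<comment> \<open>The interpolation itself: because r'/p = (r' - 2)/2, the r'-th power is (W
    v^2)^((r'-2)/2) v^2, a power of the weighted supremum times the L^2 density.\<close>
  have pt: "(W x powr (1 / p) * v i x) powr r' \<le> A i powr ((r' - 2) / 2) * (v i x)\<^sup>2" for i x
  proof (cases "v i x = 0")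
    case False
    then have v: "v i x > 0" using v0[of i x] by simp
    have e: "r' / p = (r' - 2) / 2" using p2 by (simp add: r'_def field_simps)
    have "(W x powr (1 / p) * v i x) powr r' = W x powr ((r' - 2) / 2) * v i x powr r'"
      using W0[of x] v by (simp add: powr_mult powr_powr e[symmetric])
    also have "v i x powr r' = ((v i x)\<^sup>2) powr ((r' - 2) / 2) * (v i x)\<^sup>2"
    proof -
      have e: "(v i x)\<^sup>2 = v i x powr 2" using v powr_realpow[of "v i x" 2] by simp
      show ?thesis unfolding e powr_powr powr_add[symmetric] by (simp add: field_simps)
    qed
    also have "W x powr ((r' - 2) / 2) * (((v i x)\<^sup>2) powr ((r' - 2) / 2) * (v i x)\<^sup>2) = (W x * (v i x)\<^sup>2) powr ((r' - 2) / 2) * (v i x)\<^sup>2"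
      using W0[of x] by (simp add: powr_mult)
    also have "\<dots> \<le> A i powr ((r' - 2) / 2) * (v i x)\<^sup>2"
      using A[of x i] W0[of x] r'0 by (intro mult_right_mono powr_mono2) auto
    finally show ?thesis .
  qed simp
  have "(\<integral>\<^sup>+x. ennreal_rpow (u x) r' \<partial>lborel) \<le> (\<integral>\<^sup>+x. ennreal (S powr r') * (\<Sum>i. ennreal (\<omega> i powr (- r') * A i powr ((r' - 2) / 2)) * ennreal ((v i x)\<^sup>2)) \<partial>lborel)"
  proof (rule nn_integral_mono)
    fix x
    have "ennreal_rpow (u x) r' \<le> ennreal_rpow (\<Sum>i. ennreal (W x powr (1 / p) * v i x)) r'"
      using r'0 by (intro ennreal_rpow_mono u) auto
    also have "\<dots> \<le> ennreal (S powr r') * (\<Sum>i. ennreal (((W x powr (1 / p) * v i x) / \<omega> i) powr r'))"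
      by (rule ennreal_rpow_suminf) (use v0 \<omega> r'0 in auto)
    also have "\<dots> \<le> ennreal (S powr r') * (\<Sum>i. ennreal (\<omega> i powr (- r') * A i powr ((r' - 2) / 2)) * ennreal ((v i x)\<^sup>2))"
    proof (intro mult_left_mono suminf_le)
      fix i
      have "((W x powr (1 / p) * v i x) / \<omega> i) powr r' = \<omega> i powr (- r') * (W x powr (1 / p) * v i x) powr r'"
        using v0[of i x] \<omega>(1)[of i] by (subst powr_divide) (auto simp: powr_minus divide_inverse mult.commute)
      also have "\<dots> \<le> \<omega> i powr (- r') * (A i powr ((r' - 2) / 2) * (v i x)\<^sup>2)"
        by (intro mult_left_mono pt) simp
      finally show "ennreal (((W x powr (1 / p) * v i x) / \<omega> i) powr r') \<le> ennreal (\<omega> i powr (- r') * A i powr ((r' - 2) / 2)) * ennreal ((v i x)\<^sup>2)"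
        by (subst ennreal_mult[symmetric]) (auto simp: mult.assoc intro!: ennreal_leI)
    qed auto
    finally show "ennreal_rpow (u x) r' \<le> ennreal (S powr r') * (\<Sum>i. ennreal (\<omega> i powr (- r') * A i powr ((r' - 2) / 2)) * ennreal ((v i x)\<^sup>2))" .
  qed
  also have "\<dots> = ennreal (S powr r') * (\<Sum>i. ennreal (\<omega> i powr (- r') * A i powr ((r' - 2) / 2)) * (\<integral>\<^sup>+x. ennreal ((v i x)\<^sup>2) \<partial>lborel))"
  proof -
    have [measurable]: "v i \<in> borel_measurable borel" for i by (rule vm)
    show ?thesis by (simp add: nn_integral_cmult nn_integral_suminf)
  qed
  also have "\<dots> \<le> ennreal (S powr r') * (\<Sum>i. ennreal (\<omega> i powr (- r') * A i powr ((r' - 2) / 2)) * ennreal (B i))"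
    by (intro mult_left_mono suminf_le B) auto
  also have "\<dots> = (\<Sum>i. ennreal (S powr r' * c i))"
    using B0 by (simp add: c_def ennreal_mult[symmetric] mult.assoc flip: ennreal_suminf_cmult)
  finally have Z: "(\<integral>\<^sup>+x. ennreal_rpow (u x) r' \<partial>lborel) \<le> (\<Sum>i. ennreal (S powr r' * c i))" .
  have "Lq_norm lborel r u = ennreal_rpow (\<integral>\<^sup>+x. ennreal_rpow (u x) r' \<partial>lborel) (1 / r')"
    using r'0 by (simp add: Lq_norm_def rr)
  then have "ennreal_rpow (Lq_norm lborel r u) p = ennreal_rpow (\<integral>\<^sup>+x. ennreal_rpow (u x) r' \<partial>lborel) q"
    using r'0 by (simp add: ennreal_rpow_rpow r'q[symmetric])
  also have "\<dots> \<le> ennreal_rpow (\<Sum>i. ennreal (S powr r' * c i)) q"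
    using q by (intro ennreal_rpow_mono Z) auto
  \<comment> \<open>The weights are spent a second time, now outside the space integral. This is why
    the total exponent of \<omega> and S is p + q.\<close>
  also have "\<dots> \<le> ennreal (S powr q) * (\<Sum>i. ennreal ((S powr r' * c i / \<omega> i) powr q))"
    by (rule ennreal_rpow_suminf) (use c0 \<omega> q in auto)
  also have "\<dots> = ennreal (S powr q) * (\<Sum>i. ennreal (S powr p) * ennreal (\<omega> i powr (- (p + q)) * (B i powr q) * A i))"
  proof -
    have "(S powr r' * c i / \<omega> i) powr q = S powr p * (\<omega> i powr (- (p + q)) * (B i powr q) * A i)" for i
    proof -
      have w: "\<omega> i > 0" by (rule \<omega>)
      have 1: "(A i powr ((r' - 2) / 2)) powr q = A i"
      proof -
        have "(r' - 2) / 2 * q = 1" using p2 by (simp add: r'_def q_def field_simps)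
        then show ?thesis using A0[of i] by (simp add: powr_powr)
      qed
      have "(S powr r' * c i / \<omega> i) powr q = ((S powr r') powr q * (c i powr q)) / (\<omega> i powr q)"
        using c0[of i] w by (simp add: powr_mult powr_divide)
      also have "(S powr r') powr q = S powr p" by (simp add: powr_powr r'q)
      also have "c i powr q = (\<omega> i powr (- r')) powr q * ((A i powr ((r' - 2) / 2)) powr q * B i powr q)"
        unfolding c_def using B0[of i] by (simp add: powr_mult)
      also have "(\<omega> i powr (- r')) powr q = \<omega> i powr (- p)" by (simp add: powr_powr r'q)
      also have "S powr p * (\<omega> i powr (- p) * ((A i powr ((r' - 2) / 2)) powr q * B i powr q)) / \<omega> i powr q
        = S powr p * ((\<omega> i powr (- p) * \<omega> i powr (- q)) * (B i powr q) * A i)"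
        unfolding 1 by (simp add: powr_minus[of _ q] divide_inverse mult_ac)
      also have "\<omega> i powr (- p) * \<omega> i powr (- q) = \<omega> i powr (- (p + q))" by (simp add: powr_add[symmetric])
      finally show ?thesis .
    qed
    then show ?thesis using A0 by (simp add: ennreal_mult)
  qed
  also have "\<dots> = ennreal (S powr (p + q)) * (\<Sum>i. ennreal (\<omega> i powr (- (p + q)) * (B i powr q) * A i))"
  proof -
    have "ennreal (S powr q) * ennreal (S powr p) = ennreal (S powr (p + q))"
      by (simp add: ennreal_mult[symmetric] powr_add mult.commute)
    then show ?thesis unfolding ennreal_suminf_cmult by (simp only: mult.assoc[symmetric])
  qed
  finally show ?thesis using False by simp
qed

text \<open>In time, the i-th piece enters linearly through the step function A_i at the floor of
  l_i s, so the integral over any [t0, t] is at most a_i / l_i and the bound is independent of the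
  interval. The case p = 2 is split off because \<open>powr\<close> gives 0, not 1, for base 0 and
  exponent 0.\<close>

lemma mixed_norm_le:
  fixes p :: real and r :: ennreal and v :: "nat \<Rightarrow> real \<Rightarrow> R3 \<Rightarrow> real" and W :: "real \<Rightarrow> R3 \<Rightarrow> real"
    and A :: "nat \<Rightarrow> nat \<Rightarrow> real" and B \<omega> l a :: "nat \<Rightarrow> real" and u :: "real \<Rightarrow> R3 \<Rightarrow> ennreal"
  assumes p: "2 \<le> p" and r: "ennreal (1 / p) + 1 / r = 1 / 2"
    and um: "\<And>s. 0 \<le> s \<Longrightarrow> u s \<in> borel_measurable borel" and vm: "\<And>i s. v i s \<in> borel_measurable borel"
    and v0: "\<And>i s x. 0 \<le> v i s x" and W0: "\<And>s x. 0 \<le> s \<Longrightarrow> 0 \<le> W s x" and A0: "\<And>i n. 0 \<le> A i n" and B0: "\<And>i. 0 \<le> B i"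
    and u: "\<And>s x. 0 \<le> s \<Longrightarrow> u s x \<le> (\<Sum>i. ennreal (W s x powr (1 / p) * v i s x))"
    and A: "\<And>i s x. 0 \<le> s \<Longrightarrow> W s x * (v i s x)\<^sup>2 \<le> A i (nat \<lfloor>l i * s\<rfloor>)"
    and B: "\<And>i s. 0 \<le> s \<Longrightarrow> (\<integral>\<^sup>+x. ennreal ((v i s x)\<^sup>2) \<partial>lborel) \<le> ennreal (B i)"
    and \<omega>: "\<And>i. 0 < \<omega> i" "summable \<omega>" "suminf \<omega> \<le> S"
    and l: "\<And>i. 0 < l i" and a: "\<And>i. summable (A i)" "\<And>i. suminf (A i) \<le> a i"
    and T: "(\<Sum>i. ennreal (\<omega> i powr (- (p + (p - 2) / 2)) * (if p = 2 then 1 else B i powr ((p - 2) / 2)) * (a i / l i))) \<le> ennreal T" "0 \<le> T"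
    and t: "0 \<le> t0"
  shows "mixed_norm t0 t p r u \<le> ennreal ((S powr (p + (p - 2) / 2) * T) powr (1 / p))"
proof -
  let ?q = "(p - 2) / 2"
  define e where "e i = \<omega> i powr (- (p + ?q)) * (if p = 2 then 1 else B i powr ?q)" for i
  have e0: "e i \<ge> 0" for i by (simp add: e_def)
  have a0: "a i \<ge> 0" for i using suminf_nonneg[OF a(1)[of i]] A0 a(2)[of i] by (meson order_trans)
  let ?R = "\<lambda>s. ennreal (S powr (p + ?q)) * (\<Sum>i. ennreal (e i) * (ennreal (A i (nat \<lfloor>l i * s\<rfloor>)) * indicator {0..} s))"
  have "(\<integral>\<^sup>+s. ennreal_rpow (Lq_norm lborel r (u s)) p \<partial>restrict_space lborel {t0..t})
     = (\<integral>\<^sup>+s. ennreal_rpow (Lq_norm lborel r (u s)) p * indicator {t0..t} s \<partial>lborel)"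
    by (rule nn_integral_restrict_space) simp
  also have "\<dots> \<le> (\<integral>\<^sup>+s. ?R s \<partial>lborel)"
  proof (rule nn_integral_mono)
    fix s
    show "ennreal_rpow (Lq_norm lborel r (u s)) p * indicator {t0..t} s \<le> ?R s"
    proof (cases "s \<in> {t0..t}")
      case True
      then have s: "0 \<le> s" using t by simp
      have "ennreal_rpow (Lq_norm lborel r (u s)) p
        \<le> ennreal (S powr (p + ?q)) * (\<Sum>i. ennreal (\<omega> i powr (- (p + ?q)) * (if p = 2 then 1 else B i powr ?q) * A i (nat \<lfloor>l i * s\<rfloor>)))"
        by (rule interpolated_norm_le[OF p r um[OF s] vm v0 W0[OF s] A0 B0 u[OF s] A[OF s] B[OF s] \<omega>])
      also have "\<dots> = ?R s" unfolding e_def[symmetric] using s e0 A0 by (simp only: ennreal_mult indicator_simps atLeast_iff if_True simp_thms mult_1_right)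
      finally show ?thesis using True by simp
    qed simp
  qed
  also have "\<dots> = ennreal (S powr (p + ?q)) * (\<Sum>i. ennreal (e i) * (\<integral>\<^sup>+s. ennreal (A i (nat \<lfloor>l i * s\<rfloor>)) * indicator {0..} s \<partial>lborel))"
  proof -
    have m: "(\<lambda>s. ennreal (A i (nat \<lfloor>l i * s\<rfloor>)) * indicator {0..} s) \<in> borel_measurable lborel" for i
    proof -
      have "(\<lambda>s. \<lfloor>l i * s\<rfloor>) \<in> measurable borel (count_space UNIV)" by measurable
      then have "(\<lambda>s. ennreal (A i (nat \<lfloor>l i * s\<rfloor>))) \<in> borel_measurable borel"
        by (rule measurable_compose[where g="\<lambda>n. ennreal (A i (nat n))"]) simp
      then show ?thesis by simp
    qed
    show ?thesis using m by (simp add: nn_integral_cmult nn_integral_suminf)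
  qed
  also have "\<dots> \<le> ennreal (S powr (p + ?q)) * (\<Sum>i. ennreal (e i) * ennreal (a i / l i))"
    by (intro mult_left_mono suminf_le nn_integral_floor_steps A0 a l) auto
  also have "\<dots> = ennreal (S powr (p + ?q)) * (\<Sum>i. ennreal (e i * (a i / l i)))"
    using e0 a0 l by (subst ennreal_mult) (auto simp: less_imp_le)
  also have "\<dots> \<le> ennreal (S powr (p + ?q)) * ennreal T"
    using T(1) by (intro mult_left_mono) (auto simp: e_def)
  also have "\<dots> = ennreal (S powr (p + ?q) * T)" using T(2) by (simp add: ennreal_mult)
  finally have I: "(\<integral>\<^sup>+s. ennreal_rpow (Lq_norm lborel r (u s)) p \<partial>restrict_space lborel {t0..t}) \<le> ennreal (S powr (p + ?q) * T)" .
  have "mixed_norm t0 t p r u = ennreal_rpow (\<integral>\<^sup>+s. ennreal_rpow (Lq_norm lborel r (u s)) p \<partial>restrict_space lborel {t0..t}) (1 / p)"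
    using p by (simp add: mixed_norm_def Lq_norm_def)
  also have "\<dots> \<le> ennreal_rpow (ennreal (S powr (p + ?q) * T)) (1 / p)"
    using p by (intro ennreal_rpow_mono I) auto
  also have "\<dots> = ennreal ((S powr (p + ?q) * T) powr (1 / p))" using T(2) by (simp add: ennreal_rpow_ennreal)
  finally show ?thesis .
qed

section \<open>Summation of the dyadic pieces\<close>

lemma sqint_of_nn_integral_le:
  assumes [measurable]: "g \<in> borel_measurable borel"
    and le: "(\<integral>\<^sup>+y. ennreal ((norm (g y))\<^sup>2) \<partial>lborel) \<le> ennreal c" and c: "0 \<le> c"
  shows "sqint g" "sqnorm g \<le> c"
proof -
  have "(\<integral>\<^sup>+y. ennreal ((norm (g y))\<^sup>2) \<partial>lborel) < \<infinity>"
    by (rule le_less_trans[OF le]) simp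
  then show G: "sqint g" unfolding sqint_def by (intro conjI integrableI_bounded) auto
  show "sqnorm g \<le> c" using le unfolding nn_integral_sqnorm[OF G] using c by (simp add: sqnorm_nonneg)
qed

lemma jbracket_ge: "1 \<le> jbracket y" "norm y \<le> jbracket y"
  unfolding jbracket_def by (auto intro: real_le_rsqrt)

text \<open>On the shell the bracket is at least 2^(j-1), for j = 0 because it is at least 1. The
  factor 4 covers the loss 2^(2a), as a \<le> 1.\<close>

lemma jbracket_shell:
  assumes y: "y \<in> shell j" and a: "0 \<le> a" "a \<le> 1"
  shows "1 \<le> 4 * 2 powr (- (2 * a * real j)) * (jbracket y powr a)\<^sup>2"
proof -
  have "2 powr (real j - 1) \<le> jbracket y"
  proof (cases j)
    case 0
    then show ?thesis using jbracket_ge(1)[of y] by (simp add: powr_minus)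
  next
    case (Suc n)
    then have "2 ^ n < norm y" using y by (simp add: shell_def)
    then show ?thesis using jbracket_ge(2)[of y] Suc by (simp add: powr_realpow)
  qed
  then have "(2 powr (real j - 1)) powr (2 * a) \<le> jbracket y powr (2 * a)"
    using a by (intro powr_mono2) auto
  moreover have "jbracket y powr (2 * a) = (jbracket y powr a)\<^sup>2"
    using jbracket_ge(1)[of y] by (simp add: power2_eq_square powr_add[symmetric])
  ultimately have "2 powr ((real j - 1) * (2 * a)) \<le> (jbracket y powr a)\<^sup>2" by (simp add: powr_powr)
  then have "4 * 2 powr (- (2 * a * real j)) * 2 powr ((real j - 1) * (2 * a)) \<le> 4 * 2 powr (- (2 * a * real j)) * (jbracket y powr a)\<^sup>2"
    by (intro mult_left_mono) auto
  moreover have "4 * 2 powr (- (2 * a * real j)) * 2 powr ((real j - 1) * (2 * a)) = 2 powr (2 - 2 * a)"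
  proof -
    have "(4::real) = 2 powr 2" by simp
    moreover have "2 + (- (2 * a * real j)) + (real j - 1) * (2 * a) = 2 - 2 * a" by (simp add: algebra_simps)
    ultimately show ?thesis by (simp only: powr_add[symmetric])
  qed
  moreover have "1 \<le> 2 powr (2 - 2 * a)" using a by (intro ge_one_powr_ge_zero) auto
  ultimately show ?thesis by linarith
qed

lemma measurable_jbracket [measurable]: "jbracket \<in> borel_measurable borel"
  unfolding jbracket_def by measurable

lemma measurable_piece [measurable]:
  assumes [measurable]: "g \<in> borel_measurable borel"
  shows "piece g \<mu> j \<in> borel_measurable borel"
  unfolding piece_def by measurable

text \<open>\<mu>^3 is the Jacobian of the dilation; the shell turns the weighted norm of the datum
  into decay in \<open>j\<close>.\<close>

lemma piece_bound:
  assumes [measurable]: "g \<in> borel_measurable borel" and \<mu>: "0 < \<mu>" and a: "0 \<le> a" "a \<le> 1" and \<Gamma>: "0 \<le> \<Gamma>"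
    and G: "(\<integral>\<^sup>+y. ennreal ((jbracket y powr a * norm (g y))\<^sup>2) \<partial>lborel) \<le> ennreal (\<Gamma>\<^sup>2)"
  shows "sqint (piece g \<mu> j)" "sqnorm (piece g \<mu> j) \<le> \<mu> ^ 3 * (4 * 2 powr (- (2 * a * real j)) * \<Gamma>\<^sup>2)"
proof -
  let ?c = "4 * 2 powr (- (2 * a * real j))"
  have "(\<integral>\<^sup>+w. ennreal ((norm (piece g \<mu> j w))\<^sup>2) \<partial>lborel) = ennreal (\<mu> ^ 3) * (\<integral>\<^sup>+y. ennreal ((norm (piece g \<mu> j (\<mu> *\<^sub>R y)))\<^sup>2) \<partial>lborel)"
    using \<mu> by (subst nn_integral_affine[of _ \<mu> 0]) auto
  also have "\<dots> \<le> ennreal (\<mu> ^ 3) * (\<integral>\<^sup>+y. ennreal ?c * ennreal ((jbracket y powr a * norm (g y))\<^sup>2) \<partial>lborel)"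
  proof (intro mult_left_mono nn_integral_mono)
    fix y
    have "(norm (piece g \<mu> j (\<mu> *\<^sub>R y)))\<^sup>2 \<le> ?c * (jbracket y powr a * norm (g y))\<^sup>2"
    proof (cases "y \<in> shell j")
      case True
      have "(norm (g y))\<^sup>2 * 1 \<le> (norm (g y))\<^sup>2 * (?c * (jbracket y powr a)\<^sup>2)"
        by (intro mult_left_mono jbracket_shell True a) auto
      then show ?thesis using True \<mu> by (simp add: piece_def power_mult_distrib mult_ac)
    qed (use \<mu> in \<open>simp add: piece_def\<close>)
    then show "ennreal ((norm (piece g \<mu> j (\<mu> *\<^sub>R y)))\<^sup>2) \<le> ennreal ?c * ennreal ((jbracket y powr a * norm (g y))\<^sup>2)"
      by (subst ennreal_mult[symmetric]) (auto intro: ennreal_leI)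
  qed simp
  also have "\<dots> \<le> ennreal (\<mu> ^ 3) * (ennreal ?c * ennreal (\<Gamma>\<^sup>2))"
    by (subst nn_integral_cmult) (auto intro!: mult_left_mono G)
  also have "\<dots> = ennreal (\<mu> ^ 3 * (?c * \<Gamma>\<^sup>2))"
    using \<mu> by (subst ennreal_mult[symmetric], simp, simp, subst ennreal_mult[symmetric]) auto
  finally have le: "(\<integral>\<^sup>+w. ennreal ((norm (piece g \<mu> j w))\<^sup>2) \<partial>lborel) \<le> ennreal (\<mu> ^ 3 * (?c * \<Gamma>\<^sup>2))" .
  have "0 \<le> \<mu> ^ 3 * (?c * \<Gamma>\<^sup>2)" using \<mu> by simp
  from sqint_of_nn_integral_le[OF _ le this]
  show "sqint (piece g \<mu> j)" "sqnorm (piece g \<mu> j) \<le> \<mu> ^ 3 * (?c * \<Gamma>\<^sup>2)" by simp_all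
qed

lemma piece_support: "0 < \<mu> \<Longrightarrow> \<mu> * 2 ^ j < norm w \<Longrightarrow> piece g \<mu> j w = 0"
  by (auto simp: piece_def shell_def indicator_def field_simps)

text \<open>Multiplying the weight by \<mu> turns its constant 1 into \<mu>, which for high
  frequencies exceeds 1. It is bounded by 1 + \<mu>^2, hence by 1 plus the squared radius of the
  piece: this is the origin of R^2 in the unit-frequency weight.\<close>

lemma space_time_weight_le:
  fixes x :: R3
  assumes \<mu>: "0 < \<mu>" and s: "0 \<le> s"
  shows "1 + s + norm x \<le> (1 + (\<mu> * 2 ^ j)\<^sup>2 + \<mu> * s + norm (\<mu> *\<^sub>R x)) / \<mu>"
proof -
  have "2 * \<mu> \<le> 1 + \<mu>\<^sup>2" using sum_squares_bound[of 1 \<mu>] by simp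
  moreover have "\<mu>\<^sup>2 \<le> (\<mu> * 2 ^ j)\<^sup>2"
    using \<mu> by (intro power_mono) (auto simp: mult_le_cancel_left1)
  ultimately have "\<mu> \<le> 1 + (\<mu> * 2 ^ j)\<^sup>2" using \<mu> by linarith
  then have "(1 + s + norm x) * \<mu> \<le> 1 + (\<mu> * 2 ^ j)\<^sup>2 + \<mu> * s + norm (\<mu> *\<^sub>R x)"
    using \<mu> by (simp add: algebra_simps)
  then show ?thesis using \<mu> by (simp add: pos_le_divide_eq)
qed

lemma inverse_power_powr: "0 < x \<Longrightarrow> 1 / x ^ n = x powr (- real n)" for x :: real
  by (simp add: powr_minus powr_realpow divide_inverse)

text \<open>Undoes the rescaling in the unit estimate and in the L^2 bound with R = \<mu> 2^j. In
  the first, \<mu>^3 is the dilated datum, \<mu>^\<eta> comes from R^\<eta>, \<mu>^(-\<beta>) from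
  the weight and \<mu>^(-2\<theta>) from the multiplier. In the second, the dilations of datum and
  solution cancel.\<close>

lemma piece_estimates:
  fixes \<theta> :: nat
  assumes cut: "lp_cutoff \<psi>" and \<beta>: "0 < \<beta>" "\<beta> < 1" and \<eta>: "2 * \<beta> < \<eta>" "\<eta> \<le> 2" and a: "0 \<le> a" "a \<le> 1"
  obtains U L where "0 < U" "0 < L"
    "\<And>g \<mu> j \<sigma> \<Gamma>. g \<in> borel_measurable borel \<Longrightarrow> 0 < \<mu> \<Longrightarrow> \<bar>\<sigma>\<bar> = 1 \<Longrightarrow> 0 \<le> \<Gamma> \<Longrightarrow>
      (\<integral>\<^sup>+y. ennreal ((jbracket y powr a * norm (g y))\<^sup>2) \<partial>lborel) \<le> ennreal (\<Gamma>\<^sup>2) \<Longrightarrow>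
      \<exists>A. (\<forall>n. 0 \<le> A n) \<and> summable A \<and> suminf A \<le> U * \<mu> powr (3 + \<eta> - \<beta> - 2 * real \<theta>) * 2 powr ((\<eta> - 2 * a) * real j) * \<Gamma>\<^sup>2 \<and>
        (\<forall>s x. 0 \<le> s \<longrightarrow> (1 + s + norm x) powr \<beta> * (1 / \<mu> ^ \<theta> * norm (wave (annulus \<psi> \<theta>) (\<mu> * (\<sigma> * s)) (piece g \<mu> j) (\<mu> *\<^sub>R x)))\<^sup>2 \<le> A (nat \<lfloor>\<mu> * s\<rfloor>))"
    "\<And>g \<mu> j \<tau> \<Gamma>. g \<in> borel_measurable borel \<Longrightarrow> 0 < \<mu> \<Longrightarrow> 0 \<le> \<Gamma> \<Longrightarrow>
      (\<integral>\<^sup>+y. ennreal ((jbracket y powr a * norm (g y))\<^sup>2) \<partial>lborel) \<le> ennreal (\<Gamma>\<^sup>2) \<Longrightarrow>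
      (\<integral>\<^sup>+x. ennreal ((1 / \<mu> ^ \<theta> * norm (wave (annulus \<psi> \<theta>) \<tau> (piece g \<mu> j) (\<mu> *\<^sub>R x)))\<^sup>2) \<partial>lborel)
        \<le> ennreal (L * \<mu> powr (- 2 * real \<theta>) * 2 powr (- 2 * a * real j) * \<Gamma>\<^sup>2)"
proof -
  have bk: "bump (annulus \<psi> \<theta>)" by (rule bump_annulus[OF cut])
  obtain U where U: "U > 0" and
    unit: "\<forall>R>0. \<forall>g \<sigma>. sqint g \<longrightarrow> (\<forall>y. R < norm y \<longrightarrow> g y = 0) \<longrightarrow> \<bar>\<sigma>\<bar> = 1 \<longrightarrow>
      (\<exists>M::nat\<Rightarrow>real. (\<forall>n. 0 \<le> M n) \<and> (\<forall>n t x. real n \<le> t \<longrightarrow> t \<le> real n + 1 \<longrightarrow>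
        (1 + R\<^sup>2 + t + norm x) powr \<beta> * (norm (wave (annulus \<psi> \<theta>) (\<sigma> * t) g x))\<^sup>2 \<le> M n) \<and> summable M \<and> suminf M \<le> U * R powr \<eta> * sqnorm g)"
    using unit_estimate[OF bk \<beta> \<eta>] by (elim exE conjE)
  obtain L where L: "L \<ge> 0" and
    L2: "\<forall>g R \<tau>. sqint g \<longrightarrow> (\<forall>y. R < norm y \<longrightarrow> g y = 0) \<longrightarrow>
      sqint (wave (annulus \<psi> \<theta>) \<tau> g) \<and> sqnorm (wave (annulus \<psi> \<theta>) \<tau> g) \<le> L * sqnorm g"
    using wave_L2[OF bk] by (elim exE conjE)
  show thesis
  \<comment> \<open>4 is the constant lost on a spatial shell; L + 1 makes the second constant
    strictly positive.\<close>
  proof (rule that[of "4 * U" "4 * (L + 1)"])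
    show "0 < 4 * U" "0 < 4 * (L + 1)" using U L by auto
  next
    fix g :: "R3 \<Rightarrow> complex" and \<mu> \<sigma> \<Gamma> :: real and j :: nat assume g: "g \<in> borel_measurable borel" and \<mu>: "0 < \<mu>" and \<sigma>: "\<bar>\<sigma>\<bar> = (1::real)" and \<Gamma>: "0 \<le> \<Gamma>"
      and G: "(\<integral>\<^sup>+y. ennreal ((jbracket y powr a * norm (g y))\<^sup>2) \<partial>lborel) \<le> ennreal (\<Gamma>\<^sup>2)"
    note P = piece_bound[OF g \<mu> a \<Gamma> G, of j]
    let ?R = "\<mu> * 2 ^ j"
    have R: "?R > 0" using \<mu> by simp
    have supp: "\<forall>y. ?R < norm y \<longrightarrow> piece g \<mu> j y = 0" using piece_support[OF \<mu>] by blast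
    obtain M :: "nat \<Rightarrow> real" where M: "\<forall>n. 0 \<le> M n" "summable M" "suminf M \<le> U * ?R powr \<eta> * sqnorm (piece g \<mu> j)" and
      Mb: "\<forall>n t x. real n \<le> t \<longrightarrow> t \<le> real n + 1 \<longrightarrow>
        (1 + ?R\<^sup>2 + t + norm x) powr \<beta> * (norm (wave (annulus \<psi> \<theta>) (\<sigma> * t) (piece g \<mu> j) x))\<^sup>2 \<le> M n"
      using unit[THEN spec, of ?R, THEN mp, OF R, THEN spec, of "piece g \<mu> j", THEN spec, of \<sigma>,
        THEN mp, OF P(1), THEN mp, OF supp, THEN mp, OF \<sigma>] by (elim exE conjE)
    let ?e = "\<mu> powr (- \<beta> - 2 * real \<theta>)"
    have e: "(1 / \<mu> powr \<beta>) * (1 / \<mu> ^ \<theta>)\<^sup>2 = ?e"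
      unfolding inverse_power_powr[OF \<mu>] power2_eq_square powr_minus_divide[symmetric] powr_add[symmetric] by simp
    show "\<exists>A. (\<forall>n. 0 \<le> A n) \<and> summable A \<and> suminf A \<le> (4 * U) * \<mu> powr (3 + \<eta> - \<beta> - 2 * real \<theta>) * 2 powr ((\<eta> - 2 * a) * real j) * \<Gamma>\<^sup>2 \<and>
        (\<forall>s x. 0 \<le> s \<longrightarrow> (1 + s + norm x) powr \<beta> * (1 / \<mu> ^ \<theta> * norm (wave (annulus \<psi> \<theta>) (\<mu> * (\<sigma> * s)) (piece g \<mu> j) (\<mu> *\<^sub>R x)))\<^sup>2 \<le> A (nat \<lfloor>\<mu> * s\<rfloor>))"
    proof (intro exI[of _ "\<lambda>n. ?e * M n"] conjI allI impI)
      show "0 \<le> ?e * M n" for n using M by simp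
      show "summable (\<lambda>n. ?e * M n)" by (intro summable_mult M)
      have "suminf (\<lambda>n. ?e * M n) = ?e * suminf M" by (intro suminf_mult M)
      also have "\<dots> \<le> ?e * (U * ?R powr \<eta> * (\<mu> ^ 3 * (4 * 2 powr (- (2 * a * real j)) * \<Gamma>\<^sup>2)))"
        using U by (intro mult_left_mono order_trans[OF M(3)] P) auto
      also have "?R powr \<eta> = \<mu> powr \<eta> * 2 powr (real j * \<eta>)"
        using \<mu> by (simp add: powr_mult powr_realpow[symmetric] powr_powr)
      also have "?e * (U * (\<mu> powr \<eta> * 2 powr (real j * \<eta>)) * (\<mu> ^ 3 * (4 * 2 powr (- (2 * a * real j)) * \<Gamma>\<^sup>2)))
        = 4 * U * (?e * \<mu> powr \<eta> * \<mu> ^ 3) * (2 powr (real j * \<eta>) * 2 powr (- (2 * a * real j))) * \<Gamma>\<^sup>2" by (simp only: mult_ac)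
      also have "?e * \<mu> powr \<eta> * \<mu> ^ 3 = \<mu> powr (3 + \<eta> - \<beta> - 2 * real \<theta>)"
      proof -
        have "\<mu> ^ 3 = \<mu> powr 3" using \<mu> powr_realpow[of \<mu> 3] by simp
        moreover have "(- \<beta> - 2 * real \<theta>) + \<eta> + 3 = 3 + \<eta> - \<beta> - 2 * real \<theta>" by simp
        ultimately show ?thesis by (simp only: powr_add[symmetric])
      qed
      also have "2 powr (real j * \<eta>) * 2 powr (- (2 * a * real j)) = 2 powr ((\<eta> - 2 * a) * real j)"
        by (simp add: powr_add[symmetric] algebra_simps)
      finally show "suminf (\<lambda>n. ?e * M n) \<le> (4 * U) * \<mu> powr (3 + \<eta> - \<beta> - 2 * real \<theta>) * 2 powr ((\<eta> - 2 * a) * real j) * \<Gamma>\<^sup>2" .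
    next
      fix s :: real and x :: R3 assume s: "0 \<le> s"
      define n where "n = nat \<lfloor>\<mu> * s\<rfloor>"
      have "0 \<le> \<mu> * s" using s \<mu> by simp
      then have n: "real n \<le> \<mu> * s" "\<mu> * s \<le> real n + 1" unfolding n_def by linarith+
      let ?w = "norm (wave (annulus \<psi> \<theta>) (\<mu> * (\<sigma> * s)) (piece g \<mu> j) (\<mu> *\<^sub>R x))"
      let ?X = "1 + ?R\<^sup>2 + \<mu> * s + norm (\<mu> *\<^sub>R x)"
      have X: "?X \<ge> 0" using \<mu> s by (auto intro!: add_nonneg_nonneg)
      have "(1 + s + norm x) powr \<beta> * (1 / \<mu> ^ \<theta> * ?w)\<^sup>2 \<le> (?X / \<mu>) powr \<beta> * (1 / \<mu> ^ \<theta> * ?w)\<^sup>2"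
        using \<beta> s by (intro mult_right_mono powr_mono2 space_time_weight_le \<mu>) auto
      also have "\<dots> = ?e * (?X powr \<beta> * ?w\<^sup>2)"
        unfolding e[symmetric] powr_divide power_mult_distrib by (simp only: divide_inverse mult_1_left mult_ac)
      also have "\<dots> \<le> ?e * M n"
        using Mb[rule_format, OF n, of "\<mu> *\<^sub>R x"] by (intro mult_left_mono) (auto simp: mult.left_commute)
      finally show "(1 + s + norm x) powr \<beta> * (1 / \<mu> ^ \<theta> * ?w)\<^sup>2 \<le> ?e * M (nat \<lfloor>\<mu> * s\<rfloor>)" unfolding n_def .
    qed
  next
    fix g :: "R3 \<Rightarrow> complex" and \<mu> \<tau> \<Gamma> :: real and j :: nat assume g: "g \<in> borel_measurable borel" and \<mu>: "0 < \<mu>" and \<Gamma>: "0 \<le> \<Gamma>"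
      and G: "(\<integral>\<^sup>+y. ennreal ((jbracket y powr a * norm (g y))\<^sup>2) \<partial>lborel) \<le> ennreal (\<Gamma>\<^sup>2)"
    note P = piece_bound[OF g \<mu> a \<Gamma> G, of j]
    define h where "h = wave (annulus \<psi> \<theta>) \<tau> (piece g \<mu> j)"
    have "\<forall>y. \<mu> * 2 ^ j < norm y \<longrightarrow> piece g \<mu> j y = 0" using piece_support[OF \<mu>] by blast
    then have h: "sqint h" "sqnorm h \<le> L * sqnorm (piece g \<mu> j)"
      using L2 P(1) unfolding h_def by blast+
    have hm [measurable]: "h \<in> borel_measurable borel" using h by (simp add: sqint_def)
    have b: "sqnorm h \<le> (L + 1) * (\<mu> ^ 3 * (4 * 2 powr (- (2 * a * real j)) * \<Gamma>\<^sup>2))"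
      using L P(2) sqnorm_nonneg[of "piece g \<mu> j"] by (intro order_trans[OF h(2)] mult_mono) auto
    \<comment> \<open>Evaluating at \<mu> x divides the integral by \<mu>^3, which compensates the
      dilated datum.\<close>
    have "ennreal (\<mu> ^ 3) * (\<integral>\<^sup>+x. ennreal ((norm (h (\<mu> *\<^sub>R x)))\<^sup>2) \<partial>lborel) = ennreal (sqnorm h)"
      using \<mu> unfolding nn_integral_sqnorm[OF h(1), symmetric] by (subst (2) nn_integral_affine[of _ \<mu> 0]) auto
    then have i: "(\<integral>\<^sup>+x. ennreal ((norm (h (\<mu> *\<^sub>R x)))\<^sup>2) \<partial>lborel) = ennreal (1 / \<mu> ^ 3 * sqnorm h)"
    proof -
      have "ennreal (1 / \<mu> ^ 3) * (ennreal (\<mu> ^ 3) * I) = I" for I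
        using \<mu> by (subst mult.assoc[symmetric], subst ennreal_mult[symmetric]) auto
      from this[of "\<integral>\<^sup>+x. ennreal ((norm (h (\<mu> *\<^sub>R x)))\<^sup>2) \<partial>lborel"]
      show ?thesis unfolding \<open>ennreal (\<mu> ^ 3) * _ = _\<close>
        using ennreal_mult[of "1 / \<mu> ^ 3" "sqnorm h"] \<mu> by (simp only: sqnorm_nonneg zero_le_divide_1_iff zero_le_power less_imp_le)
    qed
    let ?e = "\<mu> powr (- 2 * real \<theta>)"
    have e: "(1 / \<mu> ^ \<theta>)\<^sup>2 = ?e"
      unfolding inverse_power_powr[OF \<mu>] power2_eq_square powr_add[symmetric] by simp
    have "(\<integral>\<^sup>+x. ennreal ((1 / \<mu> ^ \<theta> * norm (h (\<mu> *\<^sub>R x)))\<^sup>2) \<partial>lborel) = (\<integral>\<^sup>+x. ennreal ?e * ennreal ((norm (h (\<mu> *\<^sub>R x)))\<^sup>2) \<partial>lborel)"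
      by (simp only: power_mult_distrib e ennreal_mult powr_ge_zero zero_le_power2)
    also have "\<dots> = ennreal ?e * ennreal (1 / \<mu> ^ 3 * sqnorm h)"
      by (subst nn_integral_cmult) (auto simp: i)
    also have "\<dots> = ennreal (?e * (1 / \<mu> ^ 3 * sqnorm h))"
      using \<mu> by (intro ennreal_mult[symmetric]) (auto simp: sqnorm_nonneg)
    also have "\<dots> \<le> ennreal (?e * (1 / \<mu> ^ 3 * ((L + 1) * (\<mu> ^ 3 * (4 * 2 powr (- (2 * a * real j)) * \<Gamma>\<^sup>2)))))"
      using \<mu> by (intro ennreal_leI mult_left_mono b) auto
    also have "?e * (1 / \<mu> ^ 3 * ((L + 1) * (\<mu> ^ 3 * (4 * 2 powr (- (2 * a * real j)) * \<Gamma>\<^sup>2))))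
      = 4 * (L + 1) * ?e * 2 powr (- 2 * a * real j) * \<Gamma>\<^sup>2" using \<mu> by (simp add: field_simps)
    finally show "(\<integral>\<^sup>+x. ennreal ((1 / \<mu> ^ \<theta> * norm (wave (annulus \<psi> \<theta>) \<tau> (piece g \<mu> j) (\<mu> *\<^sub>R x)))\<^sup>2) \<partial>lborel)
        \<le> ennreal (4 * (L + 1) * ?e * 2 powr (- 2 * a * real j) * \<Gamma>\<^sup>2)" unfolding h_def .
  qed
qed

text \<open>A double geometric series, enumerated along \<open>prod_decode\<close> so that scales
  and shells share a single index.\<close>

lemma summable_dyadic:
  assumes c: "0 < c"
  shows "summable (\<lambda>i. 2 powr (- c * (real (fst (prod_decode i)) + real (snd (prod_decode i)))))" (is "summable ?F")
proof (rule summable_suminf_not_top)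
  define z :: real where "z = 2 powr (- c)"
  have z: "0 < z" "z < 1" using c by (auto simp: z_def powr_less_one)
  have zp: "2 powr (- c * (real m + real n)) = z ^ m * z ^ n" for m n :: nat
    by (simp add: z_def powr_realpow[symmetric] powr_powr powr_add[symmetric] algebra_simps)
  have geo: "(\<Sum>n. ennreal (b * z ^ n)) = ennreal (b * (1 / (1 - z)))" if "0 \<le> b" for b
    using that z by (intro suminf_ennreal_eq sums_mult geometric_sums) auto
  have "(\<Sum>i. ennreal (?F i)) = (\<Sum>m. ennreal (1 / (1 - z) * z ^ m))"
  proof (rule suminf_ennreal_2dimen[of _ "\<lambda>x. ennreal (2 powr (- c * (real (fst x) + real (snd x))))"])
    fix m :: nat
    show "ennreal (1 / (1 - z) * z ^ m) = (\<Sum>n. ennreal (2 powr (- c * (real (fst (m, n)) + real (snd (m, n))))))"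
      unfolding fst_conv snd_conv zp mult.commute[of "1 / (1 - z)"] by (rule geo[symmetric]) (use z in simp)
  qed
  also have "\<dots> = ennreal (1 / (1 - z) * (1 / (1 - z)))" using z by (intro geo) simp
  finally show "(\<Sum>i. ennreal (?F i)) \<noteq> top" by simp
qed simp

text \<open>Exponent bookkeeping for one piece in the p-th power of the mixed norm, with 1/\<mu>
  from its time unit. The powers of \<mu> must be positive and those of 2^j negative for the sum to
  converge.\<close>

lemma dyadic_product:
  fixes p q L U \<mu> \<Gamma> \<beta> \<eta> a \<theta> j :: real
  assumes q: "q = (p - 2) / 2" and pos: "0 < L" "0 < \<mu>" "0 \<le> \<Gamma>"
  shows "(if p = 2 then 1 else (L * \<mu> powr (- 2 * \<theta>) * 2 powr (- 2 * a * j) * \<Gamma>\<^sup>2) powr q) *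
      (U * \<mu> powr (3 + \<eta> - \<beta> - 2 * \<theta>) * 2 powr ((\<eta> - 2 * a) * j) * \<Gamma>\<^sup>2 / \<mu>)
    = L powr q * U * \<mu> powr (2 + \<eta> - \<beta> - \<theta> * p) * 2 powr ((\<eta> - a * p) * j) * \<Gamma> powr p"
proof (cases "\<Gamma> = 0")
  case False
  then have \<Gamma>: "\<Gamma> > 0" using pos by simp
  let ?b = "L * \<mu> powr (- 2 * \<theta>) * 2 powr (- 2 * a * j) * \<Gamma>\<^sup>2"
  have b: "?b > 0" using pos \<Gamma> by simp
  have \<Gamma>2: "\<Gamma>\<^sup>2 = \<Gamma> powr 2" using \<Gamma> powr_realpow[of \<Gamma> 2] by simp
  \<comment> \<open>The base is positive here, so its power with exponent 0 is 1 and the case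
    distinction disappears.\<close>
  have "(if p = 2 then 1 else ?b powr q) = ?b powr q" using b q by auto
  also have "\<dots> = L powr q * \<mu> powr (- 2 * \<theta> * q) * 2 powr (- 2 * a * j * q) * \<Gamma> powr (2 * q)"
    unfolding \<Gamma>2 by (simp only: powr_mult powr_powr)
  finally have 1: "(if p = 2 then 1 else ?b powr q) = L powr q * \<mu> powr (- 2 * \<theta> * q) * 2 powr (- 2 * a * j * q) * \<Gamma> powr (2 * q)" .
  have 2: "1 / \<mu> = \<mu> powr (- 1)" using pos by (simp add: powr_minus divide_inverse)
  have "L powr q * \<mu> powr (- 2 * \<theta> * q) * 2 powr (- 2 * a * j * q) * \<Gamma> powr (2 * q) *
      (U * \<mu> powr (3 + \<eta> - \<beta> - 2 * \<theta>) * 2 powr ((\<eta> - 2 * a) * j) * \<Gamma>\<^sup>2 / \<mu>)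
    = L powr q * U * (\<mu> powr (- 2 * \<theta> * q) * \<mu> powr (3 + \<eta> - \<beta> - 2 * \<theta>) * (1 / \<mu>)) *
      (2 powr (- 2 * a * j * q) * 2 powr ((\<eta> - 2 * a) * j)) * (\<Gamma> powr (2 * q) * \<Gamma>\<^sup>2)"
    by (simp only: divide_inverse mult_1_left mult_ac)
  also have "\<mu> powr (- 2 * \<theta> * q) * \<mu> powr (3 + \<eta> - \<beta> - 2 * \<theta>) * (1 / \<mu>) = \<mu> powr (2 + \<eta> - \<beta> - \<theta> * p)"
    unfolding 2 powr_add[symmetric] by (rule arg_cong[where f="\<lambda>e. \<mu> powr e"]) (simp add: q field_simps)
  also have "2 powr (- 2 * a * j * q) * 2 powr ((\<eta> - 2 * a) * j) = 2 powr ((\<eta> - a * p) * j)"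
    unfolding powr_add[symmetric] by (rule arg_cong[where f="\<lambda>e. 2 powr e"]) (simp add: q field_simps)
  also have "\<Gamma> powr (2 * q) * \<Gamma>\<^sup>2 = \<Gamma> powr p"
    unfolding \<Gamma>2 powr_add[symmetric] by (rule arg_cong[where f="\<lambda>e. \<Gamma> powr e"]) (simp add: q field_simps)
  finally show ?thesis unfolding 1 .
qed simp

lemma lscale_powr: "lscale k m = 2 powr (real_of_int k + 1 - real m)"
  unfolding lscale_def by (subst powr_real_of_int'[symmetric]) auto

text \<open>Separates an infinite right-hand side, where the estimate is trivial, from a finite norm
  that can be handled as a real number.\<close>

lemma Lq_norm_2_cases:
  fixes h :: "R3 \<Rightarrow> real"
  assumes h: "\<And>x. 0 \<le> h x"
  obtains "Lq_norm lborel 2 (\<lambda>x. ennreal (h x)) = \<infinity>"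
  | \<Gamma> where "0 \<le> \<Gamma>" "Lq_norm lborel 2 (\<lambda>x. ennreal (h x)) = ennreal \<Gamma>"
      "(\<integral>\<^sup>+x. ennreal ((h x)\<^sup>2) \<partial>lborel) = ennreal (\<Gamma>\<^sup>2)"
proof -
  define I where "I = (\<integral>\<^sup>+x. ennreal ((h x)\<^sup>2) \<partial>lborel)"
  have "ennreal_rpow (ennreal (h x)) 2 = ennreal ((h x)\<^sup>2)" for x
    using h[of x] by (cases "h x = 0") (simp_all add: ennreal_rpow_ennreal ennreal_rpow_def)
  then have N: "Lq_norm lborel 2 (\<lambda>x. ennreal (h x)) = ennreal_rpow I (1 / 2)"
    by (simp add: Lq_norm_def I_def)
  show thesis
  proof (cases I)
    case (real c)
    then have "Lq_norm lborel 2 (\<lambda>x. ennreal (h x)) = ennreal (sqrt c)"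
      unfolding N by (simp add: ennreal_rpow_ennreal powr_half_sqrt)
    moreover have "I = ennreal ((sqrt c)\<^sup>2)" using real by simp
    ultimately show thesis using that(2)[of "sqrt c"] real unfolding I_def by simp
  next
    case top
    then have "Lq_norm lborel 2 (\<lambda>x. ennreal (h x)) = \<infinity>" unfolding N by (simp add: ennreal_rpow_def)
    then show thesis by (rule that(1))
  qed
qed

lemma measurable_inv_fourier_of_borel:
  assumes [measurable]: "F \<in> borel_measurable borel"
  shows "inv_fourier F \<in> borel_measurable borel"
proof -
  have [measurable]: "cis \<in> borel_measurable borel"
    by (intro borel_measurable_continuous_onI continuous_intros)
  show ?thesis unfolding inv_fourier_def by measurable
qed

lemma sqint_scale:
  assumes [measurable]: "g \<in> borel_measurable borel" and \<mu>: "0 < \<mu>"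
    and le: "(\<integral>\<^sup>+y. ennreal ((norm (g y))\<^sup>2) \<partial>lborel) \<le> ennreal c" and c: "0 \<le> c"
  shows "sqint (\<lambda>w. g (w /\<^sub>R \<mu>))"
proof (rule sqint_of_nn_integral_le)
  have "(\<integral>\<^sup>+w. ennreal ((norm (g (w /\<^sub>R \<mu>)))\<^sup>2) \<partial>lborel) = ennreal (\<mu> ^ 3) * (\<integral>\<^sup>+y. ennreal ((norm (g y))\<^sup>2) \<partial>lborel)"
    using \<mu> by (subst nn_integral_affine[of _ \<mu> 0]) auto
  also have "\<dots> \<le> ennreal (\<mu> ^ 3) * ennreal c" by (intro mult_left_mono le) simp
  also have "\<dots> = ennreal (\<mu> ^ 3 * c)" using \<mu> c by (simp add: ennreal_mult)
  finally show "(\<integral>\<^sup>+w. ennreal ((norm (g (w /\<^sub>R \<mu>)))\<^sup>2) \<partial>lborel) \<le> ennreal (\<mu> ^ 3 * c)" .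
qed (use \<mu> c in simp_all)

text \<open>Treats all powers \<theta> of 1/|\<xi>| together. The free parameter is \<eta>: it must
  exceed 2 \<beta>1 for the unit estimate, stay below 2 \<beta>2 for decay over spatial shells, and
  leave a positive power of the frequency scale.\<close>

lemma weighted_strichartz:
  fixes \<theta> :: nat and p \<beta>1 \<beta>2 :: real and r :: ennreal
  assumes cut: "lp_cutoff \<psi>" and \<beta>: "0 < \<beta>1" "\<beta>1 < 1" "\<beta>1 < \<beta>2" "\<beta>2 < 1"
    and p: "2 \<le> p" and r: "ennreal (1 / p) + 1 / r = 1 / 2" and \<theta>: "real \<theta> * p < 2 - \<beta>1 + 2 * \<beta>2"
  shows "\<exists>C>0. \<forall>t0 t k \<sigma>. \<forall>f \<in> lp_domain \<psi> k. 0 \<le> t0 \<longrightarrow> -1 \<le> k \<longrightarrow> \<bar>\<sigma>\<bar> = 1 \<longrightarrow>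
    mixed_norm t0 t p r (\<lambda>s x. ennreal ((1 + s + norm x) powr (1 / p * \<beta>1) *
        norm (lp_multiplier \<psi> k (\<lambda>\<xi>. complex_of_real (1 / norm \<xi>) ^ \<theta> * cis (\<sigma> * s * norm \<xi>)) f x)))
    \<le> ennreal (C * 2 powr (((2 + 2 * \<beta>2) / p - real \<theta>) * real_of_int k)) *
      Lq_norm lborel 2 (\<lambda>x. ennreal (jbracket x powr (2 / p * \<beta>2) * norm (lp_proj \<psi> k f x)))"
proof -
  define a where "a = 2 / p * \<beta>2"
  \<comment> \<open>K is the room in the hypothesis on \<theta>p and \<delta> the decay rate over
    spatial shells, small enough that \<eta> > 2 \<beta>1 and that the power E of the frequency
    scale is positive. \<open>h\<close> is half the worse of the two rates E and \<delta>.
    \<open>Y\<close> is p times the power of 2^k to be proved.\<close>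
  define K where "K = 2 - \<beta>1 + 2 * \<beta>2 - real \<theta> * p"
  define \<delta> where "\<delta> = min (2 * \<beta>2 - 2 * \<beta>1) K / 2"
  define \<eta> where "\<eta> = 2 * \<beta>2 - \<delta>"
  define E where "E = K - \<delta>"
  define h where "h = min E \<delta> / 2"
  define q where "q = (p - 2) / 2"
  define Y where "Y = 2 + 2 * \<beta>2 - real \<theta> * p"
  have a: "0 \<le> a" "a \<le> 1" "a * p = 2 * \<beta>2" using p \<beta> by (auto simp: a_def field_simps)
  have K: "K > 0" using \<theta> by (simp add: K_def)
  have \<delta>: "\<delta> > 0" "\<delta> \<le> \<beta>2 - \<beta>1" "\<delta> \<le> K / 2" using K \<beta> by (auto simp: \<delta>_def min_def)
  have E: "E > 0" "E \<le> Y" using \<delta> K \<beta> by (auto simp: E_def Y_def K_def)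
  have h: "h > 0" "2 * h \<le> E" "2 * h \<le> \<delta>" using E \<delta> by (auto simp: h_def)
  have \<eta>: "2 * \<beta>1 < \<eta>" "\<eta> \<le> 2" using \<delta> \<beta> by (auto simp: \<eta>_def)
  have q: "q \<ge> 0" "p + q > 0" using p by (simp_all add: q_def add_pos_nonneg)
  have \<eta>E: "2 + \<eta> - \<beta>1 - real \<theta> * p = E" by (simp add: \<eta>_def E_def K_def)
  have \<eta>\<delta>: "\<eta> - a * p = - \<delta>" using a by (simp add: \<eta>_def)
  obtain U L where U: "0 < U" and L: "0 < L" and
    A: "\<And>g \<mu> j \<sigma> \<Gamma>. g \<in> borel_measurable borel \<Longrightarrow> 0 < \<mu> \<Longrightarrow> \<bar>\<sigma>\<bar> = 1 \<Longrightarrow> 0 \<le> \<Gamma> \<Longrightarrow>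
      (\<integral>\<^sup>+y. ennreal ((jbracket y powr a * norm (g y))\<^sup>2) \<partial>lborel) \<le> ennreal (\<Gamma>\<^sup>2) \<Longrightarrow>
      \<exists>A. (\<forall>n. 0 \<le> A n) \<and> summable A \<and> suminf A \<le> U * \<mu> powr (3 + \<eta> - \<beta>1 - 2 * real \<theta>) * 2 powr ((\<eta> - 2 * a) * real j) * \<Gamma>\<^sup>2 \<and>
        (\<forall>s x. 0 \<le> s \<longrightarrow> (1 + s + norm x) powr \<beta>1 * (1 / \<mu> ^ \<theta> * norm (wave (annulus \<psi> \<theta>) (\<mu> * (\<sigma> * s)) (piece g \<mu> j) (\<mu> *\<^sub>R x)))\<^sup>2 \<le> A (nat \<lfloor>\<mu> * s\<rfloor>))" and
    B: "\<And>g \<mu> j \<tau> \<Gamma>. g \<in> borel_measurable borel \<Longrightarrow> 0 < \<mu> \<Longrightarrow> 0 \<le> \<Gamma> \<Longrightarrow>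
      (\<integral>\<^sup>+y. ennreal ((jbracket y powr a * norm (g y))\<^sup>2) \<partial>lborel) \<le> ennreal (\<Gamma>\<^sup>2) \<Longrightarrow>
      (\<integral>\<^sup>+x. ennreal ((1 / \<mu> ^ \<theta> * norm (wave (annulus \<psi> \<theta>) \<tau> (piece g \<mu> j) (\<mu> *\<^sub>R x)))\<^sup>2) \<partial>lborel)
        \<le> ennreal (L * \<mu> powr (- 2 * real \<theta>) * 2 powr (- 2 * a * real j) * \<Gamma>\<^sup>2)"
    by (rule piece_estimates[OF cut \<beta>(1,2) \<eta> a(1,2)]) (rule that)
  define M J where "M i = fst (prod_decode i)" and "J i = snd (prod_decode i)" for i
  define F where "F c i = 2 powr (- c * (real (M i) + real (J i)))" for c i
  have F: "summable (F c)" if "c > 0" for c using summable_dyadic[OF that] unfolding F_def M_def J_def .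
  have F0: "F c i > 0" for c i by (simp add: F_def)
  \<comment> \<open>Chosen so that \<omega>^(-(p+q)) grows at rate \<open>h\<close> only: of the
    available decay 2h, one h pays for the weights and the other keeps the series summable.\<close>
  define \<omega> where "\<omega> = F (h / (p + q))"
  have \<omega>s: "summable \<omega>" using F h q by (simp add: \<omega>_def)
  have S: "suminf \<omega> > 0" using \<omega>s F0 by (intro suminf_pos) (auto simp: \<omega>_def)
  have Fh: "suminf (F h) > 0" "summable (F h)" using F[OF h(1)] F0 by (auto intro: suminf_pos)
  define C3 where "C3 = L powr q * U"
  have C3: "C3 > 0" using L U by (simp add: C3_def)
  define C1 where "C1 = suminf \<omega> powr (p + q) * (C3 * suminf (F h))"
  have C1: "C1 > 0" using S C3 Fh by (simp add: C1_def)
  \<comment> \<open>2^(Y/p) accounts for the top scale being 2^(k+1) instead of 2^k.\<close>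
  define C where "C = C1 powr (1 / p) * 2 powr (Y / p)"
  have C: "C > 0" using C1 by (simp add: C_def)
  show ?thesis
  proof (intro exI[of _ C] conjI allI ballI impI C)
    fix t0 t :: real and k :: int and \<sigma> :: real and f
    assume f: "f \<in> lp_domain \<psi> k" and t0: "0 \<le> t0" and k: "-1 \<le> k" and \<sigma>: "\<bar>\<sigma>\<bar> = 1"
    let ?u = "\<lambda>s x. ennreal ((1 + s + norm x) powr (1 / p * \<beta>1) *
        norm (lp_multiplier \<psi> k (\<lambda>\<xi>. complex_of_real (1 / norm \<xi>) ^ \<theta> * cis (\<sigma> * s * norm \<xi>)) f x))"
    obtain H where H: "sqint H" "\<And>\<xi>. 8/5 * 2 powi k < norm \<xi> \<Longrightarrow> H \<xi> = 0"
      and Hm: "\<And>m. m \<in> borel_measurable borel \<Longrightarrow> lp_multiplier \<psi> k m f = inv_fourier (\<lambda>\<xi>. m \<xi> * H \<xi>)"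
      by (rule lp_multiplier_eq[OF cut k f]) (rule that)
    have Hb [measurable]: "H \<in> borel_measurable borel" using H by (simp add: sqint_def)
    have sym [measurable]: "(\<lambda>\<xi>::R3. complex_of_real (1 / norm \<xi>) ^ \<theta> * cis (\<tau> * norm \<xi>)) \<in> borel_measurable borel" for \<tau>
    proof -
      have [measurable]: "cis \<in> borel_measurable borel"
        by (intro borel_measurable_continuous_onI continuous_intros)
      show ?thesis by measurable
    qed
    define g where "g = inv_fourier H"
    have g: "g \<in> borel_measurable borel" unfolding g_def by (rule measurable_inv_fourier_of_borel) measurable
    have proj: "lp_proj \<psi> k f = g" unfolding lp_proj_def g_def by (subst Hm) auto
    have "mixed_norm t0 t p r ?u \<le> ennreal (C * 2 powr (((2 + 2 * \<beta>2) / p - real \<theta>) * real_of_int k)) *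
      Lq_norm lborel 2 (\<lambda>x. ennreal (jbracket x powr a * norm (g x)))"
    proof (rule Lq_norm_2_cases[of "\<lambda>x. jbracket x powr a * norm (g x)"])
      assume "Lq_norm lborel 2 (\<lambda>x. ennreal (jbracket x powr a * norm (g x))) = \<infinity>"
      then show ?thesis using C by (simp add: ennreal_mult_top)
    next
      fix \<Gamma> assume \<Gamma>: "0 \<le> \<Gamma>" and N: "Lq_norm lborel 2 (\<lambda>x. ennreal (jbracket x powr a * norm (g x))) = ennreal \<Gamma>"
        and G: "(\<integral>\<^sup>+x. ennreal ((jbracket x powr a * norm (g x))\<^sup>2) \<partial>lborel) = ennreal (\<Gamma>\<^sup>2)"
      note G' = eq_refl[OF G]
      have g2: "(\<integral>\<^sup>+y. ennreal ((norm (g y))\<^sup>2) \<partial>lborel) \<le> ennreal (\<Gamma>\<^sup>2)"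
      proof (rule order_trans[OF nn_integral_mono G'])
        fix y
        have "1 * norm (g y) \<le> jbracket y powr a * norm (g y)"
          using jbracket_ge(1)[of y] a by (intro mult_right_mono ge_one_powr_ge_zero) auto
        then show "ennreal ((norm (g y))\<^sup>2) \<le> ennreal ((jbracket y powr a * norm (g y))\<^sup>2)"
          by (intro ennreal_leI power_mono) auto
      qed
      define l where "l i = lscale k (M i)" for i
      have l: "l i > 0" for i by (simp add: l_def lscale_pos)
      define v where "v i s x = 1 / l i ^ \<theta> * norm (wave (annulus \<psi> \<theta>) (l i * (\<sigma> * s)) (piece g (l i) (J i)) (l i *\<^sub>R x))" for i s x
      define b where "b i = L * l i powr (- 2 * real \<theta>) * 2 powr (- 2 * a * real (J i)) * \<Gamma>\<^sup>2" for i
      define d where "d i = U * l i powr (3 + \<eta> - \<beta>1 - 2 * real \<theta>) * 2 powr ((\<eta> - 2 * a) * real (J i)) * \<Gamma>\<^sup>2" for i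
      have "\<forall>i. \<exists>A. (\<forall>n. 0 \<le> A n) \<and> summable A \<and> suminf A \<le> d i \<and> (\<forall>s x. 0 \<le> s \<longrightarrow> (1 + s + norm x) powr \<beta>1 * (v i s x)\<^sup>2 \<le> A (nat \<lfloor>l i * s\<rfloor>))"
        unfolding d_def v_def by (intro allI A g l \<sigma> \<Gamma> G')
      then obtain AA where AA: "\<forall>i. (\<forall>n. 0 \<le> AA i n) \<and> summable (AA i) \<and> suminf (AA i) \<le> d i \<and>
          (\<forall>s x. 0 \<le> s \<longrightarrow> (1 + s + norm x) powr \<beta>1 * (v i s x)\<^sup>2 \<le> AA i (nat \<lfloor>l i * s\<rfloor>))"
        by (rule exE[OF choice])
      define T where "T = C3 * 2 powr (Y * (real_of_int k + 1)) * \<Gamma> powr p * suminf (F h)"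
      have T: "T \<ge> 0" using C3 Fh by (simp add: T_def)
      have bk: "bump (annulus \<psi> \<theta>)" by (rule bump_annulus[OF cut])
      have "mixed_norm t0 t p r ?u \<le> ennreal ((suminf \<omega> powr (p + (p - 2) / 2) * T) powr (1 / p))"
      proof (rule mixed_norm_le[where v=v and W="\<lambda>s x. (1 + s + norm x) powr \<beta>1" and A=AA and B=b and \<omega>=\<omega> and l=l and a=d])
        show "?u s \<in> borel_measurable borel" for s
        proof -
          have [measurable]: "inv_fourier (\<lambda>\<xi>. complex_of_real (1 / norm \<xi>) ^ \<theta> * cis (\<sigma> * s * norm \<xi>) * H \<xi>) \<in> borel_measurable borel"
            by (rule measurable_inv_fourier_of_borel) measurable
          show ?thesis unfolding Hm[OF sym] by measurable
        qed
        show "v i s \<in> borel_measurable borel" for i s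
        proof -
          have [measurable]: "wave (annulus \<psi> \<theta>) (l i * (\<sigma> * s)) (piece g (l i) (J i)) \<in> borel_measurable borel"
            by (intro measurable_wave bk measurable_piece g)
          show ?thesis unfolding v_def by measurable
        qed
        show "0 \<le> v i s x" for i s x using l[of i] by (simp add: v_def)
        show "0 \<le> AA i n" "summable (AA i)" "suminf (AA i) \<le> d i" for i n using AA by blast+
        show "0 \<le> b i" for i using L by (simp add: b_def)
        show "0 \<le> s \<Longrightarrow> (1 + s + norm x) powr \<beta>1 * (v i s x)\<^sup>2 \<le> AA i (nat \<lfloor>l i * s\<rfloor>)" for i s x using AA by blast
        show "(\<integral>\<^sup>+x. ennreal ((v i s x)\<^sup>2) \<partial>lborel) \<le> ennreal (b i)" for i s
          unfolding v_def b_def by (intro B g l \<Gamma> G')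
        show "0 < \<omega> i" for i by (simp add: \<omega>_def F0)
        show "?u s x \<le> (\<Sum>i. ennreal (((1 + s + norm x) powr \<beta>1) powr (1 / p) * v i s x))" if s: "0 \<le> s" for s x
        proof -
          let ?w = "(1 + s + norm x) powr (1 / p * \<beta>1)"
          let ?V = "\<lambda>m j. 1 / lscale k m ^ \<theta> * norm (wave (annulus \<psi> \<theta>) (lscale k m * (\<sigma> * s)) (piece g (lscale k m) j) (lscale k m *\<^sub>R x))"
          have "?u s x = ennreal ?w * ennreal (norm (inv_fourier (\<lambda>\<xi>. (complex_of_real (1 / norm \<xi>) ^ \<theta> * cis ((\<sigma> * s) * norm \<xi>)) * H \<xi>) x))"
            unfolding Hm[OF sym] by (intro ennreal_mult) auto
          also have "\<dots> \<le> ennreal ?w * (\<Sum>m. ennreal (1 / lscale k m ^ \<theta> * norm (wave (annulus \<psi> \<theta>) (lscale k m * (\<sigma> * s)) (\<lambda>w. g (w /\<^sub>R lscale k m)) (lscale k m *\<^sub>R x))))"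
            unfolding g_def by (intro mult_left_mono frequency_decomposition cut H) auto
          also have "\<dots> \<le> ennreal ?w * (\<Sum>m. \<Sum>j. ennreal (?V m j))"
          proof (intro mult_left_mono suminf_le)
            fix m
            have lm: "0 \<le> 1 / lscale k m ^ \<theta>" using lscale_pos[of k m] by simp
            have "ennreal (norm (wave (annulus \<psi> \<theta>) (lscale k m * (\<sigma> * s)) (\<lambda>w. g (w /\<^sub>R lscale k m)) (lscale k m *\<^sub>R x)))
              \<le> (\<Sum>j. ennreal (norm (wave (annulus \<psi> \<theta>) (lscale k m * (\<sigma> * s)) (piece g (lscale k m) j) (lscale k m *\<^sub>R x))))"
              by (intro space_decomposition bk sqint_scale[OF g lscale_pos g2]) simp
            then have "ennreal (1 / lscale k m ^ \<theta>) * ennreal (norm (wave (annulus \<psi> \<theta>) (lscale k m * (\<sigma> * s)) (\<lambda>w. g (w /\<^sub>R lscale k m)) (lscale k m *\<^sub>R x)))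
              \<le> ennreal (1 / lscale k m ^ \<theta>) * (\<Sum>j. ennreal (norm (wave (annulus \<psi> \<theta>) (lscale k m * (\<sigma> * s)) (piece g (lscale k m) j) (lscale k m *\<^sub>R x))))"
              by (rule mult_left_mono) simp
            then show "ennreal (1 / lscale k m ^ \<theta> * norm (wave (annulus \<psi> \<theta>) (lscale k m * (\<sigma> * s)) (\<lambda>w. g (w /\<^sub>R lscale k m)) (lscale k m *\<^sub>R x)))
              \<le> (\<Sum>j. ennreal (?V m j))"
              by (simp only: ennreal_mult[OF lm norm_ge_zero] ennreal_suminf_cmult)
          qed auto
          \<comment> \<open>Frequency scales and spatial shells are merged into one sequence of
            pieces, the form required by the summation of mixed norms.\<close>
          also have "(\<Sum>m. \<Sum>j. ennreal (?V m j)) = (\<Sum>i. ennreal (v i s x))"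
            unfolding v_def l_def M_def J_def
            by (rule suminf_ennreal_2dimen[of _ "\<lambda>z. ennreal (?V (fst z) (snd z))", symmetric]) simp
          also have "ennreal ?w * \<dots> = (\<Sum>i. ennreal (((1 + s + norm x) powr \<beta>1) powr (1 / p) * v i s x))"
          proof -
            have "0 \<le> v i s x" for i using l[of i] by (simp add: v_def)
            then have "ennreal (((1 + s + norm x) powr \<beta>1) powr (1 / p) * v i s x) = ennreal ?w * ennreal (v i s x)" for i
              unfolding powr_powr mult.commute[of \<beta>1] by (intro ennreal_mult) auto
            then show ?thesis by (simp only: ennreal_suminf_cmult)
          qed
          finally show ?thesis .
        qed
        \<comment> \<open>Each term is the target power of 2^k times a term of a convergent double
          geometric series.\<close>
        have D: "\<omega> i powr (- (p + q)) * (if p = 2 then 1 else b i powr q) * (d i / l i) \<le> C3 * 2 powr (Y * (real_of_int k + 1)) * \<Gamma> powr p * F h i" for i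
        proof -
          have lE: "l i powr E = 2 powr (E * (real_of_int k + 1 - real (M i)))"
            by (simp add: l_def lscale_powr powr_powr mult.commute)
          have w: "\<omega> i powr (- (p + q)) = 2 powr (h * (real (M i) + real (J i)))"
          proof -
            have "- (h / (p + q)) * (real (M i) + real (J i)) * - (p + q) = h * (real (M i) + real (J i))" using q by (simp add: field_simps)
            then show ?thesis unfolding \<omega>_def F_def powr_powr by simp
          qed
          have "\<omega> i powr (- (p + q)) * (if p = 2 then 1 else b i powr q) * (d i / l i) = \<omega> i powr (- (p + q)) * ((if p = 2 then 1 else b i powr q) * (d i / l i))"
            by (simp only: mult.assoc)
          also have "(if p = 2 then 1 else b i powr q) * (d i / l i) = C3 * l i powr E * 2 powr (- \<delta> * real (J i)) * \<Gamma> powr p"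
            unfolding b_def d_def dyadic_product[OF q_def L l \<Gamma>] \<eta>E \<eta>\<delta> C3_def ..
          also have "\<omega> i powr (- (p + q)) * (C3 * l i powr E * 2 powr (- \<delta> * real (J i)) * \<Gamma> powr p)
            = C3 * (2 powr (h * (real (M i) + real (J i)) + E * (real_of_int k + 1 - real (M i)) + - \<delta> * real (J i))) * \<Gamma> powr p"
            unfolding w lE powr_add by (simp only: mult_ac)
          also have "\<dots> \<le> C3 * 2 powr (Y * (real_of_int k + 1) + - h * (real (M i) + real (J i))) * \<Gamma> powr p"
          proof (intro mult_right_mono mult_left_mono powr_mono)
            \<comment> \<open>The scales carry the power E, smaller than the claimed Y; since k + 1
              \<ge> 0, enlarging the exponent is allowed.\<close>
            have "E * (real_of_int k + 1) \<le> Y * (real_of_int k + 1)" using E k by (intro mult_right_mono) auto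
            moreover have "2 * h * real (M i) \<le> E * real (M i)" "2 * h * real (J i) \<le> \<delta> * real (J i)"
              using h by (auto intro: mult_right_mono)
            ultimately show "h * (real (M i) + real (J i)) + E * (real_of_int k + 1 - real (M i)) + - \<delta> * real (J i) \<le> Y * (real_of_int k + 1) + - h * (real (M i) + real (J i))"
              by (simp add: algebra_simps)
          qed (use C3 in auto)
          also have "\<dots> = C3 * 2 powr (Y * (real_of_int k + 1)) * \<Gamma> powr p * F h i"
            unfolding F_def powr_add by (simp only: mult_ac)
          finally show ?thesis .
        qed
        have "(\<Sum>i. ennreal (\<omega> i powr (- (p + q)) * (if p = 2 then 1 else b i powr q) * (d i / l i)))
          \<le> (\<Sum>i. ennreal (C3 * 2 powr (Y * (real_of_int k + 1)) * \<Gamma> powr p * F h i))"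
          by (intro suminf_le ennreal_leI D) auto
        also have "\<dots> = ennreal T" unfolding T_def suminf_mult[OF Fh(2), symmetric]
          using C3 F0 Fh(2) by (intro suminf_ennreal2 summable_mult mult_nonneg_nonneg) (auto intro: less_imp_le)
        finally show "(\<Sum>i. ennreal (\<omega> i powr (- (p + (p - 2) / 2)) * (if p = 2 then 1 else b i powr ((p - 2) / 2)) * (d i / l i))) \<le> ennreal T"
          unfolding q_def .
      qed (use p r \<omega>s l T t0 in auto)
      also have "(suminf \<omega> powr (p + (p - 2) / 2) * T) powr (1 / p) = C * 2 powr (((2 + 2 * \<beta>2) / p - real \<theta>) * real_of_int k) * \<Gamma>"
      proof -
        have "suminf \<omega> powr (p + (p - 2) / 2) * T = C1 * 2 powr (Y * (real_of_int k + 1)) * \<Gamma> powr p"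
          unfolding T_def C1_def q_def by (simp only: mult_ac)
        then have "(suminf \<omega> powr (p + (p - 2) / 2) * T) powr (1 / p) = C1 powr (1 / p) * 2 powr (Y * (real_of_int k + 1) * (1 / p)) * \<Gamma> powr (p * (1 / p))"
          by (simp only: powr_mult powr_powr)
        also have "\<Gamma> powr (p * (1 / p)) = \<Gamma>" using p \<Gamma> by simp
        also have "Y * (real_of_int k + 1) * (1 / p) = Y / p + ((2 + 2 * \<beta>2) / p - real \<theta>) * real_of_int k"
          using p by (simp add: Y_def field_simps)
        finally show ?thesis unfolding C_def powr_add by (simp only: mult_ac)
      qed
      also have "ennreal (C * 2 powr (((2 + 2 * \<beta>2) / p - real \<theta>) * real_of_int k) * \<Gamma>)
        = ennreal (C * 2 powr (((2 + 2 * \<beta>2) / p - real \<theta>) * real_of_int k)) * ennreal \<Gamma>"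
        using C \<Gamma> by (intro ennreal_mult) auto
      finally show ?thesis unfolding N .
    qed simp
    then show "mixed_norm t0 t p r ?u \<le> ennreal (C * 2 powr (((2 + 2 * \<beta>2) / p - real \<theta>) * real_of_int k)) *
      Lq_norm lborel 2 (\<lambda>x. ennreal (jbracket x powr (2 / p * \<beta>2) * norm (lp_proj \<psi> k f x)))"
      unfolding proj a_def .
  qed
qed

text \<open>The cases \<theta> = 0 and \<theta> = 1 of one estimate. For \<theta> = 1 the upper
  bound on p is exactly the condition that the low frequencies can be summed; for \<theta> = 0 that
  condition holds for every p.\<close>

theorem theorem3p1:
  fixes \<psi> :: "real \<Rightarrow> real" and \<beta>1 \<beta>2 :: real
  assumes "lp_cutoff \<psi>"
    and "0 < \<beta>1" and "\<beta>1 < 1"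
    and "\<beta>1 < \<beta>2" and "\<beta>2 < min (3/2 * \<beta>1) 1"
  shows
    "(\<forall>(p::real) (r::ennreal).
        2 \<le> p \<and> 2 < r \<and> ennreal (1 / p) + 1 / r = 1 / 2 \<longrightarrow>
        (\<exists>C::real. 0 < C \<and>
          (\<forall>t0 t. \<forall>k::int. \<forall>\<sigma>\<in>{1, -1::real}. \<forall>f \<in> lp_domain \<psi> k.
            0 \<le> t0 \<and> t0 \<le> t \<and> -1 \<le> k \<longrightarrow>
            mixed_norm t0 t p r
              (\<lambda>s x. ennreal ((1 + s + norm x) powr (1 / p * \<beta>1) *
                 norm (lp_multiplier \<psi> k (half_wave_symbol \<sigma> s) f x)))
            \<le> ennreal (C * 2 powr (2 / p * (1 + \<beta>2) * real_of_int k)) *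
              Lq_norm lborel 2
                (\<lambda>x. ennreal (jbracket x powr (2 / p * \<beta>2) * norm (lp_proj \<psi> k f x))))))
     \<and>
     (\<forall>(p::real) (r::ennreal).
        2 \<le> p \<and> p < 2 + 2 * \<beta>2 - \<beta>1 \<and> ennreal (2 + 4 / (2 * \<beta>2 - \<beta>1)) < r \<and>
        ennreal (1 / p) + 1 / r = 1 / 2 \<longrightarrow>
        (\<exists>C::real. 0 < C \<and>
          (\<forall>t0 t. \<forall>k::int. \<forall>\<sigma>\<in>{1, -1::real}. \<forall>f \<in> lp_domain \<psi> k.
            0 \<le> t0 \<and> t0 \<le> t \<and> -1 \<le> k \<longrightarrow>
            mixed_norm t0 t p r
              (\<lambda>s x. ennreal ((1 + s + norm x) powr (1 / p * \<beta>1) *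
                 norm (lp_multiplier \<psi> k
                   (\<lambda>\<xi>. inv_grad_symbol \<xi> * half_wave_symbol \<sigma> s \<xi>) f x)))
            \<le> ennreal (C * 2 powr (((2 + 2 * \<beta>2) / p - 1) * real_of_int k)) *
              Lq_norm lborel 2
                (\<lambda>x. ennreal (jbracket x powr (2 / p * \<beta>2) * norm (lp_proj \<psi> k f x))))))"
proof (intro conjI allI impI)
  fix p :: real and r :: ennreal
  assume "2 \<le> p \<and> 2 < r \<and> ennreal (1 / p) + 1 / r = 1 / 2"
  then have p: "2 \<le> p" and r: "ennreal (1 / p) + 1 / r = 1 / 2" by auto
  have e: "((2 + 2 * \<beta>2) / p - real 0) * real_of_int k = 2 / p * (1 + \<beta>2) * real_of_int k" for k
    using p by (simp add: field_simps)
  have "real 0 * p < 2 - \<beta>1 + 2 * \<beta>2" "\<beta>2 < 1" using assms by auto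
  from weighted_strichartz[OF assms(1-4) this(2) p r this(1)]
  obtain C where C: "C > 0" "\<forall>t0 t k \<sigma>. \<forall>f \<in> lp_domain \<psi> k. 0 \<le> t0 \<longrightarrow> -1 \<le> k \<longrightarrow> \<bar>\<sigma>\<bar> = 1 \<longrightarrow>
    mixed_norm t0 t p r (\<lambda>s x. ennreal ((1 + s + norm x) powr (1 / p * \<beta>1) *
        norm (lp_multiplier \<psi> k (half_wave_symbol \<sigma> s) f x)))
    \<le> ennreal (C * 2 powr (2 / p * (1 + \<beta>2) * real_of_int k)) *
      Lq_norm lborel 2 (\<lambda>x. ennreal (jbracket x powr (2 / p * \<beta>2) * norm (lp_proj \<psi> k f x)))"
    unfolding e power_0 mult_1_left half_wave_symbol_def[symmetric] by (elim exE conjE)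
  show "\<exists>C>0. \<forall>t0 t. \<forall>k. \<forall>\<sigma>\<in>{1, -1}. \<forall>f \<in> lp_domain \<psi> k. 0 \<le> t0 \<and> t0 \<le> t \<and> -1 \<le> k \<longrightarrow>
    mixed_norm t0 t p r (\<lambda>s x. ennreal ((1 + s + norm x) powr (1 / p * \<beta>1) *
        norm (lp_multiplier \<psi> k (half_wave_symbol \<sigma> s) f x)))
    \<le> ennreal (C * 2 powr (2 / p * (1 + \<beta>2) * real_of_int k)) *
      Lq_norm lborel 2 (\<lambda>x. ennreal (jbracket x powr (2 / p * \<beta>2) * norm (lp_proj \<psi> k f x)))"
    by (intro exI[of _ C] conjI C(1) allI ballI impI C(2)[rule_format]) auto
next
  fix p :: real and r :: ennreal
  assume "2 \<le> p \<and> p < 2 + 2 * \<beta>2 - \<beta>1 \<and> ennreal (2 + 4 / (2 * \<beta>2 - \<beta>1)) < r \<and> ennreal (1 / p) + 1 / r = 1 / 2"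
  then have p: "2 \<le> p" "p < 2 + 2 * \<beta>2 - \<beta>1" and r: "ennreal (1 / p) + 1 / r = 1 / 2" by auto
  have "real 1 * p < 2 - \<beta>1 + 2 * \<beta>2" "\<beta>2 < 1" using assms p by auto
  from weighted_strichartz[OF assms(1-4) this(2) p(1) r this(1)]
  obtain C where C: "C > 0" "\<forall>t0 t k \<sigma>. \<forall>f \<in> lp_domain \<psi> k. 0 \<le> t0 \<longrightarrow> -1 \<le> k \<longrightarrow> \<bar>\<sigma>\<bar> = 1 \<longrightarrow>
    mixed_norm t0 t p r (\<lambda>s x. ennreal ((1 + s + norm x) powr (1 / p * \<beta>1) *
        norm (lp_multiplier \<psi> k (\<lambda>\<xi>. inv_grad_symbol \<xi> * half_wave_symbol \<sigma> s \<xi>) f x)))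
    \<le> ennreal (C * 2 powr (((2 + 2 * \<beta>2) / p - 1) * real_of_int k)) *
      Lq_norm lborel 2 (\<lambda>x. ennreal (jbracket x powr (2 / p * \<beta>2) * norm (lp_proj \<psi> k f x)))"
    unfolding power_one_right of_nat_1 half_wave_symbol_def[symmetric] inv_grad_symbol_def[symmetric] by (elim exE conjE)
  show "\<exists>C>0. \<forall>t0 t. \<forall>k. \<forall>\<sigma>\<in>{1, -1}. \<forall>f \<in> lp_domain \<psi> k. 0 \<le> t0 \<and> t0 \<le> t \<and> -1 \<le> k \<longrightarrow>
    mixed_norm t0 t p r (\<lambda>s x. ennreal ((1 + s + norm x) powr (1 / p * \<beta>1) *
        norm (lp_multiplier \<psi> k (\<lambda>\<xi>. inv_grad_symbol \<xi> * half_wave_symbol \<sigma> s \<xi>) f x)))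
    \<le> ennreal (C * 2 powr (((2 + 2 * \<beta>2) / p - 1) * real_of_int k)) *
      Lq_norm lborel 2 (\<lambda>x. ennreal (jbracket x powr (2 / p * \<beta>2) * norm (lp_proj \<psi> k f x)))"
    by (intro exI[of _ C] conjI C(1) allI ballI impI C(2)[rule_format]) auto
qed

end
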